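(* Let $\alpha\in(0,2)$, $\beta\in(0,1]$, $\lambda\ge 0$, and let Assumptions A, B1 and B2 (stated in the context) be satisfied. Then for any $f\in C^{\beta}(H)$ there exists a unique solution $u\in C^{\alpha+\beta}(H)$ to the Cauchy problem $$\partial_t u(t,x)=(L-\lambda)u(t,x)+f(t,x),\ (t,x)\in H,\qquad u(0,x)=0,\ x\in\mathbf{R}^d,$$ where $L=A+B$. Moreover, there is a constant $C=C(\alpha,\beta,d,K,\eta)$, that is, depending only on $\alpha,\beta,d,K,\eta$, such that $$|u|_{\alpha+\beta}\le C|f|_{\beta},$$ and for all $0\le s\le t\le T$, $$|u(t,\cdot)-u(s,\cdot)|_{\frac{\alpha}{2}+\beta}\le C(t-s)^{1/2}|f|_{\beta}.$$
   Context: Spaces. $T>0$ is fixed throughout, $H=[0,T]\times\mathbf{R}^d$, $\mathbf{R}^d_0=\mathbf{R}^d\setminus\{0\}$. For a function $u$ on $H$ and $\beta\in(0,1]$: $|u|_0=\sup_{t,x}|u(t,x)|$; $[u]_\beta=\sup_{t,x,h\ne0}|u(t,x+h)-u(t,x)|/|h|^\beta$ if $\beta\in(0,1)$; $[u]_1=\sup_{t,x,h\neq0}|u(t,x+h)+u(t,x-h)-2u(t,x)|/|h|$. For $\beta>0$ write $\beta=[\beta]^-+\{\beta\}^+$ with $[\beta]^-\in\{0,1,2,\dots\}$ and $\{\beta\}^+\in(0,1]$. $C^\beta(H)$ is the space of measurable functions $u$ on $H$ with finite norm $|u|_\beta=\sum_{|\gamma|\le[\beta]^-}|D^\gamma u|_0+\sup_{|\gamma|=[\beta]^-}[D^\gamma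 u]_{\{\beta\}^+}$, where $D^\gamma$ are partial derivatives in $x$ and $\gamma$ are multiindices. $C^\beta(\mathbf{R}^d)$, with norm also denoted $|\cdot|_\beta$, is the corresponding space of functions on $\mathbf{R}^d$. Operators. $\chi_\alpha(y)=1_{\alpha>1}+1_{\alpha=1}1_{\{|y|\le1\}}$. Let $(U,\mathcal U)$ be a measurable space with a non-negative measure $\pi(d\upsilon)$, and let $m:H\times\mathbf{R}^d_0\to[0,\infty)$, $b:H\to\mathbf{R}^d$, $c:H\times U\to\mathbf{R}^d$, $\rho:H\times U\to\mathbf{R}$, $l:H\to\mathbf{R}$ and $m_0:[0,T]\times\mathbf{R}^d_0\to[0,\infty)$ be measurable. $K$ and $\eta$ are fixed positive constants. $(U_n)$ is a decreasing sequence in $\mathcal U$ with $U=\bigcup_nU_n^c$. Put $$Au(t,x)=\int_{\mathbf{R}^d}[u(t,x+y)-u(t,x)-(\nabla u(t,x),y)\chi_\alpha(y)]\,m(t,x,y)\frac{dy}{|y|^{d+\alpha}},$$ $$Bu(t,x)=(b(t,x),\nabla u(t,x))1_{1\le\alpha<2}+\int_U[u(t,x+c(t,x,\upsilon))-u(t,x)-(\nabla u(t,x),c(t,x,\upsilon))1_{U_1}(\upsilon)1_{1<\alpha<2}]\,\rho(t,x,\upsilon)\,\pi(d\upsilon)+l(t,x)u(t,x).$$ Assumption $A_0$ (on $m_0$). (i) $m_0=m_0(t,y)\ge0$ is measurable, homogeneous in $y$ with index zero, differentiable in $y$ up to order $d_0=[d/2]+1$, and $|D_y^\gamma m_0(t,y)|\le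 K$ for all $t\in[0,T]$, $|y|=1$ and multiindices $|\gamma|\le d_0$. (ii) If $\alpha=1$, then $\int_{S^{d-1}}w\,m_0(t,w)\,\mu_{d-1}(dw)=0$ for all $t\in[0,T]$, where $S^{d-1}$ is the unit sphere of $\mathbf{R}^d$ and $\mu_{d-1}$ the Lebesgue (surface) measure on it. (iii) For all $t\in[0,T]$, $\inf_{|\xi|=1}\int_{S^{d-1}}|(w,\xi)|^\alpha m_0(t,w)\,\mu_{d-1}(dw)\ge\eta>0$. Assumption A. (i) For all $(t,x)\in H$, $y\in\mathbf{R}^d_0$: $|m(\cdot,y)|_\beta\le K$ (norm of $C^\beta(H)$) and $m(t,x,y)\ge m_0(t,y)$, where $m_0$ satisfies Assumption $A_0$. (ii) If $\alpha=1$, then $\int_{r<|y|\le1}y\,m(t,x,y)\frac{dy}{|y|^{d+\alpha}}=0$ for all $(t,x)\in H$, $r\in(0,1)$. Assumption B1. (i) For all $(t,x)\in H$, $\int_{U_1}|c(t,x,\upsilon)|^\alpha\pi(d\upsilon)+\int_{U_1^c}\big(|c(t,x,\upsilon)|^{\alpha\wedge1}\wedge1\big)\pi(d\upsilon)\le K$. (ii) $\lim_{\varepsilon\to0}\sup_{t,x}\int_U1_{|c(t,x,\upsilon)|\le\varepsilon}|c(t,x,\upsilon)|^\alpha\pi(d\upsilon)=0$. Assumption B2. (i) $|b|_\beta+|l|_\beta\le K$. (ii) If $\alpha\in[1,2)$, there is a constant $C_0$ such that for all $(t,x)\in H$, $h\in\mathbf{R}^d$: $\int_{U_1}|c(t,x,\upsilon)-c(t,x+h,\upsilon)|^\alpha\pi(d\upsilon)\le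 C_0|h|^{\alpha\beta}$ and $\int_{U_1^c}[|c(t,x,\upsilon)-c(t,x+h,\upsilon)|\wedge1]\pi(d\upsilon)\le C_0|h|^\beta$. (iii) If $\alpha<1$, there are $\beta'$ with $\alpha+\beta>\alpha+\beta'\ge\beta$ and a constant $C_0$ such that for all $(t,x)\in H$, $h\in\mathbf{R}^d$: $\int_{U_1}|c(t,x,\upsilon)-c(t,x+h,\upsilon)|^{(\alpha+\beta')\wedge1}\pi(d\upsilon)\le C_0|h|^\beta$ and $\int_{U_1^c}\big(|c(t,x,\upsilon)-c(t,x+h,\upsilon)|^{(\alpha+\beta')\wedge1}\wedge1\big)\pi(d\upsilon)\le C_0|h|^\beta$. (iv) For all $\upsilon\in U$, $|\rho(\cdot,\upsilon)|_\beta\le K$. Solution. $u\in C^{\alpha+\beta}(H)$ is a solution of the Cauchy problem if $u(t,x)=\int_0^t[Lu(s,x)-\lambda u(s,x)+f(s,x)]\,ds$ for each $(t,x)\in H$.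
   Formalization: C may also depend on T, on C_0 and β' of B2 and on a modulus κ→0 bounding the quantity in B1(ii), since uniformity in C_0 and κ fails; π is assumed σ-finite, since otherwise a solution need not exist; C is obtained for each carrier type of U. *)

theory Defs
  imports "HOL-Analysis.Analysis"
begin

definition strip :: "real \<Rightarrow> (real \<times> (real^'d)) set" where
  "strip T = {0..T} \<times> UNIV"

subsection \<open>Partial derivatives in the space variable\<close>

definition pdiff :: "'d::finite \<Rightarrow> (real^'d \<Rightarrow> 'b::real_normed_vector) \<Rightarrow> real^'d \<Rightarrow> 'b" where
  "pdiff i g x = vector_derivative (\<lambda>r. g (x + r *\<^sub>R axis i 1)) (at 0)"

primrec pdiffs :: "'d::finite list \<Rightarrow> (real^'d \<Rightarrow> 'b::real_normed_vector) \<Rightarrow> real^'d \<Rightarrow> 'b" where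
  "pdiffs [] g = g"
| "pdiffs (i # w) g = pdiff i (pdiffs w g)"

definition pdiffs_exist :: "nat \<Rightarrow> (real^'d) set \<Rightarrow> (real^'d \<Rightarrow> 'b::real_normed_vector) \<Rightarrow> bool" where
  "pdiffs_exist k S g \<longleftrightarrow> (\<forall>w i. length w < k \<longrightarrow>
     (\<forall>x\<in>S. (\<lambda>r. pdiffs w g (x + r *\<^sub>R axis i 1)) differentiable (at 0)))"

definition coords :: "'d::finite list" where
  "coords = (SOME xs. distinct xs \<and> set xs = UNIV)"

definition msize :: "('d::finite \<Rightarrow> nat) \<Rightarrow> nat" where
  "msize \<gamma> = (\<Sum>i\<in>UNIV. \<gamma> i)"

text \<open>The derivative of multiindex \<^term>\<open>\<gamma>\<close> is taken in the order of the fixed enumeration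
  \<^const>\<open>coords\<close> of the coordinates; the order is immaterial whenever the mixed derivatives
  are continuous.\<close>

definition mdiff :: "('d \<Rightarrow> nat) \<Rightarrow> (real^'d \<Rightarrow> 'b::real_normed_vector) \<Rightarrow> real^'d \<Rightarrow> 'b::real_normed_vector" where
  "mdiff \<gamma> = pdiffs (concat (map (\<lambda>i. replicate (\<gamma> i) i) coords))"

definition grad :: "(real^'d \<Rightarrow> real) \<Rightarrow> real^'d \<Rightarrow> real^'d" where
  "grad g x = (\<chi> i. pdiff i g x)"

subsection \<open>Hoelder--Zygmund norms\<close>

text \<open>A function on \<^term>\<open>strip T\<close> is a family \<^term>\<open>u t\<close> indexed by \<^term>\<open>t \<in> {0..T}\<close>, a
  function on the whole space is a family indexed by a one-point set.  All norms are
  extended-valued: they are infinite for unbounded quantities, and also if a required derivative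
  does not exist.\<close>

definition sup_norm :: "'i set \<Rightarrow> ('i \<Rightarrow> real^'d \<Rightarrow> 'b::real_normed_vector) \<Rightarrow> ennreal" where
  "sup_norm I u = (SUP (t, x)\<in>I \<times> UNIV. ennreal (norm (u t x)))"

definition seminorm :: "'i set \<Rightarrow> real \<Rightarrow> ('i \<Rightarrow> real^'d \<Rightarrow> 'b::real_normed_vector) \<Rightarrow> ennreal" where
  "seminorm I \<beta> u = (SUP (t, x, h)\<in>I \<times> UNIV \<times> (- {0}).
     if \<beta> < 1 then ennreal (norm (u t (x + h) - u t x) / norm h powr \<beta>)
     else ennreal (norm (u t (x + h) + u t (x - h) - 2 *\<^sub>R u t x) / norm h))"

text \<open>Every \<^term>\<open>\<beta> > 0\<close> is split as \<^term>\<open>real (int_part \<beta>) + frac_part \<beta>\<close> with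
  \<^term>\<open>0 < frac_part \<beta>\<close> and \<^term>\<open>frac_part \<beta> \<le> 1\<close>, so an integer exponent has
  fractional part one.\<close>

definition int_part :: "real \<Rightarrow> nat" where
  "int_part \<beta> = nat (\<lceil>\<beta>\<rceil> - 1)"

definition frac_part :: "real \<Rightarrow> real" where
  "frac_part \<beta> = \<beta> - real (int_part \<beta>)"

definition holder_norm :: "'i set \<Rightarrow> real \<Rightarrow> ('i \<Rightarrow> real^'d \<Rightarrow> 'b::real_normed_vector) \<Rightarrow> ennreal" where
  "holder_norm I \<beta> u =
     (if \<forall>t\<in>I. pdiffs_exist (int_part \<beta>) UNIV (u t)
      then (\<Sum>\<gamma> | msize \<gamma> \<le> int_part \<beta>. sup_norm I (\<lambda>t. mdiff \<gamma> (u t)))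
         + (SUP \<gamma>\<in>{\<gamma>. msize \<gamma> = int_part \<beta>}. seminorm I (frac_part \<beta>) (\<lambda>t. mdiff \<gamma> (u t)))
      else \<infinity>)"

definition norm_H :: "real \<Rightarrow> real \<Rightarrow> (real \<Rightarrow> real^'d \<Rightarrow> 'b::real_normed_vector) \<Rightarrow> ennreal" where
  "norm_H T \<beta> u = holder_norm {0..T} \<beta> u"

definition norm_Rd :: "real \<Rightarrow> (real^'d \<Rightarrow> 'b::real_normed_vector) \<Rightarrow> ennreal" where
  "norm_Rd \<beta> g = holder_norm (UNIV :: unit set) \<beta> (\<lambda>_. g)"

definition C_H :: "real \<Rightarrow> real \<Rightarrow> (real \<Rightarrow> real^'d \<Rightarrow> real) set" where
  "C_H T \<beta> = {u. case_prod u \<in> borel_measurable (restrict_space borel (strip T))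
                 \<and> norm_H T \<beta> u < \<infinity>}"

subsection \<open>The operators\<close>

definition chi :: "real \<Rightarrow> real^'d \<Rightarrow> real" where
  "chi \<alpha> y = (if \<alpha> > 1 \<or> \<alpha> = 1 \<and> norm y \<le> 1 then 1 else 0)"

definition op_A :: "real \<Rightarrow> (real \<Rightarrow> real^'d \<Rightarrow> real^'d \<Rightarrow> real)
    \<Rightarrow> (real \<Rightarrow> real^'d \<Rightarrow> real) \<Rightarrow> real \<Rightarrow> real^'d \<Rightarrow> real" where
  "op_A \<alpha> m u t x =
     (LINT y|lborel. (u t (x + y) - u t x - (grad (u t) x \<bullet> y) * chi \<alpha> y)
        * m t x y / norm y powr (real CARD('d) + \<alpha>))"

definition op_B :: "real \<Rightarrow> 'u measure \<Rightarrow> 'u set \<Rightarrow> (real \<Rightarrow> real^'d \<Rightarrow> real^'d)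
    \<Rightarrow> (real \<Rightarrow> real^'d \<Rightarrow> 'u \<Rightarrow> real^'d) \<Rightarrow> (real \<Rightarrow> real^'d \<Rightarrow> 'u \<Rightarrow> real) \<Rightarrow> (real \<Rightarrow> real^'d \<Rightarrow> real)
    \<Rightarrow> (real \<Rightarrow> real^'d \<Rightarrow> real) \<Rightarrow> real \<Rightarrow> real^'d \<Rightarrow> real" where
  "op_B \<alpha> \<pi> U1 b c \<rho> l u t x =
     (if 1 \<le> \<alpha> then b t x \<bullet> grad (u t) x else 0)
     + (LINT v|\<pi>. (u t (x + c t x v) - u t x
          - (grad (u t) x \<bullet> c t x v) * indicator U1 v * (if 1 < \<alpha> then 1 else 0)) * \<rho> t x v)
     + l t x * u t x"

subsection \<open>The assumptions\<close>

text \<open>Surface measure on the unit sphere, as the cone measure: a set of directions gets \<^term>\<open>CARD('d)\<close>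
  times the volume of the cone over it in the unit ball.\<close>

definition sphere_measure :: "(real^'d) measure" where
  "sphere_measure = scale_measure (of_nat CARD('d))
     (distr (density lborel (indicator (ball 0 1))) borel sgn)"

definition assumption_A0 :: "real \<Rightarrow> real \<Rightarrow> real \<Rightarrow> real \<Rightarrow> (real \<Rightarrow> real^'d \<Rightarrow> real) \<Rightarrow> bool" where
  "assumption_A0 T \<alpha> K \<eta> m0 \<longleftrightarrow>
     (\<lambda>(t, y). m0 t y) \<in> borel_measurable (restrict_space borel ({0..T} \<times> (- {0}))) \<and>
     (\<forall>t\<in>{0..T}.
        (\<forall>y. y \<noteq> 0 \<longrightarrow> 0 \<le> m0 t y) \<and>
        (\<forall>y r. y \<noteq> 0 \<longrightarrow> r > 0 \<longrightarrow> m0 t (r *\<^sub>R y) = m0 t y) \<and>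
        pdiffs_exist (CARD('d) div 2 + 1) (- {0}) (m0 t) \<and>
        (\<forall>y \<gamma>. norm y = 1 \<longrightarrow> msize \<gamma> \<le> CARD('d) div 2 + 1 \<longrightarrow> \<bar>mdiff \<gamma> (m0 t) y\<bar> \<le> K) \<and>
        (\<alpha> = 1 \<longrightarrow> (LINT w|sphere_measure. m0 t w *\<^sub>R w) = 0) \<and>
        (INF \<xi>\<in>sphere 0 1. \<integral>\<^sup>+w. ennreal (\<bar>w \<bullet> \<xi>\<bar> powr \<alpha> * m0 t w) \<partial>sphere_measure) \<ge> ennreal \<eta>)"

definition assumption_A :: "real \<Rightarrow> real \<Rightarrow> real \<Rightarrow> real \<Rightarrow> real
    \<Rightarrow> (real \<Rightarrow> real^'d \<Rightarrow> real^'d \<Rightarrow> real) \<Rightarrow> (real \<Rightarrow> real^'d \<Rightarrow> real) \<Rightarrow> bool" where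
  "assumption_A T \<alpha> \<beta> K \<eta> m m0 \<longleftrightarrow>
     (\<forall>y. y \<noteq> 0 \<longrightarrow> norm_H T \<beta> (\<lambda>t x. m t x y) \<le> ennreal K) \<and>
     (\<forall>t\<in>{0..T}. \<forall>x y. y \<noteq> 0 \<longrightarrow> m0 t y \<le> m t x y) \<and>
     assumption_A0 T \<alpha> K \<eta> m0 \<and>
     (\<alpha> = 1 \<longrightarrow> (\<forall>t\<in>{0..T}. \<forall>x. \<forall>r\<in>{0<..<1}.
        (LINT y:{y. r < norm y \<and> norm y \<le> 1}|lborel.
           (m t x y / norm y powr (real CARD('d) + \<alpha>)) *\<^sub>R y) = 0))"

text \<open>Names the quantity that vanishes as \<^term>\<open>\<epsilon>\<close> tends to zero in \<open>assumption_B1\<close>, so that its rate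
  of decay can be prescribed: estimates of \<^const>\<open>op_B\<close> depend on that rate and on the Hoelder
  constant \<^term>\<open>C0\<close> of \<^term>\<open>c\<close>.\<close>

definition small_jumps :: "real \<Rightarrow> real \<Rightarrow> 'u measure \<Rightarrow> (real \<Rightarrow> real^'d \<Rightarrow> 'u \<Rightarrow> real^'d) \<Rightarrow> real \<Rightarrow> ennreal" where
  "small_jumps T \<alpha> \<pi> c \<epsilon> =
     (SUP (t, x)\<in>strip T. \<integral>\<^sup>+v. (if norm (c t x v) \<le> \<epsilon> then ennreal (norm (c t x v) powr \<alpha>) else 0) \<partial>\<pi>)"

definition assumption_B1 :: "real \<Rightarrow> real \<Rightarrow> real \<Rightarrow> 'u measure \<Rightarrow> 'u set
    \<Rightarrow> (real \<Rightarrow> real^'d \<Rightarrow> 'u \<Rightarrow> real^'d) \<Rightarrow> bool" where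
  "assumption_B1 T \<alpha> K \<pi> U1 c \<longleftrightarrow>
     (\<forall>t\<in>{0..T}. \<forall>x.
        (\<integral>\<^sup>+v\<in>U1. ennreal (norm (c t x v) powr \<alpha>) \<partial>\<pi>)
        + (\<integral>\<^sup>+v\<in>space \<pi> - U1. ennreal (min (norm (c t x v) powr min \<alpha> 1) 1) \<partial>\<pi>) \<le> ennreal K) \<and>
     (small_jumps T \<alpha> \<pi> c \<longlongrightarrow> 0) (at_right 0)"

definition assumption_B2 :: "real \<Rightarrow> real \<Rightarrow> real \<Rightarrow> real \<Rightarrow> real \<Rightarrow> real \<Rightarrow> 'u measure \<Rightarrow> 'u set
    \<Rightarrow> (real \<Rightarrow> real^'d \<Rightarrow> real^'d) \<Rightarrow> (real \<Rightarrow> real^'d \<Rightarrow> 'u \<Rightarrow> real^'d)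
    \<Rightarrow> (real \<Rightarrow> real^'d \<Rightarrow> 'u \<Rightarrow> real) \<Rightarrow> (real \<Rightarrow> real^'d \<Rightarrow> real) \<Rightarrow> bool" where
  "assumption_B2 T \<alpha> \<beta> K C0 \<beta>' \<pi> U1 b c \<rho> l \<longleftrightarrow>
     norm_H T \<beta> b + norm_H T \<beta> l \<le> ennreal K \<and>
     (1 \<le> \<alpha> \<longrightarrow> (\<forall>t\<in>{0..T}. \<forall>x h.
        (\<integral>\<^sup>+v\<in>U1. ennreal (norm (c t x v - c t (x + h) v) powr \<alpha>) \<partial>\<pi>)
          \<le> ennreal (C0 * norm h powr (\<alpha> * \<beta>)) \<and>
        (\<integral>\<^sup>+v\<in>space \<pi> - U1. ennreal (min (norm (c t x v - c t (x + h) v)) 1) \<partial>\<pi>)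
          \<le> ennreal (C0 * norm h powr \<beta>))) \<and>
     (\<alpha> < 1 \<longrightarrow> \<alpha> + \<beta> > \<alpha> + \<beta>' \<and> \<alpha> + \<beta>' \<ge> \<beta> \<and> (\<forall>t\<in>{0..T}. \<forall>x h.
        (\<integral>\<^sup>+v\<in>U1. ennreal (norm (c t x v - c t (x + h) v) powr min (\<alpha> + \<beta>') 1) \<partial>\<pi>)
          \<le> ennreal (C0 * norm h powr \<beta>) \<and>
        (\<integral>\<^sup>+v\<in>space \<pi> - U1. ennreal (min (norm (c t x v - c t (x + h) v) powr min (\<alpha> + \<beta>') 1) 1) \<partial>\<pi>)
          \<le> ennreal (C0 * norm h powr \<beta>))) \<and>
     (\<forall>v\<in>space \<pi>. norm_H T \<beta> (\<lambda>t x. \<rho> t x v) \<le> ennreal K)"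

text \<open>Sigma-finiteness of \<^term>\<open>\<pi>\<close> is the usual convention for a jump measure; it follows from
  \<^term>\<open>\<forall>n\<ge>1. emeasure \<pi> (space \<pi> - U n) < \<infinity>\<close> and is what makes the nonlocal part of \<^const>\<open>op_B\<close> measurable
  in \<^term>\<open>(t, x)\<close>.\<close>

definition standing :: "real \<Rightarrow> 'u measure \<Rightarrow> (nat \<Rightarrow> 'u set) \<Rightarrow> (real \<Rightarrow> real^'d \<Rightarrow> real^'d \<Rightarrow> real)
    \<Rightarrow> (real \<Rightarrow> real^'d \<Rightarrow> real^'d) \<Rightarrow> (real \<Rightarrow> real^'d \<Rightarrow> 'u \<Rightarrow> real^'d)
    \<Rightarrow> (real \<Rightarrow> real^'d \<Rightarrow> 'u \<Rightarrow> real) \<Rightarrow> (real \<Rightarrow> real^'d \<Rightarrow> real) \<Rightarrow> bool" where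
  "standing T \<pi> U m b c \<rho> l \<longleftrightarrow>
     sigma_finite_measure \<pi> \<and>
     (\<forall>n\<ge>1. U n \<in> sets \<pi>) \<and> (\<forall>n\<ge>1. U (Suc n) \<subseteq> U n) \<and>
     (\<Union>n\<in>{1..}. space \<pi> - U n) = space \<pi> \<and>
     (\<lambda>(t, x, y). m t x y) \<in> borel_measurable (restrict_space borel ({0..T} \<times> UNIV \<times> (- {0}))) \<and>
     (\<forall>t\<in>{0..T}. \<forall>x y. y \<noteq> 0 \<longrightarrow> 0 \<le> m t x y) \<and>
     (\<lambda>(t, x). b t x) \<in> borel_measurable (restrict_space borel (strip T)) \<and>
     (\<lambda>((t, x), v). c t x v) \<in> borel_measurable (restrict_space borel (strip T) \<Otimes>\<^sub>M \<pi>) \<and>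
     (\<lambda>((t, x), v). \<rho> t x v) \<in> borel_measurable (restrict_space borel (strip T) \<Otimes>\<^sub>M \<pi>) \<and>
     (\<lambda>(t, x). l t x) \<in> borel_measurable (restrict_space borel (strip T))"

subsection \<open>The Cauchy problem\<close>

definition is_solution :: "real \<Rightarrow> real \<Rightarrow> real \<Rightarrow> ((real \<Rightarrow> real^'d \<Rightarrow> real) \<Rightarrow> real \<Rightarrow> real^'d \<Rightarrow> real)
    \<Rightarrow> real \<Rightarrow> (real \<Rightarrow> real^'d \<Rightarrow> real) \<Rightarrow> (real \<Rightarrow> real^'d \<Rightarrow> real) \<Rightarrow> bool" where
  "is_solution T \<alpha> \<beta> L lam f u \<longleftrightarrow>
     u \<in> C_H T (\<alpha> + \<beta>) \<and>
     (\<forall>t\<in>{0..T}. \<forall>x.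
        set_integrable lborel {0..t} (\<lambda>s. L u s x - lam * u s x + f s x) \<and>
        u t x = (LINT s:{0..t}|lborel. L u s x - lam * u s x + f s x))"

end

theory Submission imports Defs begin

text \<open>For \<open>0 < s < 3\<close> the space \<open>C^s\<close> is described by the bound and the third differences of a function.
A priori estimate: apply the third difference in direction \<open>h\<close> to the equation. It solves an equation of
the same type up to commutators which, by interpolation, are \<open>O(|h|^be)\<close> with a constant depending only
on norms of order below \<open>al + be\<close>. Near a maximum of a third difference, taken with \<open>|h|\<close> almost optimal for
the Zygmund seminorm \<open>N\<close>, the part of the principal operator coming from the cone where \<open>m0\<close> is
positive is at most \<open>-c N |h|^be\<close>. The maximum principle then gives \<open>c N <= C |f|_be\<close> plus lower-order terms,
independently of \<open>lam\<close>; these are absorbed on short time intervals by the maximum principle for \<open>u\<close> itself. For the kernel \<open>K |y|^(-d-al)\<close> solutions are limits of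
those of the kernels truncated at \<open>|y| = ep\<close>, which are bounded operators: the argument above is uniform in \<open>ep\<close> at
scales \<open>|h| > ep\<close>. The method of continuity carries existence over to the general operator, and the
estimate in time is the geometric mean of the estimate in space and of the Lipschitz bound in time.\<close>

section \<open>Differences and Zygmund seminorms\<close>

text \<open>The gain in the cone has an algebraic source. A third difference with step
  \<open>n h\<close> is a sum of \<open>n^3\<close> third differences with step \<open>h\<close>,
  while its bound is only \<open>n^s\<close> times larger. As \<open>s < 3\<close>, third
  differences with step \<open>h\<close> cannot stay close to their extreme value throughout a ball
  of several steps, and a kernel positive in one cone notices this; elsewhere a nonnegative kernel
  does no harm at a maximum. Hence no coefficients are frozen in space and no fundamental solution
  appears. Three obstacles shape the details. Suprema over the whole space are not attained, so
  every argument runs at near maxima with explicit tolerances. The coefficients are only measurable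
  in time, so the operator at one time has to act on the function at another. At integer orders the
  Zygmund classes are weak: order one does not imply Lipschitz continuity. Therefore a margin
  \<open>ta\<close> surrounds every critical order.\<close>

lemmas alg = algebra_simps
lemmas mlm = mult_left_mono
lemmas mrm = mult_right_mono

abbreviation slim :: "(nat => 'a::topological_space) => 'a => bool" (infix "~~>" 60) where
 "f ~~> l \<equiv> filterlim f (nhds l) sequentially"

abbreviation scl :: "real => 'a => 'a::real_vector" (infixr "*." 75) where
 "r *. x \<equiv> scaleR r x"

abbreviation bm :: "'a measure => ('a => 'b::topological_space) set" where
 "bm \<equiv> borel_measurable"

definition df :: "'a::real_normed_vector => ('a => 'b::real_normed_vector) => 'a => 'b" where
 "df h u x = u (x + h) - u x"

abbreviation df2 :: "'a::real_normed_vector => ('a => 'b::real_normed_vector) => 'a => 'b" where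
 "df2 h u \<equiv> df h (df h u)"

abbreviation df3 :: "'a::real_normed_vector => ('a => 'b::real_normed_vector) => 'a => 'b" where
 "df3 h u \<equiv> df h (df2 h u)"

abbreviation npw :: "'a::real_normed_vector => real => real" (infixr "pw" 80) where
 "x pw a \<equiv> norm x powr a"

abbreviation pk :: "real => real^'d => real" where
 "pk al y \<equiv> y pw (real CARD('d) + al)"

definition bd :: "real => ('a::real_normed_vector => 'b::real_normed_vector) => bool" where
 "bd M u \<longleftrightarrow> (ALL x. norm (u x) <= M)"

definition Zyg :: "real => real => ('a::real_normed_vector => 'b::real_normed_vector) => bool" where
 "Zyg s N u \<longleftrightarrow> 0 <= N & (ALL h x. norm (df3 h u x) <= N * h pw s)"

lemma bdD: "bd M u ==> norm (u x) <= M"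
 by (simp add: bd_def)

lemma bd_nonneg: "bd M u ==> 0 <= M"
 using norm_ge_zero order_trans unfolding bd_def by blast

lemma bd_mono: "bd M u ==> M <= M' ==> bd M' u"
 unfolding bd_def by (meson order_trans)

lemma ZygD: "Zyg s N u ==> norm (df3 h u x) <= N * h pw s"
 by (simp add: Zyg_def)

lemma Zyg_nonneg: "Zyg s N u ==> 0 <= N"
 by (simp add: Zyg_def)

lemma Zyg_mono: "Zyg s N u ==> N <= N' ==> Zyg s N' u"
 unfolding Zyg_def by (meson mrm order_trans powr_ge_zero)

lemma df_commute: "df h (df k u) = df k (df h u)"
 by (rule ext) (simp add: df_def alg)

lemma df_add: "df h (%x. u x + v x) = (%x. df h u x + df h v x)"
 by (rule ext) (simp add: df_def alg)

lemma df_diff: "df h (%x. u x - v x) = (%x. df h u x - df h v x)"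
 by (rule ext) (simp add: df_def alg)

lemma df_minus: "df h (%x. - v x) = (%x. - df h v x)"
 by (rule ext) (simp add: df_def alg)

lemma df_cmult: "df h (%x. a * v x) = (%x. a * df h v x)" for v :: "'a::real_normed_vector => real"
 by (rule ext) (simp add: df_def alg)

lemma df_shift: "df h (%x. u (x + k)) = (%x. df h u (x + k))"
 by (rule ext) (simp add: df_def alg)

lemma df_zero [simp]: "df 0 u x = 0"
 by (simp add: df_def)

lemma bd_df: assumes "bd M u" shows "bd (2 * M) (df h u)"
 unfolding bd_def df_def
proof
 fix x show "norm (u (x + h) - u x) <= 2 * M"
  using norm_triangle_ineq4[of "u (x+h)" "u x"] bdD[OF assms, of x] bdD[OF assms, of "x+h"] by linarith
qed

lemma bd_df2: "bd M u ==> bd (4 * M) (df h (df k u))"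
 using bd_df[OF bd_df] by fastforce

lemma bd_df3: "bd M u ==> bd (8 * M) (df h (df k (df l u)))"
 using bd_df[OF bd_df2] by fastforce

lemma bd_add: "bd M u ==> bd N v ==> bd (M + N) (%x. u x + v x)"
 unfolding bd_def by (meson add_mono norm_triangle_ineq order_trans)

lemma bd_diff: "bd M u ==> bd N v ==> bd (M + N) (%x. u x - v x)"
 unfolding bd_def by (meson add_mono norm_triangle_ineq4 order_trans)

lemma bd_cmult: "bd M u ==> bd (abs a * M) (%x. a * u x)" for u :: "'a::real_normed_vector => real"
 unfolding bd_def by (simp add: abs_mult mlm)

lemma bd_shift: "bd M u ==> bd M (%x. u (x + k))"
 unfolding bd_def by simp

lemma Zyg_add: assumes "Zyg s M u" "Zyg s N v" shows "Zyg s (M + N) (%x. u x + v x)"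
 unfolding Zyg_def df_add
proof (intro conjI allI)
 show "0 <= M + N" using Zyg_nonneg[OF assms(1)] Zyg_nonneg[OF assms(2)] by simp
 fix h x
 show "norm (df3 h u x + df3 h v x) <= (M + N) * h pw s"
  using norm_triangle_ineq[of "df3 h u x" "df3 h v x"]
  ZygD[OF assms(1), of h x] ZygD[OF assms(2), of h x] by (simp add: alg)
qed

lemma Zyg_diff: assumes "Zyg s M u" "Zyg s N v" shows "Zyg s (M + N) (%x. u x - v x)"
 unfolding Zyg_def df_diff
proof (intro conjI allI)
 show "0 <= M + N" using Zyg_nonneg[OF assms(1)] Zyg_nonneg[OF assms(2)] by simp
 fix h x
 show "norm (df3 h u x - df3 h v x) <= (M + N) * h pw s"
  using norm_triangle_ineq4[of "df3 h u x" "df3 h v x"]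
  ZygD[OF assms(1), of h x] ZygD[OF assms(2), of h x] by (simp add: alg)
qed

lemma Zyg_cmult: "Zyg s M u ==> Zyg s (abs a * M) (%x. a * u x)" for u :: "'a::real_normed_vector => real"
 unfolding Zyg_def df_cmult by (simp add: abs_mult mlm mult.assoc)

lemma Zyg_shift: "Zyg s M u ==> Zyg s M (%x. u (x + k))"
 unfolding Zyg_def df_shift by simp

lemma Zyg_df: assumes "Zyg s N u" shows "Zyg s (2 * N) (df h u)"
proof -
 have "Zyg s (N + N) (%x. u (x + h) - u x)"
  by (intro Zyg_diff Zyg_shift assms)
 thus ?thesis unfolding df_def[abs_def] by simp
qed

lemma Zyg_df2: "Zyg s N u ==> Zyg s (4 * N) (df h (df k u))"
 using Zyg_df[OF Zyg_df] by fastforce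

lemma Zyg_df3: "Zyg s N u ==> Zyg s (8 * N) (df h (df k (df l u)))"
 using Zyg_df[OF Zyg_df2] by fastforce

text \<open>The iteration moves to larger scales: after \<open>n\<close> doublings the first term is
  at most \<open>a ^ n * B\<close>, which vanishes because \<open>\<phi>\<close> is bounded above,
  and the powers of \<open>h\<close> add up to a geometric series of ratio
  \<open>a * 2 powr sg\<close>. This ratio is what limits the orders in the Marchaud
  inequalities.\<close>

lemma doubling_iteration:
 fixes \<phi> :: "'a::real_normed_vector => real"
 assumes b: "!!h. \<phi> h <= B" and it: "!!h. \<phi> h <= a * \<phi> (2 *. h) + Q * h pw sg"
  and "0 <= Q" "0 <= a" "a < 1" "a * 2 powr sg < 1"
 shows "\<phi> h <= Q * h pw sg / (1 - a * 2 powr sg)"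
proof -
 let ?q = "a * 2 powr sg"
 have main: "\<phi> h <= a ^ n * \<phi> ((2 ^ n) *. h) + Q * h pw sg * (\<Sum>i<n. ?q ^ i)" for n
 proof (induction n)
  case 0 thus ?case by simp
 next
  case (Suc n)
  have "\<phi> ((2 ^ n) *. h) <= a * \<phi> (2 *. ((2 ^ n) *. h)) + Q * norm ((2 ^ n) *. h) powr sg"
  by (rule it)
  also have "norm (((2::real) ^ n) *. h) powr sg = (2 powr sg) ^ n * h pw sg"
  by (simp add: powr_mult powr_power powr_realpow[symmetric] powr_powr mult.commute)
  finally have "a ^ n * \<phi> ((2 ^ n) *. h) <= a ^ n * (a * \<phi> ((2 ^ Suc n) *. h) + Q * ((2 powr sg) ^ n * h pw sg))"
  using assms(4) by (intro mlm) auto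
  thus ?case using Suc by (simp add: alg power_mult_distrib)
 qed
 have q0: "0 <= ?q" using assms by simp
 have le: "\<phi> h <= a ^ n * B + Q * h pw sg / (1 - ?q)" for n
 proof -
  have "(\<Sum>i<n. ?q ^ i) <= 1 / (1 - ?q)"
  using sum_gp_strict[of ?q n] assms q0 by (simp add: divide_simps)
  hence "Q * h pw sg * (\<Sum>i<n. ?q ^ i) <= Q * h pw sg * (1 / (1 - ?q))"
  using assms by (intro mlm) auto
  moreover have "a ^ n * \<phi> ((2 ^ n) *. h) <= a ^ n * B"
  using assms by (intro mlm) auto
  ultimately show ?thesis using main[of n] by simp
 qed
 have "(%n. a ^ n * B + Q * h pw sg / (1 - ?q)) ~~> 0 * B + Q * h pw sg / (1 - ?q)"
  using assms by (intro tendsto_intros LIMSEQ_realpow_zero) auto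
 thus ?thesis
  using LIMSEQ_le_const[of _ _ "\<phi> h"] le by fastforce
qed

section \<open>Marchaud inequalities: lower differences from higher ones\<close>

definition marchaud2 :: "real => real" where
 "marchaud2 sg = 1 / (1 - 2 powr (sg - 2))"

text \<open>Both constants are sums of the series in \<open>doubling_iteration\<close>: ratio
  \<open>2 powr sg / 4\<close> when second differences are recovered from third ones, ratio
  \<open>2 powr sg / 2\<close>, with a further factor 1/2, when first differences are recovered from
  second ones.\<close>

definition marchaud1 :: "real => real" where
 "marchaud1 sg = 1 / (2 * (1 - 2 powr (sg - 1)))"

lemma marchaud2_pos: "sg < 2 ==> 0 < marchaud2 sg"
 by (simp add: marchaud2_def powr_less_one)

lemma marchaud1_pos: "sg < 1 ==> 0 < marchaud1 sg"
 by (simp add: marchaud1_def powr_less_one)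

text \<open>The letters are the values at \<open>x\<close>, \<open>x + h\<close>, ...,
  \<open>x + 4 h\<close>. With \<open>T\<close> the shift by \<open>h\<close>, this is
  \<open>4 (T - 1)^2 = (T^2 - 1)^2 - (T + 3) (T - 1)^3\<close>.\<close>

lemma fourfold_df2_identity:
 fixes a b c d e :: "'b::real_normed_vector"
 shows "4 *. (c - b - (b - a)) = e - c - (c - a)
  - ((e - d - (d - c) - (d - c - (c - b))) + 3 *. (d - c - (c - b) - (c - b - (b - a))))"
proof -
 have 4: "4 *. v = v + v + v + v" and 3: "3 *. v = v + v + v" for v :: 'b
  using scaleR_left_distrib[of 1 1 v] scaleR_left_distrib[of 2 1 v] scaleR_left_distrib[of 3 1 v]
  by simp_all
 show ?thesis unfolding 3 4 by (simp only: alg)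
qed

text \<open>Writing \<open>T\<close> for the shift by \<open>h\<close>, the bound comes from \<open>(T + 1)\<^sup>2 - 4 = (T - 1) (T + 3)\<close>.\<close>

lemma df2_bound_scale:
 assumes u: "bd M u" and Z: "!!h x. ep <= norm h ==> norm (df3 h u x) <= N * h pw sg"
  and N: "0 <= N" and sg: "sg < 2" and h: "ep <= norm h"
 shows "norm (df2 h u x) <= marchaud2 sg * N * h pw sg"
proof -
 have up: "norm (df2 h u x) <= (SUP x. norm (df2 h u x))" for h x
  by (intro cSUP_upper) (auto intro!: bdd_aboveI2 bdD[OF bd_df2[OF u]])
 have M: "0 <= M" using bd_nonneg[OF u] .
 \<comment> \<open>Below the scale \<open>ep\<close> the function is set to zero. Doubling only
   increases the norm, so the recursion never asks for a smaller scale, and below \<open>ep\<close>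
   it holds trivially.\<close>
 define \<phi> where "\<phi> h = (if ep <= norm h then SUP x. norm (df2 h u x) else 0)" for h
 have \<phi>0: "0 <= \<phi> h" for h using order_trans[OF norm_ge_zero up[of h 0]] by (simp add: \<phi>_def)
 have "\<phi> h <= N * h pw sg / (1 - 1/4 * 2 powr sg)" for h
 proof (rule doubling_iteration[where B = "4 * M"])
  show "\<phi> h <= 4 * M" for h
  proof (cases "ep <= norm h")
  case True
  have "(SUP x. norm (df2 h u x)) <= 4 * M"
  by (rule cSUP_least) (auto intro!: bdD[OF bd_df2[OF u]])
  thus ?thesis using True by (simp add: \<phi>_def)
  qed (use M in \<open>simp add: \<phi>_def\<close>)
  show "\<phi> h <= 1/4 * \<phi> (2 *. h) + N * h pw sg" for h
  proof (cases "ep <= norm h")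
  case True
  have True2: "ep <= norm (2 *. h)"
  proof -
  have "norm (2 *. h) = 2 * norm h" by simp
  thus ?thesis using True norm_ge_zero[of h] by linarith
  qed
  have "(SUP x. norm (df2 h u x)) <= 1/4 * (SUP x. norm (df (2 *. h) (df (2 *. h) u) x)) + N * h pw sg"
  proof (rule cSUP_least)
  fix x
  have e: "4 *. df2 h u x = df (2 *. h) (df (2 *. h) u) x
  - (df3 h u (x + h) + 3 *. df3 h u x)"
  proof -
  have x: "y + 2 *. h = y + h + h" for y
  by (simp add: scaleR_2 add.assoc)
  show ?thesis unfolding df_def x by (rule fourfold_df2_identity)
  qed
  have "4 * norm (df2 h u x) = norm (4 *. df2 h u x)" by simp
  also have "... <= norm (df (2 *. h) (df (2 *. h) u) x) + (norm (df3 h u (x + h)) + 3 * norm (df3 h u x))"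
  unfolding e
  using norm_triangle_ineq4[of "df (2 *. h) (df (2 *. h) u) x" "df3 h u (x + h) + 3 *. df3 h u x"]
  norm_triangle_ineq[of "df3 h u (x + h)" "3 *. df3 h u x"] by simp
  also have "... <= (SUP x. norm (df (2 *. h) (df (2 *. h) u) x)) + (N * h pw sg + 3 * (N * h pw sg))"
  by (intro add_mono mlm Z True up) auto
  finally show "norm (df2 h u x) <= 1/4 * (SUP x. norm (df (2 *. h) (df (2 *. h) u) x)) + N * h pw sg"
  by simp
  qed auto
  thus ?thesis using True True2 by (simp add: \<phi>_def)
  next
  case False
  hence "\<phi> h = 0" by (simp add: \<phi>_def)
  thus ?thesis using \<phi>0[of "2 *. h"] N by simp
  qed
  have "(2::real) powr sg < 2 powr 2" using sg by (intro powr_less_mono) auto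
  thus "1/4 * 2 powr sg < 1" by simp
 qed (use N in auto)
 moreover have "1/4 * 2 powr sg = 2 powr (sg - 2)" by (simp add: powr_diff)
 ultimately have "\<phi> h <= marchaud2 sg * N * h pw sg"
  unfolding marchaud2_def by simp
 thus ?thesis using up[of h x] h by (simp add: \<phi>_def)
qed

lemma df2_bound:
 assumes "bd M u" "Zyg sg N u" "sg < 2"
 shows "norm (df2 h u x) <= marchaud2 sg * N * h pw sg"
 using df2_bound_scale[of M u 0 N sg h x] ZygD[OF assms(2)] Zyg_nonneg[OF assms(2)] assms by simp

text \<open>Rests on \<open>2 (T - 1) = (T^2 - 1) - (T - 1)^2\<close> for the shift
  \<open>T\<close>; the factor 1/2 per doubling beats the growth \<open>2 powr sg\<close> only below
  order one.\<close>

lemma df1_bound_of_df2: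
 assumes u: "bd M u" and Z: "!!h x. norm (df2 h u x) <= Q * h pw sg" and "sg < 1" "0 <= Q"
 shows "norm (df h u x) <= marchaud1 sg * Q * h pw sg"
proof -
 have up: "norm (df h u x) <= (SUP x. norm (df h u x))" for h x
  by (intro cSUP_upper) (auto intro!: bdd_aboveI2 bdD[OF bd_df[OF u]])
 define \<phi> where "\<phi> h = (SUP x. norm (df h u x))" for h
 have "\<phi> h <= (Q/2) * h pw sg / (1 - 1/2 * 2 powr sg)" for h
 proof (rule doubling_iteration[where B = "2 * M"])
  show "\<phi> h <= 2 * M" for h unfolding \<phi>_def
  by (rule cSUP_least) (auto intro!: bdD[OF bd_df[OF u]])
  show "\<phi> h <= 1/2 * \<phi> (2 *. h) + (Q/2) * h pw sg" for h
  unfolding \<phi>_def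
  proof (rule cSUP_least)
  fix x
  have e: "2 *. df h u x = df (2 *. h) u x - df2 h u x"
  by (simp add: df_def alg scaleR_2)
  have "2 * norm (df h u x) = norm (2 *. df h u x)" by simp
  also have "... <= norm (df (2 *. h) u x) + norm (df2 h u x)"
  unfolding e by (rule norm_triangle_ineq4)
  also have "... <= (SUP x. norm (df (2 *. h) u x)) + Q * h pw sg"
  by (intro add_mono Z up)
  finally show "norm (df h u x) <= 1/2 * (SUP x. norm (df (2 *. h) u x)) + (Q/2) * h pw sg"
  by simp
  qed auto
  have "(2::real) powr sg < 2 powr 1" using assms(3) by (intro powr_less_mono) auto
  thus "1/2 * 2 powr sg < 1" by simp
 qed (use assms in auto)
 moreover have "1/2 * 2 powr sg = 2 powr (sg - 1)" by (simp add: powr_diff)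
 ultimately have "(SUP x. norm (df h u x)) <= marchaud1 sg * Q * h pw sg"
  unfolding \<phi>_def marchaud1_def by (simp add: mult.commute[of 2])
 thus ?thesis using up[of h x] by linarith
qed

lemma df1_bound:
 assumes u: "bd M u" and Z: "Zyg sg N u" and "sg < 1"
 shows "norm (df h u x) <= marchaud1 sg * marchaud2 sg * N * h pw sg"
 using df1_bound_of_df2[OF u df2_bound[OF u Z]] assms Zyg_nonneg[OF Z] marchaud2_pos[of sg]
 by (simp add: mult.assoc)

text \<open>Third differences in \<open>h\<close> and in \<open>k\<close> commute, so the sixfold
  difference is bounded by the \<open>s\<close>-th power of the smaller increment, hence by
  \<open>|k|^(s - ta) |h|^ta\<close>. In this way an order is shared between two increments without
  any derivative.\<close>

lemma Zyg_triple_mixed: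
 assumes Z: "Zyg s N u" and "0 <= ta" "ta <= s"
 shows "Zyg ta (8 * N * k pw (s - ta)) (df3 k u)"
 unfolding Zyg_def
proof (intro conjI allI)
 have N: "0 <= N" using Z Zyg_nonneg by blast
 thus "0 <= 8 * N * k pw (s - ta)" by simp
 fix h x
 let ?G = "df3 h (df3 k u)"
 show "norm (?G x) <= 8 * N * k pw (s - ta) * h pw ta"
 proof (cases "norm h <= norm k")
  case True
  have "norm (?G x) <= (8 * N) * h pw s"
  by (rule ZygD[OF Zyg_df3[OF Z]])
  also have "h pw s = h pw (s - ta) * h pw ta"
  by (simp flip: powr_add)
  also have "8 * N * (h pw (s - ta) * h pw ta) <= 8 * N * (k pw (s - ta) * h pw ta)"
  using N True assms by (intro mlm mrm powr_mono2) auto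
  finally show ?thesis by (simp add: mult.assoc)
 next
  case False
  have e: "?G = df3 k (df3 h u)"
  by (metis df_commute)
  have "norm (?G x) <= (8 * N) * k pw s"
  unfolding e by (rule ZygD[OF Zyg_df3[OF Z]])
  also have "k pw s = k pw (s - ta) * k pw ta"
  by (simp flip: powr_add)
  also have "8 * N * (k pw (s - ta) * k pw ta) <= 8 * N * (k pw (s - ta) * h pw ta)"
  using N False assms by (intro mlm powr_mono2) auto
  finally show ?thesis by (simp add: mult.assoc)
 qed
qed

text \<open>The Marchaud inequality is applied in \<open>h\<close> to \<open>df3 k u\<close>, whose
  seminorm of order \<open>ta\<close> carries the factor \<open>|k|^(s - ta)\<close>. The increment
  \<open>h\<close> takes \<open>ta\<close> of the order and \<open>k\<close> the rest.\<close>

lemma Zyg_mixed2: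
 assumes u: "bd M u" and Z: "Zyg s N u" and "0 <= ta" "ta <= s" "ta < 2"
 shows "Zyg (s - ta) (8 * marchaud2 ta * N * h pw ta) (df2 h u)"
 unfolding Zyg_def
proof (intro conjI allI)
 show "0 <= 8 * marchaud2 ta * N * h pw ta"
  using Zyg_nonneg[OF Z] marchaud2_pos[OF assms(5)] by simp
 fix k x
 have "df3 k (df2 h u) = df2 h (df3 k u)"
  by (metis df_commute)
 thus "norm (df3 k (df2 h u) x) <= 8 * marchaud2 ta * N * h pw ta * k pw (s - ta)"
  using df2_bound[OF bd_df3[OF u] Zyg_triple_mixed[OF Z assms(3,4)] assms(5), of h k x]
  by (simp add: alg)
qed

lemma Zyg_mixed1:
 assumes u: "bd M u" and Z: "Zyg s N u" and "0 <= ta" "ta <= s" "ta < 1"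
 shows "Zyg (s - ta) (8 * (marchaud1 ta * marchaud2 ta) * N * h pw ta) (df h u)"
 unfolding Zyg_def
proof (intro conjI allI)
 show "0 <= 8 * (marchaud1 ta * marchaud2 ta) * N * h pw ta"
  using Zyg_nonneg[OF Z] marchaud2_pos[of ta] marchaud1_pos[of ta] assms by simp
 fix k x
 have "df3 k (df h u) = df h (df3 k u)"
  by (metis df_commute)
 thus "norm (df3 k (df h u) x) <= 8 * (marchaud1 ta * marchaud2 ta) * N * h pw ta * k pw (s - ta)"
  using df1_bound[OF bd_df3[OF u] Zyg_triple_mixed[OF Z assms(3,4)] assms(5), of h k x]
  by (simp add: alg)
qed

section \<open>Interpolation between the sup norm and a seminorm\<close>

lemma Zyg_interp:
 assumes u: "bd M u" and Z: "Zyg s N u" and "0 <= sg" "sg <= s" "0 < r"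
 shows "Zyg sg (N * r powr (s - sg) + 8 * M * r powr (- sg)) u"
 unfolding Zyg_def
proof (intro conjI allI)
 have N: "0 <= N" using Z Zyg_nonneg by blast
 have M: "0 <= M" using u bd_nonneg by blast
 thus "0 <= N * r powr (s - sg) + 8 * M * r powr (- sg)" using N by simp
 fix h :: 'a and x
 show "norm (df3 h u x) <= (N * r powr (s - sg) + 8 * M * r powr (- sg)) * h pw sg"
 proof (cases "norm h <= r")
  case True
  have "norm (df3 h u x) <= N * h pw s" by (rule ZygD[OF Z])
  also have "h pw s = h pw (s - sg) * h pw sg"
  by (simp flip: powr_add)
  also have "N * (h pw (s - sg) * h pw sg) <= N * (r powr (s - sg) * h pw sg)"
  using N True assms by (intro mlm mrm powr_mono2) auto
  also have "... <= (N * r powr (s - sg) + 8 * M * r powr (- sg)) * h pw sg"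
  using M by (simp add: alg)
  finally show ?thesis .
 next
  case False
  have "norm (df3 h u x) <= 8 * M" by (rule bdD[OF bd_df3[OF u]])
  also have "... = 8 * M * (r powr (- sg) * r powr sg)"
  using assms by (simp flip: powr_add)
  also have "... <= 8 * M * (r powr (- sg) * h pw sg)"
  using M False assms by (intro mlm powr_mono2) auto
  also have "... <= (N * r powr (s - sg) + 8 * M * r powr (- sg)) * h pw sg"
  using N by (simp add: alg)
  finally show ?thesis .
 qed
qed

text \<open>All orders up to \<open>p\<close> at once, so that a lower-order norm is a single number.\<close>
definition low :: "real => real => ('a::real_normed_vector => 'b::real_normed_vector) => bool" where
 "low p Q u \<longleftrightarrow> bd Q u & (ALL sg. 0 < sg & sg <= p --> Zyg sg Q u)"

lemma low_bd: "low p Q u ==> bd Q u" and low_Zyg: "low p Q u ==> 0 < sg ==> sg <= p ==> Zyg sg Q u"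
 by (auto simp: low_def)

lemma low_mono: "low p Q u ==> Q <= Q' ==> low p Q' u"
 unfolding low_def using bd_mono Zyg_mono by blast

lemma low_interp:
 assumes u: "bd M u" and Z: "Zyg s N u" and "0 < p" "p <= s" "0 < r" "r <= 1"
 shows "low p (N * r powr (s - p) + 8 * M * r powr (- p)) u"
 unfolding low_def
proof (intro conjI allI impI)
 have N: "0 <= N" using Z Zyg_nonneg by blast
 have M: "0 <= M" using u bd_nonneg by blast
 have "r powr 0 <= r powr (- p)" using assms by (intro powr_mono') auto
 hence r: "1 <= r powr (- p)" using assms by simp
 have "M * 1 <= M * (8 * r powr (- p))"
  using M r by (intro mlm) auto
 hence "M <= N * r powr (s - p) + 8 * M * r powr (- p)"
  using M mult_nonneg_nonneg[OF N, of "r powr (s-p)"] by simp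
 thus "bd (N * r powr (s - p) + 8 * M * r powr (- p)) u" using bd_mono u by blast
 fix sg assume s: "0 < sg & sg <= p"
 show "Zyg sg (N * r powr (s - p) + 8 * M * r powr (- p)) u"
 proof (rule Zyg_mono[OF Zyg_interp[OF u Z, of sg r]])
  show "N * r powr (s - sg) + 8 * M * r powr (- sg) <= N * r powr (s - p) + 8 * M * r powr (- p)"
  using N M assms s by (intro add_mono mlm powr_mono') auto
 qed (use s assms in auto)
qed

lemma low_Zyg1:
 assumes "bd N u" "Zyg s N u" "0 < p" "p <= s" shows "low p (9 * N) u"
 using low_interp[OF assms(1,2,3,4), of 1] by simp

text \<open>A scale \<open>r\<close> with \<open>r powr (s - p) <= e\<close> gives the top-order
  seminorm the factor \<open>e\<close>, at the price of a large factor in front of the sup norm.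
  Keeping \<open>r <= 1\<close> lets one scale serve all orders up to \<open>p\<close>.\<close>

lemma low_interp_eps:
 assumes "0 < p" "p < s" "0 < e"
 shows "EX C>0. ALL u M N. bd M u & Zyg s N u --> low p (e * N + C * M) u"
proof -
 define r where "r = min 1 (e powr (1 / (s - p)))"
 have r: "0 < r" "r <= 1" using assms by (auto simp: r_def)
 have "r powr (s - p) <= (e powr (1 / (s - p))) powr (s - p)"
  using r assms by (intro powr_mono2) (auto simp: r_def)
 also have "... = e" using assms by (simp add: powr_powr)
 finally have re: "r powr (s - p) <= e" .
 show ?thesis
 proof (intro exI[of _ "8 * r powr (- p)"] conjI allI impI)
  show "0 < 8 * r powr (- p)" using r by simp
  fix u :: "'a::real_normed_vector => 'b::real_normed_vector" and M N assume a: "bd M u & Zyg s N u"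
  hence "0 <= N" using Zyg_nonneg by blast
  have "low p (N * r powr (s - p) + 8 * M * r powr (- p)) u"
  using a assms r by (intro low_interp) auto
  moreover have "N * r powr (s - p) <= e * N" using mlm[OF re \<open>0 <= N\<close>] by (simp add: mult.commute)
  ultimately show "low p (e * N + 8 * r powr (- p) * M) u"
  by (elim low_mono) (simp add: alg)
 qed
qed

lemma Zyg_continuous:
 assumes u: "bd M u" and Z: "Zyg s N u" and "0 < s"
 shows "continuous_on UNIV u"
proof -
 define sg where "sg = min s (1/2)"
 have sg: "0 < sg" "sg <= s" "sg < 1" using assms by (auto simp: sg_def)
 obtain C where C: "!!h x. norm (df h u x) <= C * h pw sg"
  using df1_bound[OF u Zyg_interp[OF u Z, of sg 1] sg(3)] sg by fastforce
 show ?thesis unfolding continuous_on_eq_continuous_within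
 proof (intro ballI)
  fix x :: 'a
  have "((%y. C * norm (y - x) powr sg) \<longlongrightarrow> C * 0) (at x)"
  proof (intro tendsto_intros)
  have "((%y. norm (y - x)) \<longlongrightarrow> norm (x - x)) (at x)" by (intro tendsto_intros)
  thus "((%y. norm (y - x) powr sg) \<longlongrightarrow> 0) (at x)"
  using sg by (intro tendsto_zero_powrI[where b = sg]) (auto)
  qed
  hence lim: "((%y. C * norm (y - x) powr sg) \<longlongrightarrow> 0) (at x)" by simp
  have "((%y. u y - u x) \<longlongrightarrow> 0) (at x)"
  proof (rule Lim_null_comparison[OF _ lim])
  show "\<forall>\<^sub>F y in at x. norm (u y - u x) <= C * norm (y - x) powr sg"
  using C[of "_ - x" x] by (auto simp: df_def intro!: always_eventually)
  qed
  hence "(u \<longlongrightarrow> u x) (at x)" by (rule LIM_zero_cancel)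
  thus "continuous (at x within UNIV) u" by (simp add: continuous_within)
 qed
qed

section \<open>The gradient\<close>

text \<open>Cauchy's functional equation. The defect \<open>f r - r * f 1\<close> is additive and
  vanishes on the integers, so it is periodic and bounded everywhere; a bounded additive function is
  zero.\<close>

lemma additive_locally_bounded_scale:
 fixes f :: "real => real"
 assumes add: "!!x y. f (x + y) = f x + f y" and b: "!!r. abs r <= 1 ==> abs (f r) <= B"
 shows "f r = r * f 1"
proof -
 define g where "g r = f r - r * f 1" for r
 have gadd: "g (x + y) = g x + g y" for x y by (simp add: g_def add alg)
 have g0: "g 0 = 0" using gadd[of 0 0] by simp
 have gminus: "g (- x) = - g x" for x using gadd[of x "-x"] g0 by simp
 have gn: "g (real n * x) = real n * g x" for n x
  by (induction n) (auto simp: g0 gadd alg)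
 have g1: "g 1 = 0" by (simp add: g_def)
 have gint: "g (of_int n) = 0" for n
  using gn[of "nat (abs n)" 1] gminus[of "of_int n"] g1 by (cases "n >= 0") auto
 have gb: "abs (g r) <= 2 * B" for r
 proof -
  have "g r = g (frac r)" using gadd[of "frac r" "of_int \<lfloor>r\<rfloor>"] gint by (simp add: frac_def)
  moreover have "abs (frac r) <= 1" using frac_ge_0[of r] frac_lt_1[of r] by linarith
  moreover have "abs (frac r * f 1) <= 1 * abs (f 1)" unfolding abs_mult
  using \<open>abs (frac r) <= 1\<close> by (intro mrm) auto
  moreover have "abs (f 1) <= B" using b[of 1] by simp
  ultimately show ?thesis using b[of "frac r"] unfolding g_def by linarith
 qed
 have "g r = 0"
 proof (rule ccontr)
  assume a: "g r ~= 0"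
  obtain n where "2 * B < real n * abs (g r)" using a reals_Archimedean3[of "abs (g r)"] by auto
  thus False using gb[of "real n * r"] gn[of n r] by (simp add: abs_mult)
 qed
 thus ?thesis by (simp add: g_def)
qed

definition taylor_const :: "real => real" where
 "taylor_const sg = marchaud2 sg / (1 - 2 powr (1 - sg))"

lemma taylor_const_pos: "1 < sg ==> sg < 2 ==> 0 < taylor_const sg"
 using powr_less_one[of 2 "1 - sg"] marchaud2_pos[of sg] by (simp add: taylor_const_def)

text \<open>The quotients \<open>2^k (u(x + y/2^k) - u(x))\<close> change from \<open>k\<close> to
  \<open>k + 1\<close> by \<open>2^k\<close> times a second difference with step
  \<open>y/2^(k+1)\<close>, a geometric quantity of ratio \<open>2 powr (1 - sg)\<close>. Hence they
  converge for \<open>sg > 1\<close>, and the sum of the series bounds the distance of the limit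
  from the increment. The limit is additive because its defect again consists of second differences,
  and it is bounded on segments, hence linear by Cauchy's equation.\<close>

lemma linear_part_exists:
 fixes u :: "'a::real_normed_vector => real"
 assumes u: "bd M u" and Z: "!!h x. norm (df2 h u x) <= Q * h pw sg" and "0 <= Q" "1 < sg"
 shows "EX D. linear D & (ALL y. abs (u (x + y) - u x - D y) <= Q / (1 - 2 powr (1 - sg)) * y pw sg)"
proof -
 define q where "q = (2::real) powr (1 - sg)"
 have q: "0 < q" "q < 1" using assms by (auto simp: q_def powr_less_one)
 define a where "a y k = 2 ^ k * (u (x + (1 / 2 ^ k) *. y) - u x)" for y k
 have pw: "2 ^ k * norm ((1 / 2 ^ k) *. y) powr sg = q ^ k * y pw sg" for k and y :: 'a
 proof -
  have "norm ((1 / 2 ^ k) *. y) = 2 powr (- real k) * norm y"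
  by (simp add: powr_minus powr_realpow divide_simps)
  hence "norm ((1 / 2 ^ k) *. y) powr sg = (2 powr (- real k)) powr sg * y pw sg"
  by (simp only: powr_mult)
  hence "2 ^ k * norm ((1 / 2 ^ k) *. y) powr sg = (2 powr real k * 2 powr (- real k * sg)) * y pw sg"
  by (simp add: powr_powr powr_realpow)
  also have "2 powr real k * 2 powr (- real k * sg) = (2 powr (1 - sg)) powr real k"
  by (simp add: powr_powr alg flip: powr_add)
  also have "... = q ^ k" unfolding q_def[symmetric] using q by (simp add: powr_realpow)
  finally show ?thesis .
 qed
 have d: "abs (a y (Suc k) - a y k) <= Q * y pw sg * q ^ k" for y k
 proof -
  define z where "z = (1 / 2 ^ Suc k) *. y"
  have z2: "(1 / 2 ^ k) *. y = z + z" unfolding z_def by (simp add: scaleR_add_left[symmetric])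
  have "a y (Suc k) - a y k = - (2 ^ k * df2 z u x)"
  unfolding a_def z_def[symmetric] z2 df_def by (simp add: alg)
  hence "abs (a y (Suc k) - a y k) = 2 ^ k * norm (df2 z u x)" by (simp add: abs_mult)
  also have "... <= 2 ^ k * (Q * z pw sg)" by (intro mlm Z) auto
  also have "... <= 2 ^ k * (Q * norm ((1 / 2 ^ k) *. y) powr sg)"
  using assms unfolding z_def
  by (intro mlm powr_mono2) (auto simp: divide_simps)
  also have "... = Q * y pw sg * q ^ k" using pw[of k y] by (simp add: alg)
  finally show ?thesis .
 qed
 define D where "D y = a y 0 + (\<Sum>k. a y (Suc k) - a y k)" for y
 have gs: "(%k. Q * y pw sg * q ^ k) sums (Q * y pw sg * (1 / (1 - q)))" for y :: 'a
  using q by (intro sums_mult geometric_sums) auto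
 have sm: "summable (%k. a y (Suc k) - a y k)" for y
  by (rule summable_comparison_test'[OF sums_summable[OF gs[of y]], of 0]) (use d in auto)
 have lim: "(%n. a y n) ~~> D y" for y
 proof -
  have "(%n. a y 0 + (\<Sum>k<n. a y (Suc k) - a y k)) ~~> D y"
  unfolding D_def by (intro tendsto_intros summable_LIMSEQ sm)
  thus ?thesis by (simp add: sum_lessThan_telescope)
 qed
 have bnd: "abs (u (x + y) - u x - D y) <= Q / (1 - q) * y pw sg" for y
 proof -
  have "norm (\<Sum>k. a y (Suc k) - a y k) <= (\<Sum>k. Q * y pw sg * q ^ k)"
  by (rule norm_suminf_le) (use d sums_summable[OF gs[of y]] in auto)
  also have "... = Q / (1 - q) * y pw sg" using sums_unique[OF gs[of y]] by simp
  finally show ?thesis unfolding D_def by (simp add: a_def)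
 qed
 have add: "D (y + z) = D y + D z" for y z
 proof -
  have "(%k. a (y + z) k - a y k - a z k) ~~> D (y + z) - D y - D z"
  by (intro tendsto_intros lim)
  moreover have "(%k. a (y + z) k - a y k - a z k) ~~> 0"
  proof (rule Lim_null_comparison)
  show "(%k. q ^ k * (Q * (norm (y + z) powr sg + norm (z - y) powr sg))) ~~> 0"
  using q by (intro tendsto_mult_left_zero LIMSEQ_realpow_zero) auto
  have "abs (a (y + z) k - a y k - a z k) <= q ^ k * (Q * (norm (y + z) powr sg + norm (z - y) powr sg))" for k
  proof -
  define p where "p = (1 / 2 ^ k) *. y"
  define w where "w = (1 / 2 ^ k) *. z"
  \<comment> \<open>The defect of additivity is a difference of two second differences with the
    common midpoint \<open>x + (p + w)/2\<close>: one spans \<open>x\<close> and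
    \<open>x + p + w\<close>, the other \<open>x + p\<close> and \<open>x + w\<close>.\<close>
  define r where "r = (1/2) *. (p + w)"
  define t where "t = (1/2) *. (w - p)"
  have r2: "x + r + r = x + (p + w)" unfolding r_def
  using scaleR_add_left[of "1/2" "1/2" "p + w"] by (simp add: add.assoc)
  have t2: "x + p + t + t = x + w" unfolding t_def
  using scaleR_add_left[of "1/2" "1/2" "w - p"] by (simp add: add.assoc)
  have pt: "x + p + t = x + r"
  proof -
  have "p = (1/2) *. p + (1/2) *. p" by (simp flip: scaleR_add_left)
  thus ?thesis unfolding t_def r_def by (simp add: alg)
  qed
  have "a (y + z) k - a y k - a z k = 2 ^ k * (df2 r u x - df2 t u (x + p))"
  unfolding a_def df_def r2 t2 unfolding pt scaleR_add_right p_def[symmetric] w_def[symmetric]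
  by (simp add: alg)
  hence "abs (a (y + z) k - a y k - a z k) = 2 ^ k * abs (df2 r u x - df2 t u (x + p))"
  by (simp add: abs_mult)
  also have "... <= 2 ^ k * (Q * norm (p + w) powr sg + Q * norm (w - p) powr sg)"
  proof (rule mlm)
  have "abs (df2 r u x) <= Q * norm (p + w) powr sg"
  proof -
  have "Q * r pw sg <= Q * norm (p + w) powr sg"
  using assms by (auto simp: r_def intro!: mlm powr_mono2)
  thus ?thesis using Z[of r x] by simp
  qed
  moreover have "abs (df2 t u (x + p)) <= Q * norm (w - p) powr sg"
  proof -
  have "Q * t pw sg <= Q * norm (w - p) powr sg"
  using assms by (auto simp: t_def intro!: mlm powr_mono2)
  thus ?thesis using Z[of t "x + p"] by simp
  qed
  ultimately show "abs (df2 r u x - df2 t u (x + p)) <= Q * norm (p + w) powr sg + Q * norm (w - p) powr sg"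
  by linarith
  qed simp
  also have "... = q ^ k * (Q * (norm (y + z) powr sg + norm (z - y) powr sg))"
  proof -
  have "p + w = (1 / 2 ^ k) *. (y + z)" "w - p = (1 / 2 ^ k) *. (z - y)"
  by (simp_all add: p_def w_def scaleR_add_right scaleR_diff_right)
  hence "2 ^ k * (Q * norm (p + w) powr sg + Q * norm (w - p) powr sg)
  = Q * (2 ^ k * norm ((1 / 2 ^ k) *. (y + z)) powr sg) + Q * (2 ^ k * norm ((1 / 2 ^ k) *. (z - y)) powr sg)"
  by (simp only: distrib_left mult.left_commute)
  also have "... = q ^ k * (Q * (norm (y + z) powr sg + norm (z - y) powr sg))"
  unfolding pw by (simp only: distrib_left mult.left_commute)
  finally show ?thesis .
  qed
  finally show ?thesis .
  qed
  thus "\<forall>\<^sub>F k in sequentially. norm (a (y + z) k - a y k - a z k) <= q ^ k * (Q * (norm (y + z) powr sg + norm (z - y) powr sg))"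
  by simp
  qed
  ultimately have "D (y + z) - D y - D z = 0" using LIMSEQ_unique by blast
  thus ?thesis by simp
 qed
 have "linear D"
 proof (rule linearI)
  fix r :: real and y
  have "D (r *. y) = r * D (1 *. y)"
  proof (rule additive_locally_bounded_scale[of "%r. D (r *. y)" "2 * M + Q / (1 - q) * y pw sg"])
  fix r :: real assume r: "abs r <= 1"
  have "abs (u (x + r *. y) - u x) <= 2 * M" using bdD[OF bd_df[OF u], of "r *. y" x] by (simp add: df_def)
  moreover have "Q / (1 - q) * norm (r *. y) powr sg <= Q / (1 - q) * y pw sg"
  using assms q r by (intro mlm powr_mono2) (auto simp: mult_left_le_one_le)
  ultimately show "abs (D (r *. y)) <= 2 * M + Q / (1 - q) * y pw sg"
  using bnd[of "r *. y"] by linarith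
  qed (simp add: scaleR_add_left add)
  thus "D (r *. y) = r *. D y" by simp
 qed (rule add)
 thus ?thesis using bnd unfolding q_def by blast
qed

lemma grad_eqI:
 fixes u :: "real^'d => real"
 assumes "(u has_derivative (%y. g \<bullet> y)) (at x)"
 shows "grad u x = g"
proof -
 have "pdiff i u x = g $ i" for i
 proof -
  have "((%r. u (x + r *. axis i 1)) has_derivative (%r. g \<bullet> (0 + r *. axis i 1))) (at 0)"
  by (rule has_derivative_compose[of "%r. x + r *. axis i 1" _ 0 _ u, simplified])
  (use assms in \<open>auto intro!: derivative_eq_intros\<close>)
  hence "((%r. u (x + r *. axis i 1)) has_vector_derivative (g $ i)) (at 0)"
  by (simp add: has_vector_derivative_def inner_axis mult.commute)
  thus ?thesis unfolding pdiff_def by (rule vector_derivative_at)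
 qed
 thus ?thesis by (simp add: grad_def vec_eq_iff)
qed

text \<open>The linear part found by dyadic quotients is a derivative in the usual sense, and its
  values on the axes identify it with \<open>grad\<close>, which is built from one-dimensional
  derivatives only.\<close>

lemma grad_taylor:
 fixes u :: "real^'d => real"
 assumes u: "bd M u" and Z: "Zyg sg Q u" and s: "1 < sg" "sg < 2"
 shows "abs (u (x + y) - u x - grad u x \<bullet> y) <= taylor_const sg * Q * y pw sg"
  and "(u has_derivative (%y. grad u x \<bullet> y)) (at x)"
proof -
 have Q: "0 <= marchaud2 sg * Q" using Zyg_nonneg[OF Z] marchaud2_pos[of sg] s by simp
 obtain D where D: "linear D" and
  b: "!!y. abs (u (x + y) - u x - D y) <= taylor_const sg * Q * y pw sg"
  using linear_part_exists[OF u df2_bound[OF u Z s(2)] Q s(1), of x]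
  by (auto simp: taylor_const_def)
 define g where "g = (\<chi> i. D (axis i 1))"
 have Dg: "D y = g \<bullet> y" for y
 proof -
  have "D y = D (\<Sum>i\<in>UNIV. y $ i *. axis i 1)"
  using basis_expansion[of y] by (simp add: scalar_mult_eq_scaleR)
  also have "... = g \<bullet> y"
  using D by (simp add: linear_sum linear_scale inner_vec_def g_def mult.commute)
  finally show ?thesis .
 qed
 have der: "(u has_derivative (%y. g \<bullet> y)) (at x)"
  unfolding has_derivative_at
 proof (intro conjI)
  show "bounded_linear (%y. g \<bullet> y)" by (rule bounded_linear_inner_right)
  show "(%h. norm (u (x + h) - u x - g \<bullet> h) / norm h) \<midarrow>0\<rightarrow> 0"
  proof (rule Lim_null_comparison)
  have "((%h::real^'d. norm h) \<longlongrightarrow> 0) (at 0)" by (rule tendsto_norm_zero) simp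
  hence "((%h::real^'d. h pw (sg - 1)) \<longlongrightarrow> 0) (at 0)"
  using s by (intro tendsto_zero_powrI[where b = "sg - 1"]) auto
  thus "((%h::real^'d. taylor_const sg * Q * h pw (sg - 1)) \<longlongrightarrow> 0) (at 0)"
  by (rule tendsto_mult_right_zero)
  have "norm (norm (u (x + h) - u x - g \<bullet> h) / norm h) <= taylor_const sg * Q * h pw (sg - 1)" if "h ~= 0" for h
  using b[of h] that unfolding Dg by (simp add: powr_diff divide_right_mono)
  thus "\<forall>\<^sub>F h in at 0. norm (norm (u (x + h) - u x - g \<bullet> h) / norm h) <= taylor_const sg * Q * h pw (sg - 1)"
  by (auto simp: eventually_at_filter)
  qed
 qed
 have "grad u x = g" by (rule grad_eqI[OF der])
 thus "abs (u (x + y) - u x - grad u x \<bullet> y) <= taylor_const sg * Q * y pw sg"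
  "(u has_derivative (%y. grad u x \<bullet> y)) (at x)"
  using b[of y] der Dg by auto
qed

lemma grad_has_derivative:
 fixes u :: "real^'d => real"
 assumes u: "bd M u" and Z: "Zyg s Q u" and s: "1 < s"
 shows "(u has_derivative (%y. grad u x \<bullet> y)) (at x)"
proof -
 define sg where "sg = min s (3/2)"
 have "1 < sg" "sg < 2" "sg <= s" using s by (auto simp: sg_def)
 thus ?thesis
  using grad_taylor(2)[OF u Zyg_interp[OF u Z, of sg 1]] by simp
qed

lemma grad_lin:
 fixes u v :: "real^'d => real"
 assumes "(u has_derivative (%y. grad u x \<bullet> y)) (at x)" "(v has_derivative (%y. grad v x \<bullet> y)) (at x)"
 shows "grad (%x. u x + a * v x) x = grad u x + a *. grad v x"
 using assms by (intro grad_eqI) (auto intro!: derivative_eq_intros simp: inner_left_distrib)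

lemma grad_df:
 fixes u :: "real^'d => real"
 assumes d: "!!x. (u has_derivative (%y. grad u x \<bullet> y)) (at x)"
 shows "grad (df h u) x = df h (grad u) x" "(df h u has_derivative (%y. grad (df h u) x \<bullet> y)) (at x)"
proof -
 have "((%x. u (x + h)) has_derivative (%y. grad u (x + h) \<bullet> y)) (at x)"
  by (rule has_derivative_compose[of "%x. x + h" "%y. y" x UNIV u, simplified])
  (use d in \<open>auto intro!: derivative_eq_intros\<close>)
 hence "(df h u has_derivative (%y. df h (grad u) x \<bullet> y)) (at x)"
  unfolding df_def using d[of x] by (auto intro!: derivative_eq_intros simp: inner_diff_left)
 thus "grad (df h u) x = df h (grad u) x" "(df h u has_derivative (%y. grad (df h u) x \<bullet> y)) (at x)"
  using grad_eqI[of "df h u" "df h (grad u) x" x] by auto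
qed

lemma grad_shift:
 fixes u :: "real^'d => real"
 shows "grad (%x. u (x + h)) x = grad u (x + h)"
 by (simp add: grad_def pdiff_def add_ac)

definition grad_const :: "real => real" where
 "grad_const ta = marchaud1 (1 - ta) * marchaud2 (1 - ta) + taylor_const (1 + ta)"

lemma grad_const_pos: "0 < ta ==> ta < 1 ==> 0 < grad_const ta"
 unfolding grad_const_def
 by (intro add_pos_pos mult_pos_pos marchaud1_pos marchaud2_pos taylor_const_pos) auto

text \<open>A step of length \<open>r\<close> along the gradient turns \<open>r |grad g|\<close>
  into an increment plus a Taylor remainder. Order one alone would not control a gradient, so the
  two orders \<open>1 - ta\<close> and \<open>1 + ta\<close> are used; the free scale
  \<open>r\<close> lets them be balanced, typically at the length of an increment.\<close>

lemma grad_bound: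
 fixes g :: "real^'d => real"
 assumes u: "bd M g" and Z1: "Zyg (1 - ta) Q1 g" and Z2: "Zyg (1 + ta) Q2 g"
  and t: "0 < ta" "ta < 1" and r: "0 < r"
 shows "norm (grad g x) <= grad_const ta * (Q1 * r powr (- ta) + Q2 * r powr ta)"
proof (cases "grad g x = 0")
 case True
 thus ?thesis using grad_const_pos[OF t] Zyg_nonneg[OF Z1] Zyg_nonneg[OF Z2] by simp
next
 case False
 define y where "y = (r / norm (grad g x)) *. grad g x"
 have ny: "norm y = r" using False r by (simp add: y_def)
 have "grad g x \<bullet> y = r * norm (grad g x)"
  using False by (simp add: y_def power2_norm_eq_inner[symmetric] power2_eq_square)
 moreover have "abs (g (x + y) - g x) <= marchaud1 (1 - ta) * marchaud2 (1 - ta) * Q1 * r powr (1 - ta)"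
  using df1_bound[OF u Z1, of y x] t ny by (simp add: df_def)
 moreover have "abs (g (x + y) - g x - grad g x \<bullet> y) <= taylor_const (1 + ta) * Q2 * r powr (1 + ta)"
  using grad_taylor(1)[OF u Z2, of x y] t ny by simp
 ultimately have le: "r * norm (grad g x) <= marchaud1 (1 - ta) * marchaud2 (1 - ta) * Q1 * r powr (1 - ta)
  + taylor_const (1 + ta) * Q2 * r powr (1 + ta)" by linarith
 also have "... = r * (marchaud1 (1 - ta) * marchaud2 (1 - ta) * (Q1 * r powr (- ta)) + taylor_const (1 + ta) * (Q2 * r powr ta))"
  using r by (simp add: powr_diff powr_add powr_minus divide_simps alg)
 finally have "norm (grad g x) <= marchaud1 (1 - ta) * marchaud2 (1 - ta) * (Q1 * r powr (- ta)) + taylor_const (1 + ta) * (Q2 * r powr ta)"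
  using r by simp
 also have "... <= grad_const ta * (Q1 * r powr (- ta)) + grad_const ta * (Q2 * r powr ta)"
  using Zyg_nonneg[OF Z1] Zyg_nonneg[OF Z2] t unfolding grad_const_def
  by (intro add_mono mrm) (auto intro!: mult_nonneg_nonneg less_imp_le[OF marchaud1_pos]
  less_imp_le[OF marchaud2_pos] less_imp_le[OF taylor_const_pos])
 finally show ?thesis by (simp add: alg)
qed

section \<open>Power kernels\<close>

lemma dyadic_bracket:
 fixes z :: real assumes "1 <= z" shows "EX k::nat. 2 ^ k <= z & z < 2 ^ Suc k"
proof -
 obtain n where n: "z < 2 ^ n" using real_arch_pow[of 2 z] by auto
 define m where "m = (LEAST n. z < 2 ^ n)"
 have m: "z < 2 ^ m" unfolding m_def by (rule LeastI[of "%n. z < 2 ^ n", OF n])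
 hence "m ~= 0" using assms by (cases m) auto
 then obtain k where k: "m = Suc k" by (cases m) auto
 hence "~ z < 2 ^ k" using not_less_Least[of k "%n. z < 2 ^ n"] m_def by auto
 thus ?thesis using m k by (intro exI[of _ k]) auto
qed

lemma annulus_integral_le:
 fixes ro :: real assumes "0 < ro"
 shows "(\<integral>\<^sup>+(y::real^'d). ennreal (y pw (- real CARD('d))) * indicator {y. ro < norm y & norm y <= 2 * ro} y \<partial>lborel)
  <= ennreal (unit_ball_vol (real CARD('d)) * 2 ^ CARD('d))"
proof -
 have "(\<integral>\<^sup>+(y::real^'d). ennreal (y pw (- real CARD('d))) * indicator {y. ro < norm y & norm y <= 2 * ro} y \<partial>lborel)
  <= (\<integral>\<^sup>+(y::real^'d). ennreal (ro powr (- real CARD('d))) * indicator (cball 0 (2 * ro)) y \<partial>lborel)"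
  using assms by (intro nn_integral_mono)
  (auto simp: indicator_def intro!: ennreal_leI powr_mono2')
 also have "... = ennreal (ro powr (- real CARD('d))) * ennreal (unit_ball_vol (real CARD('d)) * (2 * ro) ^ CARD('d))"
  using assms by (subst nn_integral_cmult_indicator) (auto simp: emeasure_cball)
 also have "... = ennreal (unit_ball_vol (real CARD('d)) * 2 ^ CARD('d))"
  using assms by (subst ennreal_mult[symmetric])
  (auto simp: powr_minus powr_realpow power_mult_distrib field_simps)
 finally show ?thesis .
qed

text \<open>This replaces polar coordinates. The weight \<open>|y|^(-d)\<close> has mass bounded
  uniformly over all annuli \<open>ro < |y| <= 2 ro\<close>, so a function that is at most
  \<open>c q^k |y|^(-d)\<close> on the \<open>k\<close>-th annulus is dominated by a geometric
  series. The annuli shrink for integrals near the origin and grow for integrals at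
  infinity.\<close>

lemma dyadic_integral_le:
 fixes f :: "real^'d => real"
 assumes "0 < ta" "0 <= c" "!!k. 0 < ro k"
  and cover: "!!y. f y ~= 0 ==> EX k. ro k < norm y & norm y <= 2 * ro k & f y <= c * (2 powr (- ta)) ^ k * y pw (- real CARD('d))"
 shows "(\<integral>\<^sup>+y. ennreal (f y) \<partial>lborel) <= ennreal (unit_ball_vol (real CARD('d)) * 2 ^ CARD('d) / (1 - 2 powr (- ta)) * c)"
proof -
 let ?q = "(2::real) powr (- ta)" and ?V = "unit_ball_vol (real CARD('d)) * 2 ^ CARD('d)"
 let ?A = "%k. {y::real^'d. ro k < norm y & norm y <= 2 * ro k}"
 have q: "0 < ?q" "?q < 1" using assms by (auto simp: powr_less_one)
 have "(\<integral>\<^sup>+y. ennreal (f y) \<partial>lborel)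
  <= (\<integral>\<^sup>+y. (\<Sum>k. ennreal (c * ?q ^ k) * (ennreal (y pw (- real CARD('d))) * indicator (?A k) y)) \<partial>lborel)"
 proof (rule nn_integral_mono)
  fix y :: "real^'d"
  show "ennreal (f y) <= (\<Sum>k. ennreal (c * ?q ^ k) * (ennreal (y pw (- real CARD('d))) * indicator (?A k) y))"
  proof (cases "f y = 0")
  case False
  then obtain k where k: "y \<in> ?A k" "f y <= c * ?q ^ k * y pw (- real CARD('d))"
  using cover by blast
  have "ennreal (f y) <= ennreal (c * ?q ^ k * y pw (- real CARD('d)))"
  using k by (intro ennreal_leI)
  also have "... = ennreal (c * ?q ^ k) * (ennreal (y pw (- real CARD('d))) * indicator (?A k) y)"
  using k assms by (simp add: ennreal_mult)
  also have "... = (\<Sum>j\<in>{k}. ennreal (c * ?q ^ j) * (ennreal (y pw (- real CARD('d))) * indicator (?A j) y))"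
  by simp
  also have "... <= (\<Sum>k. ennreal (c * ?q ^ k) * (ennreal (y pw (- real CARD('d))) * indicator (?A k) y))"
  by (rule sum_le_suminf) auto
  finally show ?thesis .
  qed simp
 qed
 also have "... = (\<Sum>k. \<integral>\<^sup>+y. ennreal (c * ?q ^ k) * (ennreal (y pw (- real CARD('d))) * indicator (?A k) y) \<partial>lborel)"
  by (rule nn_integral_suminf) measurable
 also have "... <= (\<Sum>k. ennreal (c * ?q ^ k) * ennreal ?V)"
 proof (rule suminf_le)
  fix k
  have "(\<integral>\<^sup>+y. ennreal (c * ?q ^ k) * (ennreal (y pw (- real CARD('d))) * indicator (?A k) y) \<partial>lborel)
  = ennreal (c * ?q ^ k) * (\<integral>\<^sup>+y. (ennreal (y pw (- real CARD('d))) * indicator (?A k) y) \<partial>lborel)"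
  by (rule nn_integral_cmult) measurable
  also have "... <= ennreal (c * ?q ^ k) * ennreal ?V"
  by (intro mlm annulus_integral_le assms) auto
  finally show "(\<integral>\<^sup>+y. ennreal (c * ?q ^ k) * (ennreal (y pw (- real CARD('d))) * indicator (?A k) y) \<partial>lborel)
  <= ennreal (c * ?q ^ k) * ennreal ?V" .
 qed auto
 also have "... = (\<Sum>k. ennreal (c * ?V * ?q ^ k))"
  using assms by (intro arg_cong[where f = suminf] ext) (simp add: ennreal_mult[symmetric] alg)
 also have "... = ennreal (c * ?V * (1 / (1 - ?q)))"
  using assms q by (intro suminf_ennreal_eq sums_mult geometric_sums) auto
 also have "c * ?V * (1 / (1 - ?q)) = ?V / (1 - ?q) * c" by simp
 finally show ?thesis .
qed

definition kernel_const :: "real => 'd itself => real" where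
 "kernel_const ta _ = unit_ball_vol (real CARD('d)) * 2 ^ CARD('d) / (1 - 2 powr (- ta))"

lemma kernel_const_pos: "0 < ta ==> 0 < kernel_const ta TYPE('d::finite)"
 unfolding kernel_const_def by (intro divide_pos_pos mult_pos_pos) (auto simp: powr_less_one unit_ball_vol_pos)

lemma near_integral_le:
 assumes "0 < ta" "0 < r"
 shows "(\<integral>\<^sup>+(y::real^'d). ennreal (if norm y <= r then y pw (ta - real CARD('d)) else 0) \<partial>lborel)
  <= ennreal (kernel_const ta TYPE('d) * r powr ta)"
 unfolding kernel_const_def
proof (rule dyadic_integral_le[where ro = "%k. r / 2 ^ Suc k"])
 fix y :: "real^'d"
 assume "(if norm y <= r then y pw (ta - real CARD('d)) else 0) ~= 0"
 hence y: "0 < norm y" "norm y <= r" by (auto split: if_splits)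
 obtain k where k: "2 ^ k <= r / norm y" "r / norm y < 2 ^ Suc k"
  using dyadic_bracket[of "r / norm y"] y by auto
 have n1: "r / 2 ^ Suc k < norm y" and n2: "norm y <= r / 2 ^ k" using k y by (auto simp: field_simps)
 have "y pw ta <= (r / 2 ^ k) powr ta" using n2 y assms by (intro powr_mono2) auto
 also have "... = r powr ta * (2 powr (- ta)) ^ k"
  using assms by (simp add: powr_divide powr_realpow[symmetric] powr_powr powr_minus divide_simps mult.commute)
 finally have "y pw ta * y pw (- real CARD('d)) <= r powr ta * (2 powr (- ta)) ^ k * y pw (- real CARD('d))"
  by (rule mrm) simp
 thus "EX k. r / 2 ^ Suc k < norm y & norm y <= 2 * (r / 2 ^ Suc k)
  & (if norm y <= r then y pw (ta - real CARD('d)) else 0) <= r powr ta * (2 powr (- ta)) ^ k * y pw (- real CARD('d))"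
  using n1 n2 y by (intro exI[of _ k]) (auto simp flip: powr_add)
qed (use assms in auto)

lemma far_integral_le:
 assumes "0 < ta" "0 < r"
 shows "(\<integral>\<^sup>+(y::real^'d). ennreal (if norm y <= r then 0 else y pw (- ta - real CARD('d))) \<partial>lborel)
  <= ennreal (kernel_const ta TYPE('d) * (2 powr ta * r powr (- ta)))"
 unfolding kernel_const_def
proof (rule dyadic_integral_le[where ro = "%k. r * 2 ^ k / 2"])
 fix y :: "real^'d"
 assume "(if norm y <= r then 0 else y pw (- ta - real CARD('d))) ~= 0"
 hence y: "r < norm y" by (auto split: if_splits)
 obtain k where k: "2 ^ k <= norm y / r" "norm y / r < 2 ^ Suc k"
  using dyadic_bracket[of "norm y / r"] y assms by auto
 have n1: "r * 2 ^ Suc k / 2 <= norm y" and n2: "norm y < r * 2 ^ Suc k" using k y assms by (auto simp: field_simps)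
 have "y pw (- ta) <= (r * 2 ^ k) powr (- ta)" using n1 y assms by (intro powr_mono2') auto
 also have "... = (2 powr ta * r powr (- ta)) * (2 powr (- ta)) ^ Suc k"
  using assms by (simp add: powr_mult powr_realpow[symmetric] powr_powr powr_minus divide_simps mult.commute)
 finally have "y pw (- ta) * y pw (- real CARD('d)) <= (2 powr ta * r powr (- ta)) * (2 powr (- ta)) ^ Suc k * y pw (- real CARD('d))"
  by (rule mrm) simp
 moreover have "r * 2 ^ Suc k / 2 < norm y | norm y = r * 2 ^ k" using n1 by auto
 ultimately have *: "y pw (- ta - real CARD('d)) <= (2 powr ta * r powr (- ta)) * (2 powr (- ta)) ^ Suc k * y pw (- real CARD('d))"
  by (simp flip: powr_add)
 have "(2::real) powr (- ta) <= 1" using assms powr_mono[of "- ta" 0 2] by simp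
 hence "(2 powr (- ta)) ^ Suc k <= (2 powr (- ta)) ^ k" by (simp add: mult_left_le_one_le)
 hence "(2 powr ta * r powr (- ta)) * (2 powr (- ta)) ^ Suc k * y pw (- real CARD('d))
  <= (2 powr ta * r powr (- ta)) * (2 powr (- ta)) ^ k * y pw (- real CARD('d))"
  by (intro mrm mlm) auto
 note ** = order_trans[OF * this]
 show "EX k. r * 2 ^ k / 2 < norm y & norm y <= 2 * (r * 2 ^ k / 2)
  & (if norm y <= r then 0 else y pw (- ta - real CARD('d))) <= (2 powr ta * r powr (- ta)) * (2 powr (- ta)) ^ k * y pw (- real CARD('d))"
 \<comment> \<open>The dyadic bracket is closed on the left, the annuli on the right: the sphere
   \<open>|y| = r * 2 ^ k\<close> lies in annulus \<open>k\<close>, everything else in annulus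
   \<open>k + 1\<close>. The factor \<open>2 powr ta\<close> pays for this shift of the
   index.\<close>
 proof (cases "norm y = r * 2 ^ k")
  case True
  thus ?thesis using ** y assms by (intro exI[of _ k]) (auto)
 next
  case False
  hence "r * 2 ^ Suc k / 2 < norm y" using n1 by auto
  thus ?thesis using * n2 y by (intro exI[of _ "Suc k"]) auto
 qed
qed (use assms in auto)

text \<open>Majorant of \<open>|y|^(-d-al)\<close> times a difference, split at the scale \<open>r\<close>.\<close>
definition dom :: "real => real => real => real => real^'d => real" where
 "dom ta r a b y = (if norm y <= r then a * y pw (ta - real CARD('d)) else b * y pw (- ta - real CARD('d)))"

lemma dom_integral:
 assumes "0 < ta" "0 < r" "0 <= a" "0 <= b"
 shows "integrable lborel (dom ta r a b :: real^'d => real)"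
  "(LINT y|lborel. dom ta r a b (y :: real^'d)) <= kernel_const ta TYPE('d) * 2 powr ta * (a * r powr ta + b * r powr (- ta))"
proof -
 let ?n = "%y::real^'d. if norm y <= r then y pw (ta - real CARD('d)) else 0"
 let ?f = "%y::real^'d. if norm y <= r then 0 else y pw (- ta - real CARD('d))"
 have n: "integrable lborel ?n" "integral\<^sup>L lborel ?n <= kernel_const ta TYPE('d) * r powr ta"
 proof -
  show i: "integrable lborel ?n"
  using near_integral_le[OF assms(1,2), where 'd = 'd]
  by (intro integrableI_bounded) (auto simp: le_less_trans intro: le_less_trans)
  have "ennreal (integral\<^sup>L lborel ?n) <= ennreal (kernel_const ta TYPE('d) * r powr ta)"
  using near_integral_le[OF assms(1,2), where 'd = 'd] by (subst nn_integral_eq_integral[OF i, symmetric]) auto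
  thus "integral\<^sup>L lborel ?n <= kernel_const ta TYPE('d) * r powr ta"
  using kernel_const_pos[OF assms(1), where 'd = 'd] by (simp add: ennreal_le_iff)
 qed
 have f: "integrable lborel ?f" "integral\<^sup>L lborel ?f <= kernel_const ta TYPE('d) * (2 powr ta * r powr (- ta))"
 proof -
  show i: "integrable lborel ?f"
  using far_integral_le[OF assms(1,2), where 'd = 'd]
  by (intro integrableI_bounded) (auto simp: le_less_trans intro: le_less_trans)
  have "ennreal (integral\<^sup>L lborel ?f) <= ennreal (kernel_const ta TYPE('d) * (2 powr ta * r powr (- ta)))"
  using far_integral_le[OF assms(1,2), where 'd = 'd] by (subst nn_integral_eq_integral[OF i, symmetric]) auto
  thus "integral\<^sup>L lborel ?f <= kernel_const ta TYPE('d) * (2 powr ta * r powr (- ta))"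
  using kernel_const_pos[OF assms(1), where 'd = 'd] by (simp add: ennreal_le_iff)
 qed
 have e: "(dom ta r a b :: real^'d => real) = (%y. a * ?n y + b * ?f y)"
  by (auto simp: dom_def)
 show "integrable lborel (dom ta r a b :: real^'d => real)"
  unfolding e using n f by (intro Bochner_Integration.integrable_add integrable_mult_right) auto
 have "(LINT y|lborel. dom ta r a b (y :: real^'d)) = a * integral\<^sup>L lborel ?n + b * integral\<^sup>L lborel ?f"
  unfolding e using n f by (subst Bochner_Integration.integral_add) auto
 also have "... <= a * (kernel_const ta TYPE('d) * (2 powr ta * r powr ta)) + b * (kernel_const ta TYPE('d) * (2 powr ta * r powr (- ta)))"
 proof (intro add_mono mlm f assms order_trans[OF n(2)])
  have "1 <= (2::real) powr ta" using assms by (simp add: ge_one_powr_ge_zero)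
  thus "r powr ta <= 2 powr ta * r powr ta" using mrm[of 1 "2 powr ta" "r powr ta"] by simp
 qed (use kernel_const_pos[OF assms(1), where 'd = 'd] in auto)
 finally show "(LINT y|lborel. dom ta r a b (y :: real^'d)) <= kernel_const ta TYPE('d) * 2 powr ta * (a * r powr ta + b * r powr (- ta))"
  by (simp add: alg)
qed

section \<open>The principal operator\<close>

text \<open>Values at \<open>0\<close> are irrelevant and masked, because \<open>m\<close> is only given off the origin.\<close>
definition kern :: "real => real => (real^'d => real) => bool" where
 "kern al K k \<longleftrightarrow> 0 <= K & (%y. if y = 0 then 0 else k y) \<in> bm borel
  & (ALL y. y ~= 0 --> abs (k y) <= K)
  & (al = 1 --> (ALL r:{0<..<1}. (LINT y:{y. r < norm y & norm y <= 1}|lborel.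
  (k y / pk al y) *. y) = 0))"

definition KF :: "real => (real^'d => real) => (real^'d => real) => real^'d => real^'d => real" where
 "KF al k g x y = (g (x + y) - g x - (grad g x \<bullet> y) * chi al y) * k y / pk al y"

definition KI :: "real => (real^'d => real) => (real^'d => real) => real^'d => real" where
 "KI al k g x = (LINT y|lborel. KF al k g x y)"

lemma op_A_eq: "op_A al m u t x = KI al (m t x) (u t) x"
 by (simp add: op_A_def KI_def KF_def)

text \<open>\<open>ta\<close> is a small loss of regularity that keeps the orders \<open>al + ta\<close> and \<open>al - ta\<close> on the same side of \<open>1\<close> and \<open>2\<close> as \<open>al ~= 1\<close>.\<close>
definition good_tau :: "real => real => bool" where
 "good_tau al ta \<longleftrightarrow> 0 < al & al < 2 & 0 < ta & ta < 1 & ta < al & (al < 1 --> al + ta < 1) & (al > 1 --> 1 < al - ta & al + ta < 2)"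

lemma kern_div_bound:
 assumes "kern al K k" "abs w <= c * y pw sg" "0 <= c"
 shows "abs (w * k y / (y::real^'d) pw (real CARD('d) + al)) <= c * K * y pw (sg - al - real CARD('d))"
proof (cases "y = 0")
 case False
 have "abs (k y) <= K" using assms(1) False by (simp add: kern_def)
 hence "abs w * abs (k y) <= (c * y pw sg) * K"
  using assms(2,3) by (intro mult_mono) auto
 hence "abs (w * k y / pk al y) <= (c * y pw sg) * K / pk al y"
  by (simp add: abs_mult divide_right_mono)
 also have "... = c * K * y pw (sg - al - real CARD('d))"
  using False by (simp add: powr_diff powr_add field_simps)
 finally show ?thesis .
qed simp

lemma kern_measurable_div:
 assumes "kern al K k" "w \<in> bm borel"
 shows "(%y. w y * k y / (y::real^'d) pw (real CARD('d) + al)) \<in> bm borel"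
proof -
 have "(%y. w y * k y / (y::real^'d) pw (real CARD('d) + al))
  = (%y. w y * (if y = 0 then 0 else k y) / (y::real^'d) pw (real CARD('d) + al))"
  by auto
 moreover have [measurable]: "(%y. if y = 0 then 0 else k y) \<in> bm borel"
  using assms(1) by (simp add: kern_def)
 note assms(2)[measurable]
 have "(%y. w y * (if y = 0 then 0 else k y) / (y::real^'d) pw (real CARD('d) + al)) \<in> bm borel"
  by (intro borel_measurable_divide borel_measurable_times) measurable
 ultimately show ?thesis by simp
qed

lemma chi_measurable [measurable]: "chi al \<in> bm (borel :: (real^'d) measure)"
 unfolding chi_def by measurable

text \<open>The compensator depends on \<open>al\<close>: none below one, the gradient for jumps up
  to length one at \<open>al = 1\<close>, the gradient always above one. Order
  \<open>al + ta\<close> is integrable against the kernel near the origin and order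
  \<open>al - ta\<close> at infinity. At \<open>al = 1\<close> the second bound concerns the bare
  increment, since there the compensator averages out over shells.\<close>

lemma increment_bound:
 assumes "good_tau al ta"
 shows "EX C>0. ALL M (g::real^'d => real) Q1 Q2 x y. bd M g & Zyg (al + ta) Q1 g & Zyg (al - ta) Q2 g -->
  (norm y <= 1 --> abs (g (x + y) - g x - (grad g x \<bullet> y) * chi al y) <= (C * Q1) * y pw (al + ta)) &
  (al ~= 1 --> abs (g (x + y) - g x - (grad g x \<bullet> y) * chi al y) <= (C * Q2) * y pw (al - ta)) &
  (al <= 1 --> abs (g (x + y) - g x) <= (C * Q2) * y pw (al - ta))"
proof -
 consider "al < 1" | "al = 1" | "al > 1" by linarith
 thus ?thesis
 proof cases
  case 1
  define C1 where "C1 = marchaud1 (al + ta) * marchaud2 (al + ta)"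
  define C2 where "C2 = marchaud1 (al - ta) * marchaud2 (al - ta)"
  have C: "0 < C1" "0 < C2" using assms 1 unfolding C1_def C2_def good_tau_def
  by (auto intro!: mult_pos_pos marchaud1_pos marchaud2_pos)
  show ?thesis
  proof (intro exI[of _ "C1 + C2"] conjI allI impI)
  show "0 < C1 + C2" using C by simp
  fix M and g :: "real^'d => real" and Q1 Q2 and x y :: "real^'d"
  assume a: "bd M g & Zyg (al + ta) Q1 g & Zyg (al - ta) Q2 g"
  hence Q: "0 <= Q1" "0 <= Q2" using Zyg_nonneg by blast+
  have "abs (g (x + y) - g x) <= C1 * Q1 * y pw (al + ta)"
  using df1_bound[of M g "al + ta" Q1 y x] a assms 1 by (simp add: C1_def df_def good_tau_def)
  also have "... <= (C1 + C2) * Q1 * y pw (al + ta)" using Q C by (intro mrm) auto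
  finally show "abs (g (x + y) - g x - (grad g x \<bullet> y) * chi al y) <= (C1 + C2) * Q1 * y pw (al + ta)"
  using 1 by (simp add: chi_def)
  have "abs (g (x + y) - g x) <= C2 * Q2 * y pw (al - ta)"
  using df1_bound[of M g "al - ta" Q2 y x] a assms 1 by (simp add: C2_def df_def good_tau_def)
  also have "... <= (C1 + C2) * Q2 * y pw (al - ta)" using Q C by (intro mrm) auto
  finally show "abs (g (x + y) - g x - (grad g x \<bullet> y) * chi al y) <= (C1 + C2) * Q2 * y pw (al - ta)"
  "abs (g (x + y) - g x) <= (C1 + C2) * Q2 * y pw (al - ta)"
  using 1 by (simp_all add: chi_def)
  qed
 next
  case 2
  define C1 where "C1 = taylor_const (al + ta)"
  define C2 where "C2 = marchaud1 (al - ta) * marchaud2 (al - ta)"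
  have C: "0 < C1" "0 < C2" using assms 2 unfolding C1_def C2_def good_tau_def
  by (auto intro!: mult_pos_pos marchaud1_pos marchaud2_pos taylor_const_pos)
  show ?thesis
  proof (intro exI[of _ "C1 + C2"] conjI allI impI)
  show "0 < C1 + C2" using C by simp
  fix M and g :: "real^'d => real" and Q1 Q2 and x y :: "real^'d"
  assume a: "bd M g & Zyg (al + ta) Q1 g & Zyg (al - ta) Q2 g"
  hence Q: "0 <= Q1" "0 <= Q2" using Zyg_nonneg by blast+
  assume y: "norm y <= 1"
  have "abs (g (x + y) - g x - grad g x \<bullet> y) <= C1 * Q1 * y pw (al + ta)"
  using grad_taylor(1)[of M g "al + ta" Q1 x y] a assms 2 by (simp add: C1_def good_tau_def)
  also have "... <= (C1 + C2) * Q1 * y pw (al + ta)" using Q C by (intro mrm) auto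
  finally show "abs (g (x + y) - g x - (grad g x \<bullet> y) * chi al y) <= (C1 + C2) * Q1 * y pw (al + ta)"
  using 2 y by (simp add: chi_def)
  next
  fix M and g :: "real^'d => real" and Q1 Q2 and x y :: "real^'d"
  assume a: "bd M g & Zyg (al + ta) Q1 g & Zyg (al - ta) Q2 g"
  hence Q: "0 <= Q1" "0 <= Q2" using Zyg_nonneg by blast+
  have "abs (g (x + y) - g x) <= C2 * Q2 * y pw (al - ta)"
  using df1_bound[of M g "al - ta" Q2 y x] a assms 2 by (simp add: C2_def df_def good_tau_def)
  also have "... <= (C1 + C2) * Q2 * y pw (al - ta)" using Q C by (intro mrm) auto
  finally show "abs (g (x + y) - g x) <= (C1 + C2) * Q2 * y pw (al - ta)" .
  qed (use 2 in auto)
 next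
  case 3
  define C1 where "C1 = taylor_const (al + ta)"
  define C2 where "C2 = taylor_const (al - ta)"
  have C: "0 < C1" "0 < C2" using assms 3 unfolding C1_def C2_def good_tau_def
  by (auto intro!: taylor_const_pos)
  show ?thesis
  proof (intro exI[of _ "C1 + C2"] conjI allI impI)
  show "0 < C1 + C2" using C by simp
  fix M and g :: "real^'d => real" and Q1 Q2 and x y :: "real^'d"
  assume a: "bd M g & Zyg (al + ta) Q1 g & Zyg (al - ta) Q2 g"
  hence Q: "0 <= Q1" "0 <= Q2" using Zyg_nonneg by blast+
  have "abs (g (x + y) - g x - grad g x \<bullet> y) <= C1 * Q1 * y pw (al + ta)"
  using grad_taylor(1)[of M g "al + ta" Q1 x y] a assms 3 by (simp add: C1_def good_tau_def)
  also have "... <= (C1 + C2) * Q1 * y pw (al + ta)" using Q C by (intro mrm) auto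
  finally show "abs (g (x + y) - g x - (grad g x \<bullet> y) * chi al y) <= (C1 + C2) * Q1 * y pw (al + ta)"
  using 3 by (simp add: chi_def)
  have "abs (g (x + y) - g x - grad g x \<bullet> y) <= C2 * Q2 * y pw (al - ta)"
  using grad_taylor(1)[of M g "al - ta" Q2 x y] a assms 3 by (simp add: C2_def good_tau_def)
  also have "... <= (C1 + C2) * Q2 * y pw (al - ta)" using Q C by (intro mrm) auto
  finally show "abs (g (x + y) - g x - (grad g x \<bullet> y) * chi al y) <= (C1 + C2) * Q2 * y pw (al - ta)"
  using 3 by (simp add: chi_def)
  qed (use 3 in auto)
 qed
qed

definition far :: "real => real => (real^'d => real) => (real^'d => real) => real^'d => real^'d => real" where
 "far al r k g x y = (if norm y <= r then 0 else (g (x + y) - g x) * k y / pk al y)"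

definition farg :: "real => real => (real^'d => real) => real^'d => real^'d => real" where
 "farg al r k v y = (if norm y <= r then 0 else (v \<bullet> y) * chi al y * k y / pk al y)"

lemma integrable_dominated:
 fixes f h :: "real^'d => real"
 assumes "f \<in> bm borel" "integrable lborel h" "!!y. abs (f y) <= h y"
 shows "integrable lborel f" "abs (integral\<^sup>L lborel f) <= integral\<^sup>L lborel h"
proof -
 show i: "integrable lborel f"
  using assms by (intro Bochner_Integration.integrable_bound[of lborel h f]) (auto intro!: always_eventually intro: order_trans[OF _ abs_ge_self])
 have "abs (integral\<^sup>L lborel f) <= (LINT y|lborel. abs (f y))"
  using integral_norm_bound[of lborel f] by simp
 also have "... <= integral\<^sup>L lborel h" using assms i by (intro integral_mono) auto
 finally show "abs (integral\<^sup>L lborel f) <= integral\<^sup>L lborel h" .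
qed

lemma far_integrable:
 fixes g :: "real^'d => real"
 assumes k: "kern al K k" and g: "bd M g" "g \<in> bm borel" and "0 < al" "0 < r"
 shows "integrable lborel (far al r k g x)"
proof (rule integrable_dominated)
 show "far al r k g x \<in> bm borel"
 proof -
  note g(2)[measurable]
  show ?thesis unfolding far_def by (intro measurable_If kern_measurable_div[OF k]) measurable
 qed
 have K: "0 <= K" using k by (simp add: kern_def)
 have M: "0 <= M" using g bd_nonneg by blast
 show "integrable lborel (dom al r 0 (2 * M * K) :: real^'d => real)"
  using assms K M by (intro dom_integral) auto
 fix y
 have "abs (g (x + y) - g x) <= 2 * M" using bdD[OF bd_df[OF g(1)], of y x] by (simp add: df_def)
 hence "y ~= 0 ==> abs (g (x + y) - g x) <= 2 * M * y pw 0" by simp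
 hence "y ~= 0 ==> abs ((g (x + y) - g x) * k y / pk al y) <= 2 * M * K * y pw (0 - al - real CARD('d))"
  using M by (intro kern_div_bound[OF k]) auto
 thus "abs (far al r k g x y) <= dom al r 0 (2 * M * K) y"
  using assms(5) by (cases "y = 0") (auto simp: far_def dom_def)
qed

text \<open>Below one there is no compensator. At one it lives in the shell
  \<open>r < |y| <= 1\<close>, where the vanishing moment condition of \<open>kern\<close> removes
  it. Above one it is integrable at infinity, with size \<open>r powr (1 - al)\<close>.\<close>

lemma farg_integral:
 fixes v :: "real^'d"
 assumes k: "kern al K k" and "0 < al" "al < 2" "0 < r" "r < 1"
 shows "integrable lborel (farg al r k v)"
  "al <= 1 ==> integral\<^sup>L lborel (farg al r k v) = 0"
  "al > 1 ==> abs (integral\<^sup>L lborel (farg al r k v)) <= kernel_const (al - 1) TYPE('d) * 2 powr (al - 1) * (norm v * K * r powr (1 - al))"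
proof -
 have K: "0 <= K" using k by (simp add: kern_def)
 have meas: "farg al r k v \<in> bm borel"
  unfolding farg_def by (intro measurable_If kern_measurable_div[OF k]) measurable
 have b1: "abs ((v \<bullet> y) * chi al y * k y / pk al y) <= norm v * K * y pw (1 - al - real CARD('d))" for y
 proof (rule kern_div_bound[OF k])
  have "abs (v \<bullet> y) * abs (chi al y) <= (norm v * norm y) * 1"
  by (intro mult_mono Cauchy_Schwarz_ineq2) (auto simp: chi_def)
  thus "abs (v \<bullet> y * chi al y) <= norm v * y pw 1" by (simp add: abs_mult)
 qed simp
 {
  assume a: "al > 1"
  have i: "integrable lborel (dom (al - 1) r 0 (norm v * K) :: real^'d => real)"
  using assms K a by (intro dom_integral) auto
  have b: "abs (farg al r k v y) <= dom (al - 1) r 0 (norm v * K) y" for y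
  using b1[of y] by (auto simp: farg_def dom_def)
  show "abs (integral\<^sup>L lborel (farg al r k v)) <= kernel_const (al - 1) TYPE('d) * 2 powr (al - 1) * (norm v * K * r powr (1 - al))"
  using integrable_dominated(2)[OF meas i b] dom_integral(2)[of "al - 1" r 0 "norm v * K", where 'd = 'd] a assms K
  by (auto elim: order_trans)
  have "integrable lborel (farg al r k v)" using integrable_dominated(1)[OF meas i b] .
 } note A = this
 {
  assume a: "al < 1"
  hence "farg al r k v = (%y. 0)" by (auto simp: farg_def chi_def)
  hence "integrable lborel (farg al r k v) & integral\<^sup>L lborel (farg al r k v) = 0" by simp
 } note B = this
 {
  assume a: "al = 1"
  \<comment> \<open>On the shell \<open>|y| powr (- al)\<close> is at most
    \<open>r powr (- al)\<close>, so a majorant of near type with exponent one suffices.\<close>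
  have i: "integrable lborel (dom 1 1 (norm v * K * r powr (- al)) 0 :: real^'d => real)"
  using assms K a by (intro dom_integral) auto
  let ?S = "{y::real^'d. r < norm y & norm y <= 1}"
  have e: "farg al r k v = (%y. indicator ?S y * ((v \<bullet> y) * k y / pk al y))"
  using a by (auto simp: farg_def chi_def indicator_def)
  have b: "abs (farg al r k v y) <= dom 1 1 (norm v * K * r powr (- al)) 0 y" for y
  proof (cases "y \<in> ?S")
  case True
  have "abs (farg al r k v y) <= norm v * K * y pw (1 - al - real CARD('d))"
  using b1[of y] True by (auto simp: farg_def)
  also have "... = norm v * K * (y pw (-al) * y pw (1 - real CARD('d)))" by (simp add: alg flip: powr_add)
  also have "... <= norm v * K * (r powr (-al) * y pw (1 - real CARD('d)))"
  using K True assms by (intro mlm mrm powr_mono2') auto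
  finally show ?thesis using True by (simp add: dom_def mult.assoc)
  qed (use K in \<open>auto simp: e dom_def\<close>)
  have int: "integrable lborel (farg al r k v)" using integrable_dominated(1)[OF meas i b] .
  have vint: "integrable lborel (%y. indicator ?S y *. ((k y / pk al y) *. y))"
  proof (rule Bochner_Integration.integrable_bound)
  show "integrable lborel (dom 1 1 (K * r powr (- al)) 0 :: real^'d => real)"
  using assms K a by (intro dom_integral) auto
  have "(%y::real^'d. (1 * k y / pk al y) *. y) \<in> bm borel"
  by (intro borel_measurable_scaleR kern_measurable_div[OF k]) measurable
  moreover have "?S \<in> sets borel" by measurable
  ultimately have "(%y. indicator ?S y *. ((1 * k y / pk al y) *. y)) \<in> bm borel"
  using borel_measurable_scaleR[OF borel_measurable_indicator] by blast
  thus "(%y. indicator ?S y *. ((k y / pk al y) *. y)) \<in> bm lborel" by simp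
  have "norm (indicator ?S y *. ((k y / pk al y) *. y)) <= norm (dom 1 1 (K * r powr (- al)) 0 y)" for y
  proof (cases "y \<in> ?S")
  case True
  have "norm (indicator ?S y *. ((k y / pk al y) *. y)) = abs (norm y * k y / pk al y)"
  using True by (simp add: abs_mult)
  also have "... <= 1 * K * y pw (1 - al - real CARD('d))"
  using k by (intro kern_div_bound) auto
  also have "... = K * (y pw (-al) * y pw (1 - real CARD('d)))" by (simp add: alg flip: powr_add)
  also have "... <= K * (r powr (-al) * y pw (1 - real CARD('d)))"
  using K True assms by (intro mlm mrm powr_mono2') auto
  finally show ?thesis using True K by (simp add: dom_def mult.assoc)
  qed simp
  thus "AE y in lborel. norm (indicator ?S y *. ((k y / pk al y) *. y)) <= norm (dom 1 1 (K * r powr (- al)) 0 y)"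
  by simp
  qed
  have "integral\<^sup>L lborel (farg al r k v) = (LINT y|lborel. v \<bullet> (indicator ?S y *. ((k y / pk al y) *. y)))"
  unfolding e by (intro Bochner_Integration.integral_cong) auto
  also have "... = v \<bullet> (LINT y|lborel. indicator ?S y *. ((k y / pk al y) *. y))"
  by (rule integral_inner_right) (use vint in auto)
  also have "... = 0" using k a assms unfolding kern_def set_lebesgue_integral_def by simp
  finally have "integrable lborel (farg al r k v) & integral\<^sup>L lborel (farg al r k v) = 0" using int by simp
 } note C = this
 show "integrable lborel (farg al r k v)" "al <= 1 ==> integral\<^sup>L lborel (farg al r k v) = 0"
  using A B C by linarith+
qed

text \<open>Split at \<open>|y| = r\<close>: inside, order \<open>al + ta\<close> gives
  \<open>r powr ta\<close>; outside, order \<open>al - ta\<close> gives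
  \<open>r powr (- ta)\<close>. The scale stays free because it will be tied to the step
  \<open>h\<close> when the operator acts on differences of step \<open>h\<close>. The last estimate
  keeps the far increments untouched and pays only with the gradient; this is the form in which a
  maximum can be exploited.\<close>

lemma KI_decomposition:
 assumes ta: "good_tau al ta"
 shows "EX C>0. ALL K k M (g::real^'d => real) Q1 Q2 r x.
  kern al K k & bd M g & Zyg (al + ta) Q1 g & Zyg (al - ta) Q2 g & 0 < r & r < 1 -->
  integrable lborel (KF al k g x) &
  abs (KI al k g x) <= C * K * (Q1 * r powr ta + Q2 * r powr (- ta)) &
  abs (KI al k g x - (LINT y|lborel. far al r k g x y)) <= C * K * (Q1 * r powr ta + (if 1 <= al then norm (grad g x) else 0) * r powr (- 1))"
proof -
 obtain C where C: "0 < C" and inc: "!!M (g::real^'d => real) Q1 Q2 x y. bd M g ==> Zyg (al + ta) Q1 g ==> Zyg (al - ta) Q2 g ==>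
  (norm y <= 1 --> abs (g (x + y) - g x - (grad g x \<bullet> y) * chi al y) <= (C * Q1) * y pw (al + ta)) &
  (al ~= 1 --> abs (g (x + y) - g x - (grad g x \<bullet> y) * chi al y) <= (C * Q2) * y pw (al - ta)) &
  (al <= 1 --> abs (g (x + y) - g x) <= (C * Q2) * y pw (al - ta))"
  using increment_bound[OF ta, where 'd = 'd] by blast
 have t: "0 < ta" "0 < al" "al < 2" using ta by (auto simp: good_tau_def)
 define D where "D = kernel_const ta TYPE('d) * 2 powr ta"
 define D' where "D' = (if al > 1 then kernel_const (al - 1) TYPE('d) * 2 powr (al - 1) else 0)"
 have D: "0 < D" "0 <= D'" using kernel_const_pos[where 'd = 'd] t by (auto simp: D_def D'_def less_imp_le)
 show ?thesis
 proof (intro exI[of _ "D * C + D'"] conjI[of "0 < _"] allI impI)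
  show "0 < D * C + D'" using D C by (simp add: add_pos_nonneg)
  fix K M Q1 Q2 r :: real and k :: "real^'d => real" and x :: "real^'d" and g :: "real^'d => real"
  assume a: "kern al K k & bd M g & Zyg (al + ta) Q1 g & Zyg (al - ta) Q2 g & 0 < r & r < 1"
  hence k: "kern al K k" and g: "bd M g" "Zyg (al + ta) Q1 g" "Zyg (al - ta) Q2 g" and r: "0 < r" "r < 1" by auto
  note inc = inc[OF g]
  have Q: "0 <= Q1" "0 <= Q2" using g Zyg_nonneg by blast+
  have K: "0 <= K" using k by (simp add: kern_def)
  have gm[measurable]: "g \<in> bm borel"
  using Zyg_continuous[OF g(1,2)] t by (intro borel_measurable_continuous_onI) auto
  have KFm: "KF al k g x \<in> bm borel"
  unfolding KF_def by (intro kern_measurable_div[OF k]) measurable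
  define N where "N y = (if norm y <= r then KF al k g x y else 0)" for y
  have Nm: "N \<in> bm borel" unfolding N_def using KFm by measurable
  have nb: "abs (KF al k g x y) <= (C * Q1) * K * y pw (ta - real CARD('d))" if "norm y <= 1" for y
  using kern_div_bound[OF k, of "g (x + y) - g x - (grad g x \<bullet> y) * chi al y" "C * Q1" y "al + ta"] inc[of y x] that C Q
  by (simp add: KF_def)
  have Nb: "abs (N y) <= dom ta r (C * Q1 * K) 0 y" for y
  using nb[of y] r by (auto simp: N_def dom_def)
  have di: "integrable lborel (dom ta r a b :: real^'d => real)" "(LINT y|lborel. dom ta r a b (y :: real^'d)) <= D * (a * r powr ta + b * r powr (- ta))"
  if "0 <= a" "0 <= b" for a b using dom_integral[OF t(1) r(1) that] by (auto simp: D_def)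
  have cq: "0 <= C * Q1 * K" "0 <= C * Q2 * K" using C Q K by auto
  have N: "integrable lborel N" "abs (integral\<^sup>L lborel N) <= D * (C * Q1 * K * r powr ta)"
  using integrable_dominated[OF Nm di(1)[OF cq(1) order_refl] Nb] di(2)[OF cq(1) order_refl] by auto
  have F: "integrable lborel (far al r k g x)" by (rule far_integrable[OF k g(1) gm t(2) r(1)])
  note G = farg_integral[OF k t(2,3) r, of "grad g x"]
  have e: "KF al k g x = (%y. N y + (far al r k g x y - farg al r k (grad g x) y))"
  by (rule ext) (auto simp: N_def far_def farg_def KF_def alg diff_divide_distrib add_divide_distrib)
  have FG: "integrable lborel (%y. far al r k g x y - farg al r k (grad g x) y)"
  using F G(1) by (rule Bochner_Integration.integrable_diff)
  have int: "integrable lborel (KF al k g x)" unfolding e by (intro Bochner_Integration.integrable_add N FG)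
  have KI1: "KI al k g x = integral\<^sup>L lborel N + (LINT y|lborel. far al r k g x y - farg al r k (grad g x) y)"
  unfolding KI_def e by (intro Bochner_Integration.integral_add N FG)
  have KI2: "(LINT y|lborel. far al r k g x y - farg al r k (grad g x) y) = (LINT y|lborel. far al r k g x y) - integral\<^sup>L lborel (farg al r k (grad g x))"
  by (intro Bochner_Integration.integral_diff F G(1))
  have FGb: "abs (LINT y|lborel. far al r k g x y - farg al r k (grad g x) y) <= D * (C * Q2 * K * r powr (- ta))"
  proof (cases "al <= 1")
  case True
  have "abs (far al r k g x y) <= dom ta r 0 (C * Q2 * K) y" for y
  using kern_div_bound[OF k, of "g (x + y) - g x" "C * Q2" y "al - ta"] inc[of y x] True C Q
  by (auto simp: far_def dom_def)
  hence "abs (LINT y|lborel. far al r k g x y) <= integral\<^sup>L lborel (dom ta r 0 (C * Q2 * K) :: real^'d => real)"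
  by (intro integrable_dominated(2) borel_measurable_integrable[OF F, simplified] di(1) cq) auto
  also have "... <= D * (C * Q2 * K * r powr (- ta))" using di(2)[OF order_refl cq(2)] by simp
  finally show ?thesis unfolding KI2 using G(2)[OF True] by simp
  next
  case False
  have b: "abs (far al r k g x y - farg al r k (grad g x) y) <= dom ta r 0 (C * Q2 * K) y" for y
  proof -
  have "far al r k g x y - farg al r k (grad g x) y = (if norm y <= r then 0 else KF al k g x y)"
  unfolding e by (simp add: N_def far_def farg_def)
  thus ?thesis
  using kern_div_bound[OF k, of "g (x + y) - g x - (grad g x \<bullet> y) * chi al y" "C * Q2" y "al - ta"] inc[of y x] False C Q
  by (auto simp: dom_def KF_def)
  qed
  have "abs (LINT y|lborel. far al r k g x y - farg al r k (grad g x) y) <= integral\<^sup>L lborel (dom ta r 0 (C * Q2 * K) :: real^'d => real)"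
  by (intro integrable_dominated(2) borel_measurable_integrable[OF FG, simplified] di(1) cq b) auto
  also have "... <= D * (C * Q2 * K * r powr (- ta))" using di(2)[OF order_refl cq(2)] by simp
  finally show ?thesis .
  qed
  have "abs (KI al k g x) <= D * (C * Q1 * K * r powr ta) + D * (C * Q2 * K * r powr (- ta))"
  unfolding KI1 using N(2) FGb by linarith
  also have "... = D * C * (K * (Q1 * r powr ta + Q2 * r powr (- ta)))" by (simp add: alg)
  also have "... <= (D * C + D') * (K * (Q1 * r powr ta + Q2 * r powr (- ta)))"
  using D K Q by (intro mrm) auto
  finally have b1: "abs (KI al k g x) <= (D * C + D') * K * (Q1 * r powr ta + Q2 * r powr (- ta))" by (simp add: mult.assoc)
  define Gn where "Gn = (if 1 <= al then norm (grad g x) else 0)"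
  have Gn: "0 <= Gn" by (simp add: Gn_def)
  have "abs (integral\<^sup>L lborel (farg al r k (grad g x))) <= D' * (Gn * K * r powr (- 1))"
  proof (cases "al > 1")
  case True
  have "abs (integral\<^sup>L lborel (farg al r k (grad g x))) <= D' * (norm (grad g x) * K * r powr (1 - al))"
  using G(3)[OF True] True by (simp add: D'_def)
  also have "... <= D' * (norm (grad g x) * K * r powr (- 1))"
  using D K t r by (intro mlm powr_mono') auto
  finally show ?thesis using True by (simp add: Gn_def)
  qed (use G(2) D K Gn in auto)
  hence "abs (KI al k g x - (LINT y|lborel. far al r k g x y)) <= D * (C * Q1 * K * r powr ta) + D' * (Gn * K * r powr (- 1))"
  unfolding KI1 KI2 using N(2) by linarith
  also have "... = D * C * (K * (Q1 * r powr ta)) + D' * (K * (Gn * r powr (- 1)))" by (simp only: ac_simps)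
  also have "... <= (D * C + D') * (K * (Q1 * r powr ta)) + (D * C + D') * (K * (Gn * r powr (- 1)))"
  using D C K Q Gn by (intro add_mono mrm) auto
  finally have b2: "abs (KI al k g x - (LINT y|lborel. far al r k g x y)) <= (D * C + D') * K * (Q1 * r powr ta + Gn * r powr (- 1))"
  by (simp add: alg add_divide_distrib)
  show "integrable lborel (KF al k g x) &
  abs (KI al k g x) <= (D * C + D') * K * (Q1 * r powr ta + Q2 * r powr (- ta)) &
  abs (KI al k g x - (LINT y|lborel. far al r k g x y)) <= (D * C + D') * K * (Q1 * r powr ta + (if 1 <= al then norm (grad g x) else 0) * r powr (- 1))"
  using int b1 b2 unfolding Gn_def by simp
 qed
qed

section \<open>Gain from a cone of positivity at a near maximum\<close>

lemma small_powr:
 assumes "0 <= c" "0 < ta" "0 < e"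
 shows "EX r0>0. ALL r. 0 < r & r <= r0 --> c * r powr ta <= (e::real)"
proof (intro exI[of _ "(e / (c + 1)) powr (1 / ta)"] conjI allI impI)
 show "0 < (e / (c + 1)) powr (1 / ta)" using assms by simp
 fix r assume r: "0 < r & r <= (e / (c + 1)) powr (1 / ta)"
 have "r powr ta <= ((e / (c + 1)) powr (1 / ta)) powr ta" using r assms by (intro powr_mono2) auto
 also have "... = e / (c + 1)" using assms by (simp add: powr_powr)
 finally have "c * r powr ta <= c * (e / (c + 1))" using assms by (intro mlm) auto
 also have "... <= e" using assms by (simp add: field_simps)
 finally show "c * r powr ta <= e" .
qed

text \<open>At a near maximum the gradient is small, by a Taylor step along it, so drift and
  compensators are negligible. Small jumps are negligible by regularity, and each larger jump
  contributes at most \<open>et\<close> times its intensity. Only the jumps into \<open>S\<close>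
  are kept, to be exploited by \<open>cone_gain\<close>. The tolerance \<open>et\<close> depends on
  the function only through \<open>N\<close>, hence serves all times at once.\<close>

lemma near_max:
 assumes ta: "good_tau al ta" and p: "al + ta <= s" and K: "0 < K" and N: "0 < N" and e: "0 < e" and r1: "0 < r1"
 shows "EX et>0. ALL k (g::real^'d => real) x v S. kern al K k & (ALL y. y ~= 0 --> 0 <= k y) & bd N g & Zyg s N g
  & (ALL y. g (x + y) <= g x + et) & norm v <= K & S \<in> sets borel & (ALL y:S. r1 <= norm y) -->
  KI al k g x + (if 1 <= al then v \<bullet> grad g x else 0)
  <= e + (LINT y:S|lborel. (g (x + y) - g x) * k y / pk al y)"
proof -
 have t: "0 < ta" "ta < 1" "0 < al" "al < 2" using ta by (auto simp: good_tau_def)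
 show ?thesis
 proof (insert KI_decomposition[OF ta, where 'd = 'd], elim exE conjE, goal_cases)
 case (1 C)
 note C = 1(1) and dec = 1(2)[rule_format]
 have "0 <= C * K * (9 * N)" using C K N by simp
 then obtain r2 where r2: "0 < r2" "!!r. 0 < r ==> r <= r2 ==> C * K * (9 * N) * r powr ta <= e / 4"
  using small_powr[OF _ t(1), of "C * K * (9 * N)" "e / 4"] e by auto
 define r where "r = min (1/2) (min (r1 / 2) r2)"
 have r: "0 < r" "r < 1" "r < r1" "r <= r2" using r1 r2 by (auto simp: r_def)
 \<comment> \<open>\<open>Dn\<close> collects the factors of the gradient, from the compensator of
   the jumps beyond \<open>r\<close> and from the drift; \<open>G0\<close> is the size of the
   gradient that costs \<open>e / 4\<close>.\<close>
 define Dn where "Dn = C * K * r powr (- 1) + K"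
 define G0 where "G0 = e / (4 * Dn)"
 have den: "0 < Dn" unfolding Dn_def using C K r by (intro add_pos_pos mult_pos_pos) auto
 have G0: "0 < G0" using e den by (simp add: G0_def)
 define T where "T = (if 1 <= al then taylor_const (al + ta) else 0)"
 have T: "0 <= T" using ta by (auto simp: T_def good_tau_def intro!: less_imp_le[OF taylor_const_pos])
 obtain ro where ro: "0 < ro" "1 <= al ==> T * (9 * N) * ro powr (al + ta - 1) <= G0 / 2"
 proof (cases "1 <= al")
  case True
  hence "0 < al + ta - 1" using t by simp
  moreover have "0 <= T * (9 * N)" using T N by simp
  ultimately obtain r0 where "0 < r0" "!!r. 0 < r ==> r <= r0 ==> T * (9 * N) * r powr (al + ta - 1) <= G0 / 2"
  using small_powr[of "T * (9 * N)" "al + ta - 1" "G0 / 2"] G0 by auto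
  thus ?thesis using that[of r0] by simp
 next
  case False thus ?thesis using that[of 1] by simp
 qed
 \<comment> \<open>\<open>A\<close> bounds the mass of a kernel of size \<open>K\<close> outside the
   ball of radius \<open>r\<close>. The two entries of the minimum in \<open>et\<close> serve the
   gradient bound and the large jumps.\<close>
 define A where "A = K * (kernel_const al TYPE('d) * 2 powr al * r powr (- al))"
 have A: "0 < A" unfolding A_def using K r kernel_const_pos[OF t(3), where 'd = 'd] by simp
 define et where "et = min (ro * G0 / 2) (e / (4 * A))"
 have et: "0 < et" "et <= ro * G0 / 2" "et * A <= e / 4" using ro G0 A e by (auto simp: et_def min_def field_simps)
 show ?thesis
 proof (intro exI[of _ et] conjI allI impI)
  show "0 < et" by fact
  fix k g :: "real^'d => real" and x v :: "real^'d" and S :: "(real^'d) set"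
  assume a: "kern al K k & (ALL y. y ~= 0 --> 0 <= k y) & bd N g & Zyg s N g
  & (ALL y. g (x + y) <= g x + et) & norm v <= K & S \<in> sets borel & (ALL y:S. r1 <= norm y)"
  hence k: "kern al K k" "!!y. y ~= 0 ==> 0 <= k y" and g: "bd N g" "Zyg s N g" and mx: "!!y. g (x + y) <= g x + et"
  and v: "norm v <= K" and S: "S \<in> sets borel" "!!y. y \<in> S ==> r1 <= norm y" by auto
  have low: "low (al + ta) (9 * N) g" using g p t by (intro low_Zyg1) auto
  have gZ: "Zyg (al + ta) (9 * N) g" "Zyg (al - ta) (9 * N) g"
  using ta by (auto intro!: low_Zyg[OF low] simp: good_tau_def)
  have gm[measurable]: "g \<in> bm borel"
  using Zyg_continuous[OF g] t p by (intro borel_measurable_continuous_onI) auto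
  define Gn where "Gn = (if 1 <= al then norm (grad g x) else 0)"
  have Gn: "0 <= Gn" "Gn <= G0"
  proof -
  show "0 <= Gn" by (simp add: Gn_def)
  show "Gn <= G0"
  proof (cases "1 <= al & grad g x ~= 0")
  case True
  define y where "y = (ro / norm (grad g x)) *. grad g x"
  have ny: "norm y = ro" using True ro by (simp add: y_def)
  have "grad g x \<bullet> y = ro * norm (grad g x)"
  using True by (simp add: y_def power2_norm_eq_inner[symmetric] power2_eq_square)
  moreover have "abs (g (x + y) - g x - grad g x \<bullet> y) <= T * (9 * N) * ro powr (al + ta)"
  using grad_taylor(1)[OF g(1) gZ(1), of x y] ta True ny by (auto simp: good_tau_def T_def)
  ultimately have "ro * norm (grad g x) <= et + T * (9 * N) * ro powr (al + ta)"
  using mx[of y] by linarith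
  also have "T * (9 * N) * ro powr (al + ta) = ro * (T * (9 * N) * ro powr (al + ta - 1))"
  using ro by (simp add: powr_diff)
  also have "et + ro * (T * (9 * N) * ro powr (al + ta - 1)) <= ro * (G0 / 2) + ro * (G0 / 2)"
  using et ro True by (intro add_mono mlm) auto
  finally have "ro * norm (grad g x) <= ro * G0" by (simp add: mult.commute)
  hence "norm (grad g x) <= G0" using ro by simp
  thus ?thesis using True by (simp add: Gn_def)
  qed (use G0 in \<open>auto simp: Gn_def\<close>)
  qed
  have e2: "abs (KI al k g x - (LINT y|lborel. far al r k g x y)) <= C * K * (9 * N * r powr ta + Gn * r powr (- 1))"
  using dec[of K k N g "9 * N" "9 * N" r x] k g gZ r unfolding Gn_def by blast
  have vg: "(if 1 <= al then v \<bullet> grad g x else 0) <= K * Gn"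
  proof (cases "1 <= al")
  case True
  have "v \<bullet> grad g x <= norm v * norm (grad g x)" by (rule norm_cauchy_schwarz)
  also have "... <= K * norm (grad g x)" using v by (intro mrm) auto
  finally show ?thesis using True by (simp add: Gn_def)
  qed (simp add: Gn_def)
  have F: "integrable lborel (far al r k g x)" by (rule far_integrable[OF k(1) g(1) gm t(3) r(1)])
  let ?D = "dom al r 0 (et * K) :: real^'d => real"
  have D: "integrable lborel ?D" "integral\<^sup>L lborel ?D <= et * A"
  using dom_integral[OF t(3) r(1), of 0 "et * K", where 'd = 'd] et K by (auto simp: A_def alg)
  let ?w = "%y. (g (x + y) - g x) * k y / pk al y"
  have SF: "indicator S y *. ?w y = indicator S y *. far al r k g x y" for y :: "real^'d"
  using S(2)[of y] r by (auto simp: far_def indicator_def)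
  have iS: "integrable lborel (%y. indicator S y *. far al r k g x y)"
  using F S by (intro integrable_mult_indicator) auto
  have "(LINT y|lborel. far al r k g x y) <= (LINT y|lborel. indicator S y *. far al r k g x y + ?D y)"
  proof (rule integral_mono)
  fix y
  show "far al r k g x y <= indicator S y *. far al r k g x y + ?D y"
  proof (cases "y \<in> S | norm y <= r")
  case True
  thus ?thesis using et K by (auto simp: far_def dom_def indicator_def)
  next
  case False
  hence y: "y ~= 0" "r < norm y" "y \<notin> S" using r by auto
  have "abs (k y) <= K" "0 <= k y" using k y by (auto simp: kern_def)
  hence "(g (x + y) - g x) * k y <= et * K"
  using mx[of y] et(1) by (smt (verit) mult_mono mult_nonneg_nonneg mult_nonpos_nonneg mrm)
  hence "far al r k g x y <= et * K / pk al y"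
  using y by (simp add: far_def divide_right_mono)
  also have "... = ?D y"
  using y by (simp add: dom_def powr_diff powr_minus powr_add field_simps)
  finally show ?thesis using y by simp
  qed
  qed (use F iS D in auto)
  also have "... = (LINT y|lborel. indicator S y *. far al r k g x y) + integral\<^sup>L lborel ?D"
  using iS D by (intro Bochner_Integration.integral_add) auto
  finally have f: "(LINT y|lborel. far al r k g x y) <= (LINT y:S|lborel. ?w y) + et * A"
  using D unfolding set_lebesgue_integral_def SF by linarith
  have "Dn * Gn <= Dn * G0"
  using den Gn by (intro mlm) auto
  also have "... = e / 4" using den by (simp add: G0_def)
  finally have "C * K * (Gn * r powr (- 1)) + K * Gn <= e / 4" by (simp add: Dn_def alg)
  moreover have "C * K * (9 * N * r powr ta) <= e / 4" using r2(2)[OF r(1,4)] by (simp add: alg)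
  moreover have "C * K * (9 * N * r powr ta + Gn * r powr (- 1)) = C * K * (9 * N * r powr ta) + C * K * (Gn * r powr (- 1))"
  by (rule distrib_left)
  ultimately show "KI al k g x + (if 1 <= al then v \<bullet> grad g x else 0) <= e + (LINT y:S|lborel. ?w y)"
  using e2 vg f et(3) e by linarith
 qed
 qed
qed

lemma df_multiple: "df (real n *. h) u x = (\<Sum>i<n. df h u (x + real i *. h))"
proof (induction n)
 case (Suc n)
 have "df (real (Suc n) *. h) u x = df (real n *. h) u x + df h u (x + real n *. h)"
  by (simp add: df_def alg)
 thus ?case using Suc by simp
qed simp

lemma df_sum: "df h (%x. \<Sum>i\<in>I. f i x) = (%x. \<Sum>i\<in>I. df h (f i) x)"
 by (rule ext) (simp add: df_def sum_subtractf)

text \<open>In terms of the shift \<open>T\<close> by \<open>h\<close>, the factorisation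
  \<open>(T^n - 1)^3 = (T - 1)^3 (1 + T + ... + T^(n-1))^3\<close>.\<close>

lemma df3_multiple:
 fixes u :: "'a::real_normed_vector => 'b::real_normed_vector"
 shows "df3 (real n *. h) u x
  = (\<Sum>i<n. \<Sum>j<n. \<Sum>l<n. df3 h u (x + real (i + j + l) *. h))"
proof -
 have e: "df (real n *. h) v = (%x. \<Sum>i<n. df h v (x + real i *. h))" for v :: "'a => 'b"
  by (rule ext) (rule df_multiple)
 show ?thesis unfolding e df_sum df_shift
  by (simp add: df_shift alg)
qed

lemma integral_translate:
 fixes f :: "real^'d => real"
 assumes "f \<in> bm borel"
 shows "(LINT y|lborel. f (y + a)) = (LINT y|lborel. f y)"
proof -
 have "(LINT y|lborel. f y) = (LINT y|distr lborel borel ((+) a). f y)" by (simp add: lborel_distr_plus)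
 also have "... = (LINT y|lborel. f (a + y))" by (rule integral_distr) (use assms in auto)
 finally show ?thesis by (simp add: add.commute)
qed

lemma integrable_on_bounded:
 fixes f :: "real^'d => real"
 assumes "f \<in> bm borel" "!!y. abs (f y) <= M" "S \<in> sets borel" "S \<subseteq> cball 0 R"
 shows "integrable lborel (%y. indicator S y * f y)"
proof (rule integrableI_bounded_set[where A = "cball 0 R" and B = M])
 show "emeasure lborel (cball (0::real^'d) R) < \<infinity>" using emeasure_lborel_cball_finite by blast
 show "(%y. indicator S y * f y) \<in> bm lborel" using assms by measurable
 have M: "0 <= M" using assms(2)[of 0] by simp
 show "AE y in lborel. y \<in> cball 0 R --> norm (indicator S y * f y) <= M"
  using assms(2) M by (auto simp: indicator_def)
 show "AE y in lborel. y \<notin> cball 0 R --> indicator S y * f y = 0"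
  using assms(4) by (intro AE_I2) (auto simp: indicator_def)
qed simp

text \<open>Let \<open>v = df3 h u\<close> be near its maximum at \<open>x\<close>, with
  \<open>v x\<close> at least half of \<open>N |h|^s\<close>. Averaging \<open>v\<close> over the
  \<open>n^3\<close> shifts of \<open>df3_multiple\<close> gives a third difference with step
  \<open>n h\<close> divided by \<open>n^3\<close>, hence at most \<open>N |h|^s / 4\<close> by the
  choice of \<open>n\<close>. So \<open>v\<close> lies below its near maximum by
  \<open>N |h|^s / 4\<close> on average over a ball of size comparable with \<open>|h|\<close>,
  placed inside the cone at a distance comparable with \<open>|h|\<close>. There the kernel is at
  least \<open>de |y|^(-d-al)\<close>, which yields \<open>N |h|^(s - al)\<close>. The upper bound
  enters at the single, larger step \<open>n h\<close>, so the lemma also serves functions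
  controlled only at steps above a cutoff.\<close>

lemma cone_gain:
 assumes s: "0 < s" "s < 3" and al: "0 < al" and de: "0 < de" and r0: "0 < r0" "r0 <= 1" and K: "0 < K"
 shows "EX n>0::nat. EX ka>0. EX C>0. ALL N M et (h::real^'d) u x w k. 0 < N & h ~= 0 & bd M u & u \<in> bm borel
  & 0 < n & (ALL z. abs (df3 (real n *. h) u z) <= N * norm (real n *. h) powr s)
  & 1/2 * N * h pw s <= df3 h u x
  & 0 <= et & (ALL y. df3 h u (x + y) <= df3 h u x + et)
  & norm w = 1 & kern al K k & (ALL y. y ~= 0 --> 0 <= k y) & (ALL y. y ~= 0 & norm (y /\<^sub>R norm y - w) <= r0 --> de <= k y)
  --> (EX S:sets borel. (ALL y:S. norm h < norm y) &
  (LINT y:S|lborel. (df3 h u (x + y) - df3 h u x) * k y / pk al y)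
  <= - ka * N * h pw (s - al) + C * et * h pw (- al))"
proof -
 \<comment> \<open>Large enough for \<open>n^(s - 3) <= 1/4\<close>; this is where
   \<open>s < 3\<close> decides.\<close>
 obtain n :: nat where n: "4 powr (1 / (3 - s)) < real n" using reals_Archimedean2 by blast
 have "0 < (4::real) powr (1 / (3 - s))" by simp
 hence npos: "0 < real n" using n by linarith
 hence np: "0 < n" by simp
 have "4 = (4 powr (1 / (3 - s))) powr (3 - s)" using s by (simp add: powr_powr)
 also have "... <= real n powr (3 - s)" using n s by (intro powr_mono2) auto
 also have "... = real n ^ 3 / real n powr s" using np by (simp add: powr_diff)
 finally have n4: "real n powr s <= real n ^ 3 / 4" using npos by (simp add: field_simps)
 \<comment> \<open>With \<open>R = L |h|\<close> one has \<open>r0 R / 8 = 3 n |h|\<close>. Shifts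
   by up to \<open>3 n\<close> steps therefore keep the ball \<open>B1\<close> of radius
   \<open>r0 R / 8\<close> inside the concentric ball \<open>S\<close> of radius
   \<open>r0 R / 4\<close>, and \<open>S\<close> still lies in the cone of aperture
   \<open>r0\<close> around \<open>w\<close>.\<close>
 define L where "L = 24 * real n / r0"
 have L: "24 * real n <= L" "0 < L" using r0 npos by (auto simp: L_def field_simps)
 have L1: "24 <= L" using L np by (smt (verit) One_nat_def Suc_leI of_nat_1 of_nat_le_iff)
 define V where "V = unit_ball_vol (real CARD('d))"
 have V: "0 < V" by (simp add: V_def unit_ball_vol_pos)
 define E where "E = real CARD('d) + al"
 define ka where "ka = de * (2 * L) powr (- E) * (V * (r0 * L / 8) ^ CARD('d)) / 4"
 define C where "C = K * (L / 2) powr (- E) * (V * (r0 * L / 4) ^ CARD('d))"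
 show ?thesis
 proof (rule exI[of _ n], rule conjI[OF np], rule exI[of _ ka], rule conjI[OF _ exI[of _ C, OF conjI]]; (intro allI impI)?)
  show "0 < ka" "0 < C" using de L V r0 K by (auto simp: ka_def C_def)
  fix N M et :: real and h x w :: "real^'d" and u k :: "real^'d => real"
  let ?v = "df3 h u"
  assume a: "0 < N & h ~= 0 & bd M u & u \<in> bm borel
  & 0 < n & (ALL z. abs (df3 (real n *. h) u z) <= N * norm (real n *. h) powr s)
  & 1/2 * N * h pw s <= ?v x
  & 0 <= et & (ALL y. ?v (x + y) <= ?v x + et)
  & norm w = 1 & kern al K k & (ALL y. y ~= 0 --> 0 <= k y) & (ALL y. y ~= 0 & norm (y /\<^sub>R norm y - w) <= r0 --> de <= k y)"
  hence N: "0 < N" and h: "h ~= 0" and u: "bd M u" and um[measurable]: "u \<in> bm borel"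
  and big: "!!z. abs (df3 (real n *. h) u z) <= N * norm (real n *. h) powr s"
  and vx: "1/2 * N * h pw s <= ?v x" and et: "0 <= et" and mx: "!!y. ?v (x + y) <= ?v x + et"
  and w: "norm w = 1" and k: "kern al K k" "!!y. y ~= 0 ==> 0 <= k y"
  and cone: "!!y. y ~= 0 ==> norm (y /\<^sub>R norm y - w) <= r0 ==> de <= k y" by auto
  define H where "H = norm h"
  have H: "0 < H" using h by (simp add: H_def)
  define R where "R = L * H"
  have R: "0 < R" "24 * H <= R" "r0 * R = 24 * real n * H"
  using mult_pos_pos[OF L(2) H] mrm[OF L1, of H] H r0 unfolding R_def by (auto simp: L_def)
  define B1 where "B1 = ball (R *. w) (r0 * R / 8)"
  define S where "S = ball (R *. w) (r0 * R / 4)"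
  have [measurable]: "B1 \<in> sets borel" "S \<in> sets borel" by (auto simp: B1_def S_def)
  have Sfacts: "R / 2 <= norm y & norm y <= 2 * R & de <= k y & abs (k y) <= K & y ~= 0" if y: "y \<in> S" for y
  proof -
  have d: "norm (y - R *. w) < r0 * R / 4" using y by (simp add: S_def dist_norm norm_minus_commute)
  have rR: "r0 * R <= R" using mrm[OF r0(2) less_imp_le[OF R(1)]] by simp
  have nw: "norm (R *. w) = R" using w R by simp
  have d2: "abs (norm y - R) <= norm (y - R *. w)" using norm_triangle_ineq3[of y "R *. w"] nw by simp
  have n1: "R / 2 <= norm y" "norm y <= 2 * R" using d d2 rR R by linarith+
  hence y0: "y ~= 0" using R by auto
  have e: "(y - R *. w) + (R - norm y) *. w = y - norm y *. w"
  by (simp add: scaleR_left_diff_distrib)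
  have "y /\<^sub>R norm y - w = (1 / norm y) *. ((y - R *. w) + (R - norm y) *. w)"
  unfolding e using y0 by (simp add: scaleR_diff_right divide_inverse)
  hence "norm (y /\<^sub>R norm y - w) = norm ((y - R *. w) + (R - norm y) *. w) / norm y" by simp
  also have "... <= (norm (y - R *. w) + abs (R - norm y)) / norm y"
  using norm_triangle_ineq[of "y - R *. w" "(R - norm y) *. w"] w by (intro divide_right_mono) auto
  also have "... <= (r0 * R / 2) / norm y" using d d2 abs_minus_commute[of R "norm y"] by (intro divide_right_mono norm_ge_zero) linarith
  also have "... <= (r0 * R / 2) / (R / 2)" using n1 R(1) r0(1) y0 by (intro divide_left_mono) auto
  also have "... = r0" using R(1) by simp
  finally show ?thesis using cone[OF y0] n1 y0 k by (simp add: kern_def)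
  qed
  have SR: "S \<subseteq> cball 0 (2 * R)" using Sfacts by auto
  have v_meas[measurable]: "?v \<in> bm borel" unfolding df_def by measurable
  have vb: "abs (?v y) <= 8 * M" for y using bdD[OF bd_df3[OF u]] by simp
  \<comment> \<open>The deficit from the near maximum. Its sign allows the integral over any shifted
    \<open>B1\<close> to be bounded by the integral over \<open>S\<close>.\<close>
  define f where "f y = ?v x + et - ?v (x + y)" for y
  have f0: "0 <= f y" for y using mx[of y] by (simp add: f_def)
  have fm[measurable]: "f \<in> bm borel" unfolding f_def by measurable
  have fb: "abs (f y) <= 16 * M + et" for y using vb[of x] vb[of "x + y"] et unfolding f_def by linarith
  have intS: "integrable lborel (%y. indicator S y * f y)"
  by (rule integrable_on_bounded[OF fm fb _ SR]) measurable
  have B1R: "B1 \<subseteq> cball 0 (2 * R)"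
  proof -
  have "B1 \<subseteq> S" unfolding B1_def S_def using r0 R H by (intro subset_ball) simp
  thus ?thesis using SR by blast
  qed
  have sh: "(LINT y|lborel. indicator B1 y * f (y + real i *. h)) <= (LINT y|lborel. indicator S y * f y)" if i: "i <= 3 * n" for i
  proof -
  let ?a = "real i *. h"
  have "(LINT y|lborel. indicator B1 y * f (y + ?a)) = (LINT y|lborel. (%z. indicator B1 (z - ?a) * f z) (y + ?a))" by simp
  also have "... = (LINT y|lborel. indicator B1 (y - ?a) * f y)" by (rule integral_translate) measurable
  also have "... <= (LINT y|lborel. indicator S y * f y)"
  proof (rule integral_mono)
  have sub: "y \<in> S" if "y - ?a \<in> B1" for y
  proof -
  have "norm ?a <= 3 * real n * H" using i H by (simp add: H_def mrm)
  also have "... = r0 * R / 8" using R by simp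
  finally show ?thesis using that norm_triangle_ineq[of "y - ?a - R *. w" ?a]
  by (simp add: B1_def S_def dist_norm norm_minus_commute)
  qed
  thus "indicator B1 (y - ?a) * f y <= indicator S y * f y" for y
  using f0 by (auto simp: indicator_def)
  have "integrable lborel (%y. indicator {y. y - ?a \<in> B1} y * f y)"
  by (rule integrable_on_bounded[OF fm fb]) (use sub SR in \<open>auto\<close>)
  thus "integrable lborel (%y. indicator B1 (y - ?a) * f y)" by (simp add: indicator_def)
  qed (rule intS)
  finally show ?thesis .
  qed
  have mB1: "measure lborel B1 = V * (r0 * R / 8) ^ CARD('d)"
  using R(1) r0(1) by (simp add: B1_def content_ball V_def)
  have mS: "measure lborel S = V * (r0 * R / 4) ^ CARD('d)"
  using R(1) r0(1) by (simp add: S_def content_ball V_def)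
  let ?T = "%y. \<Sum>i<n. \<Sum>j<n. \<Sum>l<n. f (y + real (i + j + l) *. h)"
  have fi: "integrable lborel (%y. indicator B1 y * f (y + real i *. h))" for i
  by (rule integrable_on_bounded[OF _ _ _ B1R]) (use fb in \<open>auto\<close>)
  have iT: "integrable lborel (%y. indicator B1 y * ?T y)"
  unfolding sum_distrib_left by (intro Bochner_Integration.integrable_sum fi)
  have "(LINT y|lborel. indicator B1 y * (real n ^ 3 * (N * H powr s / 4))) <= (LINT y|lborel. indicator B1 y * ?T y)"
  proof (rule integral_mono[OF _ iT])
  show "integrable lborel (%y. indicator B1 y * (real n ^ 3 * (N * H powr s / 4)))"
  by (rule integrable_on_bounded[OF _ order_refl _ B1R]) auto
  fix y
  have "?T y = (\<Sum>i<n. \<Sum>j<n. \<Sum>l<n. (?v x + et)) - (\<Sum>i<n. \<Sum>j<n. \<Sum>l<n. ?v (x + y + real (i + j + l) *. h))"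
  by (simp add: f_def sum_subtractf add.assoc)
  also have "... = real n ^ 3 * (?v x + et) - df3 (real n *. h) u (x + y)"
  unfolding df3_multiple by (simp add: power3_eq_cube alg)
  finally have T: "?T y = real n ^ 3 * (?v x + et) - df3 (real n *. h) u (x + y)" .
  have "real n ^ 3 * (1/2 * N * H powr s) <= real n ^ 3 * (?v x + et)"
  using vx et by (intro mlm) (auto simp: H_def)
  moreover have "df3 (real n *. h) u (x + y) <= N * H powr s * (real n ^ 3 / 4)"
  proof -
  have "df3 (real n *. h) u (x + y) <= N * norm (real n *. h) powr s"
  using big[of "x + y"] by linarith
  also have "... = N * H powr s * real n powr s" by (simp add: H_def powr_mult)
  also have "... <= N * H powr s * (real n ^ 3 / 4)" using n4 N by (intro mlm) auto
  finally show ?thesis .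
  qed
  ultimately have "real n ^ 3 * (N * H powr s / 4) <= ?T y" unfolding T by (simp add: alg)
  thus "indicator B1 y * (real n ^ 3 * (N * H powr s / 4)) <= indicator B1 y * ?T y"
  by (intro mlm) auto
  qed
  also have "(LINT y|lborel. indicator B1 y * ?T y) = (\<Sum>i<n. \<Sum>j<n. \<Sum>l<n. (LINT y|lborel. indicator B1 y * f (y + real (i + j + l) *. h)))"
  unfolding sum_distrib_left by (simp only: Bochner_Integration.integral_sum fi Bochner_Integration.integrable_sum)
  also have "... <= (\<Sum>i<n. \<Sum>j<n. \<Sum>l<n. (LINT y|lborel. indicator S y * f y))"
  by (intro sum_mono sh) auto
  also have "... = real n ^ 3 * (LINT y|lborel. indicator S y * f y)" by (simp add: power3_eq_cube alg)
  also have "(LINT y|lborel. indicator B1 y * (real n ^ 3 * (N * H powr s / 4))) = real n ^ 3 * (measure lborel B1 * (N * H powr s / 4))"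
  by (simp add: alg)
  finally have Sf: "measure lborel B1 * (N * H powr s / 4) <= (LINT y|lborel. indicator S y * f y)"
  using npos by (simp add: field_simps)
  have main: "(LINT y:S|lborel. (?v (x + y) - ?v x) * k y / y pw E)
  <= (LINT y|lborel. indicator S y * (et * K * (R / 2) powr (- E)) - de * (2 * R) powr (- E) * (indicator S y * f y))"
  unfolding set_lebesgue_integral_def
  proof (rule integral_mono)
  fix y
  show "indicator S y *. ((?v (x + y) - ?v x) * k y / y pw E) <= indicator S y * (et * K * (R / 2) powr (- E)) - de * (2 * R) powr (- E) * (indicator S y * f y)"
  proof (cases "y \<in> S")
  case True
  note F = Sfacts[OF True]
  have E0: "0 < E" using al by (simp add: E_def add_nonneg_pos)
  have "k y * y pw (- E) <= K * (R / 2) powr (- E)"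
  using F R E0 K by (intro mult_mono powr_mono2') auto
  hence 1: "et * (k y * y pw (- E)) <= et * (K * (R / 2) powr (- E))" using et by (rule mlm)
  have "de * (2 * R) powr (- E) <= k y * y pw (- E)"
  using F R E0 de by (intro mult_mono powr_mono2') auto
  hence 2: "de * (2 * R) powr (- E) * f y <= k y * y pw (- E) * f y" using f0 by (rule mrm)
  have "(?v (x + y) - ?v x) * k y / y pw E = (et - f y) * (k y * y pw (- E))"
  by (simp add: f_def powr_minus divide_inverse)
  also have "... = et * (k y * y pw (- E)) - k y * y pw (- E) * f y" by (simp add: alg)
  finally show ?thesis using 1 2 True by simp
  qed simp
  next
  have "integrable lborel (%y. indicator S y * ((?v (x + y) - ?v x) * (if norm y <= R / 4 then 0 else (k y / y pw E))))"
  proof (rule integrable_on_bounded[OF _ _ _ SR])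
  have "(%y. 1 * k y / y pw E) \<in> bm borel"
  unfolding E_def by (rule kern_measurable_div[OF k(1)]) simp
  hence [measurable]: "(%y. k y / y pw E) \<in> bm borel" by simp
  show "(%y. (?v (x + y) - ?v x) * (if norm y <= R / 4 then 0 else (k y / y pw E))) \<in> bm borel"
  by measurable
  fix y
  have E0: "0 < E" using al by (simp add: E_def add_nonneg_pos)
  show "abs ((?v (x + y) - ?v x) * (if norm y <= R / 4 then 0 else (k y / y pw E))) <= (16 * M) * (K * (R / 4) powr (- E))"
  unfolding abs_mult
  proof (rule mult_mono)
  show "abs (?v (x + y) - ?v x) <= 16 * M" using vb[of x] vb[of "x + y"] by linarith
  show "abs (if norm y <= R / 4 then 0 else (k y / y pw E)) <= K * (R / 4) powr (- E)"
  proof (cases "norm y <= R / 4")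
  case False
  hence "y ~= 0" using R by auto
  hence "abs (k y) * y pw (- E) <= K * (R / 4) powr (- E)"
  using False R E0 K k by (intro mult_mono powr_mono2') (auto simp: kern_def)
  moreover have "abs (k y / y pw E) = abs (k y) * y pw (- E)" unfolding abs_divide powr_minus by (simp add: divide_inverse)
  ultimately show ?thesis using False by simp
  qed (use K in auto)
  show "0 <= 16 * M" using bd_nonneg[OF u] by simp
  qed simp
  qed simp
  moreover have "indicator S y * ((?v (x + y) - ?v x) * (if norm y <= R / 4 then 0 else (k y / y pw E)))
  = indicator S y *. ((?v (x + y) - ?v x) * k y / y pw E)" for y
  proof (cases "y \<in> S")
  case True
  hence "~ norm y <= R / 4" using Sfacts[of y] R by linarith
  thus ?thesis by simp
  qed simp
  ultimately show "integrable lborel (%y. indicator S y *. ((?v (x + y) - ?v x) * k y / y pw E))" by simp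
  show "integrable lborel (%y. indicator S y * (et * K * (R / 2) powr (- E)) - de * (2 * R) powr (- E) * (indicator S y * f y))"
  by (intro Bochner_Integration.integrable_diff integrable_mult_right intS integrable_on_bounded[OF _ order_refl _ SR]) auto
  qed
  also have "... = (LINT y|lborel. indicator S y * (et * K * (R / 2) powr (- E))) - (LINT y|lborel. de * (2 * R) powr (- E) * (indicator S y * f y))"
  by (intro Bochner_Integration.integral_diff integrable_mult_right intS integrable_on_bounded[OF _ order_refl _ SR]) auto
  also have "... = measure lborel S * (et * K * (R / 2) powr (- E)) - de * (2 * R) powr (- E) * (LINT y|lborel. indicator S y * f y)"
  by simp
  also have "... <= measure lborel S * (et * K * (R / 2) powr (- E)) - de * (2 * R) powr (- E) * (measure lborel B1 * (N * H powr s / 4))"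
  using Sf de by (intro diff_mono order_refl mlm) auto
  also have "measure lborel S * (et * K * (R / 2) powr (- E)) = C * et * H powr (- al)"
  proof -
  have "(R / 2) powr (- E) = (L / 2) powr (- E) * H powr (- E)" using L H by (simp add: R_def powr_mult[symmetric] ac_simps)
  moreover have "(r0 * R / 4) ^ CARD('d) = (r0 * L / 4) ^ CARD('d) * H ^ CARD('d)"
  by (simp add: R_def power_mult_distrib[symmetric] ac_simps)
  moreover have "H ^ CARD('d) * H powr (- E) = H powr (- al)"
  using H by (simp add: E_def powr_realpow[symmetric] flip: powr_add)
  ultimately show ?thesis unfolding mS C_def by (simp add: alg)
  qed
  also have "de * (2 * R) powr (- E) * (measure lborel B1 * (N * H powr s / 4)) = ka * N * H powr (s - al)"
  proof -
  have "(2 * R) powr (- E) = (2 * L) powr (- E) * H powr (- E)" using L H by (simp add: R_def powr_mult[symmetric] ac_simps)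
  moreover have "(r0 * R / 8) ^ CARD('d) = (r0 * L / 8) ^ CARD('d) * H ^ CARD('d)"
  by (simp add: R_def power_mult_distrib[symmetric] ac_simps)
  moreover have "H ^ CARD('d) * H powr (- E) * H powr s = H powr (s - al)"
  using H by (simp add: E_def powr_realpow[symmetric] flip: powr_add)
  ultimately show ?thesis unfolding mB1 ka_def by (simp add: alg)
  qed
  finally have fin: "(LINT y:S|lborel. (?v (x + y) - ?v x) * k y / pk al y) <= - ka * N * h pw (s - al) + C * et * h pw (- al)"
  by (simp add: H_def E_def)
  have "ALL y:S. norm h < norm y"
  proof
  fix y assume "y \<in> S"
  hence "R / 2 <= norm y" using Sfacts by blast
  thus "norm h < norm y" using R H unfolding H_def by linarith
  qed
  thus "EX S:sets borel. (ALL y:S. norm h < norm y) &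
  (LINT y:S|lborel. (?v (x + y) - ?v x) * k y / pk al y)
  <= - ka * N * h pw (s - al) + C * et * h pw (- al)"
  using fin by (intro bexI[of _ S]) auto
 qed
qed

section \<open>Differences of the principal operator\<close>

text \<open>\<open>4 * ta <= be\<close> means \<open>al + ta <= (al + be - ta) - be/2\<close>: after
  a first difference has consumed \<open>be/2\<close>, enough order is left for the operator to act.
  For \<open>al > 1\<close> the last condition keeps the orders \<open>al - 1 - ta\<close> and
  \<open>al - 1 + ta\<close>, used for gradient increments, above zero.\<close>

definition pars :: "real => real => real => bool" where
 "pars al be ta \<longleftrightarrow> good_tau al ta & 0 < be & be <= 1 & 4 * ta <= be & (al > 1 --> 1 + 2 * ta <= al)"

definition reg :: "real => ('a::real_normed_vector => real) => bool" where
 "reg s u \<longleftrightarrow> (EX N. bd N u & Zyg s N u)"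

lemma regI: "bd M u ==> Zyg s N u ==> reg s u"
 unfolding reg_def by (rule exI[of _ "max M N"]) (auto intro: bd_mono Zyg_mono)

lemma reg_df: "reg s u ==> reg s (df h u)"
 unfolding reg_def using bd_df Zyg_df by blast

lemma reg_shift: "reg s u ==> reg s (%x. u (x + h))"
 unfolding reg_def using bd_shift Zyg_shift by blast

lemma reg_lin: assumes "reg s u" "reg s v" shows "reg s (%x. u x + a * v x)"
proof -
 obtain M N where "bd M u" "Zyg s M u" "bd N v" "Zyg s N v" using assms unfolding reg_def by blast
 hence "bd (M + abs a * N) (%x. u x + a * v x)" "Zyg s (M + abs a * N) (%x. u x + a * v x)"
  by (intro bd_add bd_cmult Zyg_add Zyg_cmult; simp)+
 thus ?thesis by (rule regI)
qed

lemma reg_low: assumes "reg s u" "0 < p" "p <= s" obtains N where "low p N u"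
 using assms low_Zyg1 unfolding reg_def by blast

lemma reg_grad: "reg s u ==> 1 < s ==> (u has_derivative (%y. grad u x \<bullet> y)) (at x)"
 for u :: "real^'d => real"
 unfolding reg_def using grad_has_derivative by blast

text \<open>Trades the order \<open>th\<close> for the factor \<open>|h|^th\<close>, for all orders
  up to \<open>p - th\<close> at once; for the sup norm this is the Marchaud inequality.\<close>

lemma low_df:
 assumes "low p Q u" "0 < th" "th < 1" "th <= p"
 shows "low (p - th) (8 * (marchaud1 th * marchaud2 th) * Q * h pw th) (df h u)"
 unfolding low_def
proof (intro conjI allI impI)
 have Z: "Zyg th Q u" using low_Zyg[OF assms(1)] assms by auto
 have c: "0 <= marchaud1 th * marchaud2 th * Q * h pw th"
  using Zyg_nonneg[OF Z] marchaud1_pos[of th] marchaud2_pos[of th] assms by simp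
 have "bd (marchaud1 th * marchaud2 th * Q * h pw th) (df h u)"
  unfolding bd_def using df1_bound[OF low_bd[OF assms(1)] Z assms(3)] by blast
 thus "bd (8 * (marchaud1 th * marchaud2 th) * Q * h pw th) (df h u)"
  by (rule bd_mono) (use c in \<open>simp add: alg\<close>)
 fix sg assume "0 < sg & sg <= p - th"
 hence "Zyg (sg + th) Q u" using low_Zyg[OF assms(1)] assms by auto
 from Zyg_mixed1[OF low_bd[OF assms(1)] this, of th h] assms \<open>0 < sg & sg <= p - th\<close>
 show "Zyg sg (8 * (marchaud1 th * marchaud2 th) * Q * h pw th) (df h u)" by simp
qed

lemma low_shift: "low p Q u ==> low p Q (%x. u (x + h))"
 unfolding low_def using bd_shift Zyg_shift by blast

lemma low_df': "low p Q u ==> low p (2 * Q) (df h u)"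
 unfolding low_def using bd_df Zyg_df by blast

lemma low_le: "low p Q u ==> p' <= p ==> low p' Q u"
 unfolding low_def by auto

lemma low_nonneg: "low p Q u ==> 0 <= Q"
 using bd_nonneg low_bd by blast

lemma kern_cancel_integrable:
 assumes k: "kern 1 K k" and r: "0 < r" "r < 1"
 shows "set_integrable lborel {y::real^'d. r < norm y & norm y <= 1} (%y. (k y / y pw (real CARD('d) + 1)) *. y)"
 unfolding set_integrable_def
proof (rule Bochner_Integration.integrable_bound)
 let ?S = "{y::real^'d. r < norm y & norm y <= 1}"
 have K: "0 <= K" using k by (simp add: kern_def)
 show "integrable lborel (dom 1 1 (K * r powr (- 1)) 0 :: real^'d => real)"
  using r K by (intro dom_integral) auto
 have "(%y::real^'d. (1 * k y / y pw (real CARD('d) + 1)) *. y) \<in> bm borel"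
  by (intro borel_measurable_scaleR kern_measurable_div[OF k]) measurable
 moreover have "?S \<in> sets borel" by measurable
 ultimately have "(%y. indicator ?S y *. ((1 * k y / y pw (real CARD('d) + 1)) *. y)) \<in> bm borel"
  using borel_measurable_scaleR[OF borel_measurable_indicator] by blast
 thus "(%y. indicator ?S y *. ((k y / y pw (real CARD('d) + 1)) *. y)) \<in> bm lborel" by simp
 have "norm (indicator ?S y *. ((k y / y pw (real CARD('d) + 1)) *. y)) <= norm (dom 1 1 (K * r powr (- 1)) 0 y)" for y
 proof (cases "y \<in> ?S")
  case True
  have "norm (indicator ?S y *. ((k y / y pw (real CARD('d) + 1)) *. y)) = abs (norm y * k y / y pw (real CARD('d) + 1))"
  using True by (simp add: abs_mult)
  also have "... <= 1 * K * y pw (1 - 1 - real CARD('d))"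
  using k by (intro kern_div_bound) auto
  also have "... = K * (y pw (-1) * y pw (1 - real CARD('d)))" unfolding powr_add[symmetric] by simp
  also have "... <= K * (r powr (-1) * y pw (1 - real CARD('d)))"
  using K True r by (intro mlm mrm powr_mono2') auto
  finally show ?thesis using True K by (simp add: dom_def mult.assoc)
 qed simp
 thus "AE y in lborel. norm (indicator ?S y *. ((k y / y pw (real CARD('d) + 1)) *. y)) <= norm (dom 1 1 (K * r powr (- 1)) 0 y)"
  by simp
qed

text \<open>The moment condition is an equation between Bochner integrals and passes to combinations
  through integrability on the shells. The bound \<open>B\<close> is an argument of its own, because
  differences of kernels are much smaller than the kernels.\<close>

lemma kern_comb:
 assumes k: "kern al K1 k1" "kern al K2 k2" and B: "0 <= B" "!!y. y ~= 0 ==> abs (a * k1 y + b * k2 y) <= B"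
 shows "kern al B (%y::real^'d. a * k1 y + b * k2 y)"
 unfolding kern_def
proof (intro conjI impI allI ballI)
 note [measurable] = k[unfolded kern_def, THEN conjunct2, THEN conjunct1]
 have "(%y. a * (if y = 0 then 0 else k1 y) + b * (if y = 0 then 0 else k2 y)) \<in> bm borel"
  by measurable
 moreover have "(%y. a * (if y = 0 then 0 else k1 y) + b * (if y = 0 then 0 else k2 y)) = (%y. if y = 0 then 0 else a * k1 y + b * k2 y)"
  by auto
 ultimately show "(%y. if y = 0 then 0 else a * k1 y + b * k2 y) \<in> bm borel" by simp
next
 fix r :: real assume al: "al = 1" and r: "r \<in> {0<..<1}"
 let ?S = "{y::real^'d. r < norm y & norm y <= 1}" and ?z = "%k y. (k y / pk al y) *. y"
 have i: "set_integrable lborel ?S (?z k1)" "set_integrable lborel ?S (?z k2)"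
  using kern_cancel_integrable[of K1 k1 r] kern_cancel_integrable[of K2 k2 r] k r unfolding al by auto
 have z: "(LINT y:?S|lborel. ?z k1 y) = 0" "(LINT y:?S|lborel. ?z k2 y) = 0"
  using k r al unfolding kern_def by auto
 have "(LINT y:?S|lborel. ?z (%y. a * k1 y + b * k2 y) y)
  = (LINT y|lborel. a *. (indicator ?S y *. ?z k1 y) + b *. (indicator ?S y *. ?z k2 y))"
  unfolding set_lebesgue_integral_def
  by (intro Bochner_Integration.integral_cong) (auto simp: indicator_def alg add_divide_distrib)
 also have "... = (LINT y|lborel. a *. (indicator ?S y *. ?z k1 y)) + (LINT y|lborel. b *. (indicator ?S y *. ?z k2 y))"
  using i unfolding set_integrable_def by (intro Bochner_Integration.integral_add integrable_scaleR_right) auto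
 also have "... = a *. (LINT y:?S|lborel. ?z k1 y) + b *. (LINT y:?S|lborel. ?z k2 y)"
  unfolding set_lebesgue_integral_def by (simp only: integral_scaleR_right)
 finally show "(LINT y:?S|lborel. ?z (%y. a * k1 y + b * k2 y) y) = 0" using z by simp
qed (use B in auto)

lemma KI_bound:
 assumes ta: "good_tau al ta"
 shows "EX C>0. ALL K k (g::real^'d => real) Q x. kern al K k & low (al + ta) Q g -->
  integrable lborel (KF al k g x) & abs (KI al k g x) <= C * K * Q"
proof -
 show ?thesis
 proof (insert KI_decomposition[OF ta, where 'd = 'd], elim exE conjE, goal_cases)
 case (1 C)
 note C = 1(1) and dec = 1(2)[rule_format]
 define D where "D = C * ((1/2) powr ta + (1/2) powr (- ta))"
 have "integrable lborel (KF al k g x) & abs (KI al k g x) <= D * K * Q"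
  if "kern al K k & low (al + ta) Q g" for K k Q x and g :: "real^'d => real"
 proof -
  have "Zyg (al + ta) Q g" "Zyg (al - ta) Q g"
  using that ta low_Zyg[of "al + ta" Q g] by (auto simp: good_tau_def)
  thus ?thesis using dec[of K k Q g Q Q "1/2" x] that low_bd[of "al + ta" Q g]
  by (simp add: D_def alg)
 qed
 moreover have "0 < D" using C by (simp add: D_def add_pos_pos)
 ultimately show ?thesis by blast
 qed
qed

lemma KF_lin_g:
 fixes u v :: "real^'d => real"
 assumes "reg s u" "reg s v" "al < s"
 shows "KF al k (%x. u x + a * v x) x y = KF al k u x y + a * KF al k v x y"
proof (cases "1 <= al")
 case True
 hence "grad (%x. u x + a * v x) x = grad u x + a *. grad v x"
  using assms by (intro grad_lin reg_grad) auto
 thus ?thesis by (simp add: KF_def inner_add_left alg add_divide_distrib diff_divide_distrib)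
next
 case False
 thus ?thesis by (simp add: KF_def chi_def alg add_divide_distrib diff_divide_distrib)
qed

lemma KF_lin_k: "KF al (%y. a * k1 y + b * k2 y) u x y = a * KF al k1 u x y + b * KF al k2 u x y"
 by (simp add: KF_def alg add_divide_distrib diff_divide_distrib)

text \<open>Kernel and drift are kept together: for \<open>al = 1\<close> they are of the same order.\<close>

definition GI :: "real => (real^'d => real) => real^'d => (real^'d => real) => real^'d => real" where
 "GI al k v g x = KI al k g x + (if 1 <= al then v \<bullet> grad g x else 0)"

lemma KF_integrable:
 fixes u :: "real^'d => real"
 assumes "good_tau al ta" "al + ta <= s" "kern al K k" "reg s u"
 shows "integrable lborel (KF al k u x)"
proof -
 have "0 < al + ta" using assms(1) by (simp add: good_tau_def)
 then obtain N where "low (al + ta) N u" using reg_low[OF assms(4) _ assms(2)] by blast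
 thus ?thesis using KI_bound[OF assms(1), where 'd = 'd] assms(3) by blast
qed

lemma GI_lin_g:
 fixes u v :: "real^'d => real"
 assumes ta: "good_tau al ta" "al + ta <= s" and k: "kern al K k" and u: "reg s u" "reg s v"
 shows "GI al k w (%x. u x + a * v x) x = GI al k w u x + a * GI al k w v x"
proof -
 have s: "al < s" using ta by (simp add: good_tau_def)
 have "KI al k (%x. u x + a * v x) x = KI al k u x + a * KI al k v x"
  unfolding KI_def KF_lin_g[OF u s]
  using KF_integrable[OF ta k u(1)] KF_integrable[OF ta k u(2)] by (subst Bochner_Integration.integral_add) auto
 moreover have "1 <= al ==> grad (%x. u x + a * v x) x = grad u x + a *. grad v x"
  using s u by (intro grad_lin reg_grad) auto
 ultimately show ?thesis by (auto simp: GI_def inner_add_right alg)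
qed

lemma GI_lin_k:
 fixes u :: "real^'d => real"
 assumes ta: "good_tau al ta" "al + ta <= s" and k: "kern al K1 k1" "kern al K2 k2" and u: "reg s u"
 shows "GI al (%y. a * k1 y + b * k2 y) (a *. v1 + b *. v2) u x = a * GI al k1 v1 u x + b * GI al k2 v2 u x"
proof -
 have "KI al (%y. a * k1 y + b * k2 y) u x = a * KI al k1 u x + b * KI al k2 u x"
  unfolding KI_def KF_lin_k
  using KF_integrable[OF ta k(1) u] KF_integrable[OF ta k(2) u] by (subst Bochner_Integration.integral_add) auto
 thus ?thesis by (auto simp: GI_def inner_add_left alg)
qed

lemma GI_shift: "GI al k v u (x + h) = GI al k v (%z. u (z + h)) x"
 by (simp add: GI_def KI_def KF_def grad_shift add_ac)

lemma GI_bound: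
 assumes ta: "good_tau al ta"
 shows "EX C>0. ALL K k v (g::real^'d => real) Q x. kern al K k & norm v <= K & low (al + ta) Q g -->
  abs (GI al k v g x) <= C * K * Q"
proof -
 obtain C where C: "0 < C" "!!K k (g::real^'d => real) Q x. kern al K k & low (al + ta) Q g ==> abs (KI al k g x) <= C * K * Q"
  using KI_bound[OF ta, where 'd = 'd] by meson
 have t: "0 < ta" "ta < 1" using ta by (auto simp: good_tau_def)
 show ?thesis
 proof (intro exI[of _ "C + 2 * grad_const ta"] conjI allI impI)
  show "0 < C + 2 * grad_const ta" using C grad_const_pos[OF t] by simp
  fix K Q and k g :: "real^'d => real" and v x :: "real^'d"
  assume a: "kern al K k & norm v <= K & low (al + ta) Q g"
  have K: "0 <= K" using a by (simp add: kern_def)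
  have Q: "0 <= Q" using a low_nonneg by blast
  have "abs (if 1 <= al then v \<bullet> grad g x else 0) <= K * (grad_const ta * (Q + Q))"
  proof (cases "1 <= al")
  case True
  have "Zyg (1 - ta) Q g" "Zyg (1 + ta) Q g" using True t a low_Zyg[of "al + ta" Q g] by auto
  hence "norm (grad g x) <= grad_const ta * (Q + Q)"
  using grad_bound[of Q g ta Q Q 1 x] a t low_bd[of "al + ta" Q g] by simp
  moreover have "abs (v \<bullet> grad g x) <= norm v * norm (grad g x)" by (rule Cauchy_Schwarz_ineq2)
  ultimately have "abs (v \<bullet> grad g x) <= K * (grad_const ta * (Q + Q))"
  using a K by (smt (verit) mult_mono norm_ge_zero)
  thus ?thesis using True by simp
  qed (use K Q grad_const_pos[OF t] in auto)
  moreover have "abs (KI al k g x) <= C * K * Q" using C a by blast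
  ultimately show "abs (GI al k v g x) <= (C + 2 * grad_const ta) * K * Q"
  unfolding GI_def by (simp add: alg)
 qed
qed

definition dk :: "real^'d => (real^'d => real^'d => real) => real^'d => real^'d => real" where
 "dk h m x y = m (x + h) y - m x y"

text \<open>Hoelder regularity of order \<open>be <= 1\<close> is kept as \<open>be/2\<close> for first and \<open>be\<close> for second differences: at \<open>be = 1\<close> first differences are not of order \<open>be\<close>.\<close>
definition kfam :: "real => real => real => (real^'d => real^'d => real) => (real^'d => real^'d) => bool" where
 "kfam al be K m b \<longleftrightarrow> (ALL x. kern al K (m x) & norm (b x) <= K) &
  (ALL h x. norm (df h b x) <= K * h pw (be/2) & norm (df2 h b x) <= K * h pw be &
  (ALL y. y ~= 0 --> abs (dk h m x y) <= K * h pw (be/2) & abs (dk h (dk h m) x y) <= K * h pw be))"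

lemma kfam_kern:
 assumes "kfam al be K m b"
 shows "kern al K (m x)" "norm (b x) <= K"
  "kern al (K * h pw (be/2)) (dk h m x)" "norm (df h b x) <= K * h pw (be/2)"
  "kern al (K * h pw be) (dk h (dk h m) x)" "norm (df2 h b x) <= K * h pw be"
proof -
 show *: "kern al K (m x)" for x using assms by (simp add: kfam_def)
 have K: "0 <= K" using *[of x] by (simp add: kern_def)
 show **: "kern al (K * h pw (be/2)) (dk h m x)" for x
  using kern_comb[OF *[of "x + h"] *[of x], of "K * h pw (be/2)" 1 "-1"] assms K
  by (simp add: dk_def[abs_def] kfam_def)
 show "kern al (K * h pw be) (dk h (dk h m) x)"
 proof -
  have e: "dk h (dk h m) x = (%y. 1 * dk h m (x + h) y + (-1) * dk h m x y)"
  by (rule ext) (simp add: dk_def[of h "dk h m"])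
  show ?thesis unfolding e
  by (rule kern_comb[OF **[of "x + h"] **[of x]])
  (use assms K in \<open>auto simp: kfam_def e[symmetric, THEN fun_cong, simplified]\<close>)
 qed
qed (use assms in \<open>auto simp: kfam_def\<close>)

text \<open>Discrete Leibniz rule: the difference falls on the coefficients, which then act on the
  shifted function, or on the function. The coefficient part is again of the form \<open>GI\<close>,
  so the rule can be iterated.\<close>

lemma df_GI:
 fixes u :: "real^'d => real"
 assumes ta: "good_tau al ta" "al + ta <= s" and k: "!!x. kern al K (m x)" and u: "reg s u"
 shows "df h (%x. GI al (m x) (b x) u x) x = GI al (dk h m x) (df h b x) (%z. u (z + h)) x + GI al (m x) (b x) (df h u) x"
proof -
 let ?u = "%z. u (z + h)"
 have 1: "GI al (dk h m x) (df h b x) ?u x = GI al (m (x + h)) (b (x + h)) ?u x - GI al (m x) (b x) ?u x"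
  using GI_lin_k[OF ta k[of "x + h"] k[of x] reg_shift[OF u], of 1 "-1" "b (x + h)" "b x" h x]
  by (simp add: dk_def[abs_def] df_def)
 have 2: "GI al (m x) (b x) (df h u) x = GI al (m x) (b x) ?u x - GI al (m x) (b x) u x"
  using GI_lin_g[OF ta k[of x] reg_shift[OF u] u, of "b x" h "-1" x] by (simp add: df_def[abs_def])
 show ?thesis unfolding 1 2 df_def[of h "%x. GI al (m x) (b x) u x"] GI_shift by simp
qed

lemma df2_GI:
 fixes u :: "real^'d => real"
 assumes ta: "good_tau al ta" "al + ta <= s" and k: "kfam al be K m b" and u: "reg s u"
 shows "df2 h (%x. GI al (m x) (b x) u x) x = GI al (dk h (dk h m) x) (df2 h b x) (%z. u (z + h + h)) x
  + 2 * GI al (dk h m x) (df h b x) (%z. df h u (z + h)) x + GI al (m x) (b x) (df2 h u) x"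
proof -
 have e: "df h (%x. GI al (m x) (b x) v x) = (%x. GI al (dk h m x) (df h b x) (%z. v (z + h)) x + GI al (m x) (b x) (df h v) x)"
  if "reg s v" for v
  by (rule ext) (rule df_GI[OF ta kfam_kern(1)[OF k] that])
 have "df2 h (%x. GI al (m x) (b x) u x) x
  = df h (%x. GI al (dk h m x) (df h b x) (%z. u (z + h)) x) x + df h (%x. GI al (m x) (b x) (df h u) x) x"
  unfolding e[OF u] df_add ..
 also have "df h (%x. GI al (m x) (b x) (df h u) x) x = GI al (dk h m x) (df h b x) (%z. df h u (z + h)) x + GI al (m x) (b x) (df2 h u) x"
  unfolding e[OF reg_df[OF u]] ..
 also have "df h (%x. GI al (dk h m x) (df h b x) (%z. u (z + h)) x) x
  = GI al (dk h (dk h m) x) (df2 h b x) (%z. u (z + h + h)) x + GI al (dk h m x) (df h b x) (df h (%z. u (z + h))) x"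
  by (rule df_GI[OF ta kfam_kern(3)[OF k] reg_shift[OF u]])
 finally show ?thesis by (simp add: df_shift)
qed

text \<open>By the Leibniz rule the commutators contain either two differences of the coefficients,
  of size \<open>|h|^be\<close>, or one, of size \<open>|h|^(be/2)\<close>, paired with a difference
  of \<open>u\<close> that supplies the other \<open>|h|^(be/2)\<close> while its order drops from
  \<open>al + be - ta\<close> to at least \<open>al + ta\<close>. Thus only norms below the top
  order enter. The commutator of the third difference is reduced to that of the second by
  differencing the remainder \<open>R\<close>. The last estimate does use the top order: it is what
  maps order \<open>al + be\<close> into order \<open>be\<close>.\<close>

lemma GI_estimates:
 assumes par: "pars al be ta"
 shows "EX C>0. ALL K m b (u::real^'d => real) Q h x. kfam al be K m b & reg (al + be) u & low (al + be - ta) Q u -->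
  abs (GI al (m x) (b x) u x) <= C * K * Q &
  abs (df2 h (%x. GI al (m x) (b x) u x) x - GI al (m x) (b x) (df2 h u) x) <= C * K * Q * h pw be &
  abs (df3 h (%x. GI al (m x) (b x) u x) x - GI al (m x) (b x) (df3 h u) x) <= C * K * Q * h pw be &
  (ALL N. bd N u & Zyg (al + be) N u & norm h <= 1 --> abs (GI al (m x) (b x) (df2 h u) x) <= C * K * N * h pw be)"
proof -
 have ta: "good_tau al ta" and be: "0 < be" "be <= 1" "4 * ta <= be" using par by (auto simp: pars_def)
 have t: "0 < ta" "ta < 1" "0 < al" "al < 2" "ta < al" using ta by (auto simp: good_tau_def)
 define s where "s = al + be"
 define p where "p = al + be - ta"
 have ts: "al + ta <= s" "al + ta <= p" "al + ta <= p - be/2" using be t by (auto simp: s_def p_def)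
 obtain C1 where C1: "0 < C1" and GB: "!!K k v (g::real^'d => real) Q x. kern al K k ==> norm v <= K ==> low (al + ta) Q g ==>
  abs (GI al k v g x) <= C1 * K * Q" using GI_bound[OF ta, where 'd = 'd] by meson
 show ?thesis
 proof (insert KI_decomposition[OF ta, where 'd = 'd], elim exE conjE, goal_cases)
 case (1 C2)
 note C2 = 1(1) and dec = 1(2)[rule_format]
 define c where "c = 8 * (marchaud1 (be/2) * marchaud2 (be/2))"
 have c: "0 < c" unfolding c_def using be by (auto intro!: mult_pos_pos marchaud1_pos marchaud2_pos)
 define E where "E = C1 * (1 + 2 * c)"
 have E: "0 < E" "C1 <= E" using C1 mult_pos_pos[OF C1 c] by (auto simp: E_def alg)
 define c1 where "c1 = 8 * marchaud2 (be - ta)"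
 define c2 where "c2 = 8 * marchaud2 (be + ta)"
 have c12: "0 < c1" "0 < c2" using be t by (auto simp: c1_def c2_def intro!: marchaud2_pos)
 define c3 where "c3 = (if 1 <= al then 8 * marchaud2 (s - 1 + ta) else 0)"
 define c4 where "c4 = (if 1 <= al then 8 * marchaud2 (s - 1 - ta) else 0)"
 have s3: "1 <= al ==> s - 1 + ta < 2" "1 <= al ==> 0 <= s - 1 - ta" "1 <= al ==> be <= s - 1"
  using ta be t unfolding s_def good_tau_def by (cases "al = 1"; auto)+
 have c34: "0 <= c3" "0 <= c4" using s3 t by (auto simp: c3_def c4_def intro!: less_imp_le[OF marchaud2_pos])
 define F where "F = C2 * (c1 * (1/2) powr ta + c2 * (1/2) powr (- ta)) + grad_const ta * (c3 + c4)"
 have F: "0 < F" unfolding F_def using C2 c12 c34 grad_const_pos[OF t(1,2)]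
  by (intro add_pos_nonneg mult_pos_pos add_pos_pos mult_nonneg_nonneg) auto
 define C where "C = 2 * E + 2 * C1 * c + F"
 have CE: "0 < C" "E <= C" "C1 <= C" "F <= C" "2 * E + 2 * C1 * c <= C"
  using E F C1 mult_pos_pos[OF C1 c] by (auto simp: C_def)
 show ?thesis
 proof (rule exI[of _ C], rule conjI[OF CE(1)], intro allI impI)
  fix K Q and m and b :: "real^'d => real^'d" and u :: "real^'d => real" and h x :: "real^'d"
  assume a: "kfam al be K m b & reg (al + be) u & low (al + be - ta) Q u"
  hence k: "kfam al be K m b" and ur: "reg s u" and ul: "low p Q u" by (auto simp: s_def p_def)
  note kk = kfam_kern[OF k]
  have K: "0 <= K" using kk(1) by (simp add: kern_def)
  have Q: "0 <= Q" using ul low_nonneg by blast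
  have ul': "low (al + ta) Q u" using low_le[OF ul ts(2)] .
  have dl: "low (al + ta) (c * Q * h pw (be/2)) (df h u)" for h
  using low_le[OF low_df[OF ul, of "be/2" h] ts(3)] be t by (auto simp: c_def p_def)
  have hb: "h pw (be/2) * h pw (be/2) = h pw be" for h :: "real^'d" by (simp flip: powr_add)
  let ?F = "%x. GI al (m x) (b x) u x"
  define R where "R x = df2 h ?F x - GI al (m x) (b x) (df2 h u) x" for x
  have R: "abs (R x) <= E * K * Q * h pw be" for x
  proof -
  have "R x = GI al (dk h (dk h m) x) (df2 h b x) (%z. u (z + h + h)) x + 2 * GI al (dk h m x) (df h b x) (%z. df h u (z + h)) x"
  unfolding R_def using df2_GI[OF ta ts(1) k ur] by simp
  moreover have "abs (GI al (dk h (dk h m) x) (df2 h b x) (%z. u (z + h + h)) x) <= C1 * (K * h pw be) * Q"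
  using low_shift[OF low_shift[OF ul']] by (intro GB kk)
  moreover have "abs (GI al (dk h m x) (df h b x) (%z. df h u (z + h)) x) <= C1 * (K * h pw (be/2)) * (c * Q * h pw (be/2))"
  using low_shift[OF dl] by (intro GB kk)
  ultimately have "abs (R x) <= C1 * (K * h pw be) * Q + 2 * (C1 * (K * h pw (be/2)) * (c * Q * h pw (be/2)))"
  by linarith
  also have "... = C1 * (K * h pw be) * Q + 2 * (C1 * K * c * Q * (h pw (be/2) * h pw (be/2)))"
  by (simp only: ac_simps)
  also have "... = E * K * Q * h pw be" unfolding hb E_def by (simp add: alg)
  finally show ?thesis .
  qed
  have 1: "abs (?F x) <= C * K * Q"
  proof -
  have "abs (?F x) <= C1 * K * Q" by (intro GB kk ul')
  also have "... <= C * K * Q" using K Q CE by (intro mrm) auto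
  finally show ?thesis .
  qed
  have 2: "abs (R x) <= C * K * Q * h pw be"
  proof -
  have "E * K * Q * h pw be <= C * K * Q * h pw be" using K Q CE by (intro mrm) auto
  thus ?thesis using R[of x] by linarith
  qed
  have 3: "abs (df3 h ?F x - GI al (m x) (b x) (df3 h u) x) <= C * K * Q * h pw be"
  proof -
  have e: "df2 h ?F = (%x. R x + GI al (m x) (b x) (df2 h u) x)" by (rule ext) (simp add: R_def)
  have "df3 h ?F x = df h R x + df h (%x. GI al (m x) (b x) (df2 h u) x) x"
  unfolding e df_add ..
  also have "df h (%x. GI al (m x) (b x) (df2 h u) x) x
  = GI al (dk h m x) (df h b x) (%z. df2 h u (z + h)) x + GI al (m x) (b x) (df3 h u) x"
  by (rule df_GI[OF ta ts(1) kk(1) reg_df[OF reg_df[OF ur]]])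
  finally have "df3 h ?F x - GI al (m x) (b x) (df3 h u) x
  = df h R x + GI al (dk h m x) (df h b x) (%z. df2 h u (z + h)) x" by simp
  moreover have "abs (df h R x) <= 2 * (E * K * Q * h pw be)"
  using R[of x] R[of "x + h"] unfolding df_def[of h R] by linarith
  moreover have "abs (GI al (dk h m x) (df h b x) (%z. df2 h u (z + h)) x)
  <= C1 * (K * h pw (be/2)) * (2 * (c * Q * h pw (be/2)))"
  using low_shift[OF low_df'[OF dl]] by (intro GB kk)
  ultimately have "abs (df3 h ?F x - GI al (m x) (b x) (df3 h u) x)
  <= 2 * (E * K * Q * h pw be) + C1 * (K * h pw (be/2)) * (2 * (c * Q * h pw (be/2)))"
  by linarith
  also have "... = 2 * (E * K * Q * h pw be) + 2 * (C1 * K * c * Q * (h pw (be/2) * h pw (be/2)))"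
  by (simp only: ac_simps)
  also have "... = (2 * E + 2 * C1 * c) * K * Q * h pw be" unfolding hb by (simp add: alg)
  also have "... <= C * K * Q * h pw be" using K Q CE by (intro mrm) auto
  finally show ?thesis .
  qed
  have 4: "abs (GI al (m x) (b x) (df2 h u) x) <= C * K * N * h pw be"
  if uN: "bd N u" "Zyg s N u" and h: "norm h <= 1" for N
  proof (cases "h = 0")
  case True
  hence z: "df2 h u = (%_. 0)" by (simp add: fun_eq_iff)
  have "low (al + ta) 0 (%_::real^'d. 0::real)" by (simp add: low_def bd_def Zyg_def df_def)
  hence "abs (GI al (m x) (b x) (df2 h u) x) <= C1 * K * 0" unfolding z by (intro GB kk)
  thus ?thesis using True by simp
  next
  case False
  let ?g = "df2 h u"
  define H where "H = norm h"
  have H: "0 < H" "H <= 1" using False h by (auto simp: H_def)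
  have N: "0 <= N" using uN Zyg_nonneg by blast
  have Z1: "Zyg (al + ta) (c1 * N * H powr (be - ta)) ?g"
  using Zyg_mixed2[OF uN, of "be - ta" h] be t by (simp add: s_def c1_def H_def alg)
  have Z2: "Zyg (al - ta) (c2 * N * H powr (be + ta)) ?g"
  using Zyg_mixed2[OF uN, of "be + ta" h] be t by (simp add: s_def c2_def H_def alg)
  \<comment> \<open>The scale is \<open>|h| / 2\<close>: the orders \<open>al + ta\<close> and
    \<open>al - ta\<close> of \<open>df2 h u\<close> carry \<open>|h|^(be - ta)\<close> and
    \<open>|h|^(be + ta)\<close>, and together with the powers of the scale both become multiples of
    \<open>|h|^be\<close>. Halving keeps the scale below one.\<close>
  have "abs (KI al (m x) ?g x) <= C2 * K * (c1 * N * H powr (be - ta) * (H / 2) powr ta + c2 * N * H powr (be + ta) * (H / 2) powr (- ta))"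
  using dec[of K "m x" "4 * N" ?g _ _ "H / 2" x] kk(1) bd_df2[OF uN(1)] Z1 Z2 H by auto
  also have "... = C2 * K * N * (c1 * (H powr (be - ta) * (H / 2) powr ta) + c2 * (H powr (be + ta) * (H / 2) powr (- ta)))"
  by (simp add: alg)
  also have "H powr (be + ta) * (H / 2) powr (- ta) = H powr be * (1/2) powr (- ta)"
  using H by (simp add: powr_divide powr_add powr_minus field_simps)
  also have "H powr (be - ta) * (H / 2) powr ta = H powr be * (1/2) powr ta"
  using H by (simp add: powr_divide powr_diff field_simps)
  finally have b1: "abs (KI al (m x) ?g x) <= C2 * (c1 * (1/2) powr ta + c2 * (1/2) powr (- ta)) * (K * N * H powr be)"
  by (simp only: alg)
  have b2: "abs (if 1 <= al then b x \<bullet> grad ?g x else 0) <= grad_const ta * (c3 + c4) * (K * N * H powr be)"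
  proof (cases "1 <= al")
  case True
  have Z3: "Zyg (1 - ta) (c3 * N * H powr (s - 1 + ta)) ?g"
  using Zyg_mixed2[OF uN, of "s - 1 + ta" h] s3 t True by (simp add: c3_def H_def alg)
  have Z4: "Zyg (1 + ta) (c4 * N * H powr (s - 1 - ta)) ?g"
  using Zyg_mixed2[OF uN, of "s - 1 - ta" h] s3 t True by (simp add: c4_def H_def alg)
  have "norm (grad ?g x) <= grad_const ta * (c3 * N * H powr (s - 1 + ta) * H powr (- ta) + c4 * N * H powr (s - 1 - ta) * H powr ta)"
  by (rule grad_bound[OF bd_df2[OF uN(1)] Z3 Z4 t(1,2) H(1)])
  also have "... = grad_const ta * (c3 + c4) * N * (H powr (s - 1))"
  by (simp add: alg flip: powr_add)
  also have "... <= grad_const ta * (c3 + c4) * N * (H powr be)"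
  using H N c34 grad_const_pos[OF t(1,2)] s3(3)[OF True] by (intro mlm powr_mono') auto
  finally have "norm (grad ?g x) <= grad_const ta * (c3 + c4) * N * (H powr be)" .
  moreover have "abs (b x \<bullet> grad ?g x) <= norm (b x) * norm (grad ?g x)" by (rule Cauchy_Schwarz_ineq2)
  ultimately have "abs (b x \<bullet> grad ?g x) <= K * (grad_const ta * (c3 + c4) * N * (H powr be))"
  using mult_mono[OF kk(2)[of x], of "norm (grad ?g x)"] K by (meson norm_ge_zero order_trans)
  thus ?thesis using True by (simp add: alg)
  qed (use K N c34 grad_const_pos[OF t(1,2)] in auto)
  have "abs (GI al (m x) (b x) ?g x) <= F * (K * N * H powr be)"
  unfolding GI_def F_def distrib_right[of "C2 * _"] using b1 b2 by linarith
  also have "... <= C * (K * N * H powr be)" using K N CE by (intro mrm) auto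
  finally show ?thesis by (simp add: H_def mult.assoc)
  qed
  show "abs (GI al (m x) (b x) u x) <= C * K * Q &
  abs (df2 h ?F x - GI al (m x) (b x) (df2 h u) x) <= C * K * Q * h pw be &
  abs (df3 h ?F x - GI al (m x) (b x) (df3 h u) x) <= C * K * Q * h pw be &
  (ALL N. bd N u & Zyg (al + be) N u & norm h <= 1 --> abs (GI al (m x) (b x) (df2 h u) x) <= C * K * N * h pw be)"
  using 1 2 3 4 unfolding R_def s_def by blast
 qed
 qed
qed

section \<open>The maximum principle\<close>

text \<open>Time is discretised: the generator is frozen at the end point of a short time step, so no
 differentiability in time is needed, only the increment inequality \<open>inc\<close>.\<close>

lemma max_principle:
 fixes w :: "real => 'a => real" and ga :: "real => real => 'a => real"
 assumes bdd: "!!t x. t \<in> {t0..T} ==> abs (w t x) <= N"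
  and inc: "!!t' t x \<Gamma>. t0 <= t' ==> t' <= t ==> t <= T ==> (!!r. r \<in> {t'..t} ==> ga r r x <= \<Gamma>) ==> w t x - w t' x <= (t - t') * \<Gamma>"
  and cont: "!!e. e > 0 ==> EX d>0. ALL t:{t0..T}. ALL r:{t0..T}. ALL x. abs (r - t) <= d --> ga r r x <= ga r t x + e"
  and mx: "!!e. e > 0 ==> EX et>0. ALL t:{t0..T}. ALL r:{t0..T}. ALL x. (ALL y. w t y <= w t x + et) & w t x > th --> ga r t x <= e + a"
  and init: "!!x. w t0 x <= th"
  and t: "t \<in> {t0..T}"
 shows "w t x <= th + max a 0 * (t - t0)"
proof -
 define S where "S t = (SUP x. w t x)" for t
 have bnd: "bdd_above (range (w t))" if "t \<in> {t0..T}" for t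
  using bdd[OF that] by (intro bdd_aboveI2[where M = N]) (auto simp: abs_le_iff)
 have up: "w t x <= S t" if "t \<in> {t0..T}" for t x
  unfolding S_def using bnd[OF that] by (rule cSUP_upper[rotated]) auto
 have main: "S t <= th + max (a + 3 * e) 0 * (t - t0)" if e: "e > 0" for e
 proof -
  obtain d where d: "d > 0" "!!t r x. t \<in> {t0..T} ==> r \<in> {t0..T} ==> abs (r - t) <= d ==> ga r r x <= ga r t x + e"
  using cont[OF e] by blast
  obtain et where et: "et > 0" "!!t r x. t \<in> {t0..T} ==> r \<in> {t0..T} ==> (!!y. w t y <= w t x + et) ==> w t x > th ==> ga r t x <= e + a"
  using mx[OF e] by blast
  have step: "S t <= max th (S t' + (t - t') * (a + 3 * e))" if tt: "t0 <= t'" "t' < t" "t <= T" "t - t' <= d" for t' t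
  proof (cases "S t <= th")
  case False
  have tI: "t \<in> {t0..T}" "t' \<in> {t0..T}" using tt by auto
  \<comment> \<open>One tolerance for two purposes: \<open>x\<close> must be a near maximum in the
    sense of \<open>mx\<close>, and the loss in passing from the supremum to \<open>x\<close> must
    stay below the error \<open>(t - t') * e\<close> of one time step.\<close>
  define q where "q = min et ((t - t') * e)"
  have q: "q > 0" using et e tt by (simp add: q_def)
  have "max th (S t - q) < S t" using False q by simp
  then obtain x where x: "max th (S t - q) < w t x"
  unfolding S_def using bnd[OF tI(1)] by (subst (asm) less_cSUP_iff) auto
  have "q <= et" by (simp add: q_def)
  hence m: "w t y <= w t x + et" for y using up[OF tI(1), of y] x by linarith
  have "w t x - w t' x <= (t - t') * (a + 2 * e)"
  proof (rule inc)
  fix r assume r: "r \<in> {t'..t}"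
  hence "ga r r x <= ga r t x + e" using tt by (intro d(2)) auto
  moreover have "ga r t x <= e + a" using r tt x by (intro et(2) m) auto
  ultimately show "ga r r x <= a + 2 * e" by linarith
  qed (use tt in auto)
  moreover have "q <= (t - t') * e" by (simp add: q_def)
  ultimately have "S t <= S t' + (t - t') * (a + 2 * e) + (t - t') * e"
  using up[OF tI(2), of x] x by linarith
  thus ?thesis by (simp add: alg)
  qed simp
  show ?thesis
  proof (cases "t = t0")
  case True
  thus ?thesis unfolding S_def using init by (simp add: cSUP_least)
  next
  case False
  hence tt: "t0 < t" "t <= T" using t by auto
  obtain n :: nat where n: "(t - t0) / d < real n" using reals_Archimedean2 by blast
  have "0 < (t - t0) / d" using tt d by simp
  hence n0: "0 < real n" using n by linarith
  define \<Delta> where "\<Delta> = (t - t0) / real n"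
  have \<Delta>: "0 < \<Delta>" "\<Delta> <= d" using n n0 tt d by (auto simp: \<Delta>_def field_simps)
  have "S (t0 + real k * \<Delta>) <= th + max (a + 3 * e) 0 * (real k * \<Delta>)" if "k <= n" for k
  using that
  proof (induction k)
  case 0
  thus ?case unfolding S_def using init by (simp add: cSUP_least)
  next
  case (Suc k)
  have kn: "real (Suc k) * \<Delta> <= real n * \<Delta>" using Suc.prems \<Delta> by (intro mrm) auto
  have nD: "real n * \<Delta> = t - t0" using n0 by (simp add: \<Delta>_def)
  have Sk: "real (Suc k) * \<Delta> = real k * \<Delta> + \<Delta>" by (simp add: alg)
  have k0: "0 <= real k * \<Delta>" using \<Delta> by simp
  have "S (t0 + real (Suc k) * \<Delta>) <= max th (S (t0 + real k * \<Delta>) + (t0 + real (Suc k) * \<Delta> - (t0 + real k * \<Delta>)) * (a + 3 * e))"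
  using \<Delta> kn nD Sk k0 tt by (intro step) linarith+
  also have "t0 + real (Suc k) * \<Delta> - (t0 + real k * \<Delta>) = \<Delta>" by (simp add: alg)
  also have "max th (S (t0 + real k * \<Delta>) + \<Delta> * (a + 3 * e)) <= th + max (a + 3 * e) 0 * (real (Suc k) * \<Delta>)"
  proof (rule max.boundedI)
  show "th <= th + max (a + 3 * e) 0 * (real (Suc k) * \<Delta>)" using \<Delta> by simp
  have "\<Delta> * (a + 3 * e) <= \<Delta> * max (a + 3 * e) 0" using \<Delta> by (intro mlm) auto
  hence "S (t0 + real k * \<Delta>) + \<Delta> * (a + 3 * e) <= th + max (a + 3 * e) 0 * (real k * \<Delta>) + \<Delta> * max (a + 3 * e) 0"
  using Suc by (intro add_mono) auto
  also have "... = th + max (a + 3 * e) 0 * (real (Suc k) * \<Delta>)" by (simp add: alg)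
  finally show "S (t0 + real k * \<Delta>) + \<Delta> * (a + 3 * e) <= th + max (a + 3 * e) 0 * (real (Suc k) * \<Delta>)" .
  qed
  finally show ?case .
  qed
  from this[of n] show ?thesis using n0 by (simp add: \<Delta>_def)
  qed
 qed
 have "w t x <= th + max a 0 * (t - t0) + e" if e: "e > 0" for e
 proof -
  define e' where "e' = e / (3 * (t - t0 + 1))"
  have tt: "0 <= t - t0" using t by simp
  have e': "e' > 0" using e tt by (simp add: e'_def)
  have "w t x <= th + max (a + 3 * e') 0 * (t - t0)" using main[OF e'] up[OF t, of x] by linarith
  also have "max (a + 3 * e') 0 * (t - t0) <= (max a 0 + 3 * e') * (t - t0)"
  using e' tt by (intro mrm) auto
  also have "3 * e' * (t - t0) <= e" using e tt by (simp add: e'_def field_simps)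
  hence "(max a 0 + 3 * e') * (t - t0) <= max a 0 * (t - t0) + e" by (simp add: alg)
  finally show ?thesis by simp
 qed
 thus ?thesis using field_le_epsilon by blast
qed

section \<open>Equations in integrated form\<close>

definition intf :: "real => (real => 'a => real) => (real => 'a => real) => bool" where
 "intf T g u \<longleftrightarrow> (ALL t:{0..T}. ALL x. set_integrable lborel {0..t} (%s. g s x) & u t x = (LINT s:{0..t}|lborel. g s x))"

lemma intf_mono: "intf T g u ==> T' <= T ==> intf T' g u"
 unfolding intf_def by auto

lemma intf_lin:
 assumes "intf T g u" "intf T g' u'"
 shows "intf T (%s x. g s x + a * g' s x) (%t x. u t x + a * u' t x)"
 using assms unfolding intf_def by (auto simp: set_integral_add)

lemma intf_df:
 assumes "intf T g u" shows "intf T (%s. df h (g s)) (%t. df h (u t))"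
 using assms unfolding intf_def df_def by (auto simp: set_integral_diff)

lemma intf_minus: "intf T g u ==> intf T (%s x. - g s x) (%t x. - u t x)"
 unfolding intf_def by (auto simp: set_integral_uminus set_integrable_def set_lebesgue_integral_def)

lemma intf_0: assumes "intf T g u" "0 <= T" shows "u 0 x = 0"
proof -
 have "u 0 x = (LINT s:{0..0}|lborel. g s x)" using assms unfolding intf_def by simp
 also have "... = 0" unfolding set_lebesgue_integral_def
  by (rule integral_eq_zero_AE) (use AE_lborel_singleton[of "0::real"] in eventually_elim, auto)
 finally show ?thesis .
qed

lemma intf_increment:
 assumes u: "intf T g u" and t: "0 <= t'" "t' <= t" "t <= T"
 shows "set_integrable lborel {t'<..t} (%s. g s x)" "u t x - u t' x = (LINT s:{t'<..t}|lborel. g s x)"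
proof -
 have i: "set_integrable lborel {0..t} (%s. g s x)" "set_integrable lborel {0..t'} (%s. g s x)"
  and e: "u t x = (LINT s:{0..t}|lborel. g s x)" "u t' x = (LINT s:{0..t'}|lborel. g s x)"
  using u t unfolding intf_def by auto
 show j: "set_integrable lborel {t'<..t} (%s. g s x)"
  by (rule set_integrable_subset[OF i(1)]) (use t in auto)
 have "(LINT s:{0..t'} \<union> {t'<..t}|lborel. g s x) = (LINT s:{0..t'}|lborel. g s x) + (LINT s:{t'<..t}|lborel. g s x)"
  by (rule set_integral_Un[OF _ i(2) j]) auto
 moreover have "{0..t'} \<union> {t'<..t} = {0..t}" using t by auto
 ultimately show "u t x - u t' x = (LINT s:{t'<..t}|lborel. g s x)" using e by simp
qed

lemma intf_le:
 assumes u: "intf T g u" and t: "0 <= t'" "t' <= t" "t <= T" and le: "!!r. r \<in> {t'..t} ==> g r x <= \<Gamma>"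
 shows "u t x - u t' x <= (t - t') * \<Gamma>"
proof -
 have "(LINT s:{t'<..t}|lborel. g s x) <= (LINT s:{t'<..t}|lborel. \<Gamma>)"
  by (rule set_integral_mono[OF intf_increment(1)[OF u t]])
  (use le t in \<open>auto simp: set_integrable_def integrable_indicator_iff intro!: integrable_mult_left\<close>)
 also have "... = (t - t') * \<Gamma>" using t by (simp add: set_lebesgue_integral_def)
 finally show ?thesis using intf_increment(2)[OF u t] by simp
qed

lemma intf_abs_le:
 assumes u: "intf T g u" and t: "0 <= t'" "t' <= t" "t <= T" and le: "!!r. r \<in> {t'..t} ==> abs (g r x) <= \<Gamma>"
 shows "abs (u t x - u t' x) <= (t - t') * \<Gamma>"
proof -
 have "u t x - u t' x <= (t - t') * \<Gamma>" by (rule intf_le[OF u t]) (use le in \<open>force simp: abs_le_iff\<close>)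
 moreover have "- u t x - - u t' x <= (t - t') * \<Gamma>"
  by (rule intf_le[OF intf_minus[OF u] t]) (use le in \<open>force simp: abs_le_iff\<close>)
 ultimately show ?thesis by linarith
qed

definition hol :: "real => real => ('a::real_normed_vector => real) => bool" where
 "hol be F g \<longleftrightarrow> bd F g & (ALL h x. abs (df2 h g x) <= F * h pw be)"

text \<open>Operators of lower order: bounded in norms of order \<open>p < s\<close>, except for an arbitrarily small multiple of the norm of order \<open>s\<close>.\<close>
definition lowop :: "real => real => real => real => (real => real) => (real => (real^'d => real) => real^'d => real) => bool" where
 "lowop T s p be E B \<longleftrightarrow> (ALL t:{0..T}.
  (ALL u v a x. reg s u & reg s v --> B t (%x. u x + a * v x) x = B t u x + a * B t v x) &
  (ALL u Q x. reg s u & low p Q u --> abs (B t u x) <= E 1 * Q) &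
  (ALL u Q N h x e. 0 < e & norm h <= 1 & low p Q u & bd N u & Zyg s N u -->
  abs (df2 h (B t u) x) <= (e * N + E e * Q) * h pw be))"

text \<open>The direction \<open>w\<close> is uniform in \<open>x\<close>, being inherited from a
  lower bound of the kernel that is free of \<open>x\<close>; it may change with time.\<close>

definition elliptic :: "real => real => (real^'d => real^'d => real) => bool" where
 "elliptic de r0 m \<longleftrightarrow> (ALL x y. y ~= 0 --> 0 <= m x y) &
  (EX w. norm w = 1 & (ALL x y. y ~= 0 & norm (y /\<^sub>R norm y - w) <= r0 --> de <= m x y))"

text \<open>All estimates depend on the operator through these constants only, which are stable under convex combinations.\<close>
definition opc :: "real => real => real => real => real => real => real => (real => real) => (real => real^'d => real^'d => real)
  => (real => real^'d => real^'d) => (real => (real^'d => real) => real^'d => real) => bool" where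
 "opc T al be ta K de r0 E m b B \<longleftrightarrow> (ALL t:{0..T}. kfam al be K (m t) (b t) & elliptic de r0 (m t)) &
  lowop T (al + be) (al + be - ta) be E B"

definition Lop :: "real => (real => real^'d => real^'d => real) => (real => real^'d => real^'d)
  => (real => (real^'d => real) => real^'d => real) => real => (real^'d => real) => real^'d => real" where
 "Lop al m b B t u x = GI al (m t x) (b t x) u x + B t u x"

lemma opc_mono: "opc T al be ta K de r0 E m b B ==> T' <= T ==> opc T' al be ta K de r0 E m b B"
 unfolding opc_def lowop_def by auto

text \<open>Only the function is frozen in time: in \<open>max_principle\<close>,
  \<open>ga r t x\<close> becomes the operator at time \<open>r\<close> applied to the function at
  time \<open>t\<close>. Continuity in \<open>t\<close>, uniform in \<open>r\<close> and
  \<open>x\<close>, comes from interpolation: \<open>w r - w t\<close> is of size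
  \<open>|r - t|\<close> in the sup norm and bounded at order \<open>s\<close>, hence small at the
  order \<open>al + ta < s\<close> that controls the operator.\<close>

lemma generator_max_principle:
 fixes w :: "real => real^'d => real"
 assumes ta: "good_tau al ta" "al + ta < s" and t0: "0 <= t0" "t0 <= T" and lam: "0 <= lam"
  and k: "!!t x. t \<in> {0..T} ==> kern al K (m t x) & norm (b t x) <= K"
  and w: "!!t. t \<in> {0..T} ==> bd N (w t) & Zyg s N (w t)"
  and wg: "intf T g w"
  and lip: "!!r x. r \<in> {0..T} ==> abs (g r x) <= G"
  and gen: "!!r x. r \<in> {0..T} ==> g r x <= GI al (m r x) (b r x) (w r) x - lam * w r x + F"
  and mx: "!!e. e > 0 ==> EX et>0. ALL t:{0..T}. ALL r:{0..T}. ALL x. (ALL y. w t y <= w t x + et) & w t x > th -->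
  GI al (m r x) (b r x) (w t) x - lam * w t x + F <= e + a"
  and init: "!!x. w t0 x <= th" and t: "t \<in> {t0..T}"
 shows "w t x <= th + max a 0 * (t - t0)"
proof (rule max_principle[where ga = "%r t x. GI al (m r x) (b r x) (w t) x - lam * w t x + F" and N = N and w = w and th = th and a = a and ?t0.0 = t0 and T = T, OF _ _ _ _ init t])
 show "abs (w t x) <= N" if "t \<in> {t0..T}" for t x
  using w[of t] that t0 bdD[of N "w t" x] by auto
 show "w t x - w t' x <= (t - t') * \<Gamma>"
  if "t0 <= t'" "t' <= t" "t <= T" "!!r. r \<in> {t'..t} ==> GI al (m r x) (b r x) (w r) x - lam * w r x + F <= \<Gamma>" for t' t x \<Gamma>
  using that t0 by (intro intf_le[OF wg] order_trans[OF gen]) auto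
 show "EX d>0. ALL t:{t0..T}. ALL r:{t0..T}. ALL x. abs (r - t) <= d -->
  GI al (m r x) (b r x) (w r) x - lam * w r x + F <= GI al (m r x) (b r x) (w t) x - lam * w t x + F + e" if e: "e > 0" for e
 proof -
  obtain C where C: "0 < C" "!!K k v (g::real^'d => real) Q x. kern al K k & norm v <= K & low (al + ta) Q g ==> abs (GI al k v g x) <= C * K * Q"
  using GI_bound[OF ta(1), where 'd = 'd] by meson
  have K: "0 <= K" using k[of t0] t0 by (auto simp: kern_def)
  have N: "0 <= N" using w[of t0] t0 Zyg_nonneg[of s N "w t0"] by auto
  have G: "0 <= G" using lip[of t0 0] t0 by auto
  \<comment> \<open>At order \<open>s\<close> the difference \<open>w r - w t\<close> is merely
    bounded, by \<open>2 * N\<close>; this interpolation weight makes that contribution at most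
    \<open>e / 4\<close>. The rest is proportional to the time distance and is handled by the choice
    of \<open>d\<close>.\<close>
  define e1 where "e1 = e / (4 * (C * K * 2 * N + 1))"
  have CKN: "0 <= C * K * 2 * N" using C K N by simp
  have e1: "0 < e1" using e CKN by (simp add: e1_def)
  have at: "0 < al + ta" using ta by (simp add: good_tau_def)
  obtain D where D: "0 < D" and li: "!!(u::real^'d => real) M N. bd M u & Zyg s N u ==> low (al + ta) (e1 * N + D * M) u"
  using low_interp_eps[OF at ta(2) e1] by meson
  define X where "X = C * K * D * G + lam * G"
  have X: "0 <= X" using C K D G lam by (simp add: X_def)
  define d where "d = e / (2 * (X + 1))"
  have d: "0 < d" using e X by (simp add: d_def)
  show ?thesis
  proof (intro exI[of _ d] conjI ballI allI impI d)
  fix t r x assume tr: "t \<in> {t0..T}" "r \<in> {t0..T}" "abs (r - t) <= d"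
  have trI: "t \<in> {0..T}" "r \<in> {0..T}" using tr t0 by auto
  define v where "v x = w r x + (- 1) * w t x" for x
  have vb: "abs (v x) <= d * G" for x
  proof -
  have "abs (w r x - w t x) <= abs (r - t) * G"
  proof (cases "t <= r")
  case True
  hence "abs (w r x - w t x) <= (r - t) * G" using trI lip by (intro intf_abs_le[OF wg]) auto
  thus ?thesis using True by simp
  next
  case False
  hence "abs (w t x - w r x) <= (t - r) * G" using trI lip by (intro intf_abs_le[OF wg]) auto
  thus ?thesis using False by simp
  qed
  also have "... <= d * G" using tr(3) G by (rule mrm)
  finally show ?thesis by (simp add: v_def)
  qed
  hence "bd (d * G) v" by (simp add: bd_def)
  moreover have "Zyg s (N + abs (- 1) * N) v" unfolding v_def
  using w[OF trI(1)] w[OF trI(2)] by (intro Zyg_add Zyg_cmult) auto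
  ultimately have "low (al + ta) (e1 * (2 * N) + D * (d * G)) v" using li[of "d * G" v "2 * N"] by simp
  hence "abs (GI al (m r x) (b r x) v x) <= C * K * (e1 * (2 * N) + D * (d * G))"
  using C(2) k[OF trI(2)] by blast
  moreover have "GI al (m r x) (b r x) v x = GI al (m r x) (b r x) (w r) x + (- 1) * GI al (m r x) (b r x) (w t) x"
  unfolding v_def using k[OF trI(2)] w[OF trI(1)] w[OF trI(2)] ta
  by (intro GI_lin_g[where s = s]) (auto simp: reg_def)
  moreover have "abs (lam * v x) <= lam * (d * G)" using vb[of x] lam by (simp add: abs_mult mlm)
  ultimately have "GI al (m r x) (b r x) (w r) x - lam * w r x <= GI al (m r x) (b r x) (w t) x - lam * w t x
  + (C * K * (e1 * (2 * N) + D * (d * G)) + lam * (d * G))"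
  unfolding v_def by (simp add: alg)
  also have "C * K * (e1 * (2 * N) + D * (d * G)) + lam * (d * G) = (C * K * 2 * N) * e1 + X * d"
  by (simp add: X_def alg)
  also have "(C * K * 2 * N) * e1 + X * d <= e / 2 + e / 2"
  proof (rule add_mono)
  have "(C * K * 2 * N) * e1 <= (C * K * 2 * N + 1) * e1" using e1 by (intro mrm) auto
  also have "... = e / 4" using CKN by (simp add: e1_def field_simps)
  finally show "(C * K * 2 * N) * e1 <= e / 2" using e by simp
  have "X * d <= (X + 1) * d" using d by (intro mrm) auto
  also have "... = e / 2" using X by (simp add: d_def field_simps)
  finally show "X * d <= e / 2" .
  qed
  finally show "GI al (m r x) (b r x) (w r) x - lam * w r x + F <= GI al (m r x) (b r x) (w t) x - lam * w t x + F + e"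
  by simp
  qed
 qed
 show "EX et>0. ALL t:{t0..T}. ALL r:{t0..T}. ALL x. (ALL y. w t y <= w t x + et) & th < w t x -->
  GI al (m r x) (b r x) (w t) x - lam * w t x + F <= e + a" if "e > 0" for e
 proof -
  have "{t0..T} \<subseteq> {0..T}" using t0 by auto
  with mx[OF that] show ?thesis by (meson subsetD)
 qed
qed

text \<open>First bound: above a nonnegative level the term \<open>- lam * w\<close> only helps and
  a near maximum makes the operator almost nonpositive, so the growth rate is at most
  \<open>F\<close>. Second bound: above the level \<open>F / lam\<close> the damping beats the
  forcing, so this level is not crossed. The second bound is what keeps the estimates in time
  independent of \<open>lam\<close>.\<close>

lemma generator_sup_bound:
 fixes w :: "real => real^'d => real"
 assumes ta: "good_tau al ta" "al + ta < s" and t0: "0 <= t0" "t0 <= T" and lam: "0 <= lam" and F: "0 <= F"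
  and k: "!!t x. t \<in> {0..T} ==> kern al K (m t x) & norm (b t x) <= K & (ALL y. y ~= 0 --> 0 <= m t x y)"
  and w: "!!t. t \<in> {0..T} ==> bd N (w t) & Zyg s N (w t)"
  and wg: "intf T g w"
  and lip: "!!r x. r \<in> {0..T} ==> abs (g r x) <= G"
  and gen: "!!r x. r \<in> {0..T} ==> g r x <= GI al (m r x) (b r x) (w r) x - lam * w r x + F"
 shows "0 <= th ==> (!!x. w t0 x <= th) ==> t \<in> {t0..T} ==> w t x <= th + F * (t - t0)"
  and "t \<in> {0..T} ==> lam * w t x <= F"
proof -
 have K: "0 <= K" using k[of t0 0] t0 norm_ge_zero order_trans by (metis atLeastAtMost_iff)
 have N: "0 <= N" using w[of t0] t0 Zyg_nonneg[of s N "w t0"] by auto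
 have nm: "EX et>0. ALL t:{0..T}. ALL r:{0..T}. ALL x. (ALL y. w t y <= w t x + et) --> GI al (m r x) (b r x) (w t) x <= e" if e: "e > 0" for e
 proof -
  \<comment> \<open>The constants are raised by one because \<open>near_max\<close> asks for
    positive ones. The set \<open>S\<close> will be empty: for a sup bound no jump has to be
    kept.\<close>
  obtain et where et: "et > 0" and H: "!!k (g::real^'d => real) x v S. kern al (K + 1) k & (ALL y. y ~= 0 --> 0 <= k y) & bd (N + 1) g & Zyg s (N + 1) g
  & (ALL y. g (x + y) <= g x + et) & norm v <= K + 1 & S \<in> sets borel & (ALL y:S. 1 <= norm y) ==>
  KI al k g x + (if 1 <= al then v \<bullet> grad g x else 0)
  <= e + (LINT y:S|lborel. (g (x + y) - g x) * k y / pk al y)"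
  proof -
  have "0 < K + 1" "0 < N + 1" using K N by auto
  from near_max[OF ta(1) less_imp_le[OF ta(2)] this e zero_less_one, where 'd = 'd] show ?thesis
  using that by meson
  qed
  have "GI al (m r x) (b r x) (w t) x <= e" if "t \<in> {0..T}" "r \<in> {0..T}" "ALL y. w t y <= w t x + et" for t r x
  proof -
  have "kern al (K + 1) (m r x)" using k[OF that(2), of x] by (auto simp: kern_def intro: order_trans)
  moreover have "norm (b r x) <= K + 1" using k[OF that(2), of x] by auto
  moreover have "bd (N + 1) (w t)" "Zyg s (N + 1) (w t)" using w[OF that(1)] by (auto intro: bd_mono Zyg_mono)
  ultimately show ?thesis unfolding GI_def
  using H[of "m r x" "w t" x "b r x" "{}"] k[OF that(2), of x] that(3) by (simp add: set_lebesgue_integral_def)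
  qed
  thus ?thesis using et by blast
 qed
 have k': "!!t x. t \<in> {0..T} ==> kern al K (m t x) & norm (b t x) <= K" using k by blast
 show "w t x <= th + F * (t - t0)" if th: "0 <= th" "!!x. w t0 x <= th" "t \<in> {t0..T}"
 proof -
  have "w t x <= th + max F 0 * (t - t0)"
  proof (rule generator_max_principle[OF ta t0 lam k' w wg lip gen _ th(2,3)])
  fix e :: real assume "e > 0"
  from nm[OF this] obtain et where et: "et > 0" "ALL t:{0..T}. ALL r:{0..T}. ALL x. (ALL y. w t y <= w t x + et) --> GI al (m r x) (b r x) (w t) x <= e" by blast
  show "EX et>0. ALL t:{0..T}. ALL r:{0..T}. ALL x. (ALL y. w t y <= w t x + et) & w t x > th -->
  GI al (m r x) (b r x) (w t) x - lam * w t x + F <= e + F"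
  proof (intro exI[of _ et] conjI ballI allI impI et(1))
  fix t r x assume a: "t \<in> {0..T}" "r \<in> {0..T}" "(ALL y. w t y <= w t x + et) & th < w t x"
  hence "GI al (m r x) (b r x) (w t) x <= e" using et by blast
  moreover have "0 <= lam * w t x" using a lam th by simp
  ultimately show "GI al (m r x) (b r x) (w t) x - lam * w t x + F <= e + F" by linarith
  qed
  qed auto
  thus ?thesis using F by simp
 qed
 show "lam * w t x <= F" if t: "t \<in> {0..T}"
 proof (cases "lam = 0")
  case False
  hence l: "0 < lam" using lam by simp
  have T: "0 <= T" using t0 by simp
  have "w t x <= F / lam + max 0 0 * (t - 0)"
  proof (rule generator_max_principle[OF ta order_refl T lam k' w wg lip gen _ _ t])
  fix e :: real assume "e > 0"
  from nm[OF this] obtain et where et: "et > 0" "ALL t:{0..T}. ALL r:{0..T}. ALL x. (ALL y. w t y <= w t x + et) --> GI al (m r x) (b r x) (w t) x <= e" by blast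
  show "EX et>0. ALL t:{0..T}. ALL r:{0..T}. ALL x. (ALL y. w t y <= w t x + et) & w t x > F / lam -->
  GI al (m r x) (b r x) (w t) x - lam * w t x + F <= e + 0"
  proof (intro exI[of _ et] conjI ballI allI impI et(1))
  fix t r x assume a: "t \<in> {0..T}" "r \<in> {0..T}" "(ALL y. w t y <= w t x + et) & F / lam < w t x"
  hence "GI al (m r x) (b r x) (w t) x <= e" using et by blast
  moreover have "F <= lam * w t x" using a l by (simp add: field_simps)
  ultimately show "GI al (m r x) (b r x) (w t) x - lam * w t x + F <= e + 0" by linarith
  qed
  next
  show "w 0 x <= F / lam" for x using intf_0[OF wg T] F l by simp
  qed auto
  thus ?thesis using l by (simp add: field_simps)
 qed (use F in simp)
qed

section \<open>The a priori estimate\<close>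

text \<open>The regularity class is expressed by sup bounds and third differences with one constant
  for all times; \<open>solution_iff_csol\<close> identifies it, for measurable functions, with that
  of \<open>is_solution\<close>.\<close>

definition csol :: "real => real => real => (real => real^'d => real^'d => real) => (real => real^'d => real^'d)
  => (real => (real^'d => real) => real^'d => real) => real => (real => real^'d => real) => (real => real^'d => real) => bool" where
 "csol T al s m b B lam f u \<longleftrightarrow> intf T (%t x. Lop al m b B t (u t) x - lam * u t x + f t x) u &
  (EX N. ALL t:{0..T}. bd N (u t) & Zyg s N (u t))"

lemma csol_mono: "csol T al s m b B lam f u ==> T' <= T ==> csol T' al s m b B lam f u"
 unfolding csol_def using intf_mono by fastforce

lemma hol_nonneg: "hol be F f ==> 0 <= F"
 using bd_nonneg unfolding hol_def by blast

lemma Zyg_limit: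
 assumes "!!e. e > 0 ==> Zyg s (N + e) u" "0 <= N" shows "Zyg s N u"
 unfolding Zyg_def
proof (intro conjI allI)
 fix h x
 show "norm (df3 h u x) <= N * h pw s"
 proof (cases "norm h = 0")
  case True
  thus ?thesis using ZygD[OF assms(1)[of 1], of h x] by simp
 next
  case False
  hence h: "0 < h pw s" by simp
  have "norm (df3 h u x) / h pw s <= N + e" if "e > 0" for e
  using ZygD[OF assms(1)[OF that], of h x] h by (simp add: field_simps)
  hence "norm (df3 h u x) / h pw s <= N" by (rule field_le_epsilon)
  thus ?thesis using h by (simp add: field_simps)
 qed
qed (rule assms)

text \<open>Commuting a third difference with the full operator costs lower-order norms
  \<open>Q\<close> with arbitrary constants and the top-order norm \<open>N\<close> with the small
  factor \<open>2 * e\<close>, which stems from the lower-order part of the operator. The former are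
  handled by interpolation, the latter by the choice of \<open>e\<close>.\<close>

lemma Lop_remainder:
 assumes par: "pars al be ta" and K: "0 < K" and E: "!!e. 0 <= E e"
 shows "EX C>0. ALL T de r0 m b B t (u::real^'d => real) N Q h x e.
  opc T al be ta K de r0 E m b B & t \<in> {0..T} & bd N u & Zyg (al + be) N u & low (al + be - ta) Q u & 0 < e -->
  abs (Lop al m b B t u x) <= (C + E 1) * Q & abs (B t u x) <= E 1 * Q &
  (norm h <= 1 --> abs (df3 h (Lop al m b B t u) x - GI al (m t x) (b t x) (df3 h u) x)
  <= (2 * e * N + (2 * E e + C) * Q) * h pw be) &
  (norm h <= 1 --> abs (df2 h (Lop al m b B t u) x) <= (C * N + (C + E 1) * Q + N) * h pw be)"
proof -
 show ?thesis
 proof (insert GI_estimates[OF par, where 'd = 'd], elim exE conjE, goal_cases)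
 case (1 C)
 note C = 1(1) and est = 1(2)[rule_format]
 show ?thesis
 proof (rule exI[of _ "C * K"], rule conjI, use C K in simp, intro allI impI)
  fix T de r0 :: real and m and b :: "real => real^'d => real^'d" and B t and u :: "real^'d => real" and N Q :: real and h x and e :: real
  assume a: "opc T al be ta K de r0 E m b B & t \<in> {0..T} & bd N u & Zyg (al + be) N u & low (al + be - ta) Q u & 0 < e"
  hence t: "t \<in> {0..T}" and kf: "kfam al be K (m t) (b t)" and lo: "lowop T (al + be) (al + be - ta) be E B"
  and u: "bd N u" "Zyg (al + be) N u" "low (al + be - ta) Q u" and e: "0 < e" by (auto simp: opc_def)
  have r: "reg (al + be) u" using u by (auto simp: reg_def)
  have Q: "0 <= Q" "0 <= N" using u low_nonneg bd_nonneg by blast+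
  note est = est[OF conjI[OF kf conjI[OF r u(3)]]]
  have B0: "abs (B t u x) <= E 1 * Q" for x using lo t r u unfolding lowop_def by blast
  have B2: "abs (df2 h (B t u) x) <= (e * N + E e * Q) * h pw be" if "norm h <= 1" "0 < e" for e x
  using lo t that u unfolding lowop_def by blast
  have L: "Lop al m b B t u = (%x. GI al (m t x) (b t x) u x + B t u x)" by (rule ext) (simp add: Lop_def)
  have 1: "abs (Lop al m b B t u x) <= (C * K + E 1) * Q"
  using conjunct1[OF est[of x]] B0[of x] unfolding L distrib_right by linarith
  have 2: "abs (df3 h (Lop al m b B t u) x - GI al (m t x) (b t x) (df3 h u) x)
  <= (2 * e * N + (2 * E e + C * K) * Q) * h pw be" if h: "norm h <= 1"
  proof -
  have "abs (df3 h (B t u) x) <= 2 * ((e * N + E e * Q) * h pw be)"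
  using B2[OF h e, of x] B2[OF h e, of "x + h"] unfolding df_def[of h "df2 h (B t u)"] by linarith
  moreover have "df3 h (Lop al m b B t u) x - GI al (m t x) (b t x) (df3 h u) x
  = (df3 h (%x. GI al (m t x) (b t x) u x) x - GI al (m t x) (b t x) (df3 h u) x) + df3 h (B t u) x"
  unfolding L df_add by simp
  moreover have "abs (df3 h (%x. GI al (m t x) (b t x) u x) x - GI al (m t x) (b t x) (df3 h u) x) <= C * K * Q * h pw be"
  using est by blast
  ultimately have "abs (df3 h (Lop al m b B t u) x - GI al (m t x) (b t x) (df3 h u) x)
  <= C * K * Q * h pw be + 2 * ((e * N + E e * Q) * h pw be)" by linarith
  also have "... = (2 * e * N + (2 * E e + C * K) * Q) * h pw be" by (simp add: alg)
  finally show ?thesis .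
  qed
  have 3: "abs (df2 h (Lop al m b B t u) x) <= (C * K * N + (C * K + E 1) * Q + N) * h pw be" if h: "norm h <= 1"
  proof -
  have "df2 h (Lop al m b B t u) x = (df2 h (%x. GI al (m t x) (b t x) u x) x - GI al (m t x) (b t x) (df2 h u) x)
  + GI al (m t x) (b t x) (df2 h u) x + df2 h (B t u) x"
  unfolding L df_add by simp
  moreover have "abs (GI al (m t x) (b t x) (df2 h u) x) <= C * K * N * h pw be"
  using est h u by blast
  moreover have "abs (df2 h (%x. GI al (m t x) (b t x) u x) x - GI al (m t x) (b t x) (df2 h u) x) <= C * K * Q * h pw be"
  using est by blast
  ultimately have "abs (df2 h (Lop al m b B t u) x) <= C * K * Q * h pw be + C * K * N * h pw be + (1 * N + E 1 * Q) * h pw be"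
  using B2[OF h zero_less_one, of x] by linarith
  also have "... = (C * K * N + (C * K + E 1) * Q + N) * h pw be" by (simp add: alg)
  finally show ?thesis .
  qed
  show "abs (Lop al m b B t u x) <= (C * K + E 1) * Q & abs (B t u x) <= E 1 * Q &
  (norm h <= 1 --> abs (df3 h (Lop al m b B t u) x - GI al (m t x) (b t x) (df3 h u) x)
  <= (2 * e * N + (2 * E e + C * K) * Q) * h pw be) &
  (norm h <= 1 --> abs (df2 h (Lop al m b B t u) x) <= (C * K * N + (C * K + E 1) * Q + N) * h pw be)"
  using 1 2 3 B0 by blast
 qed
 qed
qed

lemma low_bound:
 assumes par: "pars al be ta" and "bd N u" "Zyg (al + be) N u"
 shows "low (al + be - ta) (9 * N) u"
 using assms by (intro low_Zyg1) (auto simp: pars_def good_tau_def)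

text \<open>The linear dependence on \<open>N\<close> is the point: it bounds right-hand sides in
  the method of continuity. Steps longer than one are covered by the sup bound.\<close>

lemma Lop_hol:
 assumes par: "pars al be ta" and K: "0 < K" and E: "!!e. 0 <= E e"
 shows "EX C>0. ALL T de r0 m b B t (u::real^'d => real) N.
  opc T al be ta K de r0 E m b B & t \<in> {0..T} & bd N u & Zyg (al + be) N u --> hol be (C * N) (Lop al m b B t u)"
proof -
 show ?thesis
 proof (insert Lop_remainder[where E = E and 'd = 'd, OF par K E], elim exE conjE, goal_cases)
 case (1 C)
 note C = 1(1) and rem = 1(2)[rule_format]
 define D where "D = C + 36 * (C + E 1) + 1"
 have D: "0 < D" using C E[of 1] by (simp add: D_def)
 have be: "0 < be" using par by (simp add: pars_def)
 show ?thesis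
 proof (intro exI[of _ D] conjI D allI impI)
  fix T de r0 :: real and m and b :: "real => real^'d => real^'d" and B t and u :: "real^'d => real" and N :: real
  assume a: "opc T al be ta K de r0 E m b B & t \<in> {0..T} & bd N u & Zyg (al + be) N u"
  have N: "0 <= N" using a bd_nonneg by blast
  have CE: "0 <= C * N" "0 <= E 1 * N" using C E[of 1] N by auto
  note rem = rem[of T de r0 m b B t N u "9 * N" 1]
  have r1: "abs (Lop al m b B t u x) <= 9 * ((C + E 1) * N)" for x
  using rem[of x] a low_bound[OF par, of N u] by (auto simp: alg)
  have r2: "abs (df2 h (Lop al m b B t u) x) <= (C * N + 9 * ((C + E 1) * N) + N) * h pw be" if "norm h <= 1" for h x
  using rem[of x h] a low_bound[OF par, of N u] that by (auto simp: alg)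
  have b: "bd (9 * ((C + E 1) * N)) (Lop al m b B t u)" unfolding bd_def using r1 by simp
  show "hol be (D * N) (Lop al m b B t u)"
  unfolding hol_def
  proof (intro conjI allI)
  show "bd (D * N) (Lop al m b B t u)"
  by (rule bd_mono[OF b]) (use CE C N in \<open>simp add: D_def alg\<close>)
  fix h x
  show "abs (df2 h (Lop al m b B t u) x) <= D * N * h pw be"
  proof (cases "norm h <= 1")
  case True
  have "(C * N + 9 * ((C + E 1) * N) + N) * h pw be <= D * N * h pw be"
  using CE C N by (intro mrm) (auto simp: D_def alg)
  thus ?thesis using r2[OF True, of x] by linarith
  next
  case False
  have "abs (df2 h (Lop al m b B t u) x) <= 4 * (9 * ((C + E 1) * N))"
  using bdD[OF bd_df2[OF b]] by simp
  also have "... <= D * N * 1" using CE C N by (simp add: D_def alg)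
  also have "... <= D * N * h pw be"
  using False be D N by (intro mlm ge_one_powr_ge_zero) auto
  finally show ?thesis .
  qed
  qed
 qed
 qed
qed

text \<open>Suppose a third difference exceeds \<open>3/4 * N * |h|^s\<close>, where
  \<open>N\<close> is the current seminorm. The maximum principle is run for \<open>df3 h u\<close>
  above the level \<open>N |h|^s / 2\<close>, where \<open>cone_gain\<close> gives a loss
  \<open>ka N |h|^be\<close>. If the loss dominated the forcing, the level could not be crossed, a
  contradiction; otherwise the comparison of both reads \<open>N <= C (F + M)\<close>. Claiming only
  the factor 3/4 avoids the choice of an extremal step.\<close>

lemma schauder_improve:
 assumes par: "pars al be ta" and K: "0 < K" and de: "0 < de" and r0: "0 < r0" "r0 <= 1" and E: "!!e. 0 <= E e"
 shows "EX C>0. ALL T m b B lam f (u::real => real^'d => real) F N M.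
  0 <= T & opc T al be ta K de r0 E m b B & 0 <= lam & csol T al (al + be) m b B lam f u &
  (ALL t:{0..T}. hol be F (f t) & bd M (u t) & Zyg (al + be) N (u t)) -->
  (ALL t:{0..T}. Zyg (al + be) (max (3/4 * N) (C * (F + M))) (u t))"
proof -
 define s where "s = al + be"
 define p where "p = al + be - ta"
 have ta: "good_tau al ta" and be: "0 < be" "be <= 1" "4 * ta <= be" using par by (auto simp: pars_def)
 have t: "0 < ta" "0 < al" "al < 2" using ta by (auto simp: good_tau_def)
 have s: "0 < s" "s < 3" "al + ta < s" "0 < p" "p < s" using t be by (auto simp: s_def p_def)
 show ?thesis
 proof (insert Lop_remainder[where E = E and 'd = 'd, OF par K E], elim exE conjE, goal_cases)
 case (1 C)
 note C = 1(1) and rem = 1(2)[rule_format]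
 show ?thesis
 proof (insert cone_gain[OF s(1,2) t(2) de r0 K, where 'd = 'd], elim exE conjE, goal_cases)
 case (1 n ka C3)
 note npos = 1(1) and ka = 1(2-3) and cone0 = 1(4)
 note cone = cone0[THEN spec, THEN spec, THEN spec, THEN spec, THEN spec, THEN spec, THEN spec, THEN spec, THEN mp]
 \<comment> \<open>The forcing contains \<open>N\<close> in the terms \<open>2 * e0 * N\<close> and
   \<open>(2 * E e0 + C) * e1 * N\<close>. With these values each is \<open>ka / 4 * N\<close>,
   together half of the gain.\<close>
 define e0 where "e0 = ka / 8"
 define e1 where "e1 = ka / (4 * (2 * E e0 + C))"
 have EC: "0 < 2 * E e0 + C" using E[of e0] C by linarith
 have e01: "0 < e0" "0 < e1" using ka EC by (auto simp: e0_def e1_def)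
 obtain D where D: "0 < D" and li: "!!(u::real^'d => real) M N. bd M u & Zyg s N u ==> low p (e1 * N + D * M) u"
  using low_interp_eps[OF s(4,5) e01(2)] by meson
 define A where "A = 8 + 4 / ka * (2 + ka + (2 * E e0 + C) * D)"
 have A: "8 <= A" using ka EC D by (simp add: A_def)
 show ?thesis
 proof (intro exI[of _ A] conjI allI impI ballI)
  show "0 < A" using A by simp
  fix T lam F N M :: real and m and b :: "real => real^'d => real^'d" and B f and u :: "real => real^'d => real" and t1
  assume a: "0 <= T & opc T al be ta K de r0 E m b B & 0 <= lam & csol T al (al + be) m b B lam f u &
  (ALL t:{0..T}. hol be F (f t) & bd M (u t) & Zyg (al + be) N (u t))" and t1: "t1 \<in> {0..T}"
  hence T: "0 <= T" and op: "opc T al be ta K de r0 E m b B" and lam: "0 <= lam"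
  and sol: "intf T (%t x. Lop al m b B t (u t) x - lam * u t x + f t x) u"
  and f: "!!t. t \<in> {0..T} ==> hol be F (f t)" and u: "!!t. t \<in> {0..T} ==> bd M (u t) & Zyg s N (u t)"
  by (auto simp: csol_def s_def)
  have kf: "kfam al be K (m t) (b t)" "elliptic de r0 (m t)" if "t \<in> {0..T}" for t
  using op that by (auto simp: opc_def)
  have F: "0 <= F" using f[OF t1] hol_nonneg by blast
  have M: "0 <= M" and N: "0 <= N" using u[OF t1] bd_nonneg Zyg_nonneg by blast+
  define N' where "N' = max (3/4 * N) (A * (F + M))"
  have N': "0 <= N'" "3/4 * N <= N'" "A * (F + M) <= N'" using N by (auto simp: N'_def)
  have AFM: "8 * M <= A * (F + M)"
  using mult_mono[of 8 A M "F + M"] A F M by simp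
  have uN: "bd (N + M) (u t)" "Zyg s (N + M) (u t)" if "t \<in> {0..T}" for t
  using u[OF that] N M by (auto intro: bd_mono Zyg_mono)
  define Q where "Q = e1 * N + D * M"
  have Q: "0 <= Q" using e01 D N M by (simp add: Q_def)
  have lowu: "low p Q (u t)" if "t \<in> {0..T}" for t unfolding Q_def using li u[OF that] by blast
  have key: "df3 h (u t1) x1 <= N' * h pw s" for h x1
  proof (rule ccontr)
  assume neg: "~ df3 h (u t1) x1 <= N' * h pw s"
  have h0: "h ~= 0" using neg by auto
  hence hs: "0 < h pw s" by simp
  have up: "df3 h (u t1) x1 <= N * h pw s" using ZygD[of s N "u t1" h x1] u[OF t1] by simp
  have NN: "N' < N"
  proof -
  have "N' * h pw s < N * h pw s" using neg up by linarith
  thus ?thesis using hs by simp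
  qed
  hence Npos: "0 < N" using N' by linarith
  \<comment> \<open>Long steps are covered by the trivial bound \<open>8 * M\<close>, which is why
    \<open>A\<close> is at least 8.\<close>
  have h1: "norm h <= 1"
  proof (rule ccontr)
  assume "~ norm h <= 1"
  hence "1 <= h pw s" using s by (intro ge_one_powr_ge_zero) auto
  hence "N' * 1 <= N' * h pw s" using N' by (intro mlm) auto
  moreover have "df3 h (u t1) x1 <= 8 * M" using bdD[OF bd_df3[of M "u t1"], of h h h x1] u[OF t1] by simp
  ultimately show False using neg N' AFM by linarith
  qed
  define w where "w t = df3 h (u t)" for t
  have w: "bd (8 * M) (w t)" "Zyg s (8 * N) (w t)" if "t \<in> {0..T}" for t
  unfolding w_def using u[OF that] by (auto intro: bd_df3 Zyg_df3)
  define g where "g t = df3 h (%x. Lop al m b B t (u t) x - lam * u t x + f t x)" for t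
  have wg: "intf T g w" unfolding g_def w_def by (intro intf_df sol)
  define Fh where "Fh = (2 * F + 2 * e0 * (N + M) + (2 * E e0 + C) * Q) * h pw be"
  \<comment> \<open>Half of \<open>N |h|^s\<close> lies below the claimed 3/4 and is still the lower
    bound that \<open>cone_gain\<close> asks for.\<close>
  define th where "th = 1/2 * N * h pw s"
  define a where "a = Fh - ka * N * h pw be"
  have gsplit: "g t x = df3 h (Lop al m b B t (u t)) x - lam * w t x + df3 h (f t) x" for t x
  unfolding g_def w_def df_add df_diff df_cmult by simp
  have f3: "abs (df3 h (f t) x) <= 2 * (F * h pw be)" if "t \<in> {0..T}" for t x
  proof -
  have "abs (df2 h (f t) x) <= F * h pw be" for x using f[OF that] by (simp add: hol_def)
  from this[of x] this[of "x + h"] show ?thesis unfolding df_def[of h "df2 h (f t)"] by linarith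
  qed
  have remt: "abs (df3 h (Lop al m b B t (u t)) x - GI al (m t x) (b t x) (w t) x)
  <= (2 * e0 * (N + M) + (2 * E e0 + C) * Q) * h pw be" and
  remL: "abs (Lop al m b B t (u t) x) <= (C + E 1) * Q" if "t \<in> {0..T}" for t x
  using rem[of T de r0 m b B t "N + M" "u t" Q e0 x h] op that uN[OF that] lowu[OF that] e01 h1 unfolding s_def p_def w_def by blast+
  have gen: "g t x <= GI al (m t x) (b t x) (w t) x - lam * w t x + Fh" if "t \<in> {0..T}" for t x
  proof -
  have "Fh = 2 * (F * h pw be) + (2 * e0 * (N + M) + (2 * E e0 + C) * Q) * h pw be"
  by (simp add: Fh_def alg)
  thus ?thesis using gsplit[of t x] f3[OF that, of x] remt[OF that, of x] by linarith
  qed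
  have lip: "abs (g t x) <= 8 * ((C + E 1) * Q) + lam * (8 * M) + 2 * (F * h pw be)" if "t \<in> {0..T}" for t x
  proof -
  have "bd ((C + E 1) * Q) (Lop al m b B t (u t))" unfolding bd_def using remL[OF that] by simp
  hence "abs (df3 h (Lop al m b B t (u t)) x) <= 8 * ((C + E 1) * Q)"
  using bdD[OF bd_df3] by fastforce
  moreover have "abs (lam * w t x) <= lam * (8 * M)"
  using bdD[OF w(1)[OF that], of x] lam by (simp add: abs_mult mlm)
  ultimately show ?thesis using gsplit[of t x] f3[OF that, of x] by linarith
  qed
  have aa: "0 < a"
  proof (rule ccontr)
  assume "~ 0 < a"
  hence a0: "max a 0 = 0" by simp
  have "w t1 x1 <= th + max a 0 * (t1 - 0)"
  proof (rule generator_max_principle[OF ta s(3) order_refl T lam _ _ wg lip gen _ _ t1])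
  show "kern al K (m t x) & norm (b t x) <= K" if "t \<in> {0..T}" for t x using kfam_kern(1,2)[OF kf(1)[OF that]] by blast
  show "bd (8 * (N + M)) (w t) & Zyg s (8 * (N + M)) (w t)" if "t \<in> {0..T}" for t
  using w[OF that] N M by (auto intro: bd_mono Zyg_mono)
  show "w 0 x <= th" for x using intf_0[OF wg T] N by (simp add: th_def)
  fix e :: real assume e: "e > 0"
  have "0 < 8 * (N + M)" using Npos M by simp
  from near_max[OF ta less_imp_le[OF s(3)] K this half_gt_zero[OF e], of "norm h", where 'd = 'd] h0
  obtain et where et: "et > 0" and H: "!!k (g::real^'d => real) x v S. kern al K k & (ALL y. y ~= 0 --> 0 <= k y) & bd (8 * (N + M)) g & Zyg s (8 * (N + M)) g
  & (ALL y. g (x + y) <= g x + et) & norm v <= K & S \<in> sets borel & (ALL y:S. norm h <= norm y) ==>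
  KI al k g x + (if 1 <= al then v \<bullet> grad g x else 0)
  <= e / 2 + (LINT y:S|lborel. (g (x + y) - g x) * k y / pk al y)"
  by auto
  \<comment> \<open>The tolerance may depend on \<open>h\<close>, since the principle is run for one
    fixed step; its cost in \<open>cone_gain\<close> grows like \<open>|h|^(-al)\<close>.\<close>
  define et' where "et' = min et (e / (2 * C3 * h pw (- al)))"
  have cp: "0 < C3 * h pw (- al)" using ka h0 by simp
  hence "0 < e / (2 * C3 * h pw (- al))" using e by (simp add: mult.assoc)
  hence et': "0 < et'" "et' <= et" using et by (auto simp: et'_def)
  have "C3 * h pw (- al) * et' <= C3 * h pw (- al) * (e / (2 * C3 * h pw (- al)))"
  using cp by (intro mlm) (auto simp: et'_def)
  also have "... = e / 2" using ka h0 by (simp add: field_simps)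
  finally have et'': "C3 * et' * h pw (- al) <= e / 2" by (simp add: ac_simps)
  show "EX et>0. ALL t:{0..T}. ALL r:{0..T}. ALL x. (ALL y. w t y <= w t x + et) & th < w t x -->
  GI al (m r x) (b r x) (w t) x - lam * w t x + Fh <= e + a"
  proof (intro exI[of _ et'] conjI et'(1) ballI allI impI)
  fix t r x assume t: "t \<in> {0..T}" and r: "r \<in> {0..T}" and ass: "(ALL y. w t y <= w t x + et') & th < w t x"
  obtain v where v: "norm v = 1" "!!y. y ~= 0 ==> norm (y /\<^sub>R norm y - v) <= r0 ==> de <= m r x y"
  using kf(2)[OF r] unfolding elliptic_def by blast
  have pos: "!!y. y ~= 0 ==> 0 <= m r x y" using kf(2)[OF r] unfolding elliptic_def by blast
  have um: "u t \<in> bm borel"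
  using Zyg_continuous[of M "u t" s N] u[OF t] s(1) by (intro borel_measurable_continuous_onI) auto
  have "EX S:sets borel. (ALL y:S. norm h < norm y) &
  (LINT y:S|lborel. (w t (x + y) - w t x) * m r x y / pk al y)
  <= - ka * N * h pw (s - al) + C3 * et' * h pw (- al)"
  unfolding w_def
  proof (rule cone[of N h M "u t" x et' v "m r x"], intro conjI allI impI)
  show "abs (df3 (real n *. h) (u t) z) <= N * norm (real n *. h) powr s" for z
  using ZygD[of s N "u t" "real n *. h" z] u[OF t] by simp
  show "1/2 * N * h pw s <= df3 h (u t) x" using ass by (simp add: w_def th_def)
  show "df3 h (u t) (x + y) <= df3 h (u t) x + et'" for y using ass by (simp add: w_def)
  qed (use Npos h0 u[OF t] um npos et' v pos kfam_kern(1)[OF kf(1)[OF r]] in auto)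
  then obtain S where S: "S \<in> sets borel" "ALL y:S. norm h < norm y"
  "(LINT y:S|lborel. (w t (x + y) - w t x) * m r x y / pk al y)
  <= - ka * N * h pw (s - al) + C3 * et' * h pw (- al)" by blast
  have "bd (8 * (N + M)) (w t)" "Zyg s (8 * (N + M)) (w t)" using w[OF t] N M by (auto intro: bd_mono Zyg_mono)
  moreover have "ALL y. w t (x + y) <= w t x + et" using ass et'(2) by (meson add_left_mono order_trans)
  ultimately have "KI al (m r x) (w t) x + (if 1 <= al then b r x \<bullet> grad (w t) x else 0)
  <= e / 2 + (LINT y:S|lborel. (w t (x + y) - w t x) * m r x y / pk al y)"
  using S kfam_kern(1,2)[OF kf(1)[OF r]] pos by (intro H) (auto intro: less_imp_le)
  hence "GI al (m r x) (b r x) (w t) x <= e + (- ka * N * h pw (s - al))"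
  unfolding GI_def using S(3) et'' by linarith
  moreover have "s - al = be" by (simp add: s_def)
  moreover have "0 <= th" using N by (simp add: th_def)
  hence "0 <= lam * w t x" using lam ass by simp
  ultimately show "GI al (m r x) (b r x) (w t) x - lam * w t x + Fh <= e + a" unfolding a_def by simp
  qed
  qed auto
  hence "df3 h (u t1) x1 <= 1/2 * N * h pw s" unfolding a0 by (simp add: w_def th_def)
  moreover have "1/2 * N * h pw s <= N' * h pw s" using N' N by (intro mrm) auto
  ultimately show False using neg by linarith
  qed
  have hb: "0 < h pw be" using h0 by simp
  have "ka * N * h pw be < (2 * F + 2 * e0 * (N + M) + (2 * E e0 + C) * Q) * h pw be"
  using aa by (simp add: a_def Fh_def)
  hence "ka * N < 2 * F + 2 * e0 * (N + M) + (2 * E e0 + C) * Q" using hb by simp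
  moreover have "(2 * E e0 + C) * Q = ka / 4 * N + (2 * E e0 + C) * D * M"
  unfolding Q_def e1_def using EC by (simp add: field_simps)
  moreover have "2 * e0 * (N + M) = ka / 4 * N + ka / 4 * M" by (simp add: e0_def alg)
  ultimately have "ka / 2 * N <= 2 * F + ka / 4 * M + (2 * E e0 + C) * D * M" by linarith
  also have "... <= (2 + ka + (2 * E e0 + C) * D) * (F + M)"
  proof -
  have "0 <= ka * F" "0 <= (2 * E e0 + C) * D * F" "0 <= ka * M" "0 <= F" "0 <= M" using ka EC D F M by auto
  thus ?thesis by (simp add: alg)
  qed
  finally have "ka * N <= 2 * ((2 + ka + (2 * E e0 + C) * D) * (F + M))" by simp
  hence "N <= 2 / ka * (2 + ka + (2 * E e0 + C) * D) * (F + M)" using ka by (simp add: field_simps)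
  also have "... <= A * (F + M)"
  proof (rule mrm)
  define X where "X = 2 + ka + (2 * E e0 + C) * D"
  have "0 <= X / ka" using ka EC D by (simp add: X_def)
  thus "2 / ka * (2 + ka + (2 * E e0 + C) * D) <= A"
  unfolding A_def X_def[symmetric] by simp
  qed (use F M in simp)
  finally show False using NN N' by linarith
  qed
  have "abs (df3 h (u t1) x) <= N' * h pw s" for h x
  proof -
  have "df3 h (u t1) x = - df3 (- h) (u t1) (x + 3 *. h)"
  proof -
  have 3: "3 *. h = h + h + h" using scaleR_left_distrib[of 2 1 h] scaleR_left_distrib[of 1 1 h] by simp
  show ?thesis unfolding 3 by (simp add: df_def alg)
  qed
  thus ?thesis using key[of h x] key[of "- h" "x + 3 *. h"] by simp
  qed
  thus "Zyg (al + be) (max (3/4 * N) (A * (F + M))) (u t1)"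
  using N' unfolding Zyg_def N'_def s_def by simp
 qed
 qed
 qed
qed

lemma df3_reverse: "df3 h u x = - df3 (- h) u (x + h + h + h)"
 by (simp add: df_def alg)

text \<open>The improvement is iterated from the finite but uncontrolled seminorm contained in
  \<open>csol\<close>; the powers of 3/4 remove it in the limit.\<close>

lemma schauder:
 assumes par: "pars al be ta" and K: "0 < K" and de: "0 < de" and r0: "0 < r0" "r0 <= 1" and E: "!!e. 0 <= E e"
 shows "EX C>0. ALL T m b B lam f (u::real => real^'d => real) F M.
  0 <= T & opc T al be ta K de r0 E m b B & 0 <= lam & csol T al (al + be) m b B lam f u &
  (ALL t:{0..T}. hol be F (f t) & bd M (u t)) --> (ALL t:{0..T}. Zyg (al + be) (C * (F + M)) (u t))"
proof -
 show ?thesis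
 proof (insert schauder_improve[where E = E and 'd = 'd, OF par K de r0 E], elim exE conjE, goal_cases)
 case (1 C)
 note C = 1(1) and imp = 1(2)[rule_format]
 show ?thesis
 proof (intro exI[of _ C] conjI C allI impI ballI)
  fix T lam F M :: real and m and b :: "real => real^'d => real^'d" and B f and u :: "real => real^'d => real" and t
  assume a: "0 <= T & opc T al be ta K de r0 E m b B & 0 <= lam & csol T al (al + be) m b B lam f u &
  (ALL t:{0..T}. hol be F (f t) & bd M (u t))" and t: "t \<in> {0..T}"
  then obtain N where N: "ALL t:{0..T}. Zyg (al + be) N (u t)" unfolding csol_def by blast
  hence N0: "0 <= N" using t Zyg_nonneg by blast
  have CFM: "0 <= C * (F + M)" using a t C bd_nonneg[of M "u t"] hol_nonneg[of be F "f t"] by simp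
  have "ALL t:{0..T}. Zyg (al + be) (max ((3/4) ^ k * N) (C * (F + M))) (u t)" for k
  proof (induction k)
  case 0
  thus ?case using N Zyg_mono by fastforce
  next
  case (Suc k)
  have "ALL t:{0..T}. Zyg (al + be) (max (3/4 * max ((3/4) ^ k * N) (C * (F + M))) (C * (F + M))) (u t)"
  by (rule ballI, rule imp[of T m b B lam f u F M]) (use a Suc in auto)
  moreover have "max (3/4 * max ((3/4) ^ k * N) (C * (F + M))) (C * (F + M)) = max ((3/4) ^ Suc k * N) (C * (F + M))"
  using CFM by (auto simp: max_def)
  ultimately show ?case by simp
  qed
  note it = this
  show "Zyg (al + be) (C * (F + M)) (u t)"
  proof (rule Zyg_limit[OF _ CFM])
  fix e :: real assume e: "e > 0"
  have "(%k. (3/4) ^ k * N) ~~> 0 * N" by (intro tendsto_intros LIMSEQ_realpow_zero) auto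
  hence "eventually (%k. (3/4) ^ k * N < e) sequentially" using e by (intro order_tendstoD(2)[where y = "0 * N"]) auto
  then obtain k where "(3/4) ^ k * N < e" by (auto simp: eventually_sequentially)
  hence "max ((3/4) ^ k * N) (C * (F + M)) <= C * (F + M) + e" using e CFM by simp
  thus "Zyg (al + be) (C * (F + M) + e) (u t)" by (rule Zyg_mono[OF bspec[OF it[of k] t]])
  qed
 qed
 qed
qed

lemma GI_minus:
 fixes u :: "real^'d => real"
 assumes "good_tau al ta" "al + ta <= s" "kern al K k" "reg s u"
 shows "GI al k w (%x. - u x) x = - GI al k w u x"
 using GI_lin_g[OF assms assms(4), of w "-2" x] by simp

text \<open>The lower-order part has no sign, so it counts as a forcing of size
  \<open>E 1 * Q\<close>, and the maximum principle for the principal part alone is applied to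
  \<open>u\<close> and to \<open>- u\<close>.\<close>

lemma sup_bounds:
 assumes par: "pars al be ta" and K: "0 < K" and E: "!!e. 0 <= E e"
  and op: "opc T al be ta K de r0 E m b B" and lam: "0 <= lam"
  and sol: "csol T al (al + be) m b B lam f (u::real => real^'d => real)"
  and u: "!!t. t \<in> {0..T} ==> hol be F (f t) & low (al + be - ta) Q (u t)"
  and t0: "0 <= t0" "t0 <= T"
 shows "bd D (u t0) ==> t \<in> {t0..T} ==> abs (u t x) <= D + (F + E 1 * Q) * (t - t0)"
  and "t \<in> {0..T} ==> lam * abs (u t x) <= F + E 1 * Q"
proof -
 have ta: "good_tau al ta" "al + ta < al + be" using par by (auto simp: pars_def good_tau_def)
 have kf: "kfam al be K (m t) (b t)" "elliptic de r0 (m t)" if "t \<in> {0..T}" for t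
  using op that by (auto simp: opc_def)
 have t0I: "t0 \<in> {0..T}" using t0 by simp
 have F: "0 <= F" using u[OF t0I] hol_nonneg by blast
 have Q: "0 <= Q" using u[OF t0I] low_nonneg by blast
 define g where "g t x = Lop al m b B t (u t) x - lam * u t x + f t x" for t x
 have ug: "intf T g u" using sol unfolding csol_def g_def by simp
 obtain N where N: "!!t. t \<in> {0..T} ==> bd N (u t) & Zyg (al + be) N (u t)" using sol unfolding csol_def by blast
 have reg: "reg (al + be) (u t)" if "t \<in> {0..T}" for t using N[OF that] by (auto simp: reg_def)
 obtain C where rem: "!!T de r0 m b B t (u::real^'d => real) N Q h x (e::real).
  opc T al be ta K de r0 E m b B & t \<in> {0..T} & bd N u & Zyg (al + be) N u & low (al + be - ta) Q u & 0 < e ==>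
  abs (Lop al m b B t u x) <= (C + E 1) * Q & abs (B t u x) <= E 1 * Q"
  using Lop_remainder[OF par K E, where 'd = 'd] by meson
 have r: "abs (Lop al m b B t (u t) x) <= (C + E 1) * Q" "abs (B t (u t) x) <= E 1 * Q" if "t \<in> {0..T}" for t x
  using rem[of T de r0 m b B t N "u t" Q 1 x] op that N[OF that] u[OF that] by auto
 have fb: "abs (f t x) <= F" if "t \<in> {0..T}" for t x using u[OF that] bdD[of F "f t" x] by (simp add: hol_def)
 have lip: "abs (g t x) <= (C + E 1) * Q + lam * N + F" if "t \<in> {0..T}" for t x
 proof -
  have "abs (lam * u t x) <= lam * N" using N[OF that] bdD[of N "u t" x] lam by (simp add: abs_mult mlm)
  thus ?thesis using r(1)[OF that, of x] fb[OF that, of x] unfolding g_def by linarith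
 qed
 have k: "kern al K (m t x) & norm (b t x) <= K & (ALL y. y ~= 0 --> 0 <= m t x y)" if "t \<in> {0..T}" for t x
  using kfam_kern(1,2)[OF kf(1)[OF that]] kf(2)[OF that] unfolding elliptic_def by blast
 have gen: "g t x <= GI al (m t x) (b t x) (u t) x - lam * u t x + (F + E 1 * Q)" if "t \<in> {0..T}" for t x
  using r(2)[OF that, of x] fb[OF that, of x] unfolding g_def Lop_def by linarith
 have gen': "- g t x <= GI al (m t x) (b t x) (%x. - u t x) x - lam * - u t x + (F + E 1 * Q)" if "t \<in> {0..T}" for t x
  using r(2)[OF that, of x] fb[OF that, of x] GI_minus[OF ta(1) less_imp_le[OF ta(2)] conjunct1[OF k[OF that, of x]] reg[OF that], of "b t x" x]
  unfolding g_def Lop_def by simp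
 have N': "bd N (%x. - u t x) & Zyg (al + be) N (%x. - u t x)" if "t \<in> {0..T}" for t
  using N[OF that] by (simp add: bd_def Zyg_def df_minus)
 have FE: "0 <= F + E 1 * Q" using F E[of 1] Q by simp
 have lip': "abs (- g t x) <= (C + E 1) * Q + lam * N + F" if "t \<in> {0..T}" for t x using lip[OF that] by simp
 note S1 = generator_sup_bound[OF ta t0 lam FE k N ug lip gen]
 note S2 = generator_sup_bound[OF ta t0 lam FE k N' intf_minus[OF ug] lip' gen']
 show "abs (u t x) <= D + (F + E 1 * Q) * (t - t0)" if D: "bd D (u t0)" and t: "t \<in> {t0..T}"
 proof -
  have D0: "0 <= D" using D bd_nonneg by blast
  have "abs (u t0 x) <= D" for x using bdD[OF D] by simp
  hence "u t0 x <= D" "- u t0 x <= D" for x by (simp_all add: abs_le_iff)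
  thus ?thesis using S1(1)[OF _ _ _ _ D0 _ t] S2(1)[OF _ _ _ _ D0 _ t] by (simp add: abs_le_iff)
 qed
 show "lam * abs (u t x) <= F + E 1 * Q" if t: "t \<in> {0..T}"
  using S1(2)[OF _ _ _ _ t, of x] S2(2)[OF _ _ _ _ t, of x] by (auto simp: abs_if)
qed

text \<open>On a time interval of length \<open>\<Delta>\<close> the sup bound grows by at most
  \<open>C2 * (F + M) * \<Delta>\<close>, where \<open>M\<close> is the supremum of
  \<open>|u|\<close> itself, because the Schauder bound feeds the lower-order part. With
  \<open>\<Delta> = 1 / (2 * C2)\<close> the term in \<open>M\<close> is absorbed. The number of
  intervals depends on \<open>T\<close> and the constants, but not on \<open>lam\<close>.\<close>

lemma sup_estimate:
 assumes par: "pars al be ta" and K: "0 < K" and de: "0 < de" and r0: "0 < r0" "r0 <= 1" and E: "!!e. 0 <= E e" and T: "0 < T"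
 shows "EX C>0. ALL m b B lam f (u::real => real^'d => real) F.
  opc T al be ta K de r0 E m b B & 0 <= lam & csol T al (al + be) m b B lam f u &
  (ALL t:{0..T}. hol be F (f t)) --> (ALL t:{0..T}. bd (C * F) (u t) & Zyg (al + be) (C * F) (u t))"
proof -
 show ?thesis
 proof (insert schauder[where E = E and 'd = 'd, OF par K de r0 E], elim exE conjE, goal_cases)
 case (1 C)
 note C = 1(1) and sch = 1(2)[rule_format]
 \<comment> \<open>Forcing \<open>F\<close> plus lower-order part \<open>E 1 * Q\<close>, with
   \<open>Q = 9 * ((C + 1) * (F + M))\<close>, is at most \<open>C2 * (F + M)\<close>.\<close>
 define C2 where "C2 = 1 + E 1 * (9 * (C + 1))"
 have C2: "0 < C2" using C E[of 1] by (simp add: C2_def add_pos_nonneg)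
 define \<Delta> where "\<Delta> = 1 / (2 * C2)"
 have \<Delta>: "0 < \<Delta>" using C2 by (simp add: \<Delta>_def)
 obtain n :: nat where n: "T / \<Delta> <= real n" using real_arch_simple by blast
 define X where "X = (2::real) ^ n"
 have X: "1 <= X" by (simp add: X_def)
 show ?thesis
 proof (intro exI[of _ "X + C * (1 + X)"] conjI allI impI ballI)
  show XX: "0 < X + C * (1 + X)" using C X by (intro add_pos_pos mult_pos_pos) auto
  fix lam F :: real and m and b :: "real => real^'d => real^'d" and B f and u :: "real => real^'d => real" and t
  assume a: "opc T al be ta K de r0 E m b B & 0 <= lam & csol T al (al + be) m b B lam f u &
  (ALL t:{0..T}. hol be F (f t))" and t: "t \<in> {0..T}"
  obtain N where N: "!!t. t \<in> {0..T} ==> bd N (u t) & Zyg (al + be) N (u t)" using a unfolding csol_def by blast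
  have F: "0 <= F" using a t hol_nonneg by blast
  have grow: "abs (u t x) <= D + C2 * (F + M) * (t - t')"
  if tt: "0 <= t'" "t' <= t''" "t'' <= T" and D: "bd D (u t')" and M: "!!t. t \<in> {0..t''} ==> bd M (u t)" and t: "t \<in> {t'..t''}"
  for t' t'' t D M x
  proof -
  have op: "opc t'' al be ta K de r0 E m b B" "csol t'' al (al + be) m b B lam f u"
  using opc_mono[of T al be ta K de r0 E m b B t''] csol_mono[of T al "al + be" m b B lam f u t''] a tt by auto
  have hf: "hol be F (f t)" if "t \<in> {0..t''}" for t using a that tt by auto
  have M0: "0 <= M" using M[of t'] tt bd_nonneg[of M "u t'"] by auto
  have Z: "ALL t:{0..t''}. Zyg (al + be) (C * (F + M)) (u t)"
  using sch[of t'' m b B lam f u F M] op hf M a tt by auto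
  have q: "0 <= C * (F + M)" using C F M0 by simp
  have low: "low (al + be - ta) (9 * ((C + 1) * (F + M))) (u t)" if "t \<in> {0..t''}" for t
  proof (rule low_bound[OF par])
  have e: "(C + 1) * (F + M) = C * (F + M) + F + M" by (simp add: alg)
  show "bd ((C + 1) * (F + M)) (u t)" by (rule bd_mono[OF M[OF that]]) (use e q F in linarith)
  show "Zyg (al + be) ((C + 1) * (F + M)) (u t)"
  by (rule Zyg_mono[OF bspec[OF Z that]]) (use e q F M0 in linarith)
  qed
  have "abs (u t x) <= D + (F + E 1 * (9 * ((C + 1) * (F + M)))) * (t - t')"
  using sup_bounds(1)[OF par K E op(1) _ op(2), of F "9 * ((C + 1) * (F + M))" t' D t x] hf low tt D t a by auto
  also have "... <= D + (C2 * (F + M)) * (t - t')"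
  using F M0 t unfolding C2_def by (intro add_left_mono mrm) (auto simp: alg)
  finally show ?thesis .
  qed
  have it: "ALL t:{0..min T (real k * \<Delta>)}. bd ((2 ^ k - 1) * F) (u t)" for k
  proof (induction k)
  case 0
  have "u 0 x = 0" for x using a T intf_0[of T _ u x] unfolding csol_def by auto
  thus ?case using T by (simp add: bd_def)
  next
  case (Suc k)
  define t' where "t' = min T (real k * \<Delta>)"
  define t'' where "t'' = min T (real (Suc k) * \<Delta>)"
  have tt: "0 <= t'" "t' <= t''" "t'' <= T" "t'' - t' <= \<Delta>" "0 <= t''"
  using T \<Delta> by (auto simp: t'_def t''_def min_def alg)
  let ?D = "(2 ^ k - 1) * F"
  have D0: "0 <= ?D" using F by simp
  \<comment> \<open>The exact supremum, because it is going to be absorbed on the left; it is finite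
    by the class of \<open>u\<close>.\<close>
  define M where "M = (SUP (t, x)\<in>{0..t''} \<times> UNIV. abs (u t x))"
  have bdN: "abs (u t x) <= N" if "t \<in> {0..t''}" for t x using N[of t] that tt bdD[of N "u t" x] by auto
  have up: "abs (u t x) <= M" if "t \<in> {0..t''}" for t x
  proof -
  have "bdd_above ((%(t, x). abs (u t x)) ` ({0..t''} \<times> UNIV))"
  by (rule bdd_aboveI2[where M = N]) (use bdN in auto)
  from cSUP_upper[OF _ this, of "(t, x)"] that show ?thesis unfolding M_def by simp
  qed
  have M0: "0 <= M" using up[of 0 0] tt by simp
  have bM: "bd M (u t)" if "t \<in> {0..t''}" for t unfolding bd_def using up[OF that] by simp
  have bnd: "abs (u t x) <= ?D + (F + M) / 2" if t: "t \<in> {0..t''}" for t x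
  proof (cases "t <= t'")
  case True
  hence "bd ?D (u t)" using Suc t by (auto simp: t'_def)
  hence "abs (u t x) <= ?D" using bdD[of ?D "u t" x] by simp
  moreover have "0 <= (F + M) / 2" using F M0 by simp
  ultimately show ?thesis by linarith
  next
  case False
  have "bd ?D (u t')" using Suc tt by (auto simp: t'_def)
  hence "abs (u t x) <= ?D + C2 * (F + M) * (t - t')"
  using tt bM t False by (intro grow[of t' t'']) auto
  also have "... <= ?D + C2 * (F + M) * \<Delta>" using t tt F M0 C2 by (intro add_left_mono mlm) auto
  also have "... = ?D + (F + M) / 2" using C2 by (simp add: \<Delta>_def)
  finally show ?thesis .
  qed
  \<comment> \<open>Solving for \<open>M\<close> gives \<open>2 * ?D + F\<close>, so the bound
    \<open>(2 ^ k - 1) * F\<close> reproduces itself with \<open>k + 1\<close>.\<close>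
  have "M <= ?D + (F + M) / 2" unfolding M_def[of ] using bnd tt
  by (intro cSUP_least) (auto simp: M_def)
  hence "M <= (2 ^ Suc k - 1) * F" by (simp add: field_simps)
  thus ?case using bM bd_mono unfolding t''_def by blast
  qed
  have "T <= real n * \<Delta>" using n \<Delta> by (simp add: field_simps)
  hence b: "bd ((X - 1) * F) (u t)" if "t \<in> {0..T}" for t using it[of n] that unfolding X_def by (simp add: min_def)
  have "Zyg (al + be) (C * (F + (X - 1) * F)) (u t)" using sch[of T m b B lam f u F "(X - 1) * F"] a b t T by auto
  moreover have "C * (F + (X - 1) * F) <= (X + C * (1 + X)) * F" "(X - 1) * F <= (X + C * (1 + X)) * F"
  proof -
  have "0 <= X * F" "0 <= C * F" "0 <= C * X * F" using X F C by auto
  thus "C * (F + (X - 1) * F) <= (X + C * (1 + X)) * F" "(X - 1) * F <= (X + C * (1 + X)) * F"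
  using F by (simp_all add: alg)
  qed
  ultimately show "bd ((X + C * (1 + X)) * F) (u t)" "Zyg (al + be) ((X + C * (1 + X)) * F) (u t)"
  using b[OF t] by (auto elim!: bd_mono Zyg_mono)
 qed
 qed
qed

text \<open>Time increments are integrals of \<open>L u - lam u + f\<close>, so a Lipschitz bound
  uniform in \<open>lam\<close> needs bounds of \<open>lam * u\<close> and
  \<open>lam * df3 h u\<close>. Both come from the damping part of the maximum principle, applied to
  \<open>u\<close> and to the equation of \<open>df3 h u\<close>, whose forcing is of size
  \<open>F |h|^be\<close> now that all norms of \<open>u\<close> are controlled.\<close>

lemma apriori:
 assumes par: "pars al be ta" and K: "0 < K" and de: "0 < de" and r0: "0 < r0" "r0 <= 1" and E: "!!e. 0 <= E e" and T: "0 < T"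
 shows "EX C>0. ALL m b B lam f (u::real => real^'d => real) F.
  opc T al be ta K de r0 E m b B & 0 <= lam & csol T al (al + be) m b B lam f u &
  (ALL t:{0..T}. hol be F (f t)) --> (ALL t:{0..T}. bd (C * F) (u t) & Zyg (al + be) (C * F) (u t)) &
  (ALL t t' x h. 0 <= t' & t' <= t & t <= T --> abs (u t x - u t' x) <= (t - t') * (C * F) &
  abs (df3 h (%x. u t x - u t' x) x) <= (t - t') * (C * F * h pw be))"
proof -
 show ?thesis
 proof (insert sup_estimate[where E = E and 'd = 'd, OF par K de r0 E T], elim exE conjE, goal_cases)
 case (1 C)
 note C = 1(1) and sup = 1(2)[rule_format]
 show ?thesis
 proof (insert Lop_remainder[where E = E and 'd = 'd, OF par K E], elim exE conjE, goal_cases)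
 case (1 C1)
 note C1 = 1(1) and rem = 1(2)[rule_format]
 show ?thesis
 proof (insert Lop_hol[where E = E and 'd = 'd, OF par K E], elim exE conjE, goal_cases)
 case (1 C2)
 note C2 = 1(1) and Lh = 1(2)[rule_format]
 have ta: "good_tau al ta" "al + ta < al + be" and be: "0 < be" using par by (auto simp: pars_def good_tau_def)
 define A0 where "A0 = 1 + E 1 * (9 * C)"
 define A1 where "A1 = 2 + 2 * C + (2 * E 1 + C1) * (9 * C)"
 define A where "A = 8 * A0 + A1"
 have A01: "0 < A0" "0 < A1" using C C1 E[of 1] by (auto simp: A0_def A1_def intro!: add_pos_nonneg)
 define D where "D = C + 2 * (C2 * C) + A + 2"
 have D: "0 < D" using C C2 A01 by (simp add: D_def A_def add_pos_pos)
 show ?thesis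
 proof (rule exI[of _ D], rule conjI[OF D], intro allI impI)
  fix lam F :: real and m and b :: "real => real^'d => real^'d" and B f and u :: "real => real^'d => real"
  assume a: "opc T al be ta K de r0 E m b B & 0 <= lam & csol T al (al + be) m b B lam f u &
  (ALL t:{0..T}. hol be F (f t))"
  hence op: "opc T al be ta K de r0 E m b B" and lam: "0 <= lam" and sol: "csol T al (al + be) m b B lam f u"
  and hf: "!!t. t \<in> {0..T} ==> hol be F (f t)" by auto
  have kf: "kfam al be K (m t) (b t)" "elliptic de r0 (m t)" if "t \<in> {0..T}" for t
  using op that by (auto simp: opc_def)
  have F: "0 <= F" using hf[of 0] T hol_nonneg by auto
  define N where "N = C * F"
  have N: "0 <= N" using C F by (simp add: N_def)
  have u: "bd N (u t)" "Zyg (al + be) N (u t)" "low (al + be - ta) (9 * N) (u t)" if "t \<in> {0..T}" for t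
  using sup[OF a] that low_bound[OF par] unfolding N_def by blast+
  have lam_u: "lam * abs (u t x) <= A0 * F" if "t \<in> {0..T}" for t x
  using sup_bounds(2)[OF par K E op lam sol, of F "9 * N" 0 t x] hf u T that by (simp add: A0_def N_def alg)
  have lam_df_le: "lam * df3 h (u t) x <= A1 * F * h pw be" if t: "t \<in> {0..T}" and h: "norm h <= 1" for t h x
  proof -
  define w where "w t = df3 h (u t)" for t
  define g where "g t = df3 h (%x. Lop al m b B t (u t) x - lam * u t x + f t x)" for t
  have wg: "intf T g w" unfolding g_def w_def using sol by (intro intf_df) (simp add: csol_def)
  have w: "bd (8 * N) (w t) & Zyg (al + be) (8 * N) (w t)" if "t \<in> {0..T}" for t
  unfolding w_def using u[OF that] by (auto intro: bd_df3 Zyg_df3)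
  have gsplit: "g t x = df3 h (Lop al m b B t (u t)) x - lam * w t x + df3 h (f t) x" for t x
  unfolding g_def w_def df_add df_diff df_cmult by simp
  have f3: "abs (df3 h (f t) x) <= 2 * (F * h pw be)" if "t \<in> {0..T}" for t x
  proof -
  have "abs (df2 h (f t) x) <= F * h pw be" for x using hf[OF that] by (simp add: hol_def)
  from this[of x] this[of "x + h"] show ?thesis unfolding df_def[of h "df2 h (f t)"] by linarith
  qed
  have remt: "abs (df3 h (Lop al m b B t (u t)) x - GI al (m t x) (b t x) (w t) x)
  <= (2 * N + (2 * E 1 + C1) * (9 * N)) * h pw be" if "t \<in> {0..T}" for t x
  using rem[of T de r0 m b B t N "u t" "9 * N" 1 x h] op that u[OF that] h unfolding w_def by simp
  have FA: "A1 * F * h pw be = 2 * (F * h pw be) + (2 * N + (2 * E 1 + C1) * (9 * N)) * h pw be"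
  by (simp add: A1_def N_def alg)
  have gen: "g t x <= GI al (m t x) (b t x) (w t) x - lam * w t x + A1 * F * h pw be" if "t \<in> {0..T}" for t x
  using gsplit[of t x] f3[OF that, of x] remt[OF that, of x] FA by linarith
  have lip: "abs (g t x) <= 8 * (C2 * N) + lam * (8 * N) + 2 * (F * h pw be)" if "t \<in> {0..T}" for t x
  proof -
  have "bd (C2 * N) (Lop al m b B t (u t))" using Lh[of T de r0 m b B t N "u t"] op that u[OF that] by (simp add: hol_def)
  hence "abs (df3 h (Lop al m b B t (u t)) x) <= 8 * (C2 * N)"
  using bdD[OF bd_df3] by fastforce
  moreover have "abs (lam * w t x) <= lam * (8 * N)"
  using bdD[of "8 * N" "w t" x] w[OF that] lam by (simp add: abs_mult mlm)
  ultimately show ?thesis using gsplit[of t x] f3[OF that, of x] by linarith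
  qed
  have k: "kern al K (m t x) & norm (b t x) <= K & (ALL y. y ~= 0 --> 0 <= m t x y)" if "t \<in> {0..T}" for t x
  using kfam_kern(1,2)[OF kf(1)[OF that]] kf(2)[OF that] unfolding elliptic_def by blast
  have F1: "0 <= A1 * F * h pw be" using A01 F by simp
  \<comment> \<open>Damping part of the maximum principle for the third difference. The opposite
    sign will follow by reversing the step.\<close>
  note S = generator_sup_bound(2)[OF ta order_refl less_imp_le[OF T] lam F1 k w wg lip gen]
  show ?thesis using S[OF _ _ _ _ t, of x] by (simp add: w_def)
  qed
  have lam_df: "abs (lam * df3 h (u t) x) <= A * F * h pw be" if t: "t \<in> {0..T}" for t h x
  proof (cases "norm h <= 1")
  case True
  have "abs (lam * df3 h (u t) x) <= A1 * F * h pw be"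
  using lam_df_le[OF t True, of x] lam_df_le[OF t, of "- h" "x + h + h + h"] True df3_reverse[of h "u t" x]
  by (simp add: abs_le_iff)
  also have "... <= A * F * h pw be" using A01 F by (intro mrm) (auto simp: A_def)
  finally show ?thesis .
  next
  case False
  have "bd (A0 * F) (%x. lam * u t x)" unfolding bd_def using lam_u[OF t] lam by (simp add: abs_mult)
  from bdD[OF bd_df3[OF this], of h h h x]
  have "abs (lam * df3 h (u t) x) <= 8 * A0 * F * 1" unfolding df_cmult by simp
  also have "... <= 8 * A0 * F * h pw be"
  using False be A01 F by (intro mlm ge_one_powr_ge_zero) auto
  also have "... <= A * F * h pw be" using A01 F by (intro mrm) (auto simp: A_def)
  finally show ?thesis .
  qed
  define g where "g t x = Lop al m b B t (u t) x - lam * u t x + f t x" for t x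
  have ug: "intf T g u" using sol unfolding csol_def g_def by simp
  have hL: "hol be (C2 * N) (Lop al m b B t (u t))" if "t \<in> {0..T}" for t
  using Lh[of T de r0 m b B t N "u t"] op that u[OF that] by simp
  have DF: "C2 * N + A0 * F + F <= D * F" "2 * (C2 * N) + A * F + 2 * F <= D * F" "C * F <= D * F"
  proof -
  have "0 <= C * F" "0 <= C2 * C * F" "0 <= A0 * F" "0 <= A1 * F" using C C2 A01 F by auto
  thus "C2 * N + A0 * F + F <= D * F" "2 * (C2 * N) + A * F + 2 * F <= D * F" "C * F <= D * F"
  using F by (simp_all add: D_def A_def N_def alg)
  qed
  have gb: "abs (g t x) <= D * F" if t: "t \<in> {0..T}" for t x
  proof -
  have "abs (Lop al m b B t (u t) x) <= C2 * N" using hL[OF t] bdD[of "C2 * N" "Lop al m b B t (u t)" x] by (simp add: hol_def)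
  moreover have "abs (f t x) <= F" using hf[OF t] bdD[of F "f t" x] by (simp add: hol_def)
  moreover have "abs (lam * u t x) <= A0 * F" using lam_u[OF t, of x] lam by (simp add: abs_mult)
  ultimately show ?thesis using DF unfolding g_def by linarith
  qed
  have g3: "abs (df3 h (g t) x) <= D * F * h pw be" if t: "t \<in> {0..T}" for t h x
  proof -
  have "df3 h (g t) x = df3 h (Lop al m b B t (u t)) x - lam * df3 h (u t) x + df3 h (f t) x"
  unfolding g_def[abs_def] df_add df_diff df_cmult by simp
  moreover have "abs (df2 h (Lop al m b B t (u t)) x) <= C2 * N * h pw be" for x
  using hL[OF t] by (simp add: hol_def)
  from this[of x] this[of "x + h"] have "abs (df3 h (Lop al m b B t (u t)) x) <= 2 * (C2 * N * h pw be)"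
  unfolding df_def[of h "df2 h (Lop al m b B t (u t))"] by linarith
  moreover have "abs (df2 h (f t) x) <= F * h pw be" for x using hf[OF t] by (simp add: hol_def)
  from this[of x] this[of "x + h"] have "abs (df3 h (f t) x) <= 2 * (F * h pw be)"
  unfolding df_def[of h "df2 h (f t)"] by linarith
  ultimately have "abs (df3 h (g t) x) <= 2 * (C2 * N * h pw be) + A * F * h pw be + 2 * (F * h pw be)"
  using lam_df[OF t, of h x] by linarith
  also have "... = (2 * (C2 * N) + A * F + 2 * F) * h pw be" by (simp add: alg)
  also have "... <= D * F * h pw be" using DF by (intro mrm) auto
  finally show ?thesis .
  qed
  show "(ALL t:{0..T}. bd (D * F) (u t) & Zyg (al + be) (D * F) (u t)) &
  (ALL t t' x h. 0 <= t' & t' <= t & t <= T --> abs (u t x - u t' x) <= (t - t') * (D * F) &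
  abs (df3 h (%x. u t x - u t' x) x) <= (t - t') * (D * F * h pw be))"
  proof (intro conjI ballI allI impI)
  fix t assume t: "t \<in> {0..T}"
  show "bd (D * F) (u t)" "Zyg (al + be) (D * F) (u t)"
  using u[OF t] DF(3) unfolding N_def by (auto intro: bd_mono Zyg_mono)
  next
  fix t t' x h assume tt: "0 <= t' & t' <= t & t <= T"
  show "abs (u t x - u t' x) <= (t - t') * (D * F)"
  using tt by (intro intf_abs_le[OF ug] gb) auto
  have "abs (df3 h (u t) x - df3 h (u t') x) <= (t - t') * (D * F * h pw be)"
  using tt by (intro intf_abs_le[OF intf_df[OF intf_df[OF intf_df[OF ug]]]] g3) auto
  thus "abs (df3 h (%x. u t x - u t' x) x) <= (t - t') * (D * F * h pw be)"
  unfolding df_diff .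
  qed
 qed
 qed
 qed
 qed
qed

section \<open>Truncated kernels\<close>

definition meas :: "real => (real => real^'d => 'b::real_normed_vector) => bool" where
 "meas T u \<longleftrightarrow> case_prod u \<in> bm (restrict_space borel (strip T))"

lemma meas_comp:
 assumes "meas T u" "a \<in> bm M" "c \<in> bm M" "!!p. p \<in> space M ==> a p \<in> {0..T}"
 shows "(%p. u (a p) (c p)) \<in> bm M"
proof -
 have "(%p. (a p, c p)) \<in> M \<rightarrow>\<^sub>M restrict_space borel (strip T)"
  using assms by (intro measurable_restrict_space2 borel_measurable_Pair) (auto simp: strip_def)
 from measurable_compose[OF this assms(1)[unfolded meas_def]] show ?thesis by simp
qed

lemma meas_section: "meas T u ==> t \<in> {0..T} ==> u t \<in> bm borel"
 by (rule meas_comp[where a = "%_. t" and c = "%x. x"]) auto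

lemma strip_measurable [measurable]:
 "fst \<in> bm (restrict_space borel (strip T))" "snd \<in> bm (restrict_space borel (strip T))"
 by (auto intro!: measurable_restrict_space1 borel_measurable_continuous_onI continuous_intros)

lemma measI: "(%p. u (fst p) (snd p)) \<in> bm (restrict_space borel (strip T)) ==> meas T u"
 unfolding meas_def by (simp add: case_prod_unfold)

lemma measD: "meas T u ==> (%p. u (fst p) (snd p)) \<in> bm (restrict_space borel (strip T))"
 unfolding meas_def by (simp add: case_prod_unfold)

lemma space_strip: "p \<in> space (restrict_space borel (strip T)) \<longleftrightarrow> fst p \<in> {0..T}"
 by (cases p) (auto simp: space_restrict_space strip_def)

lemma meas_lin: "meas T u ==> meas T v ==> meas T (%t x. u t x + (a::real) * v t x)"
 by (intro measI borel_measurable_add borel_measurable_times borel_measurable_const) (auto dest: measD)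

lemma meas_const: "meas T (%t x. c)"
 by (intro measI) simp

lemma meas_limit:
 fixes u :: "nat => real => real^'d => real"
 assumes "!!n. meas T (u n)" "!!t x. t \<in> {0..T} ==> (%n. u n t x) ~~> v t x"
 shows "meas T v"
 by (rule measI, rule borel_measurable_LIMSEQ_real[where u = "%n p. u n (fst p) (snd p)"])
  (use assms in \<open>auto simp: space_strip dest: measD\<close>)

lemma meas_set_integrable:
 fixes g :: "real => real^'d => real"
 assumes g: "meas T g" and b: "!!s. s \<in> {0..T} ==> abs (g s x) <= G" and t: "t <= T"
 shows "set_integrable lborel {0..t} (%s. g s x)"
proof -
 have "(%s. g s x) \<in> bm (restrict_space borel {0..t})"
  by (rule meas_comp[OF g]) (use t in \<open>auto simp: space_restrict_space intro!: measurable_restrict_space1\<close>)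
 hence "(%s. indicator {0..t} s *. g s x) \<in> bm borel"
  by (subst (asm) borel_measurable_restrict_space_iff) auto
 thus ?thesis unfolding set_integrable_def
  by (intro integrableI_bounded_set[where A = "{0..t}" and B = G]) (use b t in \<open>auto simp: indicator_def emeasure_lborel_Icc_eq\<close>)
qed

lemma meas_integral:
 fixes g :: "real => real^'d => real"
 assumes g: "meas T g" and T: "0 <= T"
 shows "meas T (%t x. LINT s:{0..t}|lborel. g s x)"
proof (rule measI)
 let ?M = "restrict_space borel (strip T) :: (real \<times> (real^'d)) measure"
 \<comment> \<open>Time is clamped to \<open>{0..T}\<close> so that the integrand is jointly
   measurable on the whole line; the condition discards the altered values.\<close>
 let ?h = "%p s. if 0 <= s & s <= fst p then g (min (max s 0) T) (snd p) else 0"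
 have [measurable]: "(%q. g (min (max (snd q) 0) T) (snd (fst q))) \<in> bm (?M \<Otimes>\<^sub>M lborel)"
  by (rule meas_comp[OF g]) (use T in auto)
 have "(%p. LINT s|lborel. ?h p s) \<in> bm ?M"
  by (rule lborel.borel_measurable_lebesgue_integral) (simp add: case_prod_unfold)
 moreover have "(LINT s|lborel. ?h p s) = (LINT s:{0..fst p}|lborel. g s (snd p))" if "p \<in> space ?M" for p
  unfolding set_lebesgue_integral_def using that
  by (intro Bochner_Integration.integral_cong) (auto simp: space_strip indicator_def)
 ultimately show "(%p. LINT s:{0..fst p}|lborel. g s (snd p)) \<in> bm ?M"
  by (subst measurable_cong[of ?M _ "%p. LINT s|lborel. ?h p s"]) auto
qed

lemma geometric_limit:
 fixes a :: "nat => real"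
 assumes d: "!!k. abs (a (Suc k) - a k) <= A * q ^ k" and q: "0 <= q" "q < 1"
 shows "a ~~> lim a" "abs (lim a - a k) <= A / (1 - q) * q ^ k"
proof -
 have gs: "(%i. A * q ^ k * q ^ i) sums (A * q ^ k * (1 / (1 - q)))" for k
  using q by (intro sums_mult geometric_sums) auto
 have dk: "norm (a (Suc (i + k)) - a (i + k)) <= A * q ^ k * q ^ i" for i k
  using d[of "i + k"] by (simp add: power_add alg)
 have sm: "summable (%i. a (Suc (i + k)) - a (i + k))" for k
  by (rule summable_comparison_test'[OF sums_summable[OF gs[of k]], of 0]) (use dk in auto)
 have l: "(%n. a (n + k)) ~~> a k + (\<Sum>i. a (Suc (i + k)) - a (i + k))" for k
 proof -
  have "(%n. a k + (\<Sum>i<n. a (Suc (i + k)) - a (i + k))) ~~> a k + (\<Sum>i. a (Suc (i + k)) - a (i + k))"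
  by (intro tendsto_intros summable_LIMSEQ sm)
  moreover have "(\<Sum>i<n. a (Suc (i + k)) - a (i + k)) = a (n + k) - a k" for n
  using sum_lessThan_telescope[of "%i. a (i + k)" n] by simp
  ultimately show ?thesis by simp
 qed
 from l[of 0] have "convergent a" by (auto simp: convergent_def)
 thus L: "a ~~> lim a" by (simp add: convergent_LIMSEQ_iff)
 have "lim a = a k + (\<Sum>i. a (Suc (i + k)) - a (i + k))"
  using LIMSEQ_unique[OF LIMSEQ_ignore_initial_segment[OF L, of k] l[of k]] .
 moreover have "norm (\<Sum>i. a (Suc (i + k)) - a (i + k)) <= (\<Sum>i. A * q ^ k * q ^ i)"
  by (rule norm_suminf_le) (use dk sums_summable[OF gs[of k]] in auto)
 moreover have "(\<Sum>i. A * q ^ k * q ^ i) = A / (1 - q) * q ^ k" using sums_unique[OF gs[of k]] by simp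
 ultimately show "abs (lim a - a k) <= A / (1 - q) * q ^ k" by simp
qed

text \<open>The integrands converge uniformly with rate \<open>e n\<close>, so the integrals over
  \<open>{0..t}\<close> converge with rate \<open>T * e n\<close>.\<close>

lemma intf_limit:
 fixes g :: "real => real^'d => real"
 assumes gn: "!!n. intf T (gn n) (un n)" and g: "meas T g" "!!s x. s \<in> {0..T} ==> abs (g s x) <= G"
  and e: "!!n s x. s \<in> {0..T} ==> abs (gn n s x - g s x) <= e n" "e ~~> 0"
  and u: "!!t x. t \<in> {0..T} ==> (%n. un n t x) ~~> u t x"
 shows "intf T g u"
 unfolding intf_def
proof (intro ballI allI conjI)
 fix t x assume t: "t \<in> {0..T}"
 show i: "set_integrable lborel {0..t} (%s. g s x)"
  using g t by (intro meas_set_integrable[of T g x G]) auto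
 have d: "abs (un n t x - (LINT s:{0..t}|lborel. g s x)) <= T * e n" for n
 proof -
  have j: "set_integrable lborel {0..t} (%s. gn n s x)" and eq: "un n t x = (LINT s:{0..t}|lborel. gn n s x)"
  using gn[of n] t unfolding intf_def by auto
  have "un n t x - (LINT s:{0..t}|lborel. g s x) = (LINT s:{0..t}|lborel. gn n s x - g s x)"
  unfolding eq using i j by (simp add: set_integral_diff)
  also have "abs (...) <= (LINT s:{0..t}|lborel. e n)"
  proof -
  have ii: "set_integrable lborel {0..t} (%s. gn n s x - g s x)" using i j by simp
  have "abs (LINT s:{0..t}|lborel. gn n s x - g s x) <= (LINT s:{0..t}|lborel. abs (gn n s x - g s x))"
  using set_integral_norm_bound[OF ii] by simp
  also have "... <= (LINT s:{0..t}|lborel. e n)"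
  using e(1) t by (intro set_integral_mono set_integrable_abs ii) (auto simp: set_integrable_def)
  finally show ?thesis .
  qed
  also have "... = t * e n" using t by (simp add: set_lebesgue_integral_def)
  also have "... <= T * e n" using t e(1)[of t n x] by (intro mrm) auto
  finally show ?thesis .
 qed
 have "(%n. un n t x - (LINT s:{0..t}|lborel. g s x)) ~~> 0"
  by (rule Lim_null_comparison[OF _ tendsto_mult_right_zero[OF e(2), of T]]) (use d in auto)
 hence "(%n. un n t x) ~~> (LINT s:{0..t}|lborel. g s x)" by (rule LIM_zero_cancel)
 thus "u t x = (LINT s:{0..t}|lborel. g s x)" using LIMSEQ_unique u[OF t] by blast
qed

lemma exp_integral_le:
 fixes \<mu> t :: real
 assumes "0 < \<mu>" "0 <= t"
 shows "set_integrable lborel {0..t} (%s. exp (\<mu> * s))" "(LINT s:{0..t}|lborel. exp (\<mu> * s)) <= exp (\<mu> * t) / \<mu>"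
proof -
 show "set_integrable lborel {0..t} (%s. exp (\<mu> * s))"
  by (rule borel_integrable_atLeastAtMost') (intro continuous_intros)
 have "(LINT s|lborel. exp (\<mu> * s) * indicator {0..t} s) = exp (\<mu> * t) / \<mu> - exp (\<mu> * 0) / \<mu>"
  using assms by (intro integral_FTC_Icc_real) (auto intro!: derivative_eq_intros)
 moreover have "(LINT s:{0..t}|lborel. exp (\<mu> * s)) = (LINT s|lborel. exp (\<mu> * s) * indicator {0..t} s)"
  unfolding set_lebesgue_integral_def by (intro Bochner_Integration.integral_cong) auto
 ultimately show "(LINT s:{0..t}|lborel. exp (\<mu> * s)) <= exp (\<mu> * t) / \<mu>" using assms by simp
qed

section \<open>Bounded operators with the small jumps removed\<close>

context
 fixes al K ep :: real
 assumes al: "0 < al" "al < 2" and K: "0 < K" and ep: "0 < ep"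
begin

text \<open>The constant kernel with the jumps of size at most \<open>ep\<close> removed.\<close>
definition TA :: "(real^'d => real) => real^'d => real" where
 "TA g x = (LINT y|lborel. far al ep (%_. K) g x y)"

definition tmass :: "'d::finite itself => real" where
 "tmass d = kernel_const al TYPE('d) * 2 powr al * (K * ep powr (- al))"

lemma tmass_pos: "0 < tmass TYPE('d::finite)"
 unfolding tmass_def using kernel_const_pos[OF al(1), where 'd = 'd] K ep by simp

lemma far_dom: "(!!y. abs (g (x + y) - g x) <= c) ==> abs (far al ep (%_. K) g x y) <= dom al ep 0 (c * K) (y::real^'d)"
proof (cases "norm y <= ep")
 case False
 assume "!!y. abs (g (x + y) - g x) <= c"
 hence "abs ((g (x + y) - g x)) * K / pk al y <= c * K / pk al y"
  using K by (intro divide_right_mono mrm) auto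
 also have "... = c * K * y pw (- al - real CARD('d))" by (simp add: powr_diff powr_add powr_minus field_simps)
 finally show ?thesis using False K by (simp add: far_def dom_def abs_mult)
qed (simp add: far_def dom_def)

lemma far_measurable: "g \<in> bm borel ==> far al ep (%_. K) g x \<in> bm borel"
proof -
 assume [measurable]: "g \<in> bm borel"
 show ?thesis unfolding far_def by measurable
qed

lemma TA_bound:
 fixes g :: "real^'d => real"
 assumes "g \<in> bm borel" "!!y. abs (g (x + y) - g x) <= c"
 shows "integrable lborel (far al ep (%_. K) g x)" "abs (TA g x) <= c * tmass TYPE('d::finite)"
proof -
 have c: "0 <= c" using assms(2)[of 0] by simp
 note D = dom_integral[OF al(1) ep order_refl, of "c * K", where 'd = 'd]
 note I = integrable_dominated[OF far_measurable[OF assms(1)] D(1) far_dom[OF assms(2)]]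
 show "integrable lborel (far al ep (%_. K) g x)" using I(1) c K by simp
 have "abs (TA g x) <= integral\<^sup>L lborel (dom al ep 0 (c * K) :: real^'d => real)" using I(2) c K by (simp add: TA_def)
 also have "... <= c * tmass TYPE('d)" using D(2) c K by (simp add: tmass_def alg)
 finally show "abs (TA g x) <= c * tmass TYPE('d)" .
qed

lemma TA_bd:
 assumes "g \<in> bm borel" "bd M (g :: real^'d => real)"
 shows "integrable lborel (far al ep (%_. K) g x)" "abs (TA g x) <= 2 * M * tmass TYPE('d::finite)"
 using TA_bound[OF assms(1), of x "2 * M"] bdD[OF bd_df[OF assms(2)], of _ x] by (auto simp: df_def)

lemma TA_lin:
 assumes "g \<in> bm borel" "bd M (g :: real^'d => real)" "g' \<in> bm borel" "bd M' g'"
 shows "TA (%x. g x + a * g' x) x = TA g x + a * TA g' x"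
proof -
 have "far al ep (%_. K) (%x. g x + a * g' x) x = (%y. far al ep (%_. K) g x y + a * far al ep (%_. K) g' x y)"
  by (rule ext) (simp add: far_def alg add_divide_distrib diff_divide_distrib)
 thus ?thesis unfolding TA_def using TA_bd(1)[OF assms(1,2)] TA_bd(1)[OF assms(3,4)] by simp
qed

lemma TA_df:
 assumes "g \<in> bm borel" "bd M (g :: real^'d => real)"
 shows "df h (TA g) x = TA (df h g) x"
proof -
 note [measurable] = assms(1)
 have "TA (%x. g (x + h) + (- 1) * g x) x = TA (%x. g (x + h)) x + (- 1) * TA g x"
  using assms bd_shift[OF assms(2), of h] by (intro TA_lin) auto
 moreover have "TA g (x + h) = TA (%x. g (x + h)) x" by (simp add: TA_def far_def add_ac cong: if_cong)
 ultimately show ?thesis by (simp add: df_def[abs_def])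
qed

lemma df_measurable: "g \<in> bm borel ==> df h g \<in> bm borel"
 for g :: "real^'d => real"
proof -
 assume [measurable]: "g \<in> bm borel"
 show ?thesis unfolding df_def by measurable
qed

lemma meas_TA: assumes "meas T u" shows "meas T (%t. TA (u t))"
proof (rule measI)
 let ?M = "restrict_space borel (strip T) :: (real \<times> (real^'d)) measure"
 have [measurable]: "(%q. u (fst (fst q)) (snd (fst q) + snd q)) \<in> bm (?M \<Otimes>\<^sub>M lborel)"
  "(%q. u (fst (fst q)) (snd (fst q))) \<in> bm (?M \<Otimes>\<^sub>M lborel)"
  by (rule meas_comp[OF assms], auto simp: space_pair_measure space_strip)+
 show "(%p. TA (u (fst p)) (snd p)) \<in> bm ?M"
  unfolding TA_def far_def
  by (rule lborel.borel_measurable_lebesgue_integral) (simp add: case_prod_unfold)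
qed

text \<open>Without small jumps the operator is bounded in the sup norm and the equation is a linear
  ordinary differential equation. Picard iterates converge on the whole interval in the weight
  \<open>exp (\<mu> * t)\<close>: \<open>\<mu>\<close> is twice the Lipschitz constant
  \<open>2 * La + lam\<close>, which makes the contraction factor 1/2.\<close>

lemma truncated_solution_exists:
 fixes f :: "real => real^'d => real"
 assumes f: "meas T f" "!!t. t \<in> {0..T} ==> bd F (f t)" and T: "0 <= T" and lam: "0 <= lam"
 shows "EX u M. meas T u & (ALL t:{0..T}. bd M (u t)) & intf T (%t x. TA (u t) x - lam * u t x + f t x) u"
proof -
 define La where "La = tmass TYPE('d)"
 have La: "0 < La" by (simp add: La_def tmass_pos)
 define \<mu> where "\<mu> = 2 * (2 * La + lam)"
 have \<mu>: "0 < \<mu>" using La lam by (simp add: \<mu>_def)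
 have F: "0 <= F" using f(2)[of 0] T bd_nonneg by auto
 define h where "h u t x = TA (u t) x - lam * u t x + f t x" for u t x
 define U where "U = rec_nat (%t x. 0) (%_ u t x. LINT s:{0..t}|lborel. h u s x)"
 have U0: "U 0 = (%t x. 0)" and US: "U (Suc k) = (%t x. LINT s:{0..t}|lborel. h (U k) s x)" for k
  by (simp_all add: U_def)
 have hm: "meas T (h u)" if "meas T u" for u
 proof -
  have e: "h u = (%t x. (TA (u t) x + (- lam) * u t x) + 1 * f t x)" by (intro ext) (simp add: h_def)
  show ?thesis unfolding e by (rule meas_lin[OF meas_lin[OF meas_TA[OF that] that] f(1)])
 qed
 have hb: "abs (h u t x) <= 2 * M * La + lam * M + F" if "meas T u" "t \<in> {0..T}" "bd M (u t)" for u t x M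
 proof -
  have "abs (TA (u t) x) <= 2 * M * La" unfolding La_def using that by (intro TA_bd meas_section)
  moreover have "abs (lam * u t x) <= lam * M" using bdD[OF that(3), of x] lam by (simp add: abs_mult mlm)
  ultimately show ?thesis using bdD[OF f(2)[OF that(2)], of x] unfolding h_def by simp
 qed
 have Um: "meas T (U k)" for k by (induction k) (auto simp: U0 US intro!: meas_const meas_integral hm T)
 have UI: "intf T (h (U k)) (U (Suc k))" if "ALL t:{0..T}. bd M (U k t)" for k M
  unfolding intf_def US using that
  by (auto intro!: meas_set_integrable[OF hm[OF Um]] hb Um)
 have "EX M. ALL t:{0..T}. bd M (U k t)" for k
 proof (induction k)
  case 0 thus ?case by (auto simp: U0 bd_def)
 next
  case (Suc k)
  then obtain M where M: "ALL t:{0..T}. bd M (U k t)" by blast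
  have "abs (U (Suc k) t x) <= T * (2 * M * La + lam * M + F)" if t: "t \<in> {0..T}" for t x
  proof -
  have "abs (U (Suc k) t x - U (Suc k) 0 x) <= (t - 0) * (2 * M * La + lam * M + F)"
  using t M by (intro intf_abs_le[OF UI[OF M]] hb Um) auto
  moreover have "0 <= 2 * M * La + lam * M + F" using hb[OF Um t bspec[OF M t], of x] by linarith
  ultimately show ?thesis using intf_0[OF UI[OF M] T] t
  mrm[of t T "2 * M * La + lam * M + F"] by simp
  qed
  thus ?case unfolding bd_def by (intro exI[of _ "T * (2 * M * La + lam * M + F)"]) simp
 qed
 then obtain M where M: "!!k. ALL t:{0..T}. bd (M k) (U k t)" by metis
 define A where "A = T * F"
 have A: "0 <= A" using T F by (simp add: A_def)
 have hd: "abs (h (U (Suc k)) t x - h (U k) t x) <= (2 * La + lam) * c"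
  if t: "t \<in> {0..T}" and c: "!!x. abs (U (Suc k) t x - U k t x) <= c" for k t x c
 proof -
  let ?d = "%x. U (Suc k) t x + (- 1) * U k t x"
  have bd: "bd c ?d" unfolding bd_def using c by simp
  have m: "U (Suc k) t \<in> bm borel" "U k t \<in> bm borel" using meas_section[OF Um t] by blast+
  have dm: "?d \<in> bm borel" using m by (intro borel_measurable_add borel_measurable_times borel_measurable_const)
  have "h (U (Suc k)) t x - h (U k) t x = TA ?d x - lam * ?d x"
  unfolding h_def TA_lin[OF m(1) bspec[OF M t] m(2) bspec[OF M t]] by (simp add: alg)
  moreover have "abs (TA ?d x) <= 2 * c * La" unfolding La_def by (rule TA_bd[OF dm bd])
  moreover have "abs (lam * ?d x) <= lam * c" using bdD[OF bd, of x] lam by (simp add: abs_mult mlm)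
  ultimately show ?thesis by (simp add: alg)
 qed
 have dU: "ALL t:{0..T}. ALL x. abs (U (Suc k) t x - U k t x) <= A * exp (\<mu> * t) * (1/2) ^ k" for k
 proof (induction k)
  case 0
  show ?case
  proof (intro ballI allI)
  fix t x assume t: "t \<in> {0..T}"
  have "bd 0 (U 0 s)" for s by (simp add: U0 bd_def)
  hence "abs (U 1 t x - U 1 0 x) <= (t - 0) * F"
  using t hb[OF Um, of _ 0 0 x] by (intro intf_abs_le[OF UI[of 0 0, folded One_nat_def]]) auto
  moreover have "U 1 0 x = 0" using intf_0[OF UI[of 0 0] T] by (simp add: U0 bd_def)
  moreover have "t * F <= A * exp (\<mu> * t)"
  proof -
  have "t * F <= A" unfolding A_def using t F by (intro mrm) auto
  also have "A * 1 <= A * exp (\<mu> * t)" using A t \<mu> by (intro mlm) auto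
  finally show ?thesis by simp
  qed
  ultimately show "abs (U (Suc 0) t x - U 0 t x) <= A * exp (\<mu> * t) * (1/2) ^ 0" by (simp add: U0)
  qed
 next
  case (Suc k)
  show ?case
  proof (intro ballI allI)
  fix t x assume t: "t \<in> {0..T}"
  let ?g = "%s. h (U (Suc k)) s x - h (U k) s x"
  have i: "set_integrable lborel {0..t} (%s. h (U j) s x)" and e: "U (Suc j) t x = (LINT s:{0..t}|lborel. h (U j) s x)" for j
  using UI[OF M, of j] t unfolding intf_def by auto
  have ig: "set_integrable lborel {0..t} ?g" using i by simp
  let ?c = "(2 * La + lam) * (A * (1/2) ^ k)"
  have "U (Suc (Suc k)) t x - U (Suc k) t x = (LINT s:{0..t}|lborel. ?g s)"
  unfolding e using i by (simp add: set_integral_diff)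
  also have "abs (...) <= (LINT s:{0..t}|lborel. abs (?g s))" using set_integral_norm_bound[OF ig] by simp
  also have "... <= (LINT s:{0..t}|lborel. ?c * exp (\<mu> * s))"
  proof (rule set_integral_mono[OF set_integrable_abs[OF ig]])
  show "set_integrable lborel {0..t} (%s. ?c * exp (\<mu> * s))" using exp_integral_le[OF \<mu>, of t] t by simp
  fix s assume "s \<in> {0..t}"
  hence s: "s \<in> {0..T}" using t by auto
  have "abs (?g s) <= (2 * La + lam) * (A * exp (\<mu> * s) * (1/2) ^ k)"
  using Suc s by (intro hd[OF s]) auto
  thus "abs (?g s) <= ?c * exp (\<mu> * s)" by (simp add: alg)
  qed
  also have "... = ?c * (LINT s:{0..t}|lborel. exp (\<mu> * s))" by simp
  also have "... <= ?c * (exp (\<mu> * t) / \<mu>)"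
  using La lam A t \<mu> by (intro mlm exp_integral_le) auto
  also have "... = A * exp (\<mu> * t) * (1/2) ^ Suc k"
  proof -
  define L where "L = 2 * La + lam"
  have "0 < L" using La lam by (simp add: L_def)
  thus ?thesis unfolding \<mu>_def L_def[symmetric] by simp
  qed
  finally show "abs (U (Suc (Suc k)) t x - U (Suc k) t x) <= A * exp (\<mu> * t) * (1/2) ^ Suc k" .
  qed
 qed
 define A' where "A' = A * exp (\<mu> * T)"
 have dU': "abs (U (Suc k) t x - U k t x) <= A' * (1/2) ^ k" if "t \<in> {0..T}" for k t x
 proof -
  have "A * exp (\<mu> * t) * (1/2) ^ k <= A' * (1/2) ^ k"
  unfolding A'_def using that A \<mu> by (intro mrm mlm) auto
  thus ?thesis using dU[of k] that by (meson order_trans)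
 qed
 define u where "u t x = lim (%k. U k t x)" for t x
 have lim: "(%k. U k t x) ~~> u t x" "abs (u t x - U k t x) <= 2 * A' * (1/2) ^ k" if "t \<in> {0..T}" for t x k
  using geometric_limit[of "%k. U k t x" A' "1/2"] dU'[OF that] unfolding u_def by (simp_all add: mult.commute[of 2 A'])
 have um: "meas T u" by (rule meas_limit[OF Um lim(1)])
 have ub: "bd (2 * A') (u t)" if "t \<in> {0..T}" for t
  unfolding bd_def using lim(2)[OF that, of _ 0] by (simp add: U0)
 have "intf T (h u) u"
 proof (rule intf_limit[where gn = "%k. h (U k)" and un = "%k. U (Suc k)" and e = "%k. (2 * La + lam) * (2 * A' * (1/2) ^ k)"])
  show "intf T (h (U n)) (U (Suc n))" for n by (rule UI[OF M])
  show "meas T (h u)" by (rule hm[OF um])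
  show "abs (h u s x) <= 2 * (2 * A') * La + lam * (2 * A') + F" if "s \<in> {0..T}" for s x by (rule hb[OF um that ub[OF that]])
  show "(%k. (2 * La + lam) * (2 * A' * (1/2) ^ k)) ~~> 0"
  by (intro tendsto_mult_right_zero LIMSEQ_realpow_zero) auto
  show "(%n. U (Suc n) t x) ~~> u t x" if "t \<in> {0..T}" for t x
  using lim(1)[OF that, of x] LIMSEQ_Suc by blast
  show "abs (h (U k) t x - h u t x) <= (2 * La + lam) * (2 * A' * (1/2) ^ k)" if t: "t \<in> {0..T}" for k t x
  proof -
  let ?d = "%x. u t x + (- 1) * U k t x"
  have bd: "bd (2 * A' * (1/2) ^ k) ?d" unfolding bd_def using lim(2)[OF t] by simp
  have m: "u t \<in> bm borel" "U k t \<in> bm borel" using meas_section[OF _ t] um Um by blast+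
  have dm: "?d \<in> bm borel" using m by (intro borel_measurable_add borel_measurable_times borel_measurable_const)
  have "h u t x - h (U k) t x = TA ?d x - lam * ?d x"
  unfolding h_def TA_lin[OF m(1) ub[OF t] m(2) bspec[OF M t]] by (simp add: alg)
  moreover have "abs (TA ?d x) <= 2 * (2 * A' * (1/2) ^ k) * La" unfolding La_def by (rule TA_bd[OF dm bd])
  moreover have "abs (lam * ?d x) <= lam * (2 * A' * (1/2) ^ k)" using bdD[OF bd, of x] lam by (simp add: abs_mult mlm)
  ultimately show ?thesis by (simp add: alg)
  qed
 qed
 thus ?thesis using um ub unfolding h_def by blast
qed

text \<open>The generator is bounded in the sup norm, so its continuity in time follows directly
  from the Lipschitz bound of \<open>w\<close>, without interpolation.\<close>

lemma truncated_max_principle: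
 fixes w :: "real => real^'d => real"
 assumes lam: "0 <= lam" and w: "!!t. t \<in> {0..T} ==> bd N (w t) & w t \<in> bm borel"
  and wg: "intf T g w" and lip: "!!r x. r \<in> {0..T} ==> abs (g r x) <= G"
  and gen: "!!r x. r \<in> {0..T} ==> g r x <= TA (w r) x - lam * w r x + F"
  and mx: "!!e. e > 0 ==> EX et>0. ALL t:{0..T}. ALL x. (ALL y. w t y <= w t x + et) & w t x > th --> TA (w t) x + F <= e + a"
  and th: "0 <= th" and t: "t \<in> {0..T}"
 shows "w t x <= th + max a 0 * t"
proof -
 have T: "0 <= T" using t by simp
 define La where "La = tmass TYPE('d)"
 have La: "0 < La" by (simp add: La_def tmass_pos)
 have G: "0 <= G" using lip[OF t, of 0] by simp
 have init: "w 0 x <= th" for x using intf_0[OF wg T] th by simp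
 have "w t x <= th + max a 0 * (t - 0)"
 proof (rule max_principle[where ga = "%r t x. TA (w t) x - lam * w t x + F" and N = N and w = w and th = th and a = a and ?t0.0 = 0 and T = T, OF _ _ _ _ init t])
  show "abs (w t x) <= N" if "t \<in> {0..T}" for t x using w[OF that] bdD[of N "w t" x] by auto
  show "w t x - w t' x <= (t - t') * \<Gamma>"
  if "0 <= t'" "t' <= t" "t <= T" "!!r. r \<in> {t'..t} ==> TA (w r) x - lam * w r x + F <= \<Gamma>" for t' t x \<Gamma>
  using that by (intro intf_le[OF wg] order_trans[OF gen]) auto
  show "EX d>0. ALL t:{0..T}. ALL r:{0..T}. ALL x. abs (r - t) <= d -->
  TA (w r) x - lam * w r x + F <= TA (w t) x - lam * w t x + F + e" if e: "e > 0" for e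
  proof -
  define X where "X = (2 * La + lam) * G"
  have X: "0 <= X" using La lam G by (simp add: X_def)
  define d where "d = e / (X + 1)"
  have d: "0 < d" using e X by (simp add: d_def)
  have dX: "d * X <= e" using e X by (simp add: d_def field_simps)
  show ?thesis
  proof (intro exI[of _ d] conjI ballI allI impI d)
  fix t r x assume tr: "t \<in> {0..T}" "r \<in> {0..T}" "abs (r - t) <= d"
  let ?v = "%x. w r x + (- 1) * w t x"
  have vb: "abs (?v x) <= d * G" for x
  proof -
  have "abs (w r x - w t x) <= abs (r - t) * G"
  proof (cases "t <= r")
  case True
  hence "abs (w r x - w t x) <= (r - t) * G" using tr lip by (intro intf_abs_le[OF wg]) auto
  thus ?thesis using True by simp
  next
  case False
  hence "abs (w t x - w r x) <= (t - r) * G" using tr lip by (intro intf_abs_le[OF wg]) auto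
  thus ?thesis using False by simp
  qed
  also have "... <= d * G" using tr(3) G by (rule mrm)
  finally show ?thesis by simp
  qed
  have b: "bd (d * G) ?v" unfolding bd_def using vb by simp
  have m: "w r \<in> bm borel" "w t \<in> bm borel" using w tr by auto
  have dm: "?v \<in> bm borel" using m by (intro borel_measurable_add borel_measurable_times borel_measurable_const)
  have "TA ?v x = TA (w r) x + (- 1) * TA (w t) x"
  using w[OF tr(1)] w[OF tr(2)] by (intro TA_lin) auto
  moreover have "abs (TA ?v x) <= 2 * (d * G) * La" unfolding La_def by (rule TA_bd[OF dm b])
  moreover have "abs (lam * ?v x) <= lam * (d * G)" using vb[of x] lam by (simp add: abs_mult mlm)
  moreover have "2 * (d * G) * La + lam * (d * G) = d * X" by (simp add: X_def alg)
  ultimately show "TA (w r) x - lam * w r x + F <= TA (w t) x - lam * w t x + F + e"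
  using dX by (simp add: alg abs_le_iff)
  qed
  qed
  show "EX et>0. ALL t:{0..T}. ALL r:{0..T}. ALL x. (ALL y. w t y <= w t x + et) & th < w t x -->
  TA (w t) x - lam * w t x + F <= e + a" if e: "e > 0" for e
  proof -
  from mx[OF e] obtain et where et: "et > 0" "ALL t:{0..T}. ALL x. (ALL y. w t y <= w t x + et) & w t x > th --> TA (w t) x + F <= e + a" by blast
  show ?thesis
  proof (intro exI[of _ et] conjI et(1) ballI allI impI)
  fix t r x assume a: "t \<in> {0..T}" "(ALL y. w t y <= w t x + et) & th < w t x"
  hence "TA (w t) x + F <= e + a" using et by blast
  moreover have "0 <= lam * w t x" using lam th a by simp
  ultimately show "TA (w t) x - lam * w t x + F <= e + a" by linarith
  qed
  qed
 qed
 thus ?thesis by simp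
qed

lemma TA_near_max:
 assumes "bd M (g :: real^'d => real)" "g \<in> bm borel" "0 <= et" "!!y. g (x + y) <= g x + et"
  and S: "S \<in> sets borel" "!!y. y \<in> S ==> ep < norm y"
 shows "TA g x <= et * tmass TYPE('d::finite) + (LINT y:S|lborel. (g (x + y) - g x) * K / pk al y)"
proof -
 let ?F = "far al ep (%_. K) g x"
 have F: "integrable lborel ?F" by (rule TA_bd(1)[OF assms(2,1)])
 have iS: "integrable lborel (%y. indicator S y *. ?F y)" using F S by (intro integrable_mult_indicator) auto
 let ?D = "dom al ep 0 (et * K) :: real^'d => real"
 have D: "integrable lborel ?D" "integral\<^sup>L lborel ?D <= et * tmass TYPE('d)"
  using dom_integral[OF al(1) ep, of 0 "et * K", where 'd = 'd] assms(3) K by (auto simp: tmass_def alg)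
 have "TA g x <= (LINT y|lborel. indicator S y *. ?F y + ?D y)"
  unfolding TA_def
 proof (rule integral_mono)
  fix y
  show "?F y <= indicator S y *. ?F y + ?D y"
  proof (cases "y \<in> S | norm y <= ep")
  case True
  thus ?thesis using K assms(3) by (auto simp: far_def dom_def indicator_def)
  next
  case False
  have "(g (x + y) - g x) * K / pk al y <= et * K / pk al y"
  using assms(4)[of y] K by (intro divide_right_mono mrm) auto
  also have "... = et * K * y pw (- al - real CARD('d))" by (simp add: powr_diff powr_add powr_minus field_simps)
  finally show ?thesis using False by (simp add: far_def dom_def)
  qed
 qed (use F iS D in auto)
 also have "... = (LINT y|lborel. indicator S y *. ?F y) + integral\<^sup>L lborel ?D"
  using iS D by (intro Bochner_Integration.integral_add) auto
 also have "(LINT y|lborel. indicator S y *. ?F y) = (LINT y:S|lborel. (g (x + y) - g x) * K / pk al y)"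
  unfolding set_lebesgue_integral_def
  by (intro Bochner_Integration.integral_cong) (use S(2) in \<open>fastforce simp: far_def indicator_def\<close>)+
 finally show ?thesis using D by linarith
qed

lemma truncated_sup:
 fixes w :: "real => real^'d => real"
 assumes lam: "0 <= lam" and w: "!!t. t \<in> {0..T} ==> bd N (w t) & w t \<in> bm borel"
  and wg: "intf T (%t x. TA (w t) x - lam * w t x + f t x) w" and f: "!!t. t \<in> {0..T} ==> bd F (f t)" and t: "t \<in> {0..T}"
 shows "abs (w t x) <= F * t"
proof -
 define La where "La = tmass TYPE('d)"
 have La: "0 < La" by (simp add: La_def tmass_pos)
 have F: "0 <= F" using f[OF t] bd_nonneg by blast
 have up: "w t x <= F * t" if w: "!!t. t \<in> {0..T} ==> bd N (w t) & w t \<in> bm borel"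
  and wg: "intf T (%t x. TA (w t) x - lam * w t x + f t x) w" and f: "!!t. t \<in> {0..T} ==> bd F (f t)" for w f
 proof -
  have "w t x <= 0 + max F 0 * t"
  proof (rule truncated_max_principle[OF lam w wg _ _ _ order_refl t])
  show "abs (TA (w r) x - lam * w r x + f r x) <= 2 * N * La + lam * N + F" if "r \<in> {0..T}" for r x
  proof -
  have "abs (TA (w r) x) <= 2 * N * La" unfolding La_def using w[OF that] by (intro TA_bd) auto
  moreover have "abs (lam * w r x) <= lam * N" using w[OF that] bdD[of N "w r" x] lam by (simp add: abs_mult mlm)
  ultimately show ?thesis using bdD[OF f[OF that], of x] by simp
  qed
  show "TA (w r) x - lam * w r x + f r x <= TA (w r) x - lam * w r x + F" if "r \<in> {0..T}" for r x
  using bdD[OF f[OF that], of x] by simp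
  fix e :: real assume e: "e > 0"
  show "EX et>0. ALL t:{0..T}. ALL x. (ALL y. w t y <= w t x + et) & 0 < w t x --> TA (w t) x + F <= e + F"
  proof (intro exI[of _ "e / La"] conjI ballI allI impI)
  show p: "0 < e / La" using e La by simp
  fix t x assume t: "t \<in> {0..T}" and a: "(ALL y. w t y <= w t x + e / La) & 0 < w t x"
  show "TA (w t) x + F <= e + F"
  using TA_near_max[of N "w t" "e / La" x "{}"] w[OF t] a p La by (simp add: La_def set_lebesgue_integral_def)
  qed
  qed auto
  thus ?thesis using F by simp
 qed
 have "- w t x <= F * t"
 proof (rule up[of "%t x. - w t x" "%t x. - f t x"])
  show "bd N (%x. - w t x) & (%x. - w t x) \<in> bm borel" if "t \<in> {0..T}" for t
  using w[OF that] by (simp add: bd_def)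
  show "bd F (%x. - f t x)" if "t \<in> {0..T}" for t using f[OF that] by (simp add: bd_def)
  have n: "far al ep (%_. K) (%x. - v x) x = (%y. - far al ep (%_. K) v x y)" for v :: "real^'d => real" and x
  by (rule ext) (simp add: far_def diff_divide_distrib minus_divide_left left_diff_distrib)
  have "TA (%x. - v x) x = - TA v x" for v :: "real^'d => real" and x unfolding TA_def n by simp
  thus "intf T (%t x. TA (%x. - w t x) x - lam * - w t x + - f t x) (%t x. - w t x)"
  using intf_minus[OF wg] by (simp add: alg)
 qed
 thus ?thesis using up[OF w wg f] by (simp add: abs_le_iff)
qed

end

section \<open>Symmetrisation: the error of truncation in terms of second differences\<close>

lemma lborel_uminus: "distr lborel borel uminus = (lborel :: (real^'d) measure)"
proof -
 have "(lborel :: (real^'d) measure) = density (distr lborel borel (%x. 0 + (-1) *. x)) (%_. ennreal (abs (-1) ^ DIM(real^'d)))"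
  by (rule lborel_affine) simp
 thus ?thesis by (simp add: density_1)
qed

lemma integral_reflect:
 fixes f :: "real^'d => 'b::{banach, second_countable_topology}"
 assumes "f \<in> bm borel"
 shows "(LINT y|lborel. f (- y)) = (LINT y|lborel. f y)"
proof -
 have "(LINT y|lborel. f y) = (LINT y|distr lborel borel uminus. f y)"
  by (simp add: lborel_uminus)
 also have "... = (LINT y|lborel. f (- y))" by (rule integral_distr) (use assms in auto)
 finally show ?thesis by simp
qed

lemma integrable_reflect:
 fixes f :: "real^'d => real"
 assumes "integrable lborel f" shows "integrable lborel (%y. f (- y))"
proof -
 have [measurable]: "f \<in> bm borel" using assms by simp
 have "integrable (distr lborel borel uminus) f"
  using assms by (simp add: lborel_uminus)
 thus ?thesis by (subst (asm) integrable_distr_eq) auto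
qed

text \<open>For \<open>al = 1\<close> the moment condition holds by reflection, the kernel being
  even.\<close>

lemma const_kern:
 assumes "0 < K" shows "kern al K (%_::real^'d. K)"
 unfolding kern_def
proof (intro conjI impI ballI allI)
 fix r :: real
 let ?f = "%y::real^'d. indicator {y. r < norm y & norm y <= 1} y *. (K / pk al y) *. y"
 have "(LINT y|lborel. ?f (- y)) = (LINT y|lborel. ?f y)" by (rule integral_reflect) measurable
 moreover have "(LINT y|lborel. ?f (- y)) = (LINT y|lborel. - ?f y)"
  by (intro Bochner_Integration.integral_cong) (auto simp: indicator_def)
 ultimately have "(LINT y|lborel. ?f y) = - (LINT y|lborel. ?f y)" by simp
 hence "(LINT y|lborel. ?f y) = 0" by (simp add: eq_neg_iff_add_eq_0 flip: scaleR_2)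
 thus "(LINT y:{y::real^'d. r < norm y & norm y <= 1}|lborel. (K / pk al y) *. y) = 0"
  unfolding set_lebesgue_integral_def .
qed (use assms in auto)

text \<open>Pairing \<open>y\<close> with \<open>- y\<close> turns increments, compensated or not,
  into second differences. These may be of order \<open>al + ta\<close> where first differences are
  not, so removing a small ball from an even kernel costs only \<open>r powr ta\<close>, whatever
  \<open>al\<close> is.\<close>

lemma symmetric_small_part:
 fixes G :: "real^'d => real"
 assumes G: "integrable lborel G" and b: "!!y. abs (G y + G (- y)) <= dom ta r a 0 y" and "0 < ta" "0 < r" "0 <= a"
 shows "abs (integral\<^sup>L lborel G) <= kernel_const ta TYPE('d) * 2 powr ta * (a * r powr ta)"
proof -
 have Gr: "integrable lborel (%y. G (- y))" by (rule integrable_reflect[OF G])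
 have "2 * integral\<^sup>L lborel G = (LINT y|lborel. G y + G (- y))"
  using G Gr integral_reflect[of G] by (simp add: Bochner_Integration.integral_add)
 also have "abs (...) <= integral\<^sup>L lborel (dom ta r a 0 :: real^'d => real)"
  using G Gr assms by (intro integrable_dominated(2) dom_integral(1)) auto
 also have "... <= kernel_const ta TYPE('d) * 2 powr ta * (a * r powr ta)"
  using dom_integral(2)[of ta r a 0, where 'd = 'd] assms by simp
 finally show ?thesis by simp
qed

lemma second_difference_bound:
 fixes g :: "real^'d => real"
 assumes Z: "abs (df2 y g (x - y)) <= Q * y pw (al + ta)" and "0 < K" "0 <= Q"
 shows "abs ((g (x + y) + g (x - y) - 2 * g x) * K / pk al y) <= Q * K * y pw (ta - real CARD('d))"
proof -
 have "g (x + y) + g (x - y) - 2 * g x = df2 y g (x - y)" by (simp add: df_def)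
 hence "abs (g (x + y) + g (x - y) - 2 * g x) <= Q * y pw (al + ta)" using Z by simp
 from kern_div_bound[OF const_kern[OF assms(2), of al] this assms(3)] show ?thesis by simp
qed

text \<open>Only jumps in the shell between the cutoffs matter, hence only second differences with
  steps above the smaller cutoff; in that range the solutions of the truncated equation are
  controlled.\<close>

lemma TA_shell:
 fixes g :: "real^'d => real"
 assumes par: "0 < al" "al < 2" "0 < K" and e: "0 < ep'" "ep' <= ep" and ta: "0 < ta" and Q: "0 <= Q"
  and g: "bd M g" "g \<in> bm borel" and Z: "!!y x. ep' <= norm y ==> abs (df2 y g x) <= Q * y pw (al + ta)"
 shows "abs (TA al K ep' g x - TA al K ep g x) <= kernel_const ta TYPE('d) * 2 powr ta * (Q * K * ep powr ta)"
proof -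
 let ?a = "far al ep' (%_. K) g x" and ?b = "far al ep (%_. K) g x"
 have i: "integrable lborel ?a" "integrable lborel ?b" using e by (auto intro!: TA_bd(1)[OF par] g)
 have "abs (LINT y|lborel. ?a y - ?b y) <= kernel_const ta TYPE('d) * 2 powr ta * (Q * K * ep powr ta)"
 proof (rule symmetric_small_part)
  show "integrable lborel (%y. ?a y - ?b y)" using i by simp
  show "abs (?a y - ?b y + (?a (- y) - ?b (- y))) <= dom ta ep (Q * K) 0 y" for y
  proof (cases "ep' < norm y & norm y <= ep")
  case True
  hence "?a y - ?b y + (?a (- y) - ?b (- y)) = (g (x + y) + g (x - y) - 2 * g x) * K / pk al y"
  by (simp add: far_def alg add_divide_distrib diff_divide_distrib)
  thus ?thesis using second_difference_bound[OF Z[of y "x - y"] par(3) Q] True by (simp add: dom_def)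
  next
  case False
  thus ?thesis using e Q par by (auto simp: far_def dom_def)
  qed
 qed (use ta e Q par in auto)
 moreover have "0 < ep" using e by simp
 ultimately show ?thesis using i by (simp add: TA_def par e)
qed

lemma KI_TA:
 fixes g :: "real^'d => real"
 assumes par: "0 < al" "al < 2" "0 < K" and e: "0 < ep" and ta: "good_tau al ta" and Q: "0 <= Q"
  and g: "bd M g" "Zyg (al + ta) M g" and Z: "!!y x. abs (df2 y g x) <= Q * y pw (al + ta)"
 shows "abs (KI al (%_. K) g x - TA al K ep g x) <= kernel_const ta TYPE('d) * 2 powr ta * (Q * K * ep powr ta)"
proof -
 have t: "0 < ta" using ta by (simp add: good_tau_def)
 have gm: "g \<in> bm borel" using Zyg_continuous[OF g] t par by (intro borel_measurable_continuous_onI) auto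
 let ?a = "KF al (%_. K) g x" and ?b = "far al ep (%_. K) g x"
 have i: "integrable lborel ?a" "integrable lborel ?b"
  using KF_integrable[OF ta order_refl const_kern[OF par(3)] regI[OF g]] TA_bd(1)[OF par e gm g(1)] by auto
 have chi: "chi al (- y) = chi al y" for y :: "real^'d" by (simp add: chi_def)
 have "abs (LINT y|lborel. ?a y - ?b y) <= kernel_const ta TYPE('d) * 2 powr ta * (Q * K * ep powr ta)"
 proof (rule symmetric_small_part)
  show "integrable lborel (%y. ?a y - ?b y)" using i by simp
  show "abs (?a y - ?b y + (?a (- y) - ?b (- y))) <= dom ta ep (Q * K) 0 y" for y
  proof (cases "norm y <= ep")
  case True
  hence "?a y - ?b y + (?a (- y) - ?b (- y)) = (g (x + y) + g (x - y) - 2 * g x) * K / pk al y"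
  by (simp add: far_def KF_def chi alg add_divide_distrib diff_divide_distrib)
  thus ?thesis using second_difference_bound[OF Z[of y "x - y"] par(3) Q] True by (simp add: dom_def)
  next
  case False
  hence "?a y - ?b y + (?a (- y) - ?b (- y)) = 0"
  by (simp add: far_def KF_def chi alg add_divide_distrib diff_divide_distrib)
  thus ?thesis using False by (simp add: dom_def)
  qed
 qed (use t e Q par in auto)
 thus ?thesis using i by (simp add: TA_def KI_def par e)
qed

lemma TA_df3:
 fixes g :: "real^'d => real"
 assumes par: "0 < al" "al < 2" "0 < K" "0 < ep" and g: "bd M g" "g \<in> bm borel"
 shows "df3 h (TA al K ep g) x = TA al K ep (df3 h g) x"
proof -
 have e: "df h (TA al K ep v) = TA al K ep (df h v)" if "bd N v" "v \<in> bm borel" for v :: "real^'d => real" and N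
  by (rule ext) (rule TA_df[OF par that(2,1)])
 show ?thesis using g by (simp add: e[OF g] e[OF bd_df[OF g(1)]] e[OF bd_df2[OF g(1)]] df_measurable[OF par])
qed

text \<open>The argument of \<open>schauder_improve\<close> without commutators, as a constant
  kernel commutes with differences. The jumps used in \<open>cone_gain\<close> are longer than
  \<open>|h|\<close>, so they survive the truncation when \<open>|h| >= ep\<close>, and the
  auxiliary step \<open>n h\<close> is at least as long as \<open>h\<close>. The constant does not
  see \<open>ep\<close>, and no smoothness of the solution is presupposed: regularity is produced
  here.\<close>

lemma truncated_regular:
 assumes al: "0 < al" "al < 2" and be: "0 < be" "be <= 1" and K: "0 < K"
 shows "EX C>0. ALL ep T lam f F (u::real => real^'d => real) M. 0 < ep & 0 <= lam & meas T u &
  intf T (%t x. TA al K ep (u t) x - lam * u t x + f t x) u & (ALL t:{0..T}. bd M (u t) & hol be F (f t)) -->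
  (ALL t:{0..T}. ALL h x. ep <= norm h --> abs (df3 h (u t) x) <= C * F * h pw (al + be))"
proof -
 define s where "s = al + be"
 have s: "0 < s" "s < 3" using al be by (auto simp: s_def)
 show ?thesis
 proof (insert cone_gain[OF s al(1) K zero_less_one order_refl K, where 'd = 'd], elim exE conjE, goal_cases)
 case (1 n ka C3)
 note npos = 1(1) and ka = 1(2-3) and cone0 = 1(4)
 note cone = cone0[THEN spec, THEN spec, THEN spec, THEN spec, THEN spec, THEN spec, THEN spec, THEN spec, THEN mp]
 define A where "A = 2 / ka"
 have A: "0 < A" using ka by (simp add: A_def)
 show ?thesis
 proof (rule exI[of _ A], rule conjI[OF A], intro allI impI ballI)
  fix ep T lam F M :: real and f u :: "real => real^'d => real" and t1 and h1 x1 :: "real^'d"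
  assume a: "0 < ep & 0 <= lam & meas T u &
  intf T (%t x. TA al K ep (u t) x - lam * u t x + f t x) u & (ALL t:{0..T}. bd M (u t) & hol be F (f t))"
  and t1: "t1 \<in> {0..T}" and h1: "ep <= norm h1"
  hence e: "0 < ep" and lam: "0 <= lam" and sol: "intf T (%t x. TA al K ep (u t) x - lam * u t x + f t x) u"
  and ub: "!!t. t \<in> {0..T} ==> bd M (u t)" and f: "!!t. t \<in> {0..T} ==> hol be F (f t)"
  and um: "!!t. t \<in> {0..T} ==> u t \<in> bm borel" using meas_section by auto
  define La where "La = tmass al K ep TYPE('d)"
  have La: "0 < La" using tmass_pos[OF al K e] by (simp add: La_def)
  have F: "0 <= F" using f[OF t1] hol_nonneg by blast
  have M: "0 <= M" using ub[OF t1] bd_nonneg by blast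
  have improve: "df3 h (u t1) x1 <= max (3/4 * N) (A * F) * h pw s"
  if QN: "!!t h x. t \<in> {0..T} ==> ep <= norm h ==> abs (df3 h (u t) x) <= N * h pw s"
  and h: "ep <= norm h" and t1: "t1 \<in> {0..T}" for N h x1 t1
  proof (rule ccontr)
  define N' where "N' = max (3/4 * N) (A * F)"
  assume neg: "~ df3 h (u t1) x1 <= max (3/4 * N) (A * F) * h pw s"
  have h0: "h ~= 0" using h e by auto
  hence hs: "0 < h pw s" by simp
  have N': "A * F <= N'" "3/4 * N <= N'" "0 <= N'" using mult_nonneg_nonneg[OF less_imp_le[OF A] F] by (auto simp: N'_def le_max_iff_disj)
  have "N' * h pw s < N * h pw s" using neg QN[OF t1 h, of x1] unfolding N'_def by linarith
  hence NN: "N' < N" using hs by simp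
  hence Npos: "0 < N" using N' by linarith
  define w where "w t = df3 h (u t)" for t
  have w: "bd (8 * M) (w t) & w t \<in> bm borel" if "t \<in> {0..T}" for t
  unfolding w_def using ub[OF that] um[OF that] by (auto intro!: bd_df3 df_measurable[OF al K e])
  have f3: "abs (df3 h (f t) x) <= 2 * F * h pw be" if "t \<in> {0..T}" for t x
  proof -
  have "abs (df2 h (f t) x) <= F * h pw be" for x using f[OF that] by (simp add: hol_def)
  from this[of x] this[of "x + h"] show ?thesis unfolding df_def[of h "df2 h (f t)"] by linarith
  qed
  define g where "g t = df3 h (%x. TA al K ep (u t) x - lam * u t x + f t x)" for t
  have wg: "intf T g w" unfolding g_def w_def by (intro intf_df sol)
  have gsplit: "g t x = TA al K ep (w t) x - lam * w t x + df3 h (f t) x" if "t \<in> {0..T}" for t x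
  unfolding g_def w_def df_add df_diff df_cmult TA_df3[OF al K e ub[OF that] um[OF that]] by simp
  define a where "a = 2 * F * h pw be - ka * N * h pw be"
  define th where "th = 1/2 * N * h pw s"
  have aa: "0 < a"
  proof (rule ccontr)
  assume "~ 0 < a"
  hence a0: "max a 0 = 0" by simp
  have "w t1 x1 <= th + max a 0 * t1"
  proof (rule truncated_max_principle[OF al K e lam w wg _ _ _ _ t1])
  show "0 <= th" using Npos by (simp add: th_def)
  show "abs (g t x) <= 2 * (8 * M) * La + lam * (8 * M) + 2 * F * h pw be" if t: "t \<in> {0..T}" for t x
  proof -
  have "abs (TA al K ep (w t) x) <= 2 * (8 * M) * La" unfolding La_def using w[OF t] by (intro TA_bd[OF al K e]) auto
  moreover have "abs (lam * w t x) <= lam * (8 * M)" using w[OF t] bdD[of "8 * M" "w t" x] lam by (simp add: abs_mult mlm)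
  ultimately show ?thesis using gsplit[OF t, of x] f3[OF t, of x] by linarith
  qed
  show "g t x <= TA al K ep (w t) x - lam * w t x + 2 * F * h pw be" if t: "t \<in> {0..T}" for t x
  using gsplit[OF t, of x] f3[OF t, of x] by linarith
  fix e' :: real assume e': "e' > 0"
  define D where "D = La + C3 * h pw (- al)"
  have D: "0 < D" using La ka by (simp add: D_def add_pos_nonneg)
  define et where "et = e' / D"
  have et: "0 < et" "et * D = e'" using e' D by (auto simp: et_def)
  show "EX et>0. ALL t:{0..T}. ALL x. (ALL y. w t y <= w t x + et) & th < w t x -->
  TA al K ep (w t) x + 2 * F * h pw be <= e' + a"
  proof (intro exI[of _ et] conjI et(1) ballI allI impI)
  fix t x assume t: "t \<in> {0..T}" and ass: "(ALL y. w t y <= w t x + et) & th < w t x"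
  obtain v :: "real^'d" where v: "norm v = 1" using vector_choose_size[of 1] by auto
  have nh: "ep <= norm (real n *. h)"
  proof -
  have "1 * norm h <= real n * norm h" using npos by (intro mrm) auto
  thus ?thesis using h by simp
  qed
  have "EX S:sets borel. (ALL y:S. norm h < norm y) &
  (LINT y:S|lborel. (w t (x + y) - w t x) * K / pk al y)
  <= - ka * N * h pw (s - al) + C3 * et * h pw (- al)"
  unfolding w_def
  proof (rule cone[of N h M "u t" x et v "%_. K"], intro conjI allI impI)
  show "abs (df3 (real n *. h) (u t) z) <= N * norm (real n *. h) powr s" for z
  by (rule QN[OF t nh])
  show "1/2 * N * h pw s <= df3 h (u t) x" using ass by (simp add: w_def th_def)
  show "df3 h (u t) (x + y) <= df3 h (u t) x + et" for y using ass by (simp add: w_def)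
  qed (use Npos h0 ub[OF t] um[OF t] npos et v K const_kern[OF K] in auto)
  then obtain S where S: "S \<in> sets borel" "ALL y:S. norm h < norm y"
  "(LINT y:S|lborel. (w t (x + y) - w t x) * K / pk al y)
  <= - ka * N * h pw (s - al) + C3 * et * h pw (- al)" by blast
  have "TA al K ep (w t) x <= et * La + (LINT y:S|lborel. (w t (x + y) - w t x) * K / pk al y)"
  unfolding La_def using w[OF t] ass et S h by (intro TA_near_max[OF al K e]) auto
  moreover have "s - al = be" by (simp add: s_def)
  moreover have "et * La + C3 * et * h pw (- al) = e'" using et(2) by (simp add: D_def alg)
  ultimately show "TA al K ep (w t) x + 2 * F * h pw be <= e' + a" using S(3) unfolding a_def by simp
  qed
  qed
  hence "df3 h (u t1) x1 <= 1/2 * N * h pw s" unfolding a0 by (simp add: w_def th_def)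
  also have "... <= N' * h pw s" using N' Npos by (intro mrm) auto
  finally show False using neg unfolding N'_def by blast
  qed
  have hb: "0 < h pw be" using h0 by simp
  have "ka * N * h pw be < 2 * F * h pw be" using aa by (simp add: a_def)
  hence "ka * N < 2 * F" using hb by simp
  hence "N < A * F" using ka by (simp add: A_def field_simps)
  thus False using NN N' by linarith
  qed
  \<comment> \<open>Start of the iteration: for \<open>|h| >= ep\<close> the trivial bound
    \<open>8 * M\<close> is at most \<open>N0 |h|^s\<close>. It blows up as \<open>ep\<close> tends
    to zero, but disappears as the iteration proceeds.\<close>
  define N0 where "N0 = 8 * M * ep powr (- s)"
  have it: "ALL t:{0..T}. ALL h x. ep <= norm h --> abs (df3 h (u t) x) <= max ((3/4) ^ k * N0) (A * F) * h pw s" for k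
  proof (induction k)
  case 0
  show ?case
  proof (intro ballI allI impI)
  fix t and h x :: "real^'d" assume t: "t \<in> {0..T}" and h: "ep <= norm h"
  have "abs (df3 h (u t) x) <= 8 * M * (ep powr (- s) * ep powr s)"
  using bdD[OF bd_df3[OF ub[OF t]], of h h h x] e by (simp flip: powr_add)
  also have "... <= 8 * M * (ep powr (- s) * h pw s)"
  using M h e s by (intro mlm powr_mono2) auto
  also have "... = N0 * h pw s" by (simp add: N0_def)
  also have "... <= max ((3/4) ^ 0 * N0) (A * F) * h pw s" by (intro mrm) auto
  finally show "abs (df3 h (u t) x) <= max ((3/4) ^ 0 * N0) (A * F) * h pw s" .
  qed
  next
  case (Suc k)
  have AF: "0 <= A * F" using A F by simp
  have mm: "max (3/4 * max ((3/4) ^ k * N0) (A * F)) (A * F) = max ((3/4) ^ Suc k * N0) (A * F)"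
  using AF by (auto simp: max_def)
  show ?case
  proof (intro ballI allI impI)
  fix t and h x :: "real^'d" assume t: "t \<in> {0..T}" and h: "ep <= norm h"
  have *: "df3 h (u t) x <= max ((3/4) ^ Suc k * N0) (A * F) * h pw s" if "ep <= norm h" for h x
  unfolding mm[symmetric] by (rule improve) (use Suc t that in auto)
  show "abs (df3 h (u t) x) <= max ((3/4) ^ Suc k * N0) (A * F) * h pw s"
  using *[OF h, of x] *[of "- h" "x + h + h + h"] h df3_reverse[of h "u t" x] by (simp add: abs_le_iff)
  qed
  qed
  have "(%k. max ((3/4) ^ k * N0) (A * F) * h1 pw s) ~~> max (0 * N0) (A * F) * h1 pw s"
  by (intro tendsto_intros LIMSEQ_realpow_zero) auto
  moreover have "max (0 * N0) (A * F) = A * F" using A F by simp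
  ultimately show "abs (df3 h1 (u t1) x1) <= A * F * h1 pw (al + be)"
  using LIMSEQ_le_const[of "%k. max ((3/4) ^ k * N0) (A * F) * h1 pw s" _ "abs (df3 h1 (u t1) x1)"] it t1 h1
  by (auto simp: s_def)
 qed
 qed
qed

section \<open>The constant kernel\<close>

lemma Lop_const: "Lop al (%_ _ _. K) (%_ _. 0) (%_ _ _. 0) t u x = KI al (%_. K) u x"
 by (simp add: Lop_def GI_def)

lemma df3_tendsto:
 fixes u :: "nat => real^'d => real"
 assumes "!!x. (%n. u n x) ~~> v x"
 shows "(%n. df3 h (u n) x) ~~> df3 h v x"
 unfolding df_def by (intro tendsto_intros assms)

lemma intf_cong:
 assumes "intf T g u" "!!s x. s \<in> {0..T} ==> g' s x = g s x" shows "intf T g' u"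
 unfolding intf_def
proof (intro ballI allI)
 fix t x assume t: "t \<in> {0..T}"
 have e: "indicator {0..t} s *. g' s x = indicator {0..t} s *. g s x" for s
  using assms(2)[of s x] t by (auto simp: indicator_def)
 show "set_integrable lborel {0..t} (%s. g' s x) & u t x = (LINT s:{0..t}|lborel. g' s x)"
  using assms(1) t unfolding intf_def set_integrable_def set_lebesgue_integral_def e by blast
qed

text \<open>Solutions \<open>U n\<close> with cutoff \<open>2^(-n)\<close> converge geometrically:
  consecutive ones differ by a solution of a truncated equation whose forcing, the contribution of
  one shell, is of size \<open>2^(-n ta)\<close>. Bounds on third differences above the cutoff
  extend to all steps in the limit.\<close>

lemma base_solution_exists:
 fixes f :: "real => real^'d => real"
 assumes par: "pars al be ta" and K: "0 < K" and T: "0 < T" and lam: "0 <= lam"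
  and f: "meas T f" "!!t. t \<in> {0..T} ==> hol be F (f t)"
 shows "EX u. meas T u & csol T al (al + be) (%_ _ _. K) (%_ _. 0) (%_ _ _. 0) lam f u"
proof -
 have ta: "good_tau al ta" and be: "0 < be" "be <= 1" "4 * ta <= be" using par by (auto simp: pars_def)
 have t: "0 < ta" "ta < al" "al + ta < 2" "al + ta <= al + be" and al: "0 < al" "al < 2" using ta be by (auto simp: good_tau_def)
 have F: "0 <= F" using f(2)[of 0] T hol_nonneg by auto
 have fb: "bd F (f s)" if "s \<in> {0..T}" for s using f(2)[OF that] by (simp add: hol_def)
 define ep where "ep n = (2::real) powr (- real n)" for n
 have ep: "0 < ep n" "ep (Suc n) <= ep n" for n by (auto simp: ep_def)
 define q where "q = (2::real) powr (- ta)"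
 have q: "0 < q" "q < 1" using t by (auto simp: q_def powr_less_one)
 have eq: "ep n powr ta = q ^ n" for n by (simp add: ep_def q_def powr_powr powr_power mult.commute)
 define P where "P n u \<longleftrightarrow> meas T u & (EX M. ALL s:{0..T}. bd M (u s)) & intf T (%s x. TA al K (ep n) (u s) x - lam * u s x + f s x) u" for n u
 have "ALL n. EX u. P n u"
  using truncated_solution_exists[OF al K ep(1) f(1) fb less_imp_le[OF T] lam] unfolding P_def by blast
 then obtain U where U: "ALL n. P n (U n)" by (rule choice[THEN exE])
 hence Um: "!!n. meas T (U n)" and UM: "!!n. EX M. ALL s:{0..T}. bd M (U n s)"
  and UI: "!!n. intf T (%s x. TA al K (ep n) (U n s) x - lam * U n s x + f s x) (U n)" unfolding P_def by blast+
 have Ub: "U n s \<in> bm borel" if "s \<in> {0..T}" for n s by (rule meas_section[OF Um that])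
 define M where "M = F * T"
 have M: "0 <= M" using F T by (simp add: M_def)
 have UM': "bd M (U n s)" if s: "s \<in> {0..T}" for n s
  unfolding bd_def
 proof
  fix x
  obtain M' where "!!s. s \<in> {0..T} ==> bd M' (U n s) & U n s \<in> bm borel" using UM Ub by meson
  hence "abs (U n s x) <= F * s" by (rule truncated_sup[OF al K ep(1) lam _ UI fb s])
  also have "... <= M" unfolding M_def using s F by (intro mlm) auto
  finally show "norm (U n s x) <= M" by simp
 qed
 show ?thesis
 proof (insert truncated_regular[OF al be(1,2) K, where 'd = 'd], elim exE conjE, goal_cases)
 case (1 C)
 note C = 1(1) and reg = 1(2)[rule_format]
 have U3: "abs (df3 h (U n s) x) <= C * F * h pw (al + be)" if "s \<in> {0..T}" "ep n <= norm h" for n s h x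
  using reg[of "ep n" lam T "U n" f M F] ep(1)[of n] lam Um[of n] UI[of n] UM' f(2) that by blast
 define N1 where "N1 = C * F + 8 * M"
 have N1: "0 <= N1" using C F M by (simp add: N1_def)
 define Q where "Q = marchaud2 (al + ta) * N1"
 have Q: "0 <= Q" using N1 marchaud2_pos[OF t(3)] by (simp add: Q_def)
 \<comment> \<open>The scale-restricted Marchaud inequality respects the cutoff: second differences
   are bounded, uniformly in \<open>n\<close>, at steps above \<open>ep n\<close>.\<close>
 have U2: "abs (df2 y (U n s) x) <= Q * y pw (al + ta)" if s: "s \<in> {0..T}" and y: "ep n <= norm y" for n s y x
 proof -
  have "norm (df3 h (U n s) x) <= N1 * h pw (al + ta)" if h: "ep n <= norm h" for h x
  proof (cases "norm h <= 1")
  case True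
  have "abs (df3 h (U n s) x) <= C * F * h pw (al + be)" by (rule U3[OF s h])
  also have "... <= C * F * h pw (al + ta)"
  using C F True t ep(1)[of n] h by (intro mlm powr_mono') auto
  also have "... <= N1 * h pw (al + ta)" using M by (intro mrm) (auto simp: N1_def)
  finally show ?thesis by simp
  next
  case False
  have "abs (df3 h (U n s) x) <= 8 * M * 1" using bdD[OF bd_df3[OF UM'[OF s]], of h h h n x] by simp
  also have "... <= 8 * M * h pw (al + ta)"
  using False t al M by (intro mlm ge_one_powr_ge_zero) auto
  also have "... <= N1 * h pw (al + ta)" using C F by (intro mrm) (auto simp: N1_def)
  finally show ?thesis by simp
  qed
  from df2_bound_scale[OF UM'[OF s] this N1 t(3) y] show ?thesis by (simp add: Q_def)
 qed
 define c0 where "c0 = kernel_const ta TYPE('d) * 2 powr ta"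
 have c0: "0 < c0" unfolding c0_def using kernel_const_pos[OF t(1), where 'd = 'd] by simp
 define A where "A = c0 * (Q * K) * T"
 have A: "0 <= A" using c0 Q K T by (simp add: A_def)
 have W: "abs (U (Suc n) s x - U n s x) <= A * q ^ n" if s: "s \<in> {0..T}" for n s x
 proof -
  let ?W = "%s x. U (Suc n) s x + (- 1) * U n s x"
  let ?R = "%s x. TA al K (ep (Suc n)) (U (Suc n) s) x - TA al K (ep n) (U (Suc n) s) x"
  have Wm: "bd (2 * M) (?W s) & ?W s \<in> bm borel" if "s \<in> {0..T}" for s
  proof
  show "bd (2 * M) (?W s)" using bd_diff[OF UM'[OF that] UM'[OF that], of "Suc n" n] by (simp add: alg)
  show "?W s \<in> bm borel" using Ub[OF that] by (intro borel_measurable_add borel_measurable_times borel_measurable_const)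
  qed
  have R: "bd (c0 * (Q * K) * q ^ n) (?R s)" if "s \<in> {0..T}" for s
  unfolding bd_def
  using TA_shell[OF al K ep(1) ep(2) t(1) Q UM'[OF that] Ub[OF that] U2[OF that]] by (simp add: c0_def eq alg)
  have tw: "TA al K (ep n) (?W s) x = TA al K (ep n) (U (Suc n) s) x + (- 1) * TA al K (ep n) (U n s) x" if "s \<in> {0..T}" for s x
  by (rule TA_lin[OF al K ep(1) Ub[OF that] UM'[OF that] Ub[OF that] UM'[OF that]])
  have "intf T (%s x. TA al K (ep n) (?W s) x - lam * ?W s x + ?R s x) ?W"
  proof (rule intf_cong[OF intf_lin[OF UI UI, of "Suc n" "- 1" n]])
  fix s x assume "s \<in> {0..T}"
  thus "TA al K (ep n) (?W s) x - lam * ?W s x + ?R s x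
  = (TA al K (ep (Suc n)) (U (Suc n) s) x - lam * U (Suc n) s x + f s x) + (- 1) * (TA al K (ep n) (U n s) x - lam * U n s x + f s x)"
  unfolding tw[OF \<open>s \<in> {0..T}\<close>] by (simp add: alg)
  qed
  from truncated_sup[OF al K ep(1) lam Wm this R s, of x]
  have "abs (?W s x) <= c0 * (Q * K) * q ^ n * s" .
  also have "... <= c0 * (Q * K) * q ^ n * T" using s c0 Q K q by (intro mlm) auto
  finally show ?thesis by (simp add: A_def alg)
 qed
 define u where "u s x = lim (%n. U n s x)" for s x
 define A' where "A' = A / (1 - q)"
 have A': "0 <= A'" using A q by (simp add: A'_def)
 have lim: "(%n. U n s x) ~~> u s x" "abs (u s x - U n s x) <= A' * q ^ n" if "s \<in> {0..T}" for s x n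
  using geometric_limit[of "%n. U n s x" A q] W[OF that] q unfolding u_def A'_def by auto
 have um: "meas T u" by (rule meas_limit[OF Um lim(1)])
 have ub: "bd M (u s)" if "s \<in> {0..T}" for s
  unfolding bd_def
 proof
  fix x
  have "ALL n. abs (U n s x) <= M" using bdD[OF UM'[OF that]] by simp
  thus "norm (u s x) <= M" using LIMSEQ_le_const2[OF tendsto_rabs[OF lim(1)[OF that, of x]], of M] by auto
 qed
 have uZ: "Zyg (al + be) (C * F) (u s)" if s: "s \<in> {0..T}" for s
  unfolding Zyg_def
 proof (intro conjI allI)
  show "0 <= C * F" using C F by simp
  fix h x
  show "norm (df3 h (u s) x) <= C * F * h pw (al + be)"
  proof (cases "h = 0")
  case False
  have "ep = (%n. (1/2) ^ n)" by (rule ext) (simp add: ep_def powr_minus powr_realpow power_one_over inverse_eq_divide)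
  moreover have "(%n. (1/2::real) ^ n) ~~> 0" by (intro LIMSEQ_realpow_zero) auto
  ultimately have "ep ~~> 0" by simp
  hence "eventually (%n. ep n < norm h) sequentially" using False by (intro order_tendstoD) auto
  hence "eventually (%n. abs (df3 h (U n s) x) <= C * F * h pw (al + be)) sequentially"
  by eventually_elim (use U3[OF s] in auto)
  moreover have "(%n. abs (df3 h (U n s) x)) ~~> abs (df3 h (u s) x)"
  by (intro tendsto_rabs df3_tendsto lim(1)[OF s])
  ultimately show ?thesis using tendsto_upperbound[OF _ _ sequentially_bot] by auto
  qed simp
 qed
 have uZt: "Zyg (al + ta) N1 (u s)" if s: "s \<in> {0..T}" for s
  using Zyg_interp[OF ub[OF s] uZ[OF s], of "al + ta" 1] t al by (simp add: N1_def)
 have u2: "abs (df2 y (u s) x) <= Q * y pw (al + ta)" if "s \<in> {0..T}" for s y x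
  using df2_bound[OF ub[OF that] uZt[OF that] t(3), of y x] by (simp add: Q_def)
 \<comment> \<open>An intermediate radius for the passage to the limit in the operator. Jumps
   between \<open>ep n\<close> and \<open>r n\<close> are controlled by second differences and cost
   \<open>r n powr ta\<close>; longer ones cost the sup distance \<open>q ^ n\<close> times the mass
   \<open>r n powr (- al)\<close>. With this exponent the latter product is
   \<open>2^(-n ta/2)\<close>.\<close>
 define r where "r n = (2::real) powr (- (real n * (ta / (2 * al))))" for n
 have r: "0 < r n" "ep n <= r n" for n
 proof -
  have "real n * (ta / (2 * al)) <= real n * 1" using t al by (intro mlm) (auto simp: field_simps)
  thus "ep n <= r n" by (simp add: r_def ep_def)
 qed (simp add: r_def)
 define c1 where "c1 = kernel_const al TYPE('d) * 2 powr al * K"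
 define e where "e n = c0 * (2 * Q * K * r n powr ta) + 2 * (A' * q ^ n) * (c1 * r n powr (- al)) + c0 * (Q * K * q ^ n)" for n
 have err: "abs (TA al K (ep n) (U n s) x - KI al (%_. K) (u s) x) <= e n" if s: "s \<in> {0..T}" for n s x
 proof -
  let ?v = "%x. U n s x + (- 1) * u s x"
  have usm: "u s \<in> bm borel" by (rule meas_section[OF um s])
  have vm: "?v \<in> bm borel" using Ub[OF s] usm by (intro borel_measurable_add borel_measurable_times borel_measurable_const)
  have vb: "bd (A' * q ^ n) ?v" unfolding bd_def using lim(2)[OF s] by (simp add: abs_minus_commute)
  have v2: "abs (df2 y ?v x) <= 2 * Q * y pw (al + ta)" if "ep n <= norm y" for y x
  unfolding df_add df_cmult using U2[OF s that, of x] u2[OF s, of y x] by linarith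
  have "0 <= 2 * Q" using Q by simp
  from TA_shell[where x = x, OF al K ep(1)[of n] r(2)[of n] t(1) this vb vm v2]
  have 1: "abs (TA al K (ep n) ?v x - TA al K (r n) ?v x) <= c0 * (2 * Q * K * r n powr ta)" by (simp add: c0_def)
  have 2: "abs (TA al K (r n) ?v x) <= 2 * (A' * q ^ n) * (c1 * r n powr (- al))"
  using TA_bd(2)[where x = x, OF al K r(1)[of n] vm vb] by (simp add: tmass_def[OF al K r(1)] c1_def alg)
  have "Zyg (al + ta) (max M N1) (u s)" "bd (max M N1) (u s)" using uZt[OF s] ub[OF s] by (auto intro: Zyg_mono bd_mono)
  from KI_TA[where x = x, OF al K ep(1)[of n] ta Q this(2,1) u2[OF s]]
  have 3: "abs (KI al (%_. K) (u s) x - TA al K (ep n) (u s) x) <= c0 * (Q * K * q ^ n)" by (simp add: c0_def eq)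
  have "TA al K (ep n) ?v x = TA al K (ep n) (U n s) x + (- 1) * TA al K (ep n) (u s) x"
  by (rule TA_lin[OF al K ep(1) Ub[OF s] UM'[OF s] usm ub[OF s]])
  thus ?thesis using 1 2 3 unfolding e_def by linarith
 qed
 have "e ~~> 0"
 proof -
  have "r n powr ta = (2 powr (- (ta * ta / (2 * al)))) ^ n" for n
  by (simp add: r_def powr_powr powr_power alg)
  moreover have "q ^ n * r n powr (- al) = (2 powr (- (ta / 2))) ^ n" for n
  using al by (simp add: r_def q_def powr_powr powr_power alg flip: powr_add)
  ultimately have en: "e = (%n. c0 * (2 * Q * K) * (2 powr (- (ta * ta / (2 * al)))) ^ n + 2 * A' * c1 * (2 powr (- (ta / 2))) ^ n + c0 * (Q * K) * q ^ n)"
  by (intro ext) (simp add: e_def alg)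
  have "(%n. c0 * (2 * Q * K) * (2 powr (- (ta * ta / (2 * al)))) ^ n + 2 * A' * c1 * (2 powr (- (ta / 2))) ^ n + c0 * (Q * K) * q ^ n) ~~> 0 + 0 + 0"
  using t al q by (intro tendsto_add tendsto_mult_right_zero LIMSEQ_realpow_zero) (auto simp: powr_less_one)
  thus ?thesis unfolding en by simp
 qed
 hence e0: "(%n. e n + lam * (A' * q ^ n)) ~~> 0"
  using q by (intro tendsto_add_zero tendsto_mult_right_zero LIMSEQ_realpow_zero) auto
 let ?g = "%s x. KI al (%_. K) (u s) x - lam * u s x + f s x"
 have ge: "abs (TA al K (ep n) (U n s) x - lam * U n s x + f s x - ?g s x) <= e n + lam * (A' * q ^ n)" if s: "s \<in> {0..T}" for n s x
 proof -
  have "abs (lam * (u s x - U n s x)) <= lam * (A' * q ^ n)" using lim(2)[OF s] lam by (simp add: abs_mult mlm)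
  thus ?thesis using err[OF s, of n x] by (simp add: alg)
 qed
 have gm: "meas T ?g"
 proof (rule meas_limit[where u = "%n s x. (TA al K (ep n) (U n s) x + (- lam) * U n s x) + 1 * f s x"])
  show "meas T (%s x. (TA al K (ep n) (U n s) x + (- lam) * U n s x) + 1 * f s x)" for n
  by (rule meas_lin[OF meas_lin[OF meas_TA[OF al K ep(1) Um] Um] f(1)])
  fix s x assume s: "s \<in> {0..T}"
  have "(%n. TA al K (ep n) (U n s) x - lam * U n s x + f s x - ?g s x) ~~> 0"
  by (rule Lim_null_comparison[OF _ e0]) (use ge[OF s] in auto)
  hence "(%n. TA al K (ep n) (U n s) x - lam * U n s x + f s x) ~~> ?g s x" by (rule LIM_zero_cancel)
  thus "(%n. (TA al K (ep n) (U n s) x + (- lam) * U n s x) + 1 * f s x) ~~> ?g s x" by simp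
 qed
 obtain Ck where Ck: "!!K k (g::real^'d => real) Q x. kern al K k & low (al + ta) Q g ==> abs (KI al k g x) <= Ck * K * Q"
  using KI_bound[OF ta, where 'd = 'd] by meson
 have gb: "abs (?g s x) <= Ck * K * (9 * max M (C * F)) + lam * M + F" if s: "s \<in> {0..T}" for s x
 proof -
  have "low (al + ta) (9 * max M (C * F)) (u s)"
  using ub[OF s] uZ[OF s] t al by (intro low_Zyg1[of _ _ "al + be"]) (auto intro: bd_mono Zyg_mono)
  hence "abs (KI al (%_. K) (u s) x) <= Ck * K * (9 * max M (C * F))" using Ck const_kern[OF K] by blast
  moreover have "abs (lam * u s x) <= lam * M" using bdD[OF ub[OF s], of x] lam by (simp add: abs_mult mlm)
  ultimately show ?thesis using bdD[OF fb[OF s], of x] by simp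
 qed
 have "intf T ?g u" by (rule intf_limit[OF UI gm gb ge e0 lim(1)])
 moreover have "bd (max M (C * F)) (u s) & Zyg (al + be) (max M (C * F)) (u s)" if "s \<in> {0..T}" for s
  using ub[OF that] uZ[OF that] by (auto intro: bd_mono Zyg_mono)
 ultimately show ?thesis using um unfolding csol_def Lop_const by blast
 qed
qed

section \<open>The method of continuity\<close>

lemma meas_pdiff:
 assumes u: "meas T u" and d: "!!t x. t \<in> {0..T} ==> (u t has_derivative (%y. grad (u t) x \<bullet> y)) (at x)"
 shows "meas T (%t x. pdiff i (u t) x)"
proof (rule meas_limit[where u = "%n t x. real (Suc n) * (u t (x + (1 / real (Suc n)) *. axis i 1) - u t x)"])
 fix n
 show "meas T (%t x. real (Suc n) * (u t (x + (1 / real (Suc n)) *. axis i 1) - u t x))"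
  by (intro measI borel_measurable_times borel_measurable_diff borel_measurable_const meas_comp[OF u])
  (auto simp: space_strip)
next
 fix t x assume t: "t \<in> {0..T}"
 let ?e = "axis i 1 :: real^'a"
 have "((%r. u t (x + r *. ?e)) has_derivative (%r. grad (u t) x \<bullet> (0 + r *. ?e))) (at 0)"
  by (rule has_derivative_compose[of "%r. x + r *. ?e" _ 0 _ "u t", simplified])
  (use d[OF t, of x] in \<open>auto intro!: derivative_eq_intros\<close>)
 hence "((%r. u t (x + r *. ?e)) has_real_derivative (pdiff i (u t) x)) (at 0)"
  by (simp add: has_field_derivative_def inner_axis grad_def mult_commute_abs)
 hence l: "((%h. (u t (x + h *. ?e) - u t x) / h) \<longlongrightarrow> pdiff i (u t) x) (at 0)"
  by (simp add: DERIV_def)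
 have "filterlim (%n. 1 / real (Suc n)) (at 0) sequentially"
  unfolding filterlim_at using LIMSEQ_inverse_real_of_nat by (auto simp: inverse_eq_divide)
 from filterlim_compose[OF l this]
 show "(%n. real (Suc n) * (u t (x + (1 / real (Suc n)) *. ?e) - u t x)) ~~> pdiff i (u t) x"
  by (simp add: mult.commute)
qed

lemma meas_grad:
 fixes u :: "real => real^'d => real"
 assumes u: "meas T u" and r: "!!t. t \<in> {0..T} ==> reg s (u t)" and s: "1 < s"
 shows "meas T (%t. grad (u t))"
proof (rule measI)
 have e: "grad v x = (\<Sum>i\<in>UNIV. pdiff i v x *. axis i 1)" for v :: "real^'d => real" and x
  by (simp add: grad_def vec_eq_iff axis_def if_distrib cong: if_cong)
 show "(%p. grad (u (fst p)) (snd p)) \<in> bm (restrict_space borel (strip T))"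
  unfolding e using r s
  by (intro borel_measurable_sum borel_measurable_scaleR borel_measurable_const measD[OF meas_pdiff[OF u]] reg_grad) auto
qed

definition kmeas :: "real => (real => real^'d => real^'d => real) => bool" where
 "kmeas T m \<longleftrightarrow> (%(p, y). if y = 0 then 0 else m (fst p) (snd p) y) \<in> bm (restrict_space borel (strip T) \<Otimes>\<^sub>M lborel)"

lemma meas_KI:
 assumes u: "meas T u" and r: "!!t. t \<in> {0..T} ==> reg s (u t)" and s: "al < s" and m: "kmeas T m"
 shows "meas T (%t x. KI al (m t x) (u t) x)"
proof (rule measI)
 let ?M = "restrict_space borel (strip T) :: (real \<times> (real^'a)) measure"
 have sp: "q \<in> space (?M \<Otimes>\<^sub>M lborel) ==> fst (fst q) \<in> {0..T}" for q by (auto simp: space_pair_measure space_strip)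
 have [measurable]: "(%q. u (fst (fst q)) (snd (fst q) + snd q)) \<in> bm (?M \<Otimes>\<^sub>M lborel)"
  "(%q. u (fst (fst q)) (snd (fst q))) \<in> bm (?M \<Otimes>\<^sub>M lborel)"
  by (rule meas_comp[OF u]; use sp in auto)+
 have [measurable]: "(%q. (grad (u (fst (fst q))) (snd (fst q)) \<bullet> snd q) * chi al (snd q)) \<in> bm (?M \<Otimes>\<^sub>M lborel)"
 proof (cases "1 <= al")
  case True
  hence "(%q. grad (u (fst (fst q))) (snd (fst q))) \<in> bm (?M \<Otimes>\<^sub>M lborel)"
  using s by (intro meas_comp[OF meas_grad[OF u r]]) (use sp in auto)
  thus ?thesis by measurable
 next
  case False
  hence "(%q. (grad (u (fst (fst q))) (snd (fst q)) \<bullet> snd q) * chi al (snd q)) = (%q. 0)" by (auto simp: chi_def)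
  thus ?thesis by simp
 qed
 have [measurable]: "(%q. if snd q = 0 then 0 else m (fst (fst q)) (snd (fst q)) (snd q)) \<in> bm (?M \<Otimes>\<^sub>M lborel)"
  using m by (simp add: kmeas_def case_prod_unfold)
 let ?F = "%p y. (u (fst p) (snd p + y) - u (fst p) (snd p) - (grad (u (fst p)) (snd p) \<bullet> y) * chi al y) *
  (if y = 0 then 0 else m (fst p) (snd p) y) / pk al y"
 have "(%p. LINT y|lborel. ?F p y) \<in> bm ?M"
  by (rule lborel.borel_measurable_lebesgue_integral) (simp add: case_prod_unfold)
 moreover have "?F p y = KF al (m (fst p) (snd p)) (u (fst p)) (snd p) y" for p y by (simp add: KF_def)
 ultimately show "(%p. KI al (m (fst p) (snd p)) (u (fst p)) (snd p)) \<in> bm ?M"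
  unfolding KI_def by simp
qed

lemma meas_GI:
 fixes u :: "real => real^'d => real"
 assumes u: "meas T u" and r: "!!t. t \<in> {0..T} ==> reg s (u t)" and s: "al < s" and m: "kmeas T m" and b: "meas T b"
 shows "meas T (%t x. GI al (m t x) (b t x) (u t) x)"
proof (cases "1 <= al")
 case True
 hence "meas T (%t. grad (u t))" using s by (intro meas_grad[OF u r]) auto
 from measD[OF this] have "(%p. KI al (m (fst p) (snd p)) (u (fst p)) (snd p) + b (fst p) (snd p) \<bullet> grad (u (fst p)) (snd p))
  \<in> bm (restrict_space borel (strip T))"
  by (intro borel_measurable_add borel_measurable_inner measD[OF meas_KI[OF u r s m]] measD[OF b])
 thus ?thesis unfolding GI_def using True by (simp add: measI)
next
 case False
 thus ?thesis unfolding GI_def using meas_KI[OF u r s m] by simp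
qed

text \<open>Measurability in time and space is a qualitative condition kept apart from the constants
  in \<open>opc\<close>; it makes the right-hand sides of the iteration in
  \<open>continuity_step\<close> admissible.\<close>

definition opm :: "real => real => real => (real => real^'d => real^'d => real) => (real => real^'d => real^'d)
  => (real => (real^'d => real) => real^'d => real) => bool" where
 "opm T al s m b B \<longleftrightarrow> (ALL u. meas T u & (ALL t:{0..T}. reg s (u t)) --> meas T (%t. Lop al m b B t (u t)))"

text \<open>The homotopy starts at the constant kernel \<open>K\<close> without drift and
  lower-order part. All bounds are convex and a constant kernel has no differences, so the constants
  do not grow; positivity in the cone survives because \<open>de <= K\<close>.\<close>

lemma opc_convex:
 assumes K: "0 < K" and E: "!!e. 0 <= E e" and r0: "0 < r0" and th: "0 <= th" "th <= 1"
  and op: "opc T al be ta K de r0 E m b B"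
 shows "opc T al be ta K de r0 E (%t x y. (1 - th) * K + th * m t x y) (%t x. th *. b t x) (%t u x. th * B t u (x::real^'d))"
 unfolding opc_def
proof (intro conjI ballI)
 fix t assume t: "t \<in> {0..T}"
 have kf: "kfam al be K (m t) (b t)" and el: "elliptic de r0 (m t)" using op t by (auto simp: opc_def)
 have sc: "th * c <= c" if "0 <= c" for c using th that by (simp add: mult_left_le_one_le)
 have scn: "abs (th * z) <= c" if "abs z <= c" for z c :: real
  using that th sc[OF order_trans[OF abs_ge_zero that]] mlm[OF that th(1)] by (simp add: abs_mult)
 have scv: "norm (th *. v) <= c" if "norm v <= c" for v :: "real^'d" and c
  using that th sc[of c] mlm[OF that th(1)] norm_ge_zero[of v] by simp
 show "kfam al be K (%x y. (1 - th) * K + th * m t x y) (%x. th *. b t x)"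
  unfolding kfam_def
 proof (intro conjI allI impI)
  fix x
  show "kern al K (%y. (1 - th) * K + th * m t x y)"
  proof (rule kern_comb[OF const_kern[OF K] kfam_kern(1)[OF kf]])
  fix y :: "real^'d" assume "y ~= 0"
  hence "abs (m t x y) <= K" using kfam_kern(1)[OF kf, of x] by (simp add: kern_def)
  from mlm[OF this th(1)] have "abs (th * m t x y) <= th * K" using th by (simp add: abs_mult)
  moreover have "abs ((1 - th) * K) = (1 - th) * K" using th K by simp
  moreover have "(1 - th) * K + th * K = K" by (simp add: alg)
  ultimately show "abs ((1 - th) * K + th * m t x y) <= K" by linarith
  qed (use K in auto)
  show "norm (th *. b t x) <= K" by (rule scv[OF kfam_kern(2)[OF kf]])
 next
  fix h x
  have e: "df h (%x. th *. v x) = (%x. th *. df h v x)" for v :: "real^'d => real^'d"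
  by (rule ext) (simp add: df_def alg)
  show "norm (df h (%x. th *. b t x) x) <= K * h pw (be/2)" unfolding e by (rule scv[OF kfam_kern(4)[OF kf]])
  show "norm (df2 h (%x. th *. b t x) x) <= K * h pw be" unfolding e by (rule scv[OF kfam_kern(6)[OF kf]])
  fix y :: "real^'d" assume y: "y ~= 0"
  have d: "dk h (%x y. (1 - th) * K + th * m t x y) = (%x y. th * dk h (m t) x y)" "dk h (%x y. th * w x y) = (%x y. th * dk h w x y)" for w
  by (intro ext; simp add: dk_def alg)+
  have s: "abs (dk h (m t) x y) <= K * h pw (be/2)" "abs (dk h (dk h (m t)) x y) <= K * h pw be"
  using kf y unfolding kfam_def by blast+
  show "abs (dk h (%x y. (1 - th) * K + th * m t x y) x y) <= K * h pw (be/2)"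
  "abs (dk h (dk h (%x y. (1 - th) * K + th * m t x y)) x y) <= K * h pw be"
  unfolding d by (rule scn[OF s(1)], rule scn[OF s(2)])
 qed
 obtain w where w: "norm w = 1" "!!x y. y ~= 0 ==> norm (y /\<^sub>R norm y - w) <= r0 ==> de <= m t x y"
  using el unfolding elliptic_def by blast
 \<comment> \<open>On the axis of the cone the kernel lies between \<open>de\<close> and
   \<open>K\<close>, whence \<open>de <= K\<close>.\<close>
 have "w ~= 0" using w(1) by auto
 have "norm (w /\<^sub>R norm w - w) <= r0" using w(1) r0 by simp
 hence "de <= m t 0 w" using w(2) \<open>w ~= 0\<close> by blast
 moreover have "abs (m t 0 w) <= K" using kfam_kern(1)[OF kf, of 0] \<open>w ~= 0\<close> by (simp add: kern_def)
 ultimately have deK: "de <= K" by simp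
 show "elliptic de r0 (%x y. (1 - th) * K + th * m t x y)"
  unfolding elliptic_def
 proof (intro conjI allI impI exI[of _ w] w(1))
  show "0 <= (1 - th) * K + th * m t x y" if "y ~= 0" for x y
  using that el th K by (auto simp: elliptic_def)
  fix x y assume y: "y ~= 0 & norm (y /\<^sub>R norm y - w) <= r0"
  have "(1 - th) * de + th * de <= (1 - th) * K + th * m t x y"
  using w(2) y th deK by (intro add_mono mlm) auto
  thus "de <= (1 - th) * K + th * m t x y" by (simp add: alg)
 qed
next
 have lo: "lowop T (al + be) (al + be - ta) be E B" using op by (simp add: opc_def)
 have sc: "abs (th * z) <= c" if "abs z <= c" for z c
  using that th mult_left_le_one_le[of "abs z" th] by (simp add: abs_mult)
 show "lowop T (al + be) (al + be - ta) be E (%t u x. th * B t u x)"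
  unfolding lowop_def df_cmult
 proof (intro ballI conjI allI impI)
  fix t a and u v :: "real^'d => real" and x assume t: "t \<in> {0..T}" "reg (al + be) u & reg (al + be) v"
  hence "B t (%x. u x + a * v x) x = B t u x + a * B t v x" using lo unfolding lowop_def by blast
  thus "th * B t (%x. u x + a * v x) x = th * B t u x + a * (th * B t v x)" by (simp add: alg)
 qed (rule sc, use lo in \<open>unfold lowop_def, blast\<close>)+
qed

section \<open>Linearity in the function and in the homotopy parameter\<close>

lemma Lop_lin:
 assumes par: "pars al be ta" and op: "opc T al be ta K de r0 E m b B" and t: "t \<in> {0..T}" and u: "reg (al + be) u" "reg (al + be) v"
 shows "Lop al m b B t (%x. u x + a * v x) x = Lop al m b B t u x + a * Lop al m b B t v (x::real^'d)"
proof -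
 have ta: "good_tau al ta" "al + ta <= al + be" using par by (auto simp: pars_def good_tau_def)
 have k: "kern al K (m t x)" using op t kfam_kern(1) unfolding opc_def by blast
 have "B t (%x. u x + a * v x) x = B t u x + a * B t v x" using op t u unfolding opc_def lowop_def by blast
 thus ?thesis unfolding Lop_def GI_lin_g[OF ta k u] by (simp add: alg)
qed

lemma Lop_convex:
 assumes par: "pars al be ta" and K: "0 < K" and op: "opc T al be ta K de r0 E m b B" and t: "t \<in> {0..T}" and u: "reg (al + be) u"
 shows "Lop al (%t x y. (1 - th) * K + th * m t x y) (%t x. th *. b t x) (%t u x. th * B t u x) t u x
  = KI al (%_. K) u x + th * (Lop al m b B t u x - KI al (%_. K) u (x::real^'d))"
proof -
 have ta: "good_tau al ta" "al + ta <= al + be" using par by (auto simp: pars_def good_tau_def)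
 have k: "kern al K (m t x)" using op t kfam_kern(1) unfolding opc_def by blast
 have "GI al (%y. (1 - th) * K + th * m t x y) (th *. b t x) u x = (1 - th) * KI al (%_. K) u x + th * GI al (m t x) (b t x) u x"
  using GI_lin_k[OF ta const_kern[OF K] k u, of "1 - th" th 0 "b t x" x] by (simp add: GI_def)
 thus ?thesis by (simp add: Lop_def alg)
qed

lemma csol_lin:
 assumes par: "pars al be ta" and op: "opc T al be ta K de r0 E m b B"
  and u: "csol T al (al + be) m b B lam f u" "csol T al (al + be) m b B lam g (v :: real => real^'d => real)"
 shows "csol T al (al + be) m b B lam (%t x. f t x + a * g t x) (%t x. u t x + a * v t x)"
 unfolding csol_def
proof
 obtain N N' where N: "ALL t:{0..T}. bd N (u t) & Zyg (al + be) N (u t)" "ALL t:{0..T}. bd N' (v t) & Zyg (al + be) N' (v t)"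
  using u unfolding csol_def by blast
 have r: "reg (al + be) (u t)" "reg (al + be) (v t)" if "t \<in> {0..T}" for t
  using N that unfolding reg_def by blast+
 show "intf T (%t x. Lop al m b B t (%x. u t x + a * v t x) x - lam * (u t x + a * v t x) + (f t x + a * g t x)) (%t x. u t x + a * v t x)"
  by (rule intf_cong[OF intf_lin[OF conjunct1[OF u(1)[unfolded csol_def]] conjunct1[OF u(2)[unfolded csol_def]]]])
  (simp add: Lop_lin[OF par op _ r] alg)
 have "ALL t:{0..T}. bd (N + abs a * N') (%x. u t x + a * v t x) & Zyg (al + be) (N + abs a * N') (%x. u t x + a * v t x)"
  using N by (auto intro!: bd_add bd_cmult Zyg_add Zyg_cmult)
 thus "EX N. ALL t:{0..T}. bd N (%x. u t x + a * v t x) & Zyg (al + be) N (%x. u t x + a * v t x)" by blast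
qed

lemma hol_lin: "hol be F f ==> hol be G g ==> hol be (F + abs a * G) (%x. f x + a * g x)"
 unfolding hol_def
proof (intro conjI allI; elim conjE)
 assume a: "bd F f" "bd G g"
 thus "bd (F + abs a * G) (%x. f x + a * g x)" by (intro bd_add bd_cmult)
next
 fix h x assume "ALL h x. abs (df2 h f x) <= F * h pw be" "ALL h x. abs (df2 h g x) <= G * h pw be"
 hence 1: "abs (df2 h f x) <= F * h pw be" and 2: "abs (df2 h g x) <= G * h pw be" by auto
 have "abs (a * df2 h g x) <= abs a * (G * h pw be)" using 2 by (simp add: abs_mult mlm)
 thus "abs (df2 h (%x. f x + a * g x) x) <= (F + abs a * G) * h pw be"
  unfolding df_add df_cmult using 1 by (simp add: alg)
qed

definition solvable :: "real => real => real => (real => real^'d => real^'d => real) => (real => real^'d => real^'d)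
  => (real => (real^'d => real) => real^'d => real) => real => bool" where
 "solvable T al be m b B lam \<longleftrightarrow> (ALL f F. meas T f & (ALL t:{0..T}. hol be F (f t)) -->
  (EX u. meas T u & csol T al (al + be) m b B lam f u))"

lemma hol_bd: "hol be F f ==> abs (f x) <= F"
 using bdD[of F f x] by (simp add: hol_def)

text \<open>Fixed-point iteration around the solvable parameter \<open>th\<close>: with
  \<open>D = L - L0\<close>, the equation at \<open>th'\<close> is the one at \<open>th\<close> with
  right-hand side \<open>f + (th' - th) D u\<close>. By the a priori constant \<open>C1\<close> and
  the mapping constant \<open>2 * C2\<close> of \<open>D\<close>, successive differences shrink by
  the factor \<open>2 * C1 * C2 * (th' - th) <= 1/2\<close>.\<close>

lemma continuity_step:
 fixes m :: "real => real^'d => real^'d => real"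
 assumes par: "pars al be ta" and K: "0 < K" and T: "0 < T" and E: "!!e. 0 <= E e" and r0: "0 < r0"
  and op: "opc T al be ta K de r0 E m b B" and om: "opm T al (al + be) m b B"
  and lam: "0 <= lam" and th: "0 <= th" "th <= th'" "th' <= 1"
  and C1: "0 < C1" "!!m b B lam f (u::real => real^'d => real) F.
  opc T al be ta K de r0 E m b B ==> 0 <= lam ==> csol T al (al + be) m b B lam f u ==>
  ALL t:{0..T}. hol be F (f t) ==> ALL t:{0..T}. bd (C1 * F) (u t) & Zyg (al + be) (C1 * F) (u t)"
  and C2: "0 < C2" "!!m b B t (u::real^'d => real) N. opc T al be ta K de r0 E m b B ==> t \<in> {0..T} ==> bd N u ==>
  Zyg (al + be) N u ==> hol be (C2 * N) (Lop al m b B t u)"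
  and step: "4 * (C1 * C2) * (th' - th) <= 1"
  and S: "solvable T al be (%t x y. (1 - th) * K + th * m t x y) (%t x. th *. b t x) (%t u x. th * B t u x) lam"
 shows "solvable T al be (%t x y. (1 - th') * K + th' * m t x y) (%t x. th' *. b t x) (%t u x. th' * B t u x) lam"
proof -
 let ?s = "al + be" let ?e = "th' - th"
 let ?m = "%th t x y. (1 - th) * K + th * m t x y" and ?b = "%th t x. th *. b t x" and ?B = "%th t u x. th * B t u x"
 define L where "L = Lop al m b B"
 define L0 where "L0 = (%(t::real) (u::real^'d => real) x. KI al (%_. K) u x)"
 define D where "D = (%t u x. L t u x - L0 t u x)"
 define Lt where "Lt = Lop al (?m th) (?b th) (?B th)"
 have al: "0 < al" "al < ?s" using par by (auto simp: pars_def good_tau_def)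
 have opt: "opc T al be ta K de r0 E (?m th) (?b th) (?B th)" if "0 <= th" "th <= 1" for th
  by (rule opc_convex[OF K E r0 that op])
 have Lth: "Lop al (?m th) (?b th) (?B th) t u x = L0 t u x + th * D t u x" if "t \<in> {0..T}" "reg ?s u" for th t u x
  unfolding D_def L_def L0_def by (rule Lop_convex[OF par K op that])
 have linL: "Lop al (?m th) (?b th) (?B th) t (%x. u x + a * v x) x = Lop al (?m th) (?b th) (?B th) t u x + a * Lop al (?m th) (?b th) (?B th) t v x"
  if "0 <= th" "th <= 1" "t \<in> {0..T}" "reg ?s u" "reg ?s v" for th t u v a x
  by (rule Lop_lin[OF par opt[OF that(1,2)] that(3,4,5)])
 have linD: "D t (%x. u x + a * v x) x = D t u x + a * D t v x" if "t \<in> {0..T}" "reg ?s u" "reg ?s v" for t u v a x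
  using linL[of 1 t u v a x] linL[of 0 t u v a x] Lth[of t _ 0] Lth[of t _ 1] that reg_lin[OF that(2,3), of a] by (simp add: alg)
 have holD: "hol be (2 * C2 * N) (D t u)" if "t \<in> {0..T}" "bd N u" "Zyg ?s N u" for t u N
 proof -
  have r: "reg ?s u" using that unfolding reg_def by blast
  have 1: "hol be (C2 * N) (L t u)" unfolding L_def by (rule C2(2)[OF op that])
  have 0: "hol be (C2 * N) (L0 t u)"
  proof -
  have "Lop al (?m 0) (?b 0) (?B 0) t u = L0 t u" using Lth[OF that(1) r, of 0] by (intro ext) simp
  thus ?thesis using C2(2)[OF opt[of 0] that] by simp
  qed
  show ?thesis using hol_lin[OF 1 0, of "-1"] by (simp add: D_def alg)
 qed
 show ?thesis
  unfolding solvable_def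
 proof (intro allI impI; elim conjE)
  fix f :: "real => real^'d => real" and F assume fm: "meas T f" and f: "ALL t:{0..T}. hol be F (f t)"
  have F: "0 <= F" using f T hol_nonneg[of be F "f 0"] by auto
  \<comment> \<open>Solutions are picked by choice; the contraction comes from linearity of the
    equation and the a priori estimate for differences of solutions.\<close>
  define sol where "sol g = (SOME u. meas T u & csol T al ?s (?m th) (?b th) (?B th) lam g u)" for g
  define V where "V = rec_nat (%t x. 0) (%k v. sol (%t x. f t x + ?e * D t (v t) x))"
  have V0: "V 0 = (%t x. 0)" and VS: "V (Suc k) = sol (%t x. f t x + ?e * D t (V k t) x)" for k
  by (simp_all add: V_def)
  have mL: "meas T (%t. L t (v t))" if "meas T v" "ALL t:{0..T}. reg ?s (v t)" for v
  using om that unfolding opm_def L_def by blast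
  have mL0: "meas T (%t. L0 t (v t))" if "meas T v" "ALL t:{0..T}. reg ?s (v t)" for v
  unfolding L0_def using meas_KI[OF that(1) _ al(2), of "%_ _ _. K"] that(2) by (simp add: kmeas_def case_prod_unfold)
  have mD: "meas T (%t. D t (v t))" if "meas T v" "ALL t:{0..T}. reg ?s (v t)" for v
  unfolding D_def using meas_lin[OF mL[OF that] mL0[OF that], of "-1"] by simp
  have S': "meas T (sol g) & csol T al ?s (?m th) (?b th) (?B th) lam g (sol g)"
  if "meas T g" "ALL t:{0..T}. hol be G (g t)" for g G
  proof -
  have "EX u. meas T u & csol T al ?s (?m th) (?b th) (?B th) lam g u"
  using S[unfolded solvable_def, rule_format, OF conjI[OF that]] .
  from someI_ex[OF this] show ?thesis unfolding sol_def .
  qed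
  have st: "meas T (V k) & (EX N. ALL t:{0..T}. bd N (V k t) & Zyg ?s N (V k t)) ==>
  meas T (V (Suc k)) & csol T al ?s (?m th) (?b th) (?B th) lam (%t x. f t x + ?e * D t (V k t) x) (V (Suc k))" for k
  proof (elim conjE exE)
  fix N assume m: "meas T (V k)" and N: "ALL t:{0..T}. bd N (V k t) & Zyg ?s N (V k t)"
  have "meas T (%t x. f t x + ?e * D t (V k t) x)"
  by (rule meas_lin[OF fm mD[OF m]]) (use N in \<open>unfold reg_def, blast\<close>)
  moreover have "ALL t:{0..T}. hol be (F + abs ?e * (2 * C2 * N)) (%x. f t x + ?e * D t (V k t) x)"
  using N f by (intro ballI hol_lin holD) auto
  ultimately show ?thesis unfolding VS by (rule S')
  qed
  have Vb: "meas T (V k) & (EX N. ALL t:{0..T}. bd N (V k t) & Zyg ?s N (V k t))" for k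
  proof (induction k)
  case 0
  have "bd 0 (%x::real^'d. 0::real)" "Zyg ?s 0 (%x::real^'d. 0::real)" by (auto simp: bd_def Zyg_def df_def)
  thus ?case unfolding V0 using meas_const[of T 0] by blast
  next
  case (Suc k)
  thus ?case using st[of k] unfolding csol_def by blast
  qed
  have Vs: "csol T al ?s (?m th) (?b th) (?B th) lam (%t x. f t x + ?e * D t (V k t) x) (V (Suc k))" for k
  using st Vb by blast
  have Vr: "reg ?s (V k t)" if "t \<in> {0..T}" for k t using Vb[of k] that unfolding reg_def by blast
  have z: "bd 0 (%x::real^'d. 0::real)" "Zyg ?s 0 (%x::real^'d. 0::real)" by (auto simp: bd_def Zyg_def df_def)
  define M where "M = C1 * F"
  have M: "0 <= M" using C1 F by (simp add: M_def)
  have cl: "ALL t:{0..T}. bd (M * (1/2) ^ k) (%x. V (Suc k) t x + (-1) * V k t x) & Zyg ?s (M * (1/2) ^ k) (%x. V (Suc k) t x + (-1) * V k t x)" for k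
  proof (induction k)
  case 0
  have "ALL t:{0..T}. hol be F (%x. f t x + ?e * D t (V 0 t) x)"
  proof
  fix t assume t: "t \<in> {0..T}"
  show "hol be F (%x. f t x + ?e * D t (V 0 t) x)"
  unfolding V0 using hol_lin[OF f[rule_format, OF t] holD[OF t z], of ?e] by simp
  qed
  from C1(2)[OF opt lam Vs this] th show ?case by (simp add: V0 M_def)
  next
  case (Suc k)
  let ?G = "abs ?e * (2 * C2 * (M * (1/2) ^ k))"
  have "ALL t:{0..T}. hol be ?G (%x. (f t x + ?e * D t (V (Suc k) t) x) + (-1) * (f t x + ?e * D t (V k t) x))"
  proof
  fix t assume t: "t \<in> {0..T}"
  have hz: "hol be 0 (%x::real^'d. 0)" by (auto simp: hol_def bd_def df_def)
  have "(f t x + ?e * D t (V (Suc k) t) x) + (-1) * (f t x + ?e * D t (V k t) x) = 0 + ?e * D t (%x. V (Suc k) t x + (-1) * V k t x) x" for x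
  unfolding linD[OF t Vr[OF t] Vr[OF t]] by (simp add: alg)
  thus "hol be ?G (%x. (f t x + ?e * D t (V (Suc k) t) x) + (-1) * (f t x + ?e * D t (V k t) x))"
  using hol_lin[OF hz holD[OF t], of "M * (1/2) ^ k" "%x. V (Suc k) t x + (-1) * V k t x" ?e] Suc t by simp
  qed
  from C1(2)[OF opt lam csol_lin[OF par opt Vs Vs] this] th
  have c: "ALL t:{0..T}. bd (C1 * ?G) (%x. V (Suc (Suc k)) t x + (-1) * V (Suc k) t x) &
  Zyg ?s (C1 * ?G) (%x. V (Suc (Suc k)) t x + (-1) * V (Suc k) t x)" by simp
  have "C1 * ?G = (4 * (C1 * C2) * ?e) * (M * (1/2) ^ Suc k)" using th by simp
  also have "... <= 1 * (M * (1/2) ^ Suc k)" using M by (intro mrm step) auto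
  finally have "C1 * ?G <= M * (1/2) ^ Suc k" by simp
  thus ?case using c by (blast intro: bd_mono Zyg_mono)
  qed
  define u where "u t x = lim (%k. V k t x)" for t x
  have ul: "(%k. V k t x) ~~> u t x" and ub: "abs (u t x - V k t x) <= 2 * M * (1/2) ^ k" if t: "t \<in> {0..T}" for k t x
  proof -
  have d: "abs (V (Suc k) t x - V k t x) <= M * (1/2) ^ k" for k
  using cl[of k] t bdD[of _ "%x. V (Suc k) t x + (-1) * V k t x" x] by auto
  show "(%k. V k t x) ~~> u t x" "abs (u t x - V k t x) <= 2 * M * (1/2) ^ k"
  unfolding u_def using geometric_limit[OF d] by (simp_all add: mult.commute)
  qed
  \<comment> \<open>Third differences converge as well, at the same rate and with the factor
    \<open>|h|^s\<close>, so the limit stays in the class and the operators converge along the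
    sequence.\<close>
  have uz: "abs (df3 h (u t) x - df3 h (V k t) x) <= 2 * M * h pw ?s * (1/2) ^ k"
  if t: "t \<in> {0..T}" for k t h x
  proof -
  let ?a = "%k. df3 h (V k t) x"
  have d: "abs (?a (Suc k) - ?a k) <= M * h pw ?s * (1/2) ^ k" for k
  proof -
  have "df3 h (%x. V (Suc k) t x + (-1) * V k t x) x = ?a (Suc k) - ?a k"
  by (simp only: df_add df_cmult)
  moreover have "norm (df3 h (%x. V (Suc k) t x + (-1) * V k t x) x) <= M * (1/2) ^ k * h pw ?s"
  by (rule ZygD) (use cl[of k] t in auto)
  ultimately show ?thesis by (simp add: alg)
  qed
  have "?a ~~> df3 h (u t) x" by (rule df3_tendsto) (rule ul[OF t])
  hence "lim ?a = df3 h (u t) x" by (rule limI)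
  thus ?thesis using geometric_limit(2)[OF d, of k] by simp
  qed
  have df: "bd (2 * M * (1/2) ^ k) (%x. u t x + (-1) * V k t x)" "Zyg ?s (2 * M * (1/2) ^ k) (%x. u t x + (-1) * V k t x)"
  if t: "t \<in> {0..T}" for t k
  proof -
  show "bd (2 * M * (1/2) ^ k) (%x. u t x + (-1) * V k t x)" using ub[OF t] by (simp add: bd_def)
  have "df3 h (%x. u t x + (-1) * V k t x) x = df3 h (u t) x - df3 h (V k t) x" for h x
  by (simp only: df_add df_cmult)
  thus "Zyg ?s (2 * M * (1/2) ^ k) (%x. u t x + (-1) * V k t x)"
  using uz[OF t, of _ _ k] M by (simp only: Zyg_def real_norm_def) (simp add: mult.commute mult.left_commute)
  qed
  have ubd: "ALL t:{0..T}. bd (2 * M) (u t) & Zyg ?s (2 * M) (u t)"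
  using df[of _ 0] by (simp add: V0)
  hence ur: "ALL t:{0..T}. reg ?s (u t)" unfolding reg_def by blast
  have um: "meas T u" by (rule meas_limit[OF _ ul]) (use Vb in auto)
  let ?g = "%t x. L0 t (u t) x + th' * D t (u t) x - lam * u t x + f t x"
  let ?gn = "%k t x. Lop al (?m th) (?b th) (?B th) t (V (Suc k) t) x - lam * V (Suc k) t x + (f t x + ?e * D t (V k t) x)"
  let ?en = "%k. (C2 + lam + abs ?e * (4 * C2)) * (2 * M) * (1/2) ^ k"
  have "intf T ?g u"
  proof (rule intf_limit[where gn = ?gn and un = "%k. V (Suc k)" and e = ?en and G = "C2 * (2 * M) + lam * (2 * M) + F"])
  show "intf T (?gn k) (V (Suc k))" for k using Vs[of k] unfolding csol_def by blast
  show "meas T ?g"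
  using meas_lin[OF meas_lin[OF meas_lin[OF mL0[OF um ur] mD[OF um ur], of th'] um, of "-lam"] fm, of 1] by simp
  show "abs (?g t x) <= C2 * (2 * M) + lam * (2 * M) + F" if t: "t \<in> {0..T}" for t x
  proof -
  have "abs (L0 t (u t) x + th' * D t (u t) x) <= C2 * (2 * M)"
  using hol_bd[OF C2(2)[OF opt[of th'] t, of "2 * M" "u t"], of x] ubd t th ur by (simp add: Lth)
  moreover have "abs (lam * u t x) <= lam * (2 * M)" using ubd t lam bdD[of "2 * M" "u t" x] by (simp add: abs_mult mlm)
  moreover have "abs (f t x) <= F" using f t hol_bd by blast
  ultimately show ?thesis by linarith
  qed
  show "abs (?gn k t x - ?g t x) <= ?en k" if t: "t \<in> {0..T}" for k t x
  proof -
  let ?w = "%k x. u t x + (-1) * V k t x"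
  have utr: "reg ?s (u t)" using ur t by blast
  have a: "Lop al (?m th) (?b th) (?B th) t (?w (Suc k)) x = Lop al (?m th) (?b th) (?B th) t (u t) x + (-1) * Lop al (?m th) (?b th) (?B th) t (V (Suc k) t) x"
  by (rule linL) (use th t utr Vr in auto)
  have b: "D t (?w k) x = D t (u t) x + (-1) * D t (V k t) x" by (rule linD[OF t utr Vr[OF t]])
  have c: "Lop al (?m th) (?b th) (?B th) t (u t) x = L0 t (u t) x + th * D t (u t) x" by (rule Lth[OF t utr])
  have eq: "?gn k t x - ?g t x = - Lop al (?m th) (?b th) (?B th) t (?w (Suc k)) x + lam * ?w (Suc k) x - ?e * D t (?w k) x"
  unfolding a b c by (simp add: alg)
  have q: "(1/2::real) ^ Suc k <= (1/2) ^ k" by simp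
  have "abs (Lop al (?m th) (?b th) (?B th) t (?w (Suc k)) x) <= C2 * (2 * M * (1/2) ^ Suc k)"
  by (rule hol_bd, rule C2(2)[OF opt t df[OF t]]) (use th in auto)
  also have "... <= C2 * (2 * M * (1/2) ^ k)" using C2(1) M by (intro mlm q) auto
  finally have 1: "abs (Lop al (?m th) (?b th) (?B th) t (?w (Suc k)) x) <= C2 * (2 * M * (1/2) ^ k)" .
  have "abs (?w (Suc k) x) <= 2 * M * (1/2) ^ Suc k" using ub[OF t, of x "Suc k"] by simp
  also have "... <= 2 * M * (1/2) ^ k" using M by (intro mlm q) auto
  finally have "abs (lam * ?w (Suc k) x) <= lam * (2 * M * (1/2) ^ k)" using lam by (simp add: abs_mult mlm)
  moreover have "abs (?e * D t (?w k) x) <= abs ?e * (2 * C2 * (2 * M * (1/2) ^ k))"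
  unfolding abs_mult by (intro mlm hol_bd[OF holD[OF t df[OF t]]]) auto
  moreover have "0 <= abs ?e * (2 * C2 * (2 * M * (1/2) ^ k))" using C2(1) M by simp
  moreover have "?en k = C2 * (2 * M * (1/2) ^ k) + lam * (2 * M * (1/2) ^ k) + 2 * (abs ?e * (2 * C2 * (2 * M * (1/2) ^ k)))"
  by (simp add: alg)
  ultimately show ?thesis using 1 unfolding eq by linarith
  qed
  have "(%k. (1/2::real) ^ k) ~~> 0" by (rule LIMSEQ_realpow_zero) auto
  thus "?en ~~> 0" by (rule tendsto_mult_right_zero)
  show "(%k. V (Suc k) t x) ~~> u t x" if "t \<in> {0..T}" for t x using ul[OF that] by (rule LIMSEQ_Suc)
  qed
  hence "intf T (%t x. Lop al (?m th') (?b th') (?B th') t (u t) x - lam * u t x + f t x) u"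
  by (rule intf_cong) (use Lth ur in auto)
  thus "EX u. meas T u & csol T al ?s (?m th') (?b th') (?B th') lam f u"
  using um ubd unfolding csol_def by blast
 qed
qed

text \<open>The step length \<open>1 / (4 * (C1 * C2))\<close> is the same along the whole homotopy,
  because \<open>C1\<close> and \<open>C2\<close> depend on the operator only through the constants
  that \<open>opc_convex\<close> preserves.\<close>

lemma solution_exists:
 fixes m :: "real => real^'d => real^'d => real"
 assumes par: "pars al be ta" and K: "0 < K" and T: "0 < T" and E: "!!e. 0 <= E e" and de: "0 < de" and r0: "0 < r0" "r0 <= 1"
  and op: "opc T al be ta K de r0 E m b B" and om: "opm T al (al + be) m b B" and lam: "0 <= lam"
 shows "solvable T al be m b B lam"
proof -
 let ?m = "%th t x y. (1 - th) * K + th * m t x y" and ?b = "%th t x. th *. b t x" and ?B = "%th t u x. th * B t u x"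
 obtain C1 where C1: "0 < C1" "!!m b B lam f (u::real => real^'d => real) F.
  opc T al be ta K de r0 E m b B ==> 0 <= lam ==> csol T al (al + be) m b B lam f u ==>
  ALL t:{0..T}. hol be F (f t) ==> ALL t:{0..T}. bd (C1 * F) (u t) & Zyg (al + be) (C1 * F) (u t)"
  using apriori[where E = E and 'd = 'd, OF par K de r0 E T] by meson
 obtain C2 where C2: "0 < C2" "!!m b B t (u::real^'d => real) N. opc T al be ta K de r0 E m b B ==> t \<in> {0..T} ==> bd N u ==>
  Zyg (al + be) N u ==> hol be (C2 * N) (Lop al m b B t u)"
  using Lop_hol[where E = E and 'd = 'd, OF par K E] by meson
 define w where "w = 1 / (4 * (C1 * C2))"
 have w: "0 < w" "4 * (C1 * C2) * w = 1" using C1(1) C2(1) by (auto simp: w_def)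
 have "solvable T al be (?m (min 1 (real k * w))) (?b (min 1 (real k * w))) (?B (min 1 (real k * w))) lam" for k
 proof (induction k)
  case 0
  have "solvable T al be (%_ _ (_::real^'d). K) (%_ _. 0) (%_ _ _. 0) lam"
  unfolding solvable_def using base_solution_exists[OF par K T lam, where 'd = 'd] by blast
  thus ?case by simp
 next
  case (Suc k)
  show ?case
  proof (rule continuity_step[OF par K T E r0(1) op om lam _ _ _ C1 C2 _ Suc])
  show "min 1 (real k * w) <= min 1 (real (Suc k) * w)" using w(1) by (auto simp: alg min_def)
  have "min 1 (real (Suc k) * w) - min 1 (real k * w) <= w" using w(1) by (simp add: alg min_def)
  from mlm[OF this, of "4 * (C1 * C2)"] show "4 * (C1 * C2) * (min 1 (real (Suc k) * w) - min 1 (real k * w)) <= 1"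
  using w C1(1) C2(1) by simp
  qed (use w in auto)
 qed
 moreover obtain k where "1 / w <= real k" using real_arch_simple by blast
 hence "min 1 (real k * w) = 1" using w(1) by (simp add: field_simps)
 ultimately have "solvable T al be (?m 1) (?b 1) (?B 1) lam" by metis
 thus ?thesis by simp
qed

section \<open>The jump operator\<close>

text \<open>\<open>f\<close> has \<open>L1\<close> norm at most \<open>R\<close>; integrability is part of the condition.\<close>
definition ib :: "'u measure => real => ('u => real) => bool" where
 "ib nu R f \<longleftrightarrow> 0 <= R & f \<in> bm nu & (\<integral>\<^sup>+v. ennreal (abs (f v)) \<partial>nu) <= ennreal R"

lemma ib_le:
 assumes g: "ib nu R g" and f: "f \<in> bm nu" "!!v. v \<in> space nu ==> abs (f v) <= g v" and R: "R <= R'"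
 shows "ib nu R' f"
proof -
 have "abs (f v) <= abs (g v)" if "v \<in> space nu" for v using f(2)[OF that] by linarith
 hence "(\<integral>\<^sup>+v. ennreal (abs (f v)) \<partial>nu) <= (\<integral>\<^sup>+v. ennreal (abs (g v)) \<partial>nu)"
  by (intro nn_integral_mono ennreal_leI) auto
 also have "... <= ennreal R'" using g R ennreal_leI[OF R] unfolding ib_def by (blast intro: order_trans)
 finally show ?thesis using g R f(1) by (simp add: ib_def)
qed

lemma ib_add:
 assumes f: "ib nu R f" and g: "ib nu S g" shows "ib nu (R + S) (%v. f v + g v)"
proof -
 have [measurable]: "f \<in> bm nu" "g \<in> bm nu" using f g by (auto simp: ib_def)
 have "(\<integral>\<^sup>+v. ennreal (abs (f v + g v)) \<partial>nu) <= (\<integral>\<^sup>+v. ennreal (abs (f v)) + ennreal (abs (g v)) \<partial>nu)"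
  by (intro nn_integral_mono) (simp add: ennreal_plus[symmetric] abs_triangle_ineq del: ennreal_plus)
 also have "... = (\<integral>\<^sup>+v. ennreal (abs (f v)) \<partial>nu) + (\<integral>\<^sup>+v. ennreal (abs (g v)) \<partial>nu)" by (rule nn_integral_add) auto
 also have "... <= ennreal R + ennreal S" using f g by (intro add_mono) (auto simp: ib_def)
 finally show ?thesis using f g by (simp add: ib_def)
qed

lemma ib_cmult:
 assumes f: "ib nu R f" shows "ib nu (abs a * R) (%v. a * f v)"
proof -
 have [measurable]: "f \<in> bm nu" using f by (auto simp: ib_def)
 have "(\<integral>\<^sup>+v. ennreal (abs (a * f v)) \<partial>nu) = ennreal (abs a) * (\<integral>\<^sup>+v. ennreal (abs (f v)) \<partial>nu)"
  by (subst nn_integral_cmult[symmetric]) (auto simp: abs_mult ennreal_mult)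
 also have "... <= ennreal (abs a) * ennreal R" using f by (intro mlm) (auto simp: ib_def)
 finally show ?thesis using f by (simp add: ib_def ennreal_mult)
qed

lemma ib_integral:
 assumes f: "ib nu R f" shows "integrable nu f" "abs (LINT v|nu. f v) <= R"
proof -
 have m: "f \<in> bm nu" and R: "0 <= R" and n: "(\<integral>\<^sup>+v. ennreal (abs (f v)) \<partial>nu) <= ennreal R" using f by (auto simp: ib_def)
 show i: "integrable nu f"
  by (rule integrableI_bounded[OF m]) (use n in \<open>auto intro: le_less_trans\<close>)
 have "ennreal (LINT v|nu. abs (f v)) <= ennreal R"
  using n by (subst nn_integral_eq_integral[symmetric]) (use i in auto)
 hence "(LINT v|nu. abs (f v)) <= R" using R by (simp add: ennreal_le_iff)
 thus "abs (LINT v|nu. f v) <= R" using integral_abs_bound[of nu f] by linarith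
qed

section \<open>Increments of functions of a given order\<close>

lemma lip_of_grad:
 fixes g :: "real^'d => real"
 assumes u: "bd M g" and Z: "Zyg (1 - ta) Q1 g" "Zyg (1 + ta) Q2 g" and t: "0 < ta" "ta < 1" and r: "0 < r"
 shows "abs (df c g x) <= grad_const ta * (Q1 * r powr (- ta) + Q2 * r powr ta) * norm c"
proof -
 have "norm (g (x + c) - g x) <= (grad_const ta * (Q1 * r powr (- ta) + Q2 * r powr ta)) * norm (x + c - x)"
 proof (rule differentiable_bound[of UNIV g "%x y. grad g x \<bullet> y"])
  fix z :: "real^'d"
  show "(g has_derivative (%y. grad g z \<bullet> y)) (at z within UNIV)"
  using grad_has_derivative[OF u Z(2)] t by simp
  have "onorm (%y. grad g z \<bullet> y) <= norm (grad g z)" by (rule onorm_le) (simp add: Cauchy_Schwarz_ineq2)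
  thus "onorm (%y. grad g z \<bullet> y) <= grad_const ta * (Q1 * r powr (- ta) + Q2 * r powr ta)"
  using grad_bound[OF u Z t r, of z] by linarith
 qed auto
 thus ?thesis by (simp add: df_def)
qed

text \<open>For \<open>a < 1\<close> this is the Marchaud inequality. At \<open>a = 1\<close>
  Zygmund order one gives no Lipschitz bound, whence the margin \<open>ta\<close> and the detour
  through the gradient.\<close>

lemma holder_low:
 assumes a: "0 < a" "a <= 1" and t: "0 < ta" "ta < 1"
 shows "EX C>0. ALL (g::real^'d => real) Q c x. low (a + ta) Q g -->
  abs (df c g x) <= C * Q * c pw a & abs (df c g x) <= C * Q * min (c pw a) 1"
proof -
 obtain C where C: "0 < C" and l: "!!(g::real^'d => real) Q c x. low (a + ta) Q g ==> abs (df c g x) <= C * Q * c pw a"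
 proof (cases "a < 1")
  case True
  show thesis
  proof (rule that[of "marchaud1 a * marchaud2 a"])
  show "0 < marchaud1 a * marchaud2 a" using True a marchaud1_pos[of a] marchaud2_pos[of a] by simp
  fix g :: "real^'d => real" and Q c x assume l: "low (a + ta) Q g"
  show "abs (df c g x) <= marchaud1 a * marchaud2 a * Q * c pw a"
  using df1_bound[OF low_bd[OF l] low_Zyg[OF l a(1)] True, of c x] t by simp
  qed
 next
  case False
  hence a1: "a = 1" using a by simp
  show thesis
  proof (rule that[of "2 * grad_const ta"])
  show "0 < 2 * grad_const ta" using grad_const_pos t by simp
  fix g :: "real^'d => real" and Q c x assume l: "low (a + ta) Q g"
  have "Zyg (1 - ta) Q g" "Zyg (1 + ta) Q g" using l t a1 by (auto intro!: low_Zyg[OF l])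
  from lip_of_grad[OF low_bd[OF l] this t zero_less_one, of c x]
  show "abs (df c g x) <= 2 * grad_const ta * Q * c pw a" using a1 by (simp add: alg)
  qed
 qed
 show ?thesis
 proof (intro exI[of _ "C + 2"] conjI allI impI)
  fix g :: "real^'d => real" and Q c x assume g: "low (a + ta) Q g"
  have Q: "0 <= Q" by (rule low_nonneg[OF g])
  have 1: "abs (df c g x) <= C * Q * c pw a" by (rule l[OF g])
  have 2: "abs (df c g x) <= 2 * Q" using bdD[OF bd_df[OF low_bd[OF g]], of c x] by simp
  have 3: "C * Q * c pw a <= (C + 2) * Q * c pw a" using Q by (intro mrm) auto
  show "abs (df c g x) <= (C + 2) * Q * c pw a" using 1 3 by linarith
  have 4: "2 * Q <= (C + 2) * Q * 1" using Q C by (simp add: alg)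
  show "abs (df c g x) <= (C + 2) * Q * min (c pw a) 1"
  using 1 2 3 4 by (cases "c pw a <= 1") (simp_all add: min_def)
 qed (use C in simp)
qed

text \<open>The order is shared: \<open>be\<close> goes to the second difference in
  \<open>h\<close>, \<open>a\<close> to the increment \<open>c\<close>. At \<open>a = 1\<close> the
  gradient of \<open>df2 h u\<close> is estimated from the orders \<open>1 - be/2\<close> and
  \<open>1 + be/2\<close> at the scale \<open>|h|\<close>, where both contributions are multiples of
  \<open>|h|^be\<close>.\<close>

lemma mixed_holder:
 assumes a: "0 < a" "a <= 1" and b: "0 < be" "be <= 1"
 shows "EX C>0. ALL (u::real^'d => real) M N h c x. bd M u & Zyg (a + be) N u -->
  abs (df c (df2 h u) x) <= C * N * h pw be * c pw a"
proof (cases "a < 1")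
 case True
 show ?thesis
 proof (intro exI[of _ "marchaud1 a * marchaud2 a * (8 * marchaud2 be)"] conjI allI impI; (elim conjE)?)
  show "0 < marchaud1 a * marchaud2 a * (8 * marchaud2 be)" using marchaud1_pos[of a] marchaud2_pos[of a] marchaud2_pos[of be] True b by simp
  fix u :: "real^'d => real" and M N h c x assume u: "bd M u" "Zyg (a + be) N u"
  have "Zyg a (8 * marchaud2 be * N * h pw be) (df2 h u)" using Zyg_mixed2[OF u, of be h] a b by simp
  from df1_bound[OF bd_df2[OF u(1)] this True, of c x]
  show "abs (df c (df2 h u) x) <= marchaud1 a * marchaud2 a * (8 * marchaud2 be) * N * h pw be * c pw a"
  by (simp add: alg)
 qed
next
 case False
 hence a1: "a = 1" using a by simp
 let ?t = "be/2"
 have t: "0 < ?t" "?t < 1" using b by auto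
 let ?C = "grad_const ?t * (8 * marchaud2 (be + ?t) + 8 * marchaud2 (be - ?t))"
 have m: "0 < marchaud2 (be + ?t)" "0 < marchaud2 (be - ?t)" using b by (auto intro!: marchaud2_pos)
 show ?thesis
 proof (intro exI[of _ ?C] conjI allI impI; (elim conjE)?)
  show "0 < ?C" using grad_const_pos[OF t] m by (intro mult_pos_pos add_pos_pos) auto
  fix u :: "real^'d => real" and M N h c x assume u: "bd M u" "Zyg (a + be) N u"
  show "abs (df c (df2 h u) x) <= ?C * N * h pw be * c pw a"
  proof (cases "h = 0")
  case True
  thus ?thesis by (simp add: df_def)
  next
  case False
  have Z: "Zyg (1 - ?t) (8 * marchaud2 (be + ?t) * N * h pw (be + ?t)) (df2 h u)"
  "Zyg (1 + ?t) (8 * marchaud2 (be - ?t) * N * h pw (be - ?t)) (df2 h u)"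
  using Zyg_mixed2[OF u, of "be + ?t" h] Zyg_mixed2[OF u, of "be - ?t" h] a1 b by (auto simp: alg)
  have p: "h pw (be + ?t) * h pw (- ?t) = h pw be" "h pw (be - ?t) * h pw ?t = h pw be"
  using False by (auto simp: powr_add[symmetric])
  have e: "8 * marchaud2 (be + ?t) * N * h pw (be + ?t) * h pw (- ?t)
  + 8 * marchaud2 (be - ?t) * N * h pw (be - ?t) * h pw ?t
  = (8 * marchaud2 (be + ?t) + 8 * marchaud2 (be - ?t)) * N * h pw be"
  unfolding mult.assoc p by (simp add: alg)
  show ?thesis using lip_of_grad[OF bd_df2[OF u(1)] Z t, of "norm h" c x] False a1 unfolding e by (simp add: mult.assoc)
  qed
 qed
qed

lemma mixed_taylor:
 assumes a: "1 < a" "a < 2" and b: "0 < be" "be <= 1"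
 shows "EX C>0. ALL (u::real^'d => real) M N h c x. bd M u & Zyg (a + be) N u -->
  abs (df2 h u (x + c) - df2 h u x - grad (df2 h u) x \<bullet> c) <= C * N * h pw be * c pw a"
proof (intro exI[of _ "taylor_const a * (8 * marchaud2 be)"] conjI allI impI; (elim conjE)?)
 show "0 < taylor_const a * (8 * marchaud2 be)" using taylor_const_pos[of a] marchaud2_pos[of be] a b by simp
 fix u :: "real^'d => real" and M N h c x assume u: "bd M u" "Zyg (a + be) N u"
 have "Zyg a (8 * marchaud2 be * N * h pw be) (df2 h u)" using Zyg_mixed2[OF u, of be h] a b by simp
 from grad_taylor(1)[OF bd_df2[OF u(1)] this a, of x c]
 show "abs (df2 h u (x + c) - df2 h u x - grad (df2 h u) x \<bullet> c)
  <= taylor_const a * (8 * marchaud2 be) * N * h pw be * c pw a"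
  by (simp add: alg)
qed

text \<open>The Hoelder modulus of the gradient, needed where the jump enters through its compensator.\<close>

lemma grad_holder:
 assumes a: "1 + 2 * ta <= a" "a + ta < 2" and t: "0 < ta"
 shows "EX C>0. ALL (u::real^'d => real) M N c x. bd M u & Zyg a N u -->
  norm (grad u (x + c) - grad u x) <= C * N * c pw (a - 1)"
proof -
 let ?m = "%sg. 8 * (marchaud1 sg * marchaud2 sg)"
 let ?C = "grad_const ta * (?m (a - 1 + ta) + ?m (a - 1 - ta))"
 have t1: "ta < 1" using a t by linarith
 have m: "0 < ?m (a - 1 + ta)" "0 < ?m (a - 1 - ta)"
  using a t marchaud1_pos[of "a - 1 + ta"] marchaud2_pos[of "a - 1 + ta"] marchaud1_pos[of "a - 1 - ta"] marchaud2_pos[of "a - 1 - ta"] by auto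
 show ?thesis
 proof (intro exI[of _ ?C] conjI allI impI; (elim conjE)?)
  show "0 < ?C" using grad_const_pos[OF t t1] m by simp
  fix u :: "real^'d => real" and M N c x assume u: "bd M u" "Zyg a N u"
  show "norm (grad u (x + c) - grad u x) <= ?C * N * c pw (a - 1)"
  proof (cases "c = 0")
  case True
  thus ?thesis by simp
  next
  case False
  have Z: "Zyg (1 - ta) (?m (a - 1 + ta) * N * c pw (a - 1 + ta)) (df c u)"
  "Zyg (1 + ta) (?m (a - 1 - ta) * N * c pw (a - 1 - ta)) (df c u)"
  using Zyg_mixed1[OF u, of "a - 1 + ta" c] Zyg_mixed1[OF u, of "a - 1 - ta" c] a t by (auto simp: alg)
  have p: "c pw (a - 1 + ta) * c pw (- ta) = c pw (a - 1)" "c pw (a - 1 - ta) * c pw ta = c pw (a - 1)"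
  using False by (auto simp: powr_add[symmetric])
  have e: "?m (a - 1 + ta) * N * c pw (a - 1 + ta) * c pw (- ta)
  + ?m (a - 1 - ta) * N * c pw (a - 1 - ta) * c pw ta
  = (?m (a - 1 + ta) + ?m (a - 1 - ta)) * N * c pw (a - 1)"
  unfolding mult.assoc p by (simp add: alg)
  have "grad (df c u) x = grad u (x + c) - grad u x"
  using grad_df(1)[of u c x] grad_has_derivative[OF u] a t by (simp add: df_def)
  thus ?thesis
  using grad_bound[OF bd_df[OF u(1)] Z t t1, of "norm c" x] False unfolding e by (simp add: mult.assoc)
  qed
 qed
qed

definition jint :: "real => 'u set => (real^'d => real) => real^'d => ('u => real^'d) => 'u => real" where
 "jint al U u x c v = u (x + c v) - u x - (grad u x \<bullet> c v) * indicator U v * (if 1 < al then 1 else 0)"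

text \<open>Dominates the jump \<open>c v\<close>: power \<open>a\<close> in \<open>U = U_1\<close>, truncated outside.\<close>
definition jw :: "real => 'u set => ('u => real^'d) => 'u => real" where
 "jw a U c v = (if v \<in> U then norm (c v) powr a else min (norm (c v) powr min a 1) 1)"

lemma jw_nonneg: "0 <= jw a U c v"
 by (simp add: jw_def)

lemma jint_bound:
 assumes par: "pars al be ta"
 shows "EX C>0. ALL U (g::real^'d => real) Q x c (v::'u). low (al + ta) Q g --> abs (jint al U g x c v) <= C * Q * jw al U c v"
proof -
 have t: "0 < ta" "ta < 1" "ta < al" "al + ta < 2" "0 < al" and a1: "1 < al ==> 1 + 2 * ta <= al"
  using par by (auto simp: pars_def good_tau_def)
 define a where "a = min al 1"
 have a: "0 < a" "a <= 1" using t by (auto simp: a_def)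
 obtain C where C: "0 < C" and h: "!!(g::real^'d => real) Q c x. low (a + ta) Q g ==> abs (df c g x) <= C * Q * c pw a & abs (df c g x) <= C * Q * min (c pw a) 1"
  using holder_low[OF a t(1,2), where 'd = 'd] by meson
 show ?thesis
 proof (intro exI[of _ "C + abs (taylor_const al)"] conjI allI impI)
  fix U and g :: "real^'d => real" and Q x c and v :: 'u assume g: "low (al + ta) Q g"
  have Q: "0 <= Q" by (rule low_nonneg[OF g])
  have la: "low (a + ta) Q g" by (rule low_le[OF g]) (simp add: a_def)
  show "abs (jint al U g x c v) <= (C + abs (taylor_const al)) * Q * jw al U c v"
  proof (cases "1 < al & v \<in> U")
  case True
  have "abs (jint al U g x c v) <= taylor_const al * Q * norm (c v) powr al"
  using grad_taylor(1)[OF low_bd[OF g] low_Zyg[OF g, of al], of x "c v"] True t by (simp add: jint_def)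
  also have "... <= (C + abs (taylor_const al)) * Q * norm (c v) powr al"
  using C Q by (intro mrm) auto
  finally show ?thesis using True by (simp add: jw_def)
  next
  case False
  hence e: "jint al U g x c v = df (c v) g x" by (auto simp: jint_def df_def)
  have "abs (df (c v) g x) <= C * Q * jw al U c v"
  using h[OF la, of "c v" x] False by (auto simp: jw_def a_def min_def split: if_splits)
  also have "... <= (C + abs (taylor_const al)) * Q * jw al U c v"
  using Q jw_nonneg by (intro mrm) auto
  finally show ?thesis unfolding e .
  qed
 qed (use C in linarith)
qed

text \<open>Jumps up to length \<open>e\<close> are estimated at the top order; their weight is the
  small-jump integral, which can be made small. For longer jumps a slightly lower power suffices,
  \<open>|c|^(al - ta) <= e^(-ta) |c|^al\<close>, so they need only the norm of order
  \<open>al + be - ta\<close>, at the cost of the factor \<open>e powr (- ta)\<close>.\<close>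

lemma jint_main:
 assumes par: "pars al be ta"
 shows "EX C>0. ALL U (u::real^'d => real) N Q h x c (v::'u) e. bd N u & Zyg (al + be) N u & low (al + be - ta) Q u & 0 < e & e <= 1 -->
  abs (jint al U (df2 h u) x c v) <= C * h pw be *
  (N * (if norm (c v) <= e then norm (c v) powr al else 0) + Q * e powr (- ta) * jw al U c v)"
proof -
 have t: "0 < ta" "ta < 1" "ta < al" "al + ta < 2" "0 < al" "al < 2" and a1: "1 < al ==> 1 + 2 * ta <= al" and b: "0 < be" "be <= 1" "4 * ta <= be"
  using par by (auto simp: pars_def good_tau_def)
 have mh: "EX C>0. ALL (u::real^'d => real) M N h c x. bd M u & Zyg (a + be) N u -->
  abs (df c (df2 h u) x) <= C * N * h pw be * c pw a" if "0 < a" "a <= 1" for a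
  using mixed_holder[OF that b(1,2), where 'd = 'd] .
 text \<open>\<open>P a C\<close>: the relevant difference of a second difference has order \<open>a\<close>.\<close>
 define P where "P a C \<longleftrightarrow> (ALL (u::real^'d => real) M N h c x. bd M u & Zyg (a + be) N u -->
  abs (df c (df2 h u) x - (if 1 < al then grad (df2 h u) x \<bullet> c else 0)) <= C * N * h pw be * c pw a)" for a C
 have Pex: "EX C>0. P a C" if "1 < al ==> 1 < a & a < 2" "~ 1 < al ==> 0 < a & a <= 1" for a
 proof (cases "1 < al")
  case True
  thus ?thesis using mixed_taylor[of a, OF _ _ b(1,2), where 'd = 'd] that(1) unfolding P_def by (simp add: df_def)
 next
  case False
  thus ?thesis using mh[of a] that(2) unfolding P_def by simp
 qed
 obtain C1 where C1: "0 < C1" "P al C1" using Pex[of al] t by auto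
 obtain C2 where C2: "0 < C2" "P (al - ta) C2" using Pex[of "al - ta"] t a1 by fastforce
 obtain C3 where C3: "0 < C3" "!!(u::real^'d => real) M N h c x. bd M u & Zyg (1 + be) N u ==> abs (df c (df2 h u) x) <= C3 * N * h pw be * c pw 1"
  using mh[OF zero_less_one order_refl] by meson
 let ?m = "2 * marchaud2 be"
 have m: "0 < ?m" using b by (auto intro: marchaud2_pos)
 show ?thesis
 proof (intro exI[of _ "C1 + C2 + C3 + ?m"] conjI allI impI; (elim conjE)?)
  show "0 < C1 + C2 + C3 + ?m" using C1 C2 C3 m by linarith
  fix U and u :: "real^'d => real" and N Q h x and c :: "'u => real^'d" and v :: 'u and e :: real
  assume u: "bd N u" "Zyg (al + be) N u" and l: "low (al + be - ta) Q u" and e: "0 < e" "e <= 1"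
  let ?n = "norm (c v)" and ?H = "h pw be" and ?g = "df2 h u" and ?C = "C1 + C2 + C3 + ?m"
  have N: "0 <= N" and Q: "0 <= Q" using u(1) bd_nonneg low_nonneg[OF l] by auto
  have e1: "1 <= e powr (- ta)" using powr_mono2'[of "-ta" e 1] e t by simp
  have sup: "abs (df (c v) ?g x) <= ?m * Q * ?H"
  proof -
  have "norm (?g z) <= marchaud2 be * Q * ?H" for z
  using df2_bound[OF low_bd[OF l] low_Zyg[OF l b(1)], of h z] t b by simp
  hence "bd (marchaud2 be * Q * ?H) ?g" by (simp add: bd_def)
  from bdD[OF bd_df[OF this], of "c v" x] show ?thesis by simp
  qed
  have main: "abs (jint al U ?g x c v) <= ?C * ?H * (N * (if ?n <= e then ?n powr al else 0) + Q * e powr (- ta) * jw al U c v)"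
  if "abs (jint al U ?g x c v) <= C1 * ?H * (N * (if ?n <= e then ?n powr al else 0)) |
  abs (jint al U ?g x c v) <= (C2 + C3 + ?m) * ?H * (Q * e powr (- ta) * jw al U c v)"
  proof -
  let ?X = "N * (if ?n <= e then ?n powr al else 0)" and ?Y = "Q * e powr (- ta) * jw al U c v"
  have X: "0 <= ?X" "0 <= ?Y" using N Q jw_nonneg[of al U c v] by auto
  have "C1 * ?H * ?X <= ?C * ?H * (?X + ?Y)" "(C2 + C3 + ?m) * ?H * ?Y <= ?C * ?H * (?X + ?Y)"
  using X C1(1) C2(1) C3(1) m by (intro mult_mono[OF mrm]; (simp; fail | linarith))+
  thus ?thesis using that by linarith
  qed
  have c2: "abs z <= (C2 + C3 + ?m) * ?H * (Q * e powr (- ta) * w)" if "abs z <= D * Q * ?H * y" "0 <= D" "D <= C2 + C3 + ?m" "y <= e powr (- ta) * w" "0 <= y" for z D y w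
  proof -
  have "D * Q * ?H * y <= (C2 + C3 + ?m) * Q * ?H * (e powr (- ta) * w)"
  using that Q by (intro mult_mono mult_nonneg_nonneg) auto
  thus ?thesis using that(1) by (simp add: alg)
  qed
  have pw: "?n powr (al - ta) <= e powr (- ta) * ?n powr al" if "e < ?n"
  proof -
  have "?n powr (- ta) <= e powr (- ta)" using that e t by (intro powr_mono2') auto
  hence "?n powr (- ta) * ?n powr al <= e powr (- ta) * ?n powr al" by (intro mrm) auto
  thus ?thesis by (simp add: powr_add[symmetric])
  qed
  have p: "al - ta + be = al + be - ta" by simp
  have big: "abs (df (c v) ?g x - (if 1 < al then grad ?g x \<bullet> c v else 0)) <= C2 * Q * ?H * ?n powr (al - ta)"
  proof -
  have "Zyg (al + be - ta) Q u" using low_Zyg[OF l, of "al + be - ta"] t b by simp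
  thus ?thesis using C2(2) low_bd[OF l] unfolding P_def p by blast
  qed
  have small: "abs (df (c v) ?g x - (if 1 < al then grad ?g x \<bullet> c v else 0)) <= C1 * N * ?H * ?n powr al"
  using C1(2) u unfolding P_def by blast
  show "abs (jint al U ?g x c v) <= ?C * ?H * (N * (if ?n <= e then ?n powr al else 0) + Q * e powr (- ta) * jw al U c v)"
  proof (cases "1 < al & v \<notin> U")
  case True
  hence j: "jint al U ?g x c v = df (c v) ?g x" by (simp add: jint_def df_def)
  have d: "abs (df (c v) ?g x) <= (C3 + ?m) * Q * ?H * min ?n 1"
  proof -
  have "abs (df (c v) ?g x) <= C3 * Q * ?H * ?n" using C3(2)[of Q u Q] low_bd[OF l] low_Zyg[OF l, of "1 + be"] True a1 t b by simp
  also have "... <= (C3 + ?m) * Q * ?H * ?n" using Q m by (intro mrm) auto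
  finally have 1: "abs (df (c v) ?g x) <= (C3 + ?m) * Q * ?H * ?n" .
  have "?m * Q * ?H <= (C3 + ?m) * Q * ?H" using Q C3(1) by (intro mrm) auto
  thus ?thesis using 1 sup by (simp add: min_def)
  qed
  have "1 * min ?n 1 <= e powr (- ta) * min ?n 1" using e1 by (intro mrm) auto
  thus ?thesis using C2(1) C3(1) m True
  by (intro main disjI2, unfold j) (intro c2[OF d]; simp add: jw_def)
  next
  case False
  hence j: "jint al U ?g x c v = df (c v) ?g x - (if 1 < al then grad ?g x \<bullet> c v else 0)" by (auto simp: jint_def df_def)
  show ?thesis
  proof (cases "?n <= e")
  case True
  thus ?thesis using small unfolding j[symmetric] by (intro main disjI1) (simp add: alg)
  next
  case n: False
  show ?thesis
  proof (cases "v \<in> U | ?n <= 1")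
  case True
  have "?n powr al <= jw al U c v"
  using True False powr_le1[of al ?n] t by (auto simp: jw_def min_def)
  hence "e powr (- ta) * ?n powr al <= e powr (- ta) * jw al U c v" by (intro mlm) auto
  hence "?n powr (al - ta) <= e powr (- ta) * jw al U c v" using pw n by linarith
  thus ?thesis using C2(1) C3(1) m by (intro main disjI2, unfold j) (intro c2[OF big]; simp)
  next
  \<comment> \<open>Here \<open>al <= 1\<close> and the jump is longer than one and outside
    \<open>U\<close>, so its weight \<open>jw\<close> is one and the sup norm of
    \<open>df2 h u\<close> suffices.\<close>
  case U: False
  hence j': "jint al U ?g x c v = df (c v) ?g x" using False unfolding j by auto
  have "1 <= jw al U c v" using U t by (simp add: jw_def ge_one_powr_ge_zero)
  hence "1 * 1 <= e powr (- ta) * jw al U c v" using e1 by (intro mult_mono) auto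
  moreover have "abs (df (c v) ?g x) <= ?m * Q * ?H * 1" using sup by simp
  ultimately show ?thesis using C2(1) C3(1) m by (intro main disjI2, unfold j') (rule c2[where D = ?m and y = 1]; simp)
  qed
  qed
  qed
 qed
qed

text \<open>The exponent \<open>a\<close> in which the jump sizes are Hoelder continuous in the space variable.\<close>

definition jpar :: "real => real => real => real => bool" where
 "jpar al be ta a \<longleftrightarrow> (if al < 1 then 0 < a & a <= 1 & a + ta <= al + be - ta else a = al)"

text \<open>A weighted Young inequality for the compensator, where a gradient increment of size
  \<open>|c|^(al - 1)\<close> meets the change \<open>d\<close> of the jump. The weight
  \<open>l\<close> will be \<open>|h|^be\<close>, which gives both terms this size after
  integration.\<close>

lemma young_jump:
 fixes c d :: real
 assumes "1 <= al" "0 < l" "0 <= c" "0 <= d"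
 shows "c powr (al - 1) * d <= l * c powr al + l powr (1 - al) * d powr al"
proof (cases "d <= l * c")
 case True
 have "c powr (al - 1) * d <= c powr (al - 1) * (l * c)" using True by (intro mlm) auto
 also have "... = l * c powr al" using assms by (cases "c = 0") (auto simp: powr_diff)
 finally show ?thesis by (smt (verit) mult_nonneg_nonneg powr_ge_zero)
next
 case False
 hence d: "0 < d" "c <= d / l" using assms by (auto simp: field_simps) (smt (verit) mult_nonneg_nonneg)
 have "c powr (al - 1) * d <= (d / l) powr (al - 1) * d" using d assms by (intro mrm powr_mono2) auto
 also have "... = l powr (1 - al) * d powr al" using d assms by (simp add: powr_divide powr_diff field_simps)
 finally show ?thesis using assms by (smt (verit) mult_nonneg_nonneg powr_ge_zero)
qed

text \<open>For \<open>al > 1\<close> inside \<open>U\<close> the difference is a Taylor remainder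
  at \<open>x + c v\<close> plus the gradient increment from \<open>x\<close> to
  \<open>x + c v\<close> times the change of the jump. In all other cases there is no compensator
  and a plain increment remains.\<close>

lemma jint_diff:
 assumes par: "pars al be ta" and ja: "jpar al be ta a"
 shows "EX C>0. ALL U (g::real^'d => real) Q x c c' (v::'u) l. low (al + be - ta) Q g & 0 < l -->
  abs (jint al U g x c' v - jint al U g x c v) <= C * Q * (jw a U (%v. c' v - c v) v +
  (l * jw al U c v + l powr (1 - al) * (if v \<in> U then norm (c' v - c v) powr a else 0)))"
proof -
 have t: "0 < ta" "ta < 1" "ta < al" "al + ta < 2" "0 < al" "al < 2" and a1: "1 < al ==> 1 + 2 * ta <= al" and b: "0 < be" "be <= 1" "4 * ta <= be"
  using par by (auto simp: pars_def good_tau_def)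
 define a0 where "a0 = min a 1"
 have a0: "0 < a0" "a0 <= 1" "a0 + ta <= al + be - ta" using ja t b by (auto simp: a0_def jpar_def min_def split: if_splits)
 obtain C1 where C1: "0 < C1" and h: "!!(g::real^'d => real) Q c x. low (a0 + ta) Q g ==> abs (df c g x) <= C1 * Q * c pw a0 & abs (df c g x) <= C1 * Q * min (c pw a0) 1"
  using holder_low[OF a0(1,2) t(1,2), where 'd = 'd] by meson
 obtain C2 where C2: "0 < C2" and gh: "!!(u::real^'d => real) M N c x. 1 < al ==> bd M u ==> Zyg al N u ==>
  norm (grad u (x + c) - grad u x) <= C2 * N * c pw (al - 1)"
 proof (cases "1 < al")
  case True
  from grad_holder[OF a1[OF True] t(4,1), where 'd = 'd] that show thesis by meson
 next
  case False
  thus thesis using that[of 1] by simp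
 qed
 let ?C3 = "abs (taylor_const al)"
 show ?thesis
 proof (intro exI[of _ "C1 + C2 + ?C3"] conjI allI impI; (elim conjE)?)
  show "0 < C1 + C2 + ?C3" using C1 C2 by linarith
  fix U and g :: "real^'d => real" and Q x and c c' :: "'u => real^'d" and v :: 'u and l :: real
  assume g: "low (al + be - ta) Q g" and l: "0 < l"
  have Q: "0 <= Q" by (rule low_nonneg[OF g])
  let ?d = "c' v - c v"
  let ?Y = "l * jw al U c v + l powr (1 - al) * (if v \<in> U then norm ?d powr a else 0)"
  have Y: "0 <= ?Y" using l jw_nonneg by (intro add_nonneg_nonneg mult_nonneg_nonneg) auto
  have w: "0 <= jw a U (%v. c' v - c v) v" by (rule jw_nonneg)
  show "abs (jint al U g x c' v - jint al U g x c v) <= (C1 + C2 + ?C3) * Q * (jw a U (%v. c' v - c v) v + ?Y)"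
  proof (cases "1 < al & v \<in> U")
  case True
  hence a: "a = al" using ja by (simp add: jpar_def)
  have Z: "Zyg al Q g" using low_Zyg[OF g, of al] t b by simp
  let ?z = "x + c v"
  have eq: "jint al U g x c' v - jint al U g x c v = (g (?z + ?d) - g ?z - grad g ?z \<bullet> ?d) + (grad g ?z - grad g x) \<bullet> ?d"
  using True by (simp add: jint_def alg inner_diff_left inner_diff_right)
  have 1: "abs (g (?z + ?d) - g ?z - grad g ?z \<bullet> ?d) <= ?C3 * Q * norm ?d powr al"
  using grad_taylor(1)[OF low_bd[OF g] Z, of ?z ?d] True t taylor_const_pos[of al] by simp
  have "abs ((grad g ?z - grad g x) \<bullet> ?d) <= norm (grad g ?z - grad g x) * norm ?d" by (rule Cauchy_Schwarz_ineq2)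
  also have "... <= C2 * Q * norm (c v) powr (al - 1) * norm ?d"
  using gh[OF _ low_bd[OF g] Z, of x "c v"] True by (intro mrm) auto
  also have "... = C2 * Q * (norm (c v) powr (al - 1) * norm ?d)" by simp
  also have "... <= C2 * Q * ?Y"
  using young_jump[of al l "norm (c v)" "norm ?d"] True l C2 Q a by (intro mlm) (auto simp: jw_def)
  finally have "abs (jint al U g x c' v - jint al U g x c v) <= ?C3 * Q * jw a U (%v. c' v - c v) v + C2 * Q * ?Y"
  using 1 True a unfolding eq by (simp add: jw_def)
  moreover have "?C3 * Q * jw a U (%v. c' v - c v) v + C2 * Q * ?Y <= (C1 + C2 + ?C3) * Q * jw a U (%v. c' v - c v) v + (C1 + C2 + ?C3) * Q * ?Y"
  using C1 C2 Q w Y by (intro add_mono mrm) auto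
  ultimately show ?thesis by (simp add: distrib_left)
  next
  case False
  hence eq: "jint al U g x c' v - jint al U g x c v = df ?d g (x + c v)" by (auto simp: jint_def df_def)
  have "abs (df ?d g (x + c v)) <= C1 * Q * jw a U (%v. c' v - c v) v"
  using h[OF low_le[OF g a0(3)], of ?d "x + c v"] False ja by (auto simp: jw_def a0_def jpar_def split: if_splits)
  also have "... <= (C1 + C2 + ?C3) * Q * (jw a U (%v. c' v - c v) v + ?Y)"
  using C1 C2 Q w Y by (intro mult_mono mrm) auto
  finally show ?thesis unfolding eq .
  qed
 qed
qed

section \<open>Jump estimates integrated over the marks\<close>

lemma jint_measurable:
 assumes u: "reg s u" "0 < s" and c: "c \<in> bm nu" and U: "U \<in> sets nu"
 shows "jint al U (u::real^'d => real) x c \<in> bm nu"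
proof -
 have "continuous_on UNIV u" using u Zyg_continuous unfolding reg_def by blast
 hence [measurable]: "u \<in> bm borel" by (rule borel_measurable_continuous_onI)
 note [measurable] = c U
 show ?thesis unfolding jint_def by measurable
qed

definition jdata :: "real => real => real => real => real => (real => ennreal) => 'u measure => 'u set => (real^'d => 'u => real^'d) => bool" where
 "jdata al be a K C0 ka nu U c \<longleftrightarrow> U \<in> sets nu & (ALL x. c x \<in> bm nu & ib nu K (jw al U (c x)) &
  (ALL e>0. (\<integral>\<^sup>+v. ennreal (if norm (c x v) <= e then norm (c x v) powr al else 0) \<partial>nu) <= ka e)) &
  (ALL x h. ib nu (C0 * h pw (if 1 <= al then al * be else be)) (%v. if v \<in> U then norm (c (x + h) v - c x v) powr a else 0) &
  ib nu (C0 * h pw be) (%v. if v \<in> U then 0 else min (norm (c (x + h) v - c x v) powr min a 1) 1))"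

lemma jint_diff_ib:
 assumes par: "pars al be ta" and ja: "jpar al be ta a"
 shows "EX C>0. ALL (nu::'u measure) U c ka K C0 (g::real^'d => real) Q y x h. jdata al be a K C0 ka nu U c & 0 <= K & 0 <= C0 & reg (al + be) g &
  low (al + be - ta) Q g & h ~= 0 & norm h <= 2 -->
  ib nu (C * (K + C0) * Q * h pw be) (%v. jint al U g y (c (x + h)) v - jint al U g y (c x) v)"
proof -
 have t: "0 < al" "al < 2" and b: "0 < be" "be <= 1" using par by (auto simp: pars_def good_tau_def)
 show ?thesis
 proof (insert jint_diff[OF par ja, where 'd = 'd and 'u = 'u], elim exE conjE, goal_cases)
 case (1 C)
 note C = 1(1) and d = 1(2)[rule_format]
 show ?thesis
 proof (intro exI[of _ "5 * C"] conjI allI impI; (elim conjE)?)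
  show "0 < 5 * C" using C by simp
  fix nu :: "'u measure" and U and c :: "real^'d => 'u => real^'d" and ka K C0 and g :: "real^'d => real" and Q and y x h :: "real^'d"
  assume j: "jdata al be a K C0 ka nu U c" and K: "0 <= K" "0 <= C0" and r: "reg (al + be) g" and g: "low (al + be - ta) Q g" and h: "h ~= 0" "norm h <= 2"
  have Q: "0 <= Q" by (rule low_nonneg[OF g])
  let ?H = "h pw be"
  let ?D1 = "%v. if v \<in> U then norm (c (x + h) v - c x v) powr a else 0"
  let ?D2 = "%v. if v \<in> U then 0 else min (norm (c (x + h) v - c x v) powr min a 1) 1"
  have H: "0 < ?H" using h by simp
  have pe: "h pw e <= 2" if "0 <= e" "e <= 1" for e
  proof -
  have "h pw e <= 2 powr e" using h that by (intro powr_mono2) auto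
  also have "... <= 2 powr 1" using that by (intro powr_mono) auto
  finally show ?thesis by simp
  qed
  have e1: "h pw (if 1 <= al then al * be else be) <= 2 * ?H"
  proof (cases "1 <= al")
  case True
  have "h pw ((al - 1) * be) * ?H <= 2 * ?H"
  using True t b mult_le_one[of "al - 1" be] by (intro mrm pe) auto
  thus ?thesis using True h by (simp add: powr_add[symmetric] alg)
  qed (use H in simp)
  have e2: "?H powr (1 - al) * h pw (if 1 <= al then al * be else be) <= 2 * ?H"
  proof (cases "1 <= al")
  case True
  thus ?thesis using h by (simp add: powr_powr powr_add[symmetric] alg)
  next
  case False
  have "h pw (be * (1 - al)) * ?H <= 2 * ?H"
  using False t b mult_le_one[of be "1 - al"] by (intro mrm pe) auto
  thus ?thesis using False by (simp add: powr_powr)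
  qed
  have i1: "ib nu (C0 * h pw (if 1 <= al then al * be else be)) ?D1" and i2: "ib nu (C0 * ?H) ?D2" and i3: "ib nu K (jw al U (c x))"
  using j unfolding jdata_def by blast+
  let ?T = "%v. abs (C * Q) * ((?D1 v + ?D2 v) + (?H * jw al U (c x) v + ?H powr (1 - al) * ?D1 v))"
  let ?R = "abs (C * Q) * ((C0 * h pw (if 1 <= al then al * be else be) + C0 * ?H)
  + (abs ?H * K + abs (?H powr (1 - al)) * (C0 * h pw (if 1 <= al then al * be else be))))"
  have iT: "ib nu ?R ?T" using ib_cmult[OF ib_add[OF ib_add[OF i1 i2] ib_add[OF ib_cmult[OF i3, of ?H] ib_cmult[OF i1, of "?H powr (1 - al)"]]], of "abs (C * Q)"]
  by (simp only: abs_abs)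
  have R: "?R <= 5 * C * (K + C0) * Q * ?H"
  proof -
  have "C0 * h pw (if 1 <= al then al * be else be) <= C0 * (2 * ?H)" using K by (intro mlm e1) auto
  moreover have "C0 * (?H powr (1 - al) * h pw (if 1 <= al then al * be else be)) <= C0 * (2 * ?H)" using K by (intro mlm e2) auto
  moreover have "0 <= ?H * K" using H K by simp
  ultimately have "(C0 * h pw (if 1 <= al then al * be else be) + C0 * ?H)
  + (abs ?H * K + abs (?H powr (1 - al)) * (C0 * h pw (if 1 <= al then al * be else be))) <= 5 * ((K + C0) * ?H)"
  by (simp add: alg del: powr_powr)
  hence "?R <= abs (C * Q) * (5 * ((K + C0) * ?H))" by (rule mlm) simp
  thus ?thesis using C Q by (simp add: abs_mult alg)
  qed
  have m: "c z \<in> bm nu" for z using j unfolding jdata_def by blast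
  have U: "U \<in> sets nu" using j unfolding jdata_def by blast
  show "ib nu (5 * C * (K + C0) * Q * ?H) (%v. jint al U g y (c (x + h)) v - jint al U g y (c x) v)"
  proof (rule ib_le[OF iT _ _ R])
  show "(%v. jint al U g y (c (x + h)) v - jint al U g y (c x) v) \<in> bm nu"
  using t b by (intro borel_measurable_diff jint_measurable[OF r _ m U]) auto
  fix v
  have "jw a U (%v. c (x + h) v - c x v) v = ?D1 v + ?D2 v" by (simp add: jw_def)
  thus "abs (jint al U g y (c (x + h)) v - jint al U g y (c x) v) <= ?T v"
  using d[of Q g ?H U y "c (x + h)" v "c x"] g H C Q by simp
  qed
 qed
 qed
qed

lemma jint_df:
 fixes u :: "real^'d => real"
 assumes "reg s u" "1 < al ==> 1 < s"
 shows "jint al U (df h u) x c v = jint al U u (x + h) c v - jint al U u x c v"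
proof (cases "1 < al")
 case True
 hence "grad (df h u) x = df h (grad u) x" using grad_df(1)[of u h x] reg_grad[OF assms(1)] assms(2) by blast
 hence "grad (df h u) x \<bullet> c v = grad u (x + h) \<bullet> c v - grad u x \<bullet> c v" by (simp add: df_def inner_diff_left)
 thus ?thesis unfolding jint_def df_def by (simp add: left_diff_distrib right_diff_distrib add.assoc add.commute[of h])
next
 case False
 thus ?thesis by (simp add: jint_def df_def alg)
qed

lemma jint_lin:
 fixes u :: "real^'d => real"
 assumes "reg s u" "reg s v" "1 < al ==> 1 < s"
 shows "jint al U (%x. u x + k * v x) x c w = jint al U u x c w + k * jint al U v x c w"
proof (cases "1 < al")
 case True
 hence "grad (%x. u x + k * v x) x = grad u x + k *. grad v x"
  using grad_lin[of u x v k] reg_grad assms by blast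
 thus ?thesis by (simp add: jint_def alg inner_add_left)
next
 case False
 thus ?thesis by (simp add: jint_def alg)
qed

definition hcoef :: "real => real => (real^'d => 'b::real_normed_vector) => bool" where
 "hcoef be K f \<longleftrightarrow> bd K f & (ALL h x. norm (df h f x) <= K * h pw (be/2) & norm (df2 h f x) <= K * h pw be)"

lemma ib_mult:
 assumes f: "ib nu R f" and r: "r \<in> bm nu" "!!v. v \<in> space nu ==> abs (r v) <= k" and k: "0 <= k" and R: "k * R <= R'"
 shows "ib nu R' (%v. f v * r v)"
proof -
 have [measurable]: "f \<in> bm nu" using f by (simp add: ib_def)
 have "ib nu R (%v. abs (f v))" using f by (simp add: ib_def)
 from ib_cmult[OF this, of k] k have i: "ib nu (k * R) (%v. k * abs (f v))" by simp
 show ?thesis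
 proof (rule ib_le[OF i _ _ R])
  show "(%v. f v * r v) \<in> bm nu" using f r(1) by (simp add: ib_def)
  fix v assume "v \<in> space nu"
  from mlm[OF r(2)[OF this], of "abs (f v)"] show "abs (f v * r v) <= k * abs (f v)" by (simp add: abs_mult mult.commute)
 qed
qed

text \<open>The second difference is expanded so that every term reaches the exponent
  \<open>be\<close>. One change of the jump already gives \<open>|h|^be\<close>, so the top-order
  norm of \<open>u\<close> appears only where jump and density are frozen at \<open>x\<close>. The
  density supplies \<open>be\<close> through two differences, or \<open>be/2\<close> through one,
  completed by a first difference of \<open>u\<close> or by a change of the jump.\<close>

lemma jump_estimates:
 assumes par: "pars al be ta" and ja: "jpar al be ta a"
 shows "EX C>0. ALL (nu::'u measure) U c ka ro K C0 (u::real^'d => real) Q x. jdata al be a K C0 ka nu U c & 0 <= K & 0 <= C0 &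
  (ALL x. ro x \<in> bm nu) & (ALL v:space nu. hcoef be K (%x. ro x v)) & reg (al + be) u & low (al + be - ta) Q u -->
  ib nu (C * K * K * Q) (%v. jint al U u x (c x) v * ro x v) &
  (ALL N h e k. bd N u & Zyg (al + be) N u & h ~= 0 & norm h <= 1 & 0 < e & e <= 1 & 0 <= k & ka e <= ennreal k -->
  abs (df2 h (%x. LINT v|nu. jint al U u x (c x) v * ro x v) x) <= C * K * h pw be * (k * N + e powr (- ta) * (K + C0) * Q))"
proof -
 have t: "0 < ta" "ta < 1" "ta < al" "al + ta < 2" "0 < al" "al < 2" and b: "0 < be" "be <= 1" "4 * ta <= be"
  using par by (auto simp: pars_def good_tau_def)
 obtain C1 where C1: "0 < C1" and jb: "!!U (g::real^'d => real) Q x c (v::'u). low (al + ta) Q g ==> abs (jint al U g x c v) <= C1 * Q * jw al U c v"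
  using jint_bound[OF par, where 'd = 'd and 'u = 'u] by meson
 show ?thesis
 proof (insert jint_main[OF par, where 'd = 'd and 'u = 'u], elim exE conjE, goal_cases)
 case (1 C2)
 note C2 = 1(1) and jm = 1(2)[rule_format]
 show ?thesis
 proof (insert jint_diff_ib[OF par ja, where 'd = 'd and 'u = 'u], elim exE conjE, goal_cases)
 case (1 C3)
 note C3 = 1(1) and jd = 1(2)[rule_format]
 define m where "m = 8 * (marchaud1 (be/2) * marchaud2 (be/2))"
 have m: "0 < m" using b marchaud1_pos[of "be/2"] marchaud2_pos[of "be/2"] by (simp add: m_def)
 define C where "C = C2 + 6 * C3 + 2 * C1 * m + C1"
 have C: "0 < C" "C1 <= C" using C1 C2 C3 m by (auto simp: C_def intro!: add_pos_pos)
 show ?thesis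
 proof (intro exI[of _ C] conjI C(1) allI impI; elim conjE)
  fix nu :: "'u measure" and U and c :: "real^'d => 'u => real^'d" and ka and ro :: "real^'d => 'u => real" and K C0 and u :: "real^'d => real" and Q and x :: "real^'d"
  assume j: "jdata al be a K C0 ka nu U c" and K: "0 <= K" "0 <= C0"
  and rom: "ALL x. ro x \<in> bm nu" and ro: "ALL v:space nu. hcoef be K (%x. ro x v)" and r: "reg (al + be) u" and l: "low (al + be - ta) Q u"
  have Q: "0 <= Q" by (rule low_nonneg[OF l])
  have cm: "c z \<in> bm nu" and W: "ib nu K (jw al U (c z))" and U: "U \<in> sets nu" for z using j unfolding jdata_def by blast+
  have rob: "abs (ro z v) <= K" if "v \<in> space nu" for z v using ro that bdD[of K "%x. ro x v" z] by (auto simp: hcoef_def)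
  have jm': "reg (al + be) g ==> jint al U g y (c z) \<in> bm nu" for g y z
  using t b by (intro jint_measurable[where s = "al + be", OF _ _ cm U]) auto
  have B: "ib nu (C1 * q * K) (jint al U g y (c z))" if "low (al + ta) q g" "reg (al + be) g" for q g y z
  proof -
  have "0 <= q" by (rule low_nonneg[OF that(1)])
  hence "ib nu (C1 * q * K) (%v. C1 * q * jw al U (c z) v)" using ib_cmult[OF W, of "C1 * q"] C1 by simp
  thus ?thesis by (rule ib_le[OF _ jm'[OF that(2)] jb[OF that(1)] order_refl])
  qed
  have lt: "low (al + ta) Q u" by (rule low_le[OF l]) (use b t in linarith)
  have I: "ib nu (C1 * K * K * Q) (%v. jint al U u z (c z) v * ro z v)" for z
  by (rule ib_mult[OF B[OF lt r] rom[rule_format] rob K(1)]) (auto simp: alg)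
  have mono: "C1 * K * K * Q <= C * K * K * Q" using K Q C(2) by (intro mrm) auto
  have iF: "integrable nu (%v. jint al U u z (c z) v * ro z v)" for z by (rule ib_integral(1)[OF I])
  {
  have m: "(%v. jint al U u x (c x) v * ro x v) \<in> bm nu" using I unfolding ib_def by blast
  show "ib nu (C * K * K * Q) (%v. jint al U u x (c x) v * ro x v)"
  using I[of x] ennreal_leI[OF mono] mono unfolding ib_def by (auto intro: order_trans)
  }
  fix N and h :: "real^'d" and e k assume u: "bd N u" "Zyg (al + be) N u" and h: "h ~= 0" "norm h <= 1" and e: "0 < e" "e <= 1" and k: "0 <= k" "ka e <= ennreal k"
  have N: "0 <= N" by (rule bd_nonneg[OF u(1)])
  have e1: "1 <= e powr (- ta)" using powr_mono2'[of "-ta" e 1] e t by simp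
  let ?H = "h pw be" let ?y1 = "x + h" let ?y2 = "x + (h + h)"
  define P where "P = e powr (- ta) * (K + C0) * Q"
  have P: "(K + C0) * Q <= P" "K * Q <= P" "0 <= P" "Q * e powr (- ta) * K <= P"
  proof -
  have "0 <= (K + C0) * Q" using K Q by simp
  from mrm[OF e1 this] show 1: "(K + C0) * Q <= P" by (simp add: P_def mult.assoc)
  have "K * Q <= (K + C0) * Q" using K Q by (intro mrm) auto
  thus "K * Q <= P" using 1 by linarith
  show "0 <= P" using K Q by (simp add: P_def)
  have "Q * e powr (- ta) * K <= Q * e powr (- ta) * (K + C0)" using K Q by (intro mlm) auto
  thus "Q * e powr (- ta) * K <= P" by (simp add: P_def alg)
  qed
  have hh: "norm (h + h) powr be <= 2 * ?H"
  proof -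
  have "norm (h + h) = 2 * norm h" by (simp add: scaleR_2[symmetric])
  hence "norm (h + h) powr be = 2 powr be * ?H" by (simp add: powr_mult)
  also have "... <= 2 powr 1 * ?H" using b by (intro mrm powr_mono) auto
  finally show ?thesis by simp
  qed
  have nh: "h + h ~= 0" "norm (h + h) <= 2" using h by (auto simp: scaleR_2[symmetric])
  have rdf: "reg (al + be) (df h u)" "reg (al + be) (df2 h u)" using r by (auto intro: reg_df)
  let ?d = "%v. df h (%x. ro x v) x" and ?dd = "%v. df2 h (%x. ro x v) x"
  have rod: "abs (?d v) <= K * h pw (be/2)" "abs (?dd v) <= K * ?H" if "v \<in> space nu" for v
  using ro that unfolding hcoef_def by auto
  have rodm: "?d \<in> bm nu" "?dd \<in> bm nu" unfolding df_def by (intro borel_measurable_diff rom[rule_format])+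
  \<comment> \<open>The pieces of the expansion: frozen jump and density in \<open>?t1\<close>,
    change of the jump in \<open>?t2\<close> and \<open>?t3\<close>, one difference of the density
    in \<open>?t4\<close> and \<open>?t5\<close>, two in \<open>?t6\<close>.\<close>
  let ?t1 = "%v. jint al U (df2 h u) x (c x) v * ro x v"
  let ?t2 = "%v. (jint al U u ?y2 (c ?y2) v - jint al U u ?y2 (c x) v) * ro x v"
  let ?t3 = "%v. (jint al U u ?y1 (c ?y1) v - jint al U u ?y1 (c x) v) * ro x v"
  let ?t4 = "%v. jint al U (df h u) ?y1 (c ?y2) v * ?d v"
  let ?t5 = "%v. (jint al U u ?y1 (c (?y1 + h)) v - jint al U u ?y1 (c ?y1) v) * ?d v"
  let ?t6 = "%v. jint al U u ?y2 (c ?y2) v * ?dd v"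
  have i1: "ib nu (C2 * K * ?H * (k * N + P)) ?t1"
  proof -
  let ?s = "%v. if norm (c x v) <= e then norm (c x v) powr al else 0"
  note [measurable] = cm
  have "(\<integral>\<^sup>+v. ennreal (abs (?s v)) \<partial>nu) = (\<integral>\<^sup>+v. ennreal (?s v) \<partial>nu)" by (intro nn_integral_cong) auto
  also have "... <= ka e" using j e unfolding jdata_def by blast
  finally have "ib nu k ?s" using k unfolding ib_def by (auto intro: order_trans)
  from ib_cmult[OF ib_add[OF ib_cmult[OF this, of N] ib_cmult[OF W[of x], of "Q * e powr (- ta)"]], of "C2 * ?H"]
  have i: "ib nu (C2 * ?H * (N * k + Q * e powr (- ta) * K)) (%v. C2 * ?H * (N * ?s v + Q * e powr (- ta) * jw al U (c x) v))"
  using N Q C2 by (simp add: abs_mult)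
  have "C2 * ?H * (N * k + Q * e powr (- ta) * K) <= C2 * ?H * (k * N + P)"
  using C2 P(4) by (intro mlm) (auto simp: mult.commute)
  from ib_le[OF i jm'[OF rdf(2)] jm this] u l e
  have "ib nu (C2 * ?H * (k * N + P)) (jint al U (df2 h u) x (c x))" by blast
  thus ?thesis by (rule ib_mult[OF _ rom[rule_format] rob K(1)]) (auto simp: alg)
  qed
  have K1: "K * (C3 * (K + C0) * Q * y) <= K * C3 * y * P" if "0 <= y" for y
  using mlm[OF P(1), of "K * C3 * y"] that K C3 by (simp add: alg)
  have i2: "ib nu (C3 * K * (2 * ?H) * P) ?t2"
  proof (rule ib_mult[OF jd[of K C0 ka nu U c u Q "h + h" ?y2 x] rom[rule_format] rob K(1)])
  have "K * C3 * norm (h + h) powr be * P <= K * C3 * (2 * ?H) * P" using hh K C3 P by (intro mrm mlm) auto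
  thus "K * (C3 * (K + C0) * Q * norm (h + h) powr be) <= C3 * K * (2 * ?H) * P"
  using K1[of "norm (h + h) powr be"] by (simp add: mult.commute[of C3])
  qed (use j K r l nh in auto)
  have i3: "ib nu (C3 * K * ?H * P) ?t3"
  proof (rule ib_mult[OF jd[of K C0 ka nu U c u Q h ?y1 x] rom[rule_format] rob K(1)])
  show "K * (C3 * (K + C0) * Q * ?H) <= C3 * K * ?H * P" using K1[of ?H] by (simp add: mult.commute[of C3])
  qed (use j K r l h in auto)
  have h2: "h pw (be/2) * h pw (be/2) = ?H" by (simp add: powr_add[symmetric])
  have h1: "h pw (be/2) <= 1" using h b by (intro powr_le1) auto
  have i4: "ib nu (C1 * m * K * ?H * P) ?t4"
  proof (rule ib_mult[OF B rodm(1) rod(1)])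
  show "low (al + ta) (m * Q * h pw (be/2)) (df h u)"
  unfolding m_def by (rule low_le[OF low_df[OF l]]) (use b t in auto)
  have "K * h pw (be/2) * (C1 * (m * Q * h pw (be/2)) * K) = C1 * m * K * ?H * (K * Q)" by (simp add: h2[symmetric])
  also have "... <= C1 * m * K * ?H * P" using C1 m K by (intro mlm P) auto
  finally show "K * h pw (be/2) * (C1 * (m * Q * h pw (be/2)) * K) <= C1 * m * K * ?H * P" .
  qed (use rdf K in auto)
  have i5: "ib nu (C3 * K * ?H * P) ?t5"
  proof (rule ib_mult[OF jd[of K C0 ka nu U c u Q h ?y1 ?y1] rodm(1) rod(1)])
  have "h pw (be/2) * (K * (C3 * (K + C0) * Q * ?H)) <= 1 * (K * (C3 * (K + C0) * Q * ?H))"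
  using h1 K C3 Q by (intro mrm) auto
  thus "K * h pw (be/2) * (C3 * (K + C0) * Q * ?H) <= C3 * K * ?H * P" using K1[of ?H] by (simp add: mult.commute[of C3] mult.left_commute mult.assoc)
  qed (use j K r l h in auto)
  have i6: "ib nu (C1 * K * ?H * P) ?t6"
  proof (rule ib_mult[OF B[OF lt r] rodm(2) rod(2)])
  have "K * ?H * (C1 * Q * K) = C1 * K * ?H * (K * Q)" by simp
  also have "... <= C1 * K * ?H * P" using C1 K by (intro mlm P) auto
  finally show "K * ?H * (C1 * Q * K) <= C1 * K * ?H * P" .
  qed (use K in auto)
  let ?F = "%z v. jint al U u z (c z) v * ro z v"
  have s: "1 < al ==> 1 < al + be" using b by simp
  have id: "?F ?y2 v - ?F ?y1 v - (?F ?y1 v - ?F x v)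
  = ((?t1 v + ?t2 v) + (-2) * ?t3 v) + ((2 * ?t4 v + 2 * ?t5 v) + ?t6 v)" for v
  by (simp only: jint_df[OF rdf(1) s] jint_df[OF r s]) (simp add: df_def alg)
  have "df2 h (%x. LINT v|nu. ?F x v) x = (LINT v|nu. ?F ?y2 v - ?F ?y1 v - (?F ?y1 v - ?F x v))"
  unfolding df_def add.assoc by (simp only: Bochner_Integration.integral_diff Bochner_Integration.integrable_diff iF)
  also have "... = (LINT v|nu. ((?t1 v + ?t2 v) + (-2) * ?t3 v) + ((2 * ?t4 v + 2 * ?t5 v) + ?t6 v))"
  unfolding id ..
  finally have dd: "df2 h (%x. LINT v|nu. ?F x v) x = (LINT v|nu. ((?t1 v + ?t2 v) + (-2) * ?t3 v) + ((2 * ?t4 v + 2 * ?t5 v) + ?t6 v))" .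
  have "abs (df2 h (%x. LINT v|nu. ?F x v) x) <= ((C2 * K * ?H * (k * N + P) + C3 * K * (2 * ?H) * P) + abs (-2) * (C3 * K * ?H * P))
  + ((abs (2) * (C1 * m * K * ?H * P) + abs (2) * (C3 * K * ?H * P)) + C1 * K * ?H * P)"
  unfolding dd by (rule ib_integral(2)[OF ib_add[OF ib_add[OF ib_add[OF i1 i2] ib_cmult[OF i3]] ib_add[OF ib_add[OF ib_cmult[OF i4] ib_cmult[OF i5]] i6]]])
  also have "... <= C * K * ?H * (k * N + P)"
  proof -
  have "0 <= (C - C2) * (K * ?H * (k * N))" using C1 C2 C3 m K k N by (intro mult_nonneg_nonneg) (auto simp: C_def)
  thus ?thesis by (simp add: C_def alg)
  qed
  finally show "abs (df2 h (%x. LINT v|nu. jint al U u x (c x) v * ro x v) x) <= C * K * ?H * (k * N + e powr (- ta) * (K + C0) * Q)"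
  unfolding P_def .
 qed
 qed
 qed
qed

lemma zero_order_estimates:
 assumes b: "0 < be" "be <= 1" "be <= p"
 shows "EX C>0. ALL l K (u::real^'d => real) Q h x. hcoef be K l & low p Q u --> abs (l x * u x) <= K * Q &
  abs (df2 h (%x. l x * u x) x) <= C * K * Q * h pw be"
proof -
 let ?m1 = "marchaud1 (be/2) * marchaud2 (be/2)" and ?m2 = "marchaud2 be"
 have m: "0 < ?m1" "0 < ?m2" using b marchaud1_pos[of "be/2"] marchaud2_pos[of "be/2"] marchaud2_pos[of be] by auto
 show ?thesis
 proof (intro exI[of _ "?m2 + 2 * ?m1 + 1"] conjI allI impI; (elim conjE)?)
  show "0 < ?m2 + 2 * ?m1 + 1" using m by linarith
  fix l :: "real^'d => real" and K and u :: "real^'d => real" and Q and h x :: "real^'d"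
  assume l: "hcoef be K l" and u: "low p Q u"
  have Q: "0 <= Q" by (rule low_nonneg[OF u])
  have lb: "abs (l z) <= K" and l1: "abs (df h l z) <= K * h pw (be/2)" and l2: "abs (df2 h l z) <= K * h pw be" for z
  using l bdD[of K l z] by (auto simp: hcoef_def)
  have K: "0 <= K" using lb[of 0] by linarith
  have ub: "abs (u z) <= Q" for z using bdD[OF low_bd[OF u], of z] by simp
  have u1: "abs (df h u z) <= ?m1 * Q * h pw (be/2)" for z
  using df1_bound[OF low_bd[OF u] low_Zyg[OF u, of "be/2"], of h z] b by simp
  have u2: "abs (df2 h u z) <= ?m2 * Q * h pw be" for z
  using df2_bound[OF low_bd[OF u] low_Zyg[OF u, of be], of h z] b by simp
  have p: "abs (y * z) <= Y * Z" if "abs y <= Y" "abs z <= Z" for y z Y Z :: real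
  unfolding abs_mult using that abs_ge_zero[of y] by (intro mult_mono) linarith+
  show "abs (l x * u x) <= K * Q" by (rule p[OF lb ub])
  have d: "df2 h (%x. l x * u x) x = l x * df2 h u x + 2 * (df h l x * df h u (x + h)) + df2 h l x * u (x + h + h)"
  by (simp add: df_def alg)
  have "h pw (be/2) * h pw (be/2) = h pw be" by (simp add: powr_add[symmetric])
  hence e: "K * h pw (be/2) * (?m1 * Q * h pw (be/2)) = K * ?m1 * Q * h pw be" by simp
  have "abs (df2 h (%x. l x * u x) x) <= K * (?m2 * Q * h pw be) + 2 * (K * ?m1 * Q * h pw be) + K * h pw be * Q"
  unfolding d using p[OF lb u2, of x x] p[OF l1 u1, of x "x + h"] p[OF l2 ub, of x "x + h + h"] unfolding e by linarith
  thus "abs (df2 h (%x. l x * u x) x) <= (?m2 + 2 * ?m1 + 1) * K * Q * h pw be"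
  by (simp add: alg)
 qed
qed

definition jumpop :: "real => 'u measure => 'u set => (real => real^'d => 'u => real^'d) => (real => real^'d => 'u => real)
  => (real => real^'d => real) => real => (real^'d => real) => real^'d => real" where
 "jumpop al nu U c ro l t u x = (LINT v|nu. jint al U u x (c t x) v * ro t x v) + l t x * u x"

text \<open>Assumptions B1 and B2 in terms of differences.\<close>
definition bdata :: "real => real => real => real => real => real => (real => ennreal) => 'u measure => 'u set =>
  (real => real^'d => 'u => real^'d) => (real => real^'d => 'u => real) => (real => real^'d => real) => bool" where
 "bdata T al be a K C0 ka nu U c ro l \<longleftrightarrow> (ALL t:{0..T}. jdata al be a K C0 ka nu U (c t) & (ALL x. ro t x \<in> bm nu) &
  (ALL v:space nu. hcoef be K (%x. ro t x v)) & hcoef be K (l t))"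

text \<open>The top-order norm enters with \<open>C1 * K\<close> times the bound \<open>ka\<close>
  on small jumps, so a radius with \<open>ka (r e) <= e / (C1 * K + 1)\<close> yields the factor
  \<open>e\<close>. The function \<open>E\<close> is built from these radii before the coefficients
  are named, so all operators with the same data share it.\<close>

lemma jumpop_lowop:
 assumes par: "pars al be ta" and ja: "jpar al be ta a" and K: "0 <= K" "0 <= C0" and ka: "(ka \<longlongrightarrow> 0) (at_right 0)"
 shows "EX E. (ALL e. 0 <= E e) & (ALL T (nu::'u measure) U c ro l. bdata T al be a K C0 ka nu U c ro l -->
  lowop T (al + be) (al + be - ta) be E (jumpop al nu U c ro (l :: real => real^'d => real)))"
proof -
 have t: "0 < ta" "ta < 1" "ta < al" "al + ta < 2" "0 < al" "al < 2" and b: "0 < be" "be <= 1" "4 * ta <= be"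
  using par by (auto simp: pars_def good_tau_def)
 show ?thesis
 proof (insert jump_estimates[OF par ja, where 'd = 'd and 'u = 'u], elim exE conjE, goal_cases)
 case (1 C1)
 note C1 = 1(1) and J = 1(2)
 have bp: "be <= al + be - ta" using t by simp
 show ?thesis
 proof (insert zero_order_estimates[OF b(1,2) bp, where 'd = 'd], elim exE conjE, goal_cases)
 case (1 C2)
 note C2 = 1(1) and L = 1(2)[rule_format]
 have "EX r. 0 < r & r <= 1 & ka r <= ennreal (e / (C1 * K + 1))" if "0 < e" for e
 proof -
  have "0 < ennreal (e / (C1 * K + 1))" using that C1 K by (simp add: add_nonneg_pos)
  hence "eventually (%r. ka r < ennreal (e / (C1 * K + 1))) (at_right 0)" by (rule order_tendstoD(2)[OF ka])
  then obtain d where d: "0 < d" "!!y. 0 < y ==> y < d ==> ka y < ennreal (e / (C1 * K + 1))"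
  unfolding eventually_at_right_field by auto
  hence "ka (min (d/2) 1) < ennreal (e / (C1 * K + 1))" by (intro d(2)) (auto simp: min_def)
  thus ?thesis using d(1) by (intro exI[of _ "min (d/2) 1"]) auto
 qed
 then obtain r where r: "!!e. 0 < e ==> 0 < r e & r e <= 1 & ka (r e) <= ennreal (e / (C1 * K + 1))" by metis
 define E where "E e = C1 * K * K + K + C2 * K + C1 * K * (r e powr (- ta) * (K + C0))" for e
 have E0: "0 <= C1 * K * K" "0 <= C2 * K" "0 <= C1 * K * (r e powr (- ta) * (K + C0))" for e using C1 C2 K by auto
 show ?thesis
 proof (intro exI[of _ E] conjI allI impI)
  show "0 <= E e" for e using E0(1,2) E0(3)[of e] K by (simp add: E_def)
  fix T and nu :: "'u measure" and U c ro and l :: "real => real^'d => real" assume bd: "bdata T al be a K C0 ka nu U c ro l"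
  have pp: "0 < al + be - ta" "al + be - ta <= al + be" using t b by auto
  show "lowop T (al + be) (al + be - ta) be E (jumpop al nu U c ro l)"
  unfolding lowop_def
  proof (intro ballI)
  fix t assume tT: "t \<in> {0..T}"
  have j: "jdata al be a K C0 ka nu U (c t)" "ALL x. ro t x \<in> bm nu" "ALL v:space nu. hcoef be K (%x. ro t x v)" and l: "hcoef be K (l t)"
  using bd tT unfolding bdata_def by blast+
  have J': "ib nu (C1 * K * K * Q) (%v. jint al U u x (c t x) v * ro t x v)" if "reg (al + be) u" "low (al + be - ta) Q u" for u Q x
  using J[rule_format, of K C0 ka nu U "c t" "ro t" u Q x] j K that by blast
  have i: "integrable nu (%v. jint al U u x (c t x) v * ro t x v)" if u: "reg (al + be) u" for u x
  proof -
  obtain Q where "low (al + be - ta) Q u" by (rule reg_low[OF u pp])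
  from ib_integral(1)[OF J'[OF u this]] show ?thesis .
  qed
  show "(ALL u v a x. reg (al + be) u & reg (al + be) v -->
  jumpop al nu U c ro l t (%x. u x + a * v x) x = jumpop al nu U c ro l t u x + a * jumpop al nu U c ro l t v x) &
  (ALL u Q x. reg (al + be) u & low (al + be - ta) Q u --> abs (jumpop al nu U c ro l t u x) <= E 1 * Q) &
  (ALL u Q N h x e. 0 < e & norm h <= 1 & low (al + be - ta) Q u & bd N u & Zyg (al + be) N u -->
  abs (df2 h (jumpop al nu U c ro l t u) x) <= (e * N + E e * Q) * h pw be)"
  proof (intro conjI allI impI; elim conjE)
  fix u v :: "real^'d => real" and q x assume r: "reg (al + be) u" "reg (al + be) v"
  have s: "1 < al ==> 1 < al + be" using b by simp
  have "(%w. jint al U (%x. u x + q * v x) x (c t x) w * ro t x w)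
  = (%w. jint al U u x (c t x) w * ro t x w + q * (jint al U v x (c t x) w * ro t x w))"
  by (simp only: jint_lin[OF r s]) (simp add: alg)
  thus "jumpop al nu U c ro l t (%x. u x + q * v x) x = jumpop al nu U c ro l t u x + q * jumpop al nu U c ro l t v x"
  unfolding jumpop_def using i[OF r(1), of x] i[OF r(2), of x] by (simp add: alg)
  next
  fix u :: "real^'d => real" and Q x assume u: "reg (al + be) u" "low (al + be - ta) Q u"
  have Q: "0 <= Q" by (rule low_nonneg[OF u(2)])
  have "(C1 * K * K + K) * Q <= E 1 * Q" using E0(2) E0(3)[of 1] Q by (intro mrm) (auto simp: E_def)
  thus "abs (jumpop al nu U c ro l t u x) <= E 1 * Q"
  unfolding jumpop_def using ib_integral(2)[OF J'[OF u, of x]] L[of K "l t" Q u x 0] l u by (simp add: alg)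
  next
  fix u :: "real^'d => real" and Q N and e :: real and h x :: "real^'d" assume e: "0 < e" and h: "norm h <= 1" and lo: "low (al + be - ta) Q u" and u: "bd N u" "Zyg (al + be) N u"
  show "abs (df2 h (jumpop al nu U c ro l t u) x) <= (e * N + E e * Q) * h pw be"
  proof (cases "h = 0")
  case True
  thus ?thesis by (simp add: df_def)
  next
  case False
  let ?k = "e / (C1 * K + 1)" let ?H = "h pw be"
  have Q: "0 <= Q" and N: "0 <= N" using low_nonneg[OF lo] bd_nonneg[OF u(1)] by auto
  have CK: "0 < C1 * K + 1" using C1 K by (simp add: add_nonneg_pos)
  have ru: "reg (al + be) u" by (rule regI[OF u])
  have kp: "0 <= ?k" using e CK by simp
  have 1: "abs (df2 h (%x. LINT v|nu. jint al U u x (c t x) v * ro t x v) x) <= C1 * K * ?H * (?k * N + r e powr (- ta) * (K + C0) * Q)"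
  using J[rule_format, of K C0 ka nu U "c t" "ro t" u Q x] j K ru lo u False h r[OF e] kp by blast
  have 2: "abs (df2 h (%x. l t x * u x) x) <= C2 * K * Q * ?H" using L[of K "l t" Q u x h] l lo by blast
  have s: "df2 h (jumpop al nu U c ro l t u) x = df2 h (%x. LINT v|nu. jint al U u x (c t x) v * ro t x v) x + df2 h (%x. l t x * u x) x"
  unfolding jumpop_def[abs_def] df_add ..
  have "C1 * K * ?k <= e" using e CK by (simp add: field_simps)
  from mrm[OF this, of "?H * N"] N have 3: "C1 * K * ?k * (?H * N) <= e * (?H * N)" by simp
  have 4: "0 <= C1 * K * K * (?H * Q)" "0 <= K * (?H * Q)" using E0 K Q by auto
  show ?thesis unfolding s using 1 2 3 4 by (simp add: E_def alg)
  qed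
  qed
  qed
 qed
 qed
 qed
qed

section \<open>Measurability of the jump operator\<close>

lemma meas_jumpop:
 fixes u :: "real => real^'d => real"
 assumes u: "meas T u" and r: "!!t. t \<in> {0..T} ==> reg s (u t)" and s: "al < s"
  and sf: "sigma_finite_measure nu" and U: "U \<in> sets nu" and l: "meas T l"
  and c: "(%((t, x), v). c t x v) \<in> bm (restrict_space borel (strip T) \<Otimes>\<^sub>M nu)"
  and ro: "(%((t, x), v). ro t x v) \<in> bm (restrict_space borel (strip T) \<Otimes>\<^sub>M nu)"
 shows "meas T (%t. jumpop al nu U c ro l t (u t))"
proof (rule measI)
 let ?M = "restrict_space borel (strip T) :: (real \<times> (real^'d)) measure"
 have sp: "q \<in> space (?M \<Otimes>\<^sub>M nu) ==> fst (fst q) \<in> {0..T}" for q by (auto simp: space_pair_measure space_strip)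
 have c' [measurable]: "(%q. c (fst (fst q)) (snd (fst q)) (snd q)) \<in> bm (?M \<Otimes>\<^sub>M nu)"
  and [measurable]: "(%q. ro (fst (fst q)) (snd (fst q)) (snd q)) \<in> bm (?M \<Otimes>\<^sub>M nu)"
  using c ro by (simp_all add: case_prod_unfold)
 note [measurable] = U
 have [measurable]: "(%q. u (fst (fst q)) (snd (fst q) + c (fst (fst q)) (snd (fst q)) (snd q))) \<in> bm (?M \<Otimes>\<^sub>M nu)"
  "(%q. u (fst (fst q)) (snd (fst q))) \<in> bm (?M \<Otimes>\<^sub>M nu)"
  by (rule meas_comp[OF u]; use sp in auto)+
 have [measurable]: "(%q. (grad (u (fst (fst q))) (snd (fst q)) \<bullet> c (fst (fst q)) (snd (fst q)) (snd q)) * indicator U (snd q) * (if 1 < al then 1 else 0))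
  \<in> bm (?M \<Otimes>\<^sub>M nu)"
 proof (cases "1 < al")
  case True
  hence [measurable]: "(%q. grad (u (fst (fst q))) (snd (fst q))) \<in> bm (?M \<Otimes>\<^sub>M nu)"
  using s by (intro meas_comp[OF meas_grad[OF u r]]) (use sp in auto)
  show ?thesis by measurable
 qed simp
 have "(%p. LINT v|nu. jint al U (u (fst p)) (snd p) (c (fst p) (snd p)) v * ro (fst p) (snd p) v) \<in> bm ?M"
  by (rule sigma_finite_measure.borel_measurable_lebesgue_integral[OF sf]) (simp add: case_prod_unfold jint_def)
 thus "(%p. jumpop al nu U c ro l (fst p) (u (fst p)) (snd p)) \<in> bm ?M"
  unfolding jumpop_def by (intro borel_measurable_add borel_measurable_times measD[OF u] measD[OF l])
qed

lemma opm_jumpop: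
 assumes "sigma_finite_measure nu" "U \<in> sets nu" "meas T l" "kmeas T m" "meas T b" "al < s"
  "(%((t, x), v). c t x v) \<in> bm (restrict_space borel (strip T) \<Otimes>\<^sub>M nu)"
  "(%((t, x), v). ro t x v) \<in> bm (restrict_space borel (strip T) \<Otimes>\<^sub>M nu)"
 shows "opm T al s m b (jumpop al nu U c ro (l :: real => real^'d => real))"
 unfolding opm_def
proof (intro allI impI; elim conjE)
 fix u :: "real => real^'d => real" assume u: "meas T u" "ALL t:{0..T}. reg s (u t)"
 have "meas T (%t x. GI al (m t x) (b t x) (u t) x)" "meas T (%t. jumpop al nu U c ro l t (u t))"
  using u assms by (auto intro!: meas_GI meas_jumpop)
 from meas_lin[OF this, of 1] show "meas T (%t. Lop al m b (jumpop al nu U c ro l) t (u t))"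
  by (simp add: Lop_def[abs_def])
qed

section \<open>Comparison with the Hoelder norms\<close>

lemma coords: "distinct (coords :: 'd::finite list)" "set (coords :: 'd list) = UNIV"
 using someI_ex[OF finite_distinct_list[OF finite, of "UNIV :: 'd set"], folded coords_def] by (auto simp: conj_commute coords_def)

lemma msize_eq_0: "msize ga = 0 \<longleftrightarrow> ga = (%_. 0)"
 by (auto simp: msize_def)

lemma mdiff_0: "mdiff (%_. 0) g = g" for g :: "real^'d => 'b::real_normed_vector"
proof -
 have "concat (map (%_. []) xs) = ([] :: 'd list)" for xs :: "'d list" by (induction xs) auto
 thus ?thesis by (simp only: mdiff_def replicate_0 pdiffs.simps)
qed

lemma mdiff_single: "mdiff (%j. if j = i then 1 else 0) g = pdiff i g" for g :: "real^'d => 'b::real_normed_vector"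
proof -
 have "concat (map (%j. replicate (if j = i then 1 else 0) j) xs) = (if i \<in> set xs then [i] else [])" if "distinct xs" for xs :: "'d list"
  using that by (induction xs) auto
 from this[OF coords(1)] show ?thesis by (simp add: mdiff_def coords(2))
qed

lemma holder_norm_low: "0 < be ==> be <= 1 ==> holder_norm I be u = sup_norm I u + seminorm I be u"
 unfolding holder_norm_def int_part_def frac_part_def by (auto simp: msize_eq_0 mdiff_0 pdiffs_exist_def ceiling_le_iff)

lemma sup_norm_leD: "sup_norm I u <= ennreal K ==> 0 <= K ==> t \<in> I ==> norm (u t x) <= K"
 unfolding sup_norm_def by (auto simp: SUP_le_iff ennreal_le_iff)

lemma seminorm_leD:
 assumes "seminorm I be u <= ennreal K" "0 <= K" "t \<in> I"
 shows "be < 1 ==> norm (df h (u t) x) <= K * h pw be"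
  "~ be < 1 ==> norm (df2 h (u t) x) <= K * norm h"
proof -
 have s: "(if be < 1 then ennreal (norm (u t (x + h) - u t x) / h pw be)
  else ennreal (norm (u t (x + h) + u t (x - h) - 2 *. u t x) / norm h)) <= ennreal K" if "h ~= 0" for x
  using order_trans[OF SUP_upper[of "(t, x, h)" "I \<times> UNIV \<times> (- {0})"] assms(1)[unfolded seminorm_def]] assms(3) that by auto
 show "norm (df h (u t) x) <= K * h pw be" if "be < 1"
  using s[of x] assms(2) that by (cases "h = 0") (auto simp: df_def ennreal_le_iff divide_le_eq)
 show "norm (df2 h (u t) x) <= K * norm h" if b: "~ be < 1"
 proof (cases "h = 0")
  case False
  have "df2 h (u t) x = u t (x + h + h) + u t (x + h - h) - 2 *. u t (x + h)" by (simp add: df_def scaleR_2)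
  thus ?thesis using s[of "x + h"] assms(2) b False by (auto simp: ennreal_le_iff divide_le_eq)
 qed simp
qed

lemma seminorm_df2:
 assumes n: "seminorm I be u <= ennreal K" and b: "0 < be" "be <= 1" and K: "0 <= K" and t: "t \<in> I"
 shows "norm (df2 h (u t) x) <= 2 * K * h pw be"
proof (cases "be < 1")
 case True
 have "bd (K * h pw be) (df h (u t))" using seminorm_leD(1)[OF n K t True] by (simp add: bd_def)
 from bdD[OF bd_df[OF this, of h], of x] show ?thesis by simp
next
 case False
 hence "be = 1" using b by simp
 thus ?thesis using seminorm_leD(2)[OF n K t False, of h x] K by (simp add: order_trans[OF _ mrm])
qed

lemma norm_low_df2:
 assumes n: "holder_norm I be u <= ennreal K" and b: "0 < be" "be <= 1" and K: "0 <= K" and t: "t \<in> I"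
 shows "bd K (u t)" "norm (df2 h (u t) x) <= 2 * K * h pw be"
proof -
 have le: "sup_norm I u <= ennreal K" "seminorm I be u <= ennreal K"
  using n unfolding holder_norm_low[OF b] by (meson le_iff_add order_trans add_increasing add_increasing2 order_refl zero_le)+
 show "bd K (u t)" using sup_norm_leD[OF le(1) K t] by (simp add: bd_def)
 show "norm (df2 h (u t) x) <= 2 * K * h pw be" by (rule seminorm_df2[OF le(2) b K t])
qed

text \<open>At \<open>be = 1\<close> the norm controls second differences only. These are first
  bounded with the weaker exponent \<open>be/2\<close>, at long steps by the sup norm, and the
  Marchaud inequality then yields first differences of order \<open>be/2\<close>; hence the
  constant.\<close>

lemma norm_low_hcoef:
 assumes n: "norm_H T be u <= ennreal K" and b: "0 < be" "be <= 1" and K: "0 <= K" "(4 + 4 * marchaud1 (be/2)) * K <= K'" and t: "t \<in> {0..T}"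
 shows "hcoef be K' (u t)"
proof -
 note d = norm_low_df2[OF n[unfolded norm_H_def] b K(1) t]
 have m: "0 < marchaud1 (be/2)" using b by (intro marchaud1_pos) auto
 have mK: "0 <= marchaud1 (be/2) * K" using m K by simp
 have d2: "norm (df2 h (u t) x) <= (4 * K) * h pw (be/2)" for h x
 proof (cases "norm h <= 1")
  case True
  have "h pw be <= h pw (be/2)" using True b by (cases "h = 0") (auto intro!: powr_mono')
  hence "2 * K * h pw be <= 4 * K * h pw (be/2)" using K by (intro mult_mono) auto
  thus ?thesis using d(2)[of h x] by linarith
 next
  case False
  have "4 * K * 1 <= 4 * K * h pw (be/2)" using False K b by (intro mlm ge_one_powr_ge_zero) auto
  thus ?thesis using bdD[OF bd_df2[OF d(1)], of h h x] by linarith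
 qed
 have K': "K <= K'" "2 * K <= K'" "marchaud1 (be/2) * (4 * K) <= K'" using K mK by (simp_all add: alg)
 have "norm (df h (u t) x) <= K' * h pw (be/2)" for h x
  using df1_bound_of_df2[OF d(1) d2, of h x] b K mrm[OF K'(3), of "h pw (be/2)"] by simp
 moreover have "norm (df2 h (u t) x) <= K' * h pw be" for h x
  using d(2)[of h x] mrm[OF K'(2), of "h pw be"] by simp
 ultimately show ?thesis using bd_mono[OF d(1) K'(1)] by (simp add: hcoef_def)
qed

section \<open>Mean value inequalities from partial derivatives, and the cone of positivity\<close>

lemma axis_mvt:
 fixes g :: "real^'d => 'b::real_normed_vector"
 assumes d: "!!q. q \<in> closed_segment 0 de ==> (%r. g (x + q *. axis i 1 + r *. axis i 1)) differentiable (at 0)"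
  and M: "!!q. q \<in> closed_segment 0 de ==> norm (pdiff i g (x + q *. axis i 1)) <= M"
 shows "norm (g (x + de *. axis i 1) - g x) <= M * abs de"
proof -
 let ?e = "axis i 1 :: real^'d"
 have der: "((%r. g (x + r *. ?e)) has_vector_derivative pdiff i g (x + r *. ?e)) (at r)" if r: "r \<in> closed_segment 0 de" for r
 proof -
  have "((%q. g (x + r *. ?e + q *. ?e)) has_vector_derivative pdiff i g (x + r *. ?e)) (at 0)"
  unfolding pdiff_def using d[OF r] by (simp add: vector_derivative_works)
  hence "((%q. g (x + r *. ?e + q *. ?e)) \<circ> (%q. q - r) has_vector_derivative 1 *. pdiff i g (x + r *. ?e)) (at r)"
  by (intro vector_diff_chain_at) (auto intro!: derivative_eq_intros)
  thus ?thesis by (simp add: comp_def alg)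
 qed
 have "norm (g (x + de *. ?e) - g (x + 0 *. ?e)) <= M * norm (de - 0)"
 proof (rule differentiable_bound[of "closed_segment 0 de" "%r. g (x + r *. ?e)" "%r h. h *. pdiff i g (x + r *. ?e)"])
  fix r assume r: "r \<in> closed_segment 0 de"
  show "((%r. g (x + r *. ?e)) has_derivative (%h. h *. pdiff i g (x + r *. ?e))) (at r within closed_segment 0 de)"
  using der[OF r] unfolding has_vector_derivative_def by (rule has_derivative_at_withinI)
  show "onorm (%h. h *. pdiff i g (x + r *. ?e)) <= M"
  by (rule onorm_le) (use M[OF r] in \<open>simp add: mult.commute[of M] mlm\<close>)
 qed auto
 thus ?thesis by simp
qed

lemma coord_telescope:
 fixes g :: "real^'d => 'b::real_normed_vector"
 assumes M: "!!z i. ALL j. z $ j \<in> {x $ j, y $ j} ==> z $ i = x $ i ==> norm (g (z + (y $ i - x $ i) *. axis i 1) - g z) <= M"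
 shows "norm (g y - g x) <= real CARD('d) * M"
proof -
 define z where "z S = (\<chi> j. if j \<in> S then y $ j else x $ j)" for S
 have "norm (g (z S) - g x) <= real (card S) * M" if "finite S" for S
  using that
 proof induction
  case empty
  have "z {} = x" by (simp add: z_def vec_eq_iff)
  thus ?case by simp
 next
  case (insert i S)
  have zi: "z (insert i S) = z S + (y $ i - x $ i) *. axis i 1" using insert by (auto simp: z_def vec_eq_iff axis_def)
  have "norm (g (z (insert i S)) - g (z S)) <= M" unfolding zi by (rule M) (use insert in \<open>auto simp: z_def\<close>)
  thus ?case using insert norm_triangle_ineq[of "g (z (insert i S)) - g (z S)" "g (z S) - g x"] by (simp add: alg)
 qed
 from this[of UNIV] show ?thesis by (simp add: z_def)
qed

text \<open>Partial derivatives are available without any continuity, so the path from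
  \<open>x\<close> to \<open>y\<close> runs parallel to the axes, inside the coordinate box spanned
  by the two points.\<close>

lemma coord_mvt:
 fixes g :: "real^'d => 'b::real_normed_vector"
 assumes d: "!!z i. ALL j. z $ j \<in> closed_segment (x $ j) (y $ j) ==> (%r. g (z + r *. axis i 1)) differentiable (at 0)"
  and M: "!!z i. ALL j. z $ j \<in> closed_segment (x $ j) (y $ j) ==> norm (pdiff i g z) <= M"
 shows "norm (g y - g x) <= real CARD('d) * (M * norm (y - x))"
proof (rule coord_telescope)
 fix z i assume z: "ALL j. z $ j \<in> {x $ j, y $ j}" "z $ i = x $ i"
 have M0: "0 <= M" using order_trans[OF norm_ge_zero M[of x undefined]] by simp
 have seg: "ALL j. (z + r *. axis i 1) $ j \<in> closed_segment (x $ j) (y $ j)" if r: "r \<in> closed_segment 0 (y $ i - x $ i)" for r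
 proof
  fix j
  have "x $ i + r \<in> closed_segment (x $ i) (y $ i)" using r by (auto simp: closed_segment_eq_real_ivl split: if_splits)
  moreover have "z $ j \<in> closed_segment (x $ j) (y $ j)" using z(1)[rule_format, of j] by auto
  ultimately show "(z + r *. axis i 1) $ j \<in> closed_segment (x $ j) (y $ j)" using z(2) by (auto simp: axis_def)
 qed
 have "norm (g (z + (y $ i - x $ i) *. axis i 1) - g z) <= M * abs (y $ i - x $ i)"
  by (rule axis_mvt) (use d seg M in blast)+
 also have "... <= M * norm (y - x)" using M0 component_le_norm_cart[of "y - x" i] by (intro mlm) auto
 finally show "norm (g (z + (y $ i - x $ i) *. axis i 1) - g z) <= M * norm (y - x)" .
qed

text \<open>Degree -1 of the derivative carries a bound known on the unit sphere to the points
  around it.\<close>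

lemma homogeneous_pdiff:
 fixes g :: "real^'d => real"
 assumes hom: "!!y r. y ~= 0 ==> 0 < r ==> g (r *. y) = g y" and z: "z ~= 0"
  and d: "(%r. g (z /\<^sub>R norm z + r *. axis i 1)) differentiable (at 0)"
 shows "(%r. g (z + r *. axis i 1)) differentiable (at 0)" "pdiff i g z = pdiff i g (z /\<^sub>R norm z) /\<^sub>R norm z"
proof -
 let ?y = "z /\<^sub>R norm z" and ?e = "axis i 1 :: real^'d" and ?n = "norm z"
 have n: "0 < ?n" using z by simp
 have "((%q. g (?y + q *. ?e)) has_vector_derivative pdiff i g ?y) (at (0 / ?n))"
  unfolding pdiff_def using d by (simp add: vector_derivative_works)
 moreover have "((%r. r / ?n) has_vector_derivative 1 / ?n) (at 0)"
  unfolding has_real_derivative_iff_has_vector_derivative[symmetric] by (rule DERIV_cdivide[OF DERIV_ident])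
 ultimately have "((%q. g (?y + q *. ?e)) \<circ> (%r. r / ?n) has_vector_derivative (1 / ?n) *. pdiff i g ?y) (at 0)"
  by (intro vector_diff_chain_at)
 hence v: "((%r. g (z + r *. ?e)) has_vector_derivative (1 / ?n) *. pdiff i g ?y) (at 0)"
 proof (rule has_vector_derivative_transform_within_open)
  show "open (ball 0 ?n)" "0 \<in> ball 0 ?n" using n by auto
  fix r :: real assume r: "r \<in> ball 0 ?n"
  have "?y + (r / ?n) *. ?e ~= 0"
  proof
  assume "?y + (r / ?n) *. ?e = 0"
  hence "norm ?y = norm ((r / ?n) *. ?e)" by (metis add_eq_0_iff norm_minus_cancel)
  thus False using r n by (simp add: norm_axis_1)
  qed
  from hom[OF this n] show "((%q. g (?y + q *. ?e)) \<circ> (%r. r / ?n)) r = g (z + r *. ?e)"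
  using n by (simp add: scaleR_add_right)
 qed
 thus "(%r. g (z + r *. ?e)) differentiable (at 0)" by (rule differentiableI_vector)
 show "pdiff i g z = pdiff i g ?y /\<^sub>R ?n" using vector_derivative_at[OF v] by (simp add: pdiff_def inverse_eq_divide)
qed

lemma sphere_integral_le:
 assumes m: "!!w::real^'d. w ~= 0 ==> m w <= c" "0 <= c" and al: "0 < al" and \<xi>: "norm \<xi> = 1"
 shows "(\<integral>\<^sup>+w. ennreal (abs (w \<bullet> \<xi>) powr al * m w) \<partial>sphere_measure) <= ennreal (c * (real CARD('d) * measure lborel (ball (0::real^'d) 1)))"
proof -
 let ?f = "%w::real^'d. ennreal (abs (w \<bullet> \<xi>) powr al * c)"
 have [measurable]: "(sgn :: real^'d => real^'d) \<in> bm borel"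
  unfolding sgn_div_norm[abs_def] by measurable
 have "(\<integral>\<^sup>+w. ennreal (abs (w \<bullet> \<xi>) powr al * m w) \<partial>sphere_measure) <= (\<integral>\<^sup>+w. ?f w \<partial>sphere_measure)"
 proof (intro nn_integral_mono ennreal_leI)
  fix w show "abs (w \<bullet> \<xi>) powr al * m w <= abs (w \<bullet> \<xi>) powr al * c"
  using m(1)[of w] al by (cases "w = 0") (auto intro!: mlm)
 qed
 also have "... = of_nat CARD('d) * (\<integral>\<^sup>+x. indicator (ball 0 1) x * ?f (sgn x) \<partial>lborel)"
  unfolding sphere_measure_def
  by (simp add: nn_integral_scale_measure nn_integral_distr) (subst nn_integral_density; auto intro!: borel_measurable_indicator)
 also have "... <= of_nat CARD('d) * (\<integral>\<^sup>+x. ennreal c * indicator (ball 0 1) (x::real^'d) \<partial>lborel)"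
 proof (intro mlm nn_integral_mono)
  fix x :: "real^'d"
  have "abs (sgn x \<bullet> \<xi>) <= 1" using Cauchy_Schwarz_ineq2[of "sgn x" \<xi>] \<xi> by (simp add: norm_sgn split: if_splits)
  hence "abs (sgn x \<bullet> \<xi>) powr al * c <= 1 * c" using al m(2) by (intro mrm powr_le1) auto
  from ennreal_leI[OF this] show "indicator (ball 0 1) x * ?f (sgn x) <= ennreal c * indicator (ball 0 1) x"
  by (auto simp: indicator_def)
 qed auto
 also have "... = ennreal (c * (real CARD('d) * measure lborel (ball (0::real^'d) 1)))"
  using m(2) emeasure_eq_ennreal_measure[of lborel "ball (0::real^'d) 1"] emeasure_lborel_ball_finite[of "0::real^'d" 1]
  by (subst nn_integral_cmult_indicator) (auto simp: ennreal_mult ennreal_of_nat_eq_real_of_nat mult.left_commute)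
 finally show ?thesis .
qed

text \<open>Nondegeneracy provides a direction in which \<open>m0\<close> is not small, and by homogeneity and the
 bound on the first derivatives it stays so in a cone of fixed aperture.\<close>

lemma elliptic_of_A0:
 assumes K: "0 < K" and et: "0 < et"
 shows "EX de r0. 0 < de & 0 < r0 & r0 <= 1 & (ALL T al m0 (m :: real => real^'d => real^'d => real).
  assumption_A0 T al K et m0 & 0 < al & (ALL t:{0..T}. ALL x y. y ~= 0 --> m0 t y <= m t x y) --> (ALL t:{0..T}. elliptic de r0 (m t)))"
proof -
 define ms where "ms = real CARD('d) * measure lborel (ball (0::real^'d) 1)"
 have "0 < measure lborel (ball (0::real^'d) 1)" by (simp add: content_ball_pos)
 hence ms: "0 < ms" by (simp add: ms_def)
 \<comment> \<open>\<open>ms\<close> is the mass of the sphere, so values below \<open>et'\<close>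
   everywhere would leave at most \<open>et / 2\<close> for the nondegeneracy integral.
   \<open>r0\<close> limits the variation of \<open>m0\<close> over the cone to
   \<open>et' / 2\<close>, the derivatives being at most \<open>2 * K\<close> outside the ball of
   radius 1/2.\<close>
 define et' where "et' = et / (2 * ms)"
 define r0 where "r0 = min (1/2) (et' / (4 * K * real CARD('d)))"
 have e: "0 < et'" using et ms by (simp add: et'_def)
 have r0: "0 < r0" "r0 <= 1/2" using e K by (auto simp: r0_def)
 have r0K: "real CARD('d) * (2 * K) * r0 <= et' / 2"
 proof -
  have "real CARD('d) * (2 * K) * r0 <= real CARD('d) * (2 * K) * (et' / (4 * K * real CARD('d)))"
  using K by (intro mlm) (auto simp: r0_def)
  thus ?thesis using K by simp
 qed
 show ?thesis
 proof (rule exI[of _ "et'/2"], rule exI[of _ r0], intro conjI allI impI ballI; (elim conjE)?)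
  fix T al m0 t and m :: "real => real^'d => real^'d => real"
  assume A0: "assumption_A0 T al K et m0" and al: "0 < al" and mm: "ALL t:{0..T}. ALL x y. y ~= 0 --> m0 t y <= m t x y" and t: "t \<in> {0..T}"
  let ?g = "m0 t"
  note a = A0[unfolded assumption_A0_def, THEN conjunct2, THEN bspec, OF t]
  note pos = a[THEN conjunct1, rule_format] and a = a[THEN conjunct2]
  note hom = a[THEN conjunct1, rule_format] and a = a[THEN conjunct2]
  have pe: "(%r. ?g (y + r *. axis i 1)) differentiable (at 0)" if "y ~= 0" for y i
  proof -
  from a[THEN conjunct1, unfolded pdiffs_exist_def, rule_format, of "[]" y i] show ?thesis using that by simp
  qed
  have pb: "abs (pdiff i ?g y) <= K" if "norm y = 1" for y i
  proof -
  have "msize (%j. if j = i then 1 else 0) <= CARD('d) div 2 + 1" by (simp add: msize_def)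
  from a[THEN conjunct2, THEN conjunct1, rule_format, OF that this]
  have "abs (mdiff (%j. if j = i then 1 else 0) ?g y) <= K" .
  thus ?thesis by (simp only: mdiff_single)
  qed
  have pz: "norm (pdiff i ?g z) <= 2 * K" if "1/2 <= norm z" for z i
  proof -
  have z: "z ~= 0" using that by auto
  have "norm (z /\<^sub>R norm z) = 1" using z by simp
  from pb[OF this] have "abs (pdiff i ?g (z /\<^sub>R norm z)) / norm z <= K / (1/2)" using that K by (intro frac_le) auto
  moreover have y: "z /\<^sub>R norm z ~= 0" using z by simp
  have "pdiff i ?g z = pdiff i ?g (z /\<^sub>R norm z) /\<^sub>R norm z"
  by (rule homogeneous_pdiff(2)[OF _ z pe[OF y]]) (rule hom)
  hence "norm (pdiff i ?g z) = abs (pdiff i ?g (z /\<^sub>R norm z)) / norm z"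
  by (simp add: abs_mult divide_inverse mult.commute)
  ultimately show ?thesis by simp
  qed
  obtain w where w: "norm w = 1" "et' <= ?g w"
  proof (rule ccontr)
  assume "~ thesis"
  hence lt: "?g w < et'" if "norm w = 1" for w using that \<open>!!w. norm w = 1 ==> et' <= ?g w ==> thesis\<close> by force
  have le: "?g w <= et'" if "w ~= 0" for w
  proof -
  have "?g w = ?g (w /\<^sub>R norm w)" using hom[OF that, of "inverse (norm w)"] that by simp
  moreover have "norm (w /\<^sub>R norm w) = 1" using that by simp
  ultimately show ?thesis using lt by fastforce
  qed
  obtain \<xi> :: "real^'d" where \<xi>: "norm \<xi> = 1" using norm_axis_1 by blast
  have "ennreal et <= (INF \<xi>\<in>sphere 0 1. \<integral>\<^sup>+w. ennreal (abs (w \<bullet> \<xi>) powr al * ?g w) \<partial>sphere_measure)"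
  using a[THEN conjunct2, THEN conjunct2, THEN conjunct2] .
  also have "... <= (\<integral>\<^sup>+w. ennreal (abs (w \<bullet> \<xi>) powr al * ?g w) \<partial>sphere_measure)" by (rule INF_lower) (use \<xi> in simp)
  also have "... <= ennreal (et' * ms)" unfolding ms_def using e by (intro sphere_integral_le le al \<xi>) auto
  finally have "et <= et' * ms" using e ms by (simp add: ennreal_le_iff)
  thus False using ms et by (simp add: et'_def)
  qed
  have near: "et' / 2 <= ?g y" if y: "y ~= 0" "norm (y /\<^sub>R norm y - w) <= r0" for y
  proof -
  let ?y = "y /\<^sub>R norm y"
  \<comment> \<open>The box between \<open>w\<close> and \<open>y / |y|\<close> stays within
    distance 1/2 of the unit vector \<open>w\<close>, hence away from the origin.\<close>
  have z: "1/2 <= norm z" if "ALL j. z $ j \<in> closed_segment (w $ j) (?y $ j)" for z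
  proof -
  have "norm (z - w) <= norm (?y - w)"
  proof (rule norm_le_componentwise_cart)
  fix j show "norm ((z - w) $ j) <= norm ((?y - w) $ j)"
  using that[rule_format, of j] by (auto simp: closed_segment_eq_real_ivl split: if_splits)
  qed
  hence "norm (z - w) <= 1/2" using y r0 by linarith
  thus ?thesis using w(1) norm_triangle_ineq3[of z w] by linarith
  qed
  have "norm (?g ?y - ?g w) <= real CARD('d) * (2 * K * norm (?y - w))"
  proof (rule coord_mvt)
  fix x i assume "ALL j. x $ j \<in> closed_segment (w $ j) (?y $ j)"
  from z[OF this] have x: "1/2 <= norm x" .
  hence "x ~= 0" by auto
  thus "(%r. ?g (x + r *. axis i 1)) differentiable (at 0)" by (rule pe)
  show "norm (pdiff i ?g x) <= 2 * K" by (rule pz[OF x])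
  qed
  also have "... <= real CARD('d) * (2 * K * r0)" using K y by (intro mlm) auto
  finally have "et' / 2 <= ?g ?y" using r0K w(2) by simp
  thus ?thesis using hom[OF y(1), of "inverse (norm y)"] y(1) by simp
  qed
  show "elliptic (et'/2) r0 (m t)"
  unfolding elliptic_def using pos near w(1) mm t by (meson order_trans)
 qed (use e r0 in auto)
qed

section \<open>Joint measurability of the kernel\<close>

lemma meas_extend0:
 fixes m :: "real => real^'d => real^'d => real"
 assumes m: "(%(t, x, y). m t x y) \<in> bm (restrict_space borel ({0..T} \<times> UNIV \<times> (- {0::real^'d})))"
 shows "(%q. m (fst q) (fst (snd q)) (snd (snd q)) * indicator ({0..T} \<times> UNIV \<times> (- {0})) q) \<in> bm borel"
proof -
 have "{0..T::real} \<times> UNIV \<times> (- {0}) \<in> sets (borel :: (real \<times> (real^'d) \<times> (real^'d)) measure)"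
  unfolding borel_prod[symmetric] by (intro pair_measureI) (auto simp: borel_prod)
 thus ?thesis using m by (subst (asm) borel_measurable_restrict_space_iff) (auto simp: case_prod_unfold mult.commute)
qed

lemma kmeasI:
 fixes m :: "real => real^'d => real^'d => real"
 assumes m: "(%(t, x, y). m t x y) \<in> bm (restrict_space borel ({0..T} \<times> UNIV \<times> (- {0::real^'d})))"
 shows "kmeas T m" "t \<in> {0..T} ==> (%y. if y = 0 then 0 else m t x y) \<in> bm borel"
proof -
 let ?G = "%q. m (fst q) (fst (snd q)) (snd (snd q)) * indicator ({0..T} \<times> UNIV \<times> (- {0})) q"
 let ?M = "restrict_space borel (strip T) :: (real \<times> (real^'d)) measure"
 note G = meas_extend0[OF m]
 have id: "(%p. p) \<in> bm ?M" by (rule measurable_restrict_space1) simp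
 have "(%q. (fst (fst q), snd (fst q), snd q)) \<in> bm (?M \<Otimes>\<^sub>M lborel)"
  by (intro borel_measurable_Pair) auto
 from measurable_compose[OF this G] have "(%q. ?G (fst (fst q), snd (fst q), snd q)) \<in> bm (?M \<Otimes>\<^sub>M lborel)" .
 thus "kmeas T m" unfolding kmeas_def
  by (rule measurable_cong[THEN iffD1, rotated]) (auto simp: space_pair_measure space_strip indicator_def)
 show "(%y. if y = 0 then 0 else m t x y) \<in> bm borel" if "t \<in> {0..T}"
 proof -
  have "(%y. (t, x, y)) \<in> bm borel" by (intro borel_measurable_continuous_onI continuous_intros)
  from measurable_compose[OF this G] have "(%y. ?G (t, x, y)) \<in> bm borel" .
  thus ?thesis by (rule measurable_cong[THEN iffD1, rotated]) (use that in \<open>auto simp: indicator_def\<close>)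
 qed
qed

text \<open>Differences commute with \<open>pdiff\<close>, so the third difference of the derivative
  is the derivative of \<open>df3 h u\<close>. Its gradient is estimated from the orders
  \<open>1 - ta\<close> and \<open>1 + ta\<close> at the scale \<open>|h|\<close>, where both parts
  become multiples of \<open>|h|^(s - 1)\<close>.\<close>

lemma pdiff_regular:
 assumes s: "1 < s" "s < 3"
 shows "EX C>0. ALL (u::real^'d => real) N i. bd N u & Zyg s N u --> bd (C * N) (pdiff i u) & Zyg (s - 1) (C * N) (pdiff i u)"
proof -
 define ta where "ta = min (1/2) (s - 1)"
 have t: "0 < ta" "ta < 1" "1 + ta <= s" using s by (auto simp: ta_def)
 have g: "0 < grad_const ta" by (rule grad_const_pos[OF t(1,2)])
 show ?thesis
 proof (intro exI[of _ "18 * grad_const ta"] conjI allI impI; (elim conjE)?)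
  show "0 < 18 * grad_const ta" using g by simp
  fix u :: "real^'d => real" and N i assume u: "bd N u" "Zyg s N u"
  have N: "0 <= N" by (rule bd_nonneg[OF u(1)])
  have pg: "norm (pdiff i v x) <= norm (grad v x)" for v :: "real^'d => real" and x
  using component_le_norm_cart[of "grad v x" i] by (simp add: grad_def)
  have lo: "low s (9 * N) u" by (rule low_Zyg1[OF u]) (use s in auto)
  have "norm (grad u x) <= 18 * grad_const ta * N" for x
  using grad_bound[OF u(1) low_Zyg[OF lo, of "1 - ta"] low_Zyg[OF lo, of "1 + ta"] t(1,2) zero_less_one, of x] t by simp
  thus "bd (18 * grad_const ta * N) (pdiff i u)" unfolding bd_def using pg order_trans by blast
  have gd: "grad (df h v) x = df h (grad v) x" "ALL x. (df h v has_derivative (%y. grad (df h v) x \<bullet> y)) (at x)"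
  if "ALL x. (v has_derivative (%y. grad v x \<bullet> y)) (at x)" for v :: "real^'d => real" and h x
  using grad_df[of v h] that by blast+
  have hd: "ALL x. (u has_derivative (%y. grad u x \<bullet> y)) (at x)" using grad_has_derivative[OF u s(1)] by blast
  have pd: "pdiff i (df h v) = df h (pdiff i v)" if "ALL x. (v has_derivative (%y. grad v x \<bullet> y)) (at x)" for v :: "real^'d => real" and h
  proof
  fix x show "pdiff i (df h v) x = df h (pdiff i v) x"
  using arg_cong[OF gd(1)[OF that, of h x], of "%w. w $ i"] by (simp add: grad_def df_def)
  qed
  show "Zyg (s - 1) (18 * grad_const ta * N) (pdiff i u)"
  unfolding Zyg_def
  proof (intro conjI allI)
  show "0 <= 18 * grad_const ta * N" using g N by simp
  fix h x
  have e: "df3 h (pdiff i u) x = pdiff i (df3 h u) x"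
  by (simp add: pd hd gd(2))
  show "norm (df3 h (pdiff i u) x) <= 18 * grad_const ta * N * h pw (s - 1)"
  proof (cases "h = 0")
  case True
  thus ?thesis by (simp add: df_def)
  next
  case False
  let ?v = "df3 h u"
  have Z: "Zyg (1 - ta) (8 * N * h pw (s - (1 - ta))) ?v" "Zyg (1 + ta) (8 * N * h pw (s - (1 + ta))) ?v"
  using t by (auto intro!: Zyg_triple_mixed[OF u(2)])
  have p: "h pw (s - (1 - ta)) * h pw (- ta) = h pw (s - 1)" "h pw (s - (1 + ta)) * h pw ta = h pw (s - 1)"
  using False by (auto simp: powr_add[symmetric])
  have q: "8 * N * h pw (s - (1 - ta)) * h pw (- ta) + 8 * N * h pw (s - (1 + ta)) * h pw ta = 16 * N * h pw (s - 1)"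
  unfolding mult.assoc p by simp
  have "norm (grad ?v x) <= grad_const ta * (16 * N * h pw (s - 1))"
  using grad_bound[OF bd_df3[OF u(1)] Z t(1,2), of "norm h" x] False unfolding q by simp
  also have "... <= 18 * grad_const ta * N * h pw (s - 1)"
  using mult_nonneg_nonneg[OF mult_nonneg_nonneg[OF less_imp_le[OF g] N] powr_ge_zero[of "norm h" "s - 1"]] by (simp add: mult_ac)
  finally show ?thesis unfolding e using pg[of ?v x] by linarith
  qed
  qed
 qed
qed

section \<open>From third differences to Hoelder norms of order below three\<close>

lemma pdiffs_regular:
 assumes "real k < s" "s < 3"
 shows "EX C>0. ALL (u::real^'d => real) N w. bd N u & Zyg s N u & length w <= k -->
  bd (C * N) (pdiffs w u) & Zyg (s - real (length w)) (C * N) (pdiffs w u)"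
 using assms(1)
proof (induction k)
 case 0
 thus ?case by (intro exI[of _ 1]) auto
next
 case (Suc k)
 then obtain C where C: "0 < C" and IH: "!!(u::real^'d => real) N w. bd N u & Zyg s N u & length w <= k ==>
  bd (C * N) (pdiffs w u) & Zyg (s - real (length w)) (C * N) (pdiffs w u)" by auto
 have "1 < s - real k" "s - real k < 3" using Suc.prems assms by auto
 from pdiff_regular[OF this, where 'd = 'd] obtain D where D: "0 < D"
  "!!(u::real^'d => real) N i. bd N u & Zyg (s - real k) N u ==> bd (D * N) (pdiff i u) & Zyg (s - real k - 1) (D * N) (pdiff i u)" by meson
 show ?case
 proof (intro exI[of _ "max C (D * C)"] conjI allI impI; (elim conjE)?)
  show "0 < max C (D * C)" using C by simp
  fix u :: "real^'d => real" and N and w :: "'d list" assume u: "bd N u" "Zyg s N u" and w: "length w <= Suc k"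
  have N: "0 <= N" by (rule bd_nonneg[OF u(1)])
  have le: "C * N <= max C (D * C) * N" "D * (C * N) <= max C (D * C) * N"
  using mrm[OF _ N, of C "max C (D * C)"] mrm[OF _ N, of "D * C" "max C (D * C)"] by auto
  have "bd (max C (D * C) * N) (pdiffs w u) & Zyg (s - real (length w)) (max C (D * C) * N) (pdiffs w u)"
  proof (cases "length w <= k")
  case True
  thus ?thesis using IH[of N u w] u le(1) by (blast intro: bd_mono Zyg_mono)
  next
  case False
  then obtain i w' where w': "w = i # w'" "length w' = k" using w by (cases w) auto
  have "bd (D * (C * N)) (pdiffs w u) & Zyg (s - real k - 1) (D * (C * N)) (pdiffs w u)"
  unfolding w'(1) using D(2)[of "C * N" "pdiffs w' u" i] IH[of N u w'] u w'(2) by simp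
  moreover have "s - real k - 1 = s - real (length w)" using w' by simp
  ultimately show ?thesis using le(2) by (auto intro: bd_mono Zyg_mono)
  qed
  thus "bd (max C (D * C) * N) (pdiffs w u)" "Zyg (s - real (length w)) (max C (D * C) * N) (pdiffs w u)" by auto
 qed
qed

lemma int_part: "0 < s ==> real (int_part s) < s" "0 < s ==> s <= real (int_part s) + 1"
 unfolding int_part_def by linarith+

lemma mset_multiindex:
 "distinct xs ==> mset (concat (map (%i. replicate (ga i) i) xs)) = (\<Sum>i\<in>set xs. replicate_mset (ga i) i)"
 by (induction xs) auto

lemma length_multiindex: "length (concat (map (%i. replicate (ga i) i) coords)) = msize ga" for ga :: "'d::finite => nat"
proof -
 have "size (\<Sum>i\<in>S. replicate_mset (ga i) i) = (\<Sum>i\<in>S. ga i)" if "finite S" for S using that by induction auto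
 thus ?thesis using arg_cong[OF mset_multiindex[OF coords(1), of ga], of size] by (simp add: coords(2) msize_def)
qed

lemma finite_multiindex: "finite {ga :: 'd::finite => nat. msize ga <= k}"
proof (rule finite_subset)
 have "ga i <= msize ga" for ga :: "'d => nat" and i unfolding msize_def by (rule member_le_sum) auto
 thus "{ga :: 'd => nat. msize ga <= k} \<subseteq> {ga. ALL i. (i \<in> UNIV --> ga i \<in> {..k}) & (i \<notin> UNIV --> ga i = 0)}"
  using order_trans by fastforce
 show "finite {ga :: 'd => nat. ALL i. (i \<in> UNIV --> ga i \<in> {..k}) & (i \<notin> UNIV --> ga i = 0)}"
  by (rule finite_set_of_finite_funs) auto
qed

lemma sup_norm_leI: "(!!t x. t \<in> I ==> norm (u t x) <= K) ==> sup_norm I u <= ennreal K"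
 unfolding sup_norm_def by (auto simp: SUP_le_iff intro!: ennreal_leI)

lemma seminorm_regular:
 assumes f: "0 < f" "f <= 1"
 shows "EX C>0. ALL (I::'i set) (v :: 'i => real^'d => real) N. (ALL t:I. bd N (v t) & Zyg f N (v t)) & 0 <= N --> seminorm I f v <= ennreal (C * N)"
proof (intro exI[of _ "abs (marchaud1 f) * marchaud2 f + marchaud2 f"] conjI allI impI; (elim conjE)?)
 let ?C = "abs (marchaud1 f) * marchaud2 f + marchaud2 f"
 have m: "0 < marchaud2 f" using f by (intro marchaud2_pos) auto
 thus "0 < ?C" by (simp add: add_nonneg_pos)
 fix I :: "'i set" and v :: "'i => real^'d => real" and N assume v: "ALL t:I. bd N (v t) & Zyg f N (v t)" and N: "0 <= N"
 have "(if f < 1 then ennreal (norm (v t (x + h) - v t x) / h pw f)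
  else ennreal (norm (v t (x + h) + v t (x - h) - 2 *. v t x) / norm h)) <= ennreal (?C * N)" if t: "t \<in> I" and h: "h ~= 0" for t x h
 proof (cases "f < 1")
  case True
  have "norm (df h (v t) x) <= marchaud1 f * marchaud2 f * N * h pw f" using df1_bound[OF _ _ True] v t by blast
  also have "... <= ?C * N * h pw f" using m N by (intro mrm) (auto intro!: add_increasing2 mrm)
  finally show ?thesis using True h by (auto simp: df_def divide_le_eq intro!: ennreal_leI)
 next
  case False
  hence f1: "f = 1" using f by simp
  have "norm (df2 h (v t) (x - h)) <= marchaud2 f * N * h pw f" using df2_bound[of N "v t" f N h "x - h"] v t f by auto
  also have "... <= ?C * N * h pw f" using m N by (intro mrm) auto
  finally show ?thesis using False h f1 by (auto simp: df_def divide_le_eq alg intro!: ennreal_leI)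
 qed
 thus "seminorm I f v <= ennreal (?C * N)" unfolding seminorm_def by (auto simp: SUP_le_iff)
qed

lemma holder_norm_of_Zyg:
 assumes s: "0 < s" "s < 3"
 shows "EX C>0. ALL (I::'i set) (u :: 'i => real^'d => real) N. (ALL t:I. bd N (u t) & Zyg s N (u t)) & 0 <= N --> holder_norm I s u <= ennreal (C * N)"
proof -
 let ?k = "int_part s" and ?f = "frac_part s"
 let ?G = "{ga :: 'd => nat. msize ga <= ?k}"
 have k: "real ?k < s" "s - real ?k = ?f" "0 < ?f" "?f <= 1" using int_part[OF s(1)] by (auto simp: frac_part_def)
 obtain C where C: "0 < C" and P: "!!(u::real^'d => real) N w. bd N u & Zyg s N u & length w <= ?k ==>
  bd (C * N) (pdiffs w u) & Zyg (s - real (length w)) (C * N) (pdiffs w u)"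
  using pdiffs_regular[OF k(1) s(2), where 'd = 'd] by meson
 obtain D where D: "0 < D" and S: "!!(I::'i set) (v :: 'i => real^'d => real) N. (ALL t:I. bd N (v t) & Zyg ?f N (v t)) & 0 <= N ==> seminorm I ?f v <= ennreal (D * N)"
  using seminorm_regular[OF k(3,4), where 'd = 'd and 'i = 'i] by meson
 show ?thesis
 proof (intro exI[of _ "real (card ?G) * C + D * C"] conjI allI impI; (elim conjE)?)
  show "0 < real (card ?G) * C + D * C" using C D by (simp add: add_nonneg_pos)
  fix I :: "'i set" and u :: "'i => real^'d => real" and N assume u: "ALL t:I. bd N (u t) & Zyg s N (u t)" and N: "0 <= N"
  have CN: "0 <= C * N" "0 <= D * (C * N)" using C D N by auto
  have m: "bd (C * N) (mdiff ga (u t)) & Zyg (s - real (msize ga)) (C * N) (mdiff ga (u t))" if "t \<in> I" "msize ga <= ?k" for t ga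
  using P[of N "u t" "concat (map (%i. replicate (ga i) i) coords)"] u that unfolding mdiff_def length_multiindex by blast
  have pe: "pdiffs_exist ?k UNIV (u t)" if t: "t \<in> I" for t
  unfolding pdiffs_exist_def
  proof (intro allI impI ballI)
  fix w :: "'d list" and i x assume w: "length w < ?k"
  hence "bd (C * N) (pdiffs w (u t))" "Zyg (s - real (length w)) (C * N) (pdiffs w (u t))" using P[of N "u t" w] u t by auto
  from grad_has_derivative[OF this, of x] w k(1)
  have "(pdiffs w (u t) has_derivative (%y. grad (pdiffs w (u t)) x \<bullet> y)) (at (x + 0 *. axis i 1))" by simp
  moreover have "((%r. x + r *. axis i 1) has_derivative (%r. r *. axis i 1)) (at 0)"
  by (auto intro!: derivative_eq_intros)
  ultimately show "(%r. pdiffs w (u t) (x + r *. axis i 1)) differentiable (at 0)"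
  unfolding differentiable_def using has_derivative_compose[of "%r. x + r *. axis i 1"] by blast
  qed
  have "(\<Sum>ga\<in>?G. sup_norm I (%t. mdiff ga (u t))) <= (\<Sum>ga\<in>?G. ennreal (C * N))"
  using m by (intro sum_mono sup_norm_leI) (auto simp: bd_def)
  also have "... = ennreal (real (card ?G) * (C * N))" using CN by (simp add: ennreal_mult ennreal_of_nat_eq_real_of_nat)
  finally have 1: "(\<Sum>ga\<in>?G. sup_norm I (%t. mdiff ga (u t))) <= ennreal (real (card ?G) * (C * N))" .
  have 2: "(SUP ga\<in>{ga. msize ga = ?k}. seminorm I ?f (%t. mdiff ga (u t))) <= ennreal (D * (C * N))"
  proof (rule SUP_least)
  fix ga :: "'d => nat" assume "ga \<in> {ga. msize ga = ?k}"
  hence g: "msize ga = ?k" by simp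
  show "seminorm I ?f (%t. mdiff ga (u t)) <= ennreal (D * (C * N))" by (rule S) (use m[of _ ga] g k(2) CN in auto)
  qed
  have "holder_norm I s u <= ennreal (real (card ?G) * (C * N)) + ennreal (D * (C * N))"
  unfolding holder_norm_def using pe add_mono[OF 1 2] by simp
  also have "... = ennreal (real (card ?G) * (C * N) + D * (C * N))" using CN by (intro ennreal_plus[symmetric]) auto
  finally show "holder_norm I s u <= ennreal ((real (card ?G) * C + D * C) * N)"
  by (simp only: distrib_right mult.assoc)
 qed
qed

section \<open>From Hoelder norms of order below three to third differences\<close>

lemma pdiff_df:
 fixes u :: "real^'d => real"
 assumes d: "!!x. (%r. u (x + r *. axis i 1)) differentiable (at 0)"
 shows "pdiff i (df h u) = df h (pdiff i u)" "(%r. df h u (x + r *. axis i 1)) differentiable (at 0)"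
proof -
 have v: "((%r. df h u (x + r *. axis i 1)) has_vector_derivative df h (pdiff i u) x) (at 0)" for x
 proof -
  have "((%r. u (y + r *. axis i 1)) has_vector_derivative pdiff i u y) (at 0)" for y
  unfolding pdiff_def using d by (simp add: vector_derivative_works)
  from has_vector_derivative_diff[OF this[of "x + h"] this[of x]] show ?thesis by (simp add: df_def add_ac)
 qed
 show "pdiff i (df h u) = df h (pdiff i u)" by (rule ext) (simp add: pdiff_def[of i "df h u"] vector_derivative_at[OF v])
 show "(%r. df h u (x + r *. axis i 1)) differentiable (at 0)" using v by (rule differentiableI_vector)
qed

lemma axis_df:
 fixes g :: "real^'d => real"
 assumes "!!x. (%r. g (x + r *. axis i 1)) differentiable (at 0)" "!!x. norm (pdiff i g x) <= M"
 shows "norm (df (r *. axis i 1) g x) <= M * abs r"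
 unfolding df_def by (rule axis_mvt) (rule assms)+

lemma df_coords:
 fixes g :: "real^'d => real"
 assumes "!!i z. norm (df ((h $ i) *. axis i 1) g z) <= M"
 shows "norm (df h g x) <= real CARD('d) * M"
 using coord_telescope[of x "x + h" g M] assms by (simp add: df_def)

text \<open>Only one of the two mixed derivatives of order two is a \<^const>\<open>mdiff\<close>; differences commute, so it suffices.\<close>

lemma mdiff_pair:
 fixes i j :: "'d::finite"
 obtains ga :: "'d => nat" where "msize ga = 2" "(mdiff ga :: (real^'d => real) => _) = pdiffs [i, j] | (mdiff ga :: (real^'d => real) => _) = pdiffs [j, i]"
proof
 let ?g = "%a. (if a = i then 1 else 0) + (if a = j then 1 else 0) :: nat"
 let ?w = "concat (map (%a. replicate (?g a) a) coords)"
 show m: "msize ?g = 2" by (simp add: msize_def sum.distrib)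
 have "mset ?w = (\<Sum>a\<in>UNIV. (if a = i then {#a#} else {#}) + (if a = j then {#a#} else {#}))"
  unfolding mset_multiindex[OF coords(1)] coords(2) by (intro sum.cong) auto
 also have "... = {#i, j#}" by (simp add: sum.distrib add_mset_commute)
 finally have w: "mset ?w = {#i, j#}" .
 have "length ?w = 2" unfolding length_multiindex m ..
 then obtain a b where ab: "?w = [a, b]" by (auto simp: length_Suc_conv numeral_2_eq_2)
 hence "?w = [i, j] | ?w = [j, i]" using w by (auto simp: add_eq_conv_ex)
 thus "(mdiff ?g :: (real^'d => real) => _) = pdiffs [i, j] | (mdiff ?g :: (real^'d => real) => _) = pdiffs [j, i]"
  unfolding mdiff_def by auto
qed

text \<open>Differences are split along the axes and axis differences are traded for partial
  derivatives, \<open>int_part s\<close> times, hence at most twice; what remains is a difference of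
  a top derivative, bounded by its seminorm. Mixed derivatives are not known to be continuous, so
  the argument never leaves the axes. Only finiteness matters here: a solution has to enter the a
  priori estimate with some constant.\<close>

lemma Zyg_of_holder_norm:
 fixes u :: "'i => real^'d => real"
 assumes s: "0 < s" "s < 3" and n: "holder_norm I s u < \<infinity>"
 shows "EX N. ALL t:I. bd N (u t) & Zyg s N (u t)"
proof -
 let ?k = "int_part s" and ?f = "frac_part s" and ?n = "real CARD('d)"
 have k: "real ?k < s" "s = ?f + real ?k" "0 < ?f" "?f <= 1" using int_part[OF s(1)] by (auto simp: frac_part_def)
 define R where "R = enn2real (holder_norm I s u)"
 have R: "0 <= R" "holder_norm I s u <= ennreal R" using n by (auto simp: R_def ennreal_enn2real_if)
 have pe: "pdiffs_exist ?k UNIV (u t)" if "t \<in> I" for t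
  using n that unfolding holder_norm_def by (auto split: if_splits)
 have hn: "holder_norm I s u = (\<Sum>ga | msize ga <= ?k. sup_norm I (%t. mdiff ga (u t)))
  + (SUP ga\<in>{ga. msize ga = ?k}. seminorm I ?f (%t. mdiff ga (u t)))"
  unfolding holder_norm_def using pe by simp
 have "sup_norm I (%t. mdiff (%_. 0) (u t)) <= (\<Sum>ga | msize ga <= ?k. sup_norm I (%t. mdiff ga (u t)))"
  by (rule member_le_sum[OF _ _ finite_multiindex]) (auto simp: msize_def)
 hence sn: "sup_norm I u <= ennreal R" using R(2) unfolding hn mdiff_0 by (meson le_iff_add order_trans)
 have b: "bd R (u t)" if "t \<in> I" for t using sup_norm_leD[OF sn R(1) that] by (simp add: bd_def)
 have sm: "seminorm I ?f (%t. mdiff ga (u t)) <= ennreal R" if "msize ga = ?k" for ga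
 proof -
  have "seminorm I ?f (%t. mdiff ga (u t)) <= (SUP ga\<in>{ga. msize ga = ?k}. seminorm I ?f (%t. mdiff ga (u t)))"
  by (rule SUP_upper) (use that in auto)
  also have "... <= ennreal R" using R(2) unfolding hn by (meson add_increasing order_refl order_trans zero_le)
  finally show ?thesis .
 qed
 have n1: "1 <= ?n" by (simp add: Suc_leI)
 have c: "abs (h $ i) <= norm h" for h :: "real^'d" and i by (rule component_le_norm_cart)
 have pw: "h pw ?f * norm h ^ ?k = h pw s" for h :: "real^'d"
 proof (cases "h = 0")
  case False
  hence "h pw ?f * norm h ^ ?k = h pw (?f + real ?k)" by (simp add: powr_add powr_realpow)
  thus ?thesis using k(2) by simp
 qed (use s in simp)
 have "norm (df3 h (u t) x) <= 4 * ?n ^ 3 * R * h pw s" if t: "t \<in> I" for t h x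
 proof -
  let ?u = "u t"
  have d: "(%r. ?u (x + r *. axis i 1)) differentiable (at 0)" if "1 <= ?k" for x i
  using pe[OF t, unfolded pdiffs_exist_def, rule_format, of "[]"] that by simp
  consider "?k = 0" | "?k = 1" | "?k = 2" using k s by linarith
  thus ?thesis
  proof cases
  case 1
  have "msize (%_::'d. 0) = ?k" using 1 by (simp add: msize_def)
  from seminorm_df2[OF sm[OF this, unfolded mdiff_0] k(3,4) R(1) t]
  have "bd (2 * R * h pw ?f) (df2 h ?u)" by (simp add: bd_def)
  from bdD[OF bd_df[OF this, of h], of x] have "norm (df3 h ?u x) <= 4 * 1 * R * h pw s" using 1 k(2) by simp
  also have "... <= 4 * ?n ^ 3 * R * h pw s" using R(1) n1 by (intro mrm mlm one_le_power) auto
  finally show ?thesis .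
  next
  case 2
  have D: "norm (pdiff i (df2 h ?u) z) <= 2 * R * h pw ?f" for i z
  proof -
  have "pdiff i (df2 h ?u) = df2 h (pdiff i ?u)" using pdiff_df[of "df h ?u" i h] pdiff_df[of ?u i h] d 2 by simp
  moreover have "msize (%j. if j = i then 1 else 0) = ?k" using 2 by (simp add: msize_def)
  from seminorm_df2[OF sm[OF this, unfolded mdiff_single] k(3,4) R(1) t, of h z]
  have "norm (df2 h (pdiff i ?u) z) <= 2 * R * h pw ?f" .
  ultimately show ?thesis by simp
  qed
  have "norm (df ((h $ i) *. axis i 1) (df2 h ?u) z) <= 2 * R * h pw s" for i z
  proof -
  have "norm (df ((h $ i) *. axis i 1) (df2 h ?u) z) <= 2 * R * h pw ?f * abs (h $ i)"
  by (rule axis_df[OF pdiff_df(2)[OF pdiff_df(2)[OF d]] D]) (use 2 in simp)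
  also have "... <= 2 * R * h pw ?f * norm h" using R(1) by (intro mlm c) auto
  also have "... = 2 * R * h pw s" using pw[of h] 2 by (simp add: mult.assoc)
  finally show ?thesis .
  qed
  from df_coords[OF this, of x] have "norm (df3 h ?u x) <= (2 * ?n) * (R * h pw s)" by simp
  also have "... <= (4 * ?n ^ 3) * (R * h pw s)"
  using R(1) n1 power_increasing[of 1 3 ?n] by (intro mrm mult_mono) auto
  finally show ?thesis by simp
  next
  case 3
  have f1: "?f < 1" using 3 k s by linarith
  let ?e = "%i. (h $ i) *. axis i 1 :: real^'d"
  have dd: "(%r. pdiff j ?u (x + r *. axis i 1)) differentiable (at 0)" for x i j
  using pe[OF t, unfolded pdiffs_exist_def, rule_format, of "[j]"] 3 by simp
  have key: "norm (df (?e i) (df (?e j) (df (?e l) ?u)) z) <= R * h pw s"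
  if g: "msize ga = 2" "(mdiff ga :: (real^'d => real) => _) = pdiffs [j, i]" for i j l ga z
  proof -
  have "norm (df (?e l) (pdiff j (pdiff i ?u)) z) <= R * h pw ?f" for z
  proof -
  have "norm (df (?e l) (pdiff j (pdiff i ?u)) z) <= R * norm (?e l) powr ?f"
  using seminorm_leD(1)[OF sm R(1) t f1, of ga "?e l" z] g 3 by simp
  also have "... <= R * h pw ?f" using R(1) c[of h l] k(3) by (intro mlm powr_mono2) (auto simp: norm_axis_1)
  finally show ?thesis .
  qed
  hence "norm (df (?e j) (df (?e l) (pdiff i ?u)) z) <= R * h pw ?f * abs (h $ j)" for z
  by (intro axis_df pdiff_df(2)[OF dd]) (simp add: pdiff_df(1)[OF dd])
  hence "norm (df (?e i) (df (?e j) (df (?e l) ?u)) z) <= R * h pw ?f * abs (h $ j) * abs (h $ i)"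
  using d 3 by (intro axis_df pdiff_df(2)) (simp_all add: pdiff_df)
  also have "... <= R * h pw ?f * norm h * norm h" using R(1) by (intro mult_mono mlm c) auto
  also have "... = R * h pw s" using pw[of h] 3 by (simp add: mult.assoc power2_eq_square)
  finally show ?thesis .
  qed
  have key': "norm (df (?e i) (df (?e j) (df (?e l) ?u)) z) <= R * h pw s" for i j l z
  using mdiff_pair[of i j] key[of _ j i l z] key[of _ i j l z] df_commute[of "?e i" "?e j"] by metis
  have "norm (df (?e i) (df (?e j) (df h ?u)) z) <= ?n * (R * h pw s)" for i j z
  using df_coords[of h "df (?e i) (df (?e j) ?u)" "R * h pw s" z] key' df_commute by metis
  hence "norm (df (?e i) (df2 h ?u) z) <= ?n * (?n * (R * h pw s))" for i z
  using df_coords[of h "df (?e i) (df h ?u)" "?n * (R * h pw s)" z] df_commute by metis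
  from df_coords[OF this, of x] have "norm (df3 h ?u x) <= 1 * (?n ^ 3 * (R * h pw s))" by (simp add: power3_eq_cube)
  also have "... <= 4 * (?n ^ 3 * (R * h pw s))" using R(1) by (intro mrm) auto
  finally show ?thesis by simp
  qed
 qed
 moreover have "1 <= 4 * ?n ^ 3" using one_le_power[OF n1, of 3] by linarith
 hence "1 * R <= 4 * ?n ^ 3 * R" using R(1) by (rule mrm)
 ultimately have "ALL t:I. bd (4 * ?n ^ 3 * R) (u t) & Zyg s (4 * ?n ^ 3 * R) (u t)"
  using b R(1) bd_mono by (fastforce simp: Zyg_def)
 thus ?thesis by blast
qed

section \<open>Solutions in the two formulations\<close>

lemma ib_split:
 assumes U: "U \<in> sets nu" and [measurable]: "f \<in> bm nu" "g \<in> bm nu"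
  and nn: "!!v. 0 <= f v" "!!v. 0 <= g v" and R: "0 <= R" "(\<integral>\<^sup>+v\<in>U. ennreal (f v) \<partial>nu) + (\<integral>\<^sup>+v\<in>space nu - U. ennreal (g v) \<partial>nu) <= ennreal R"
 shows "ib nu R (%v. if v \<in> U then f v else g v)"
proof -
 note [measurable] = U
 have "(\<integral>\<^sup>+v. ennreal (abs (if v \<in> U then f v else g v)) \<partial>nu)
  = (\<integral>\<^sup>+v. ennreal (f v) * indicator U v + ennreal (g v) * indicator (space nu - U) v \<partial>nu)"
  by (intro nn_integral_cong) (auto simp: nn)
 also have "... = (\<integral>\<^sup>+v\<in>U. ennreal (f v) \<partial>nu) + (\<integral>\<^sup>+v\<in>space nu - U. ennreal (g v) \<partial>nu)"
  by (rule nn_integral_add) auto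
 finally show ?thesis using R by (simp add: ib_def)
qed

text \<open>The exponent \<open>a\<close> unifies the two cases of \<open>assumption_B2\<close> for
  the increments of the jumps: \<open>al\<close> from one on, \<open>min (al + be') 1\<close> below.
  \<open>C0'\<close> is a nonnegative majorant of \<open>C0\<close>, as \<open>ib\<close> asks for
  nonnegative bounds.\<close>

lemma jdata_of_assumptions:
 fixes c :: "real => real^'d => 'u => real^'d"
 assumes st: "standing T nu U m b c ro l" and B1: "assumption_B1 T al K nu (U 1) c" and sj: "!!e. 0 < e ==> small_jumps T al nu c e <= ka e"
  and B2: "assumption_B2 T al be K C0 be' nu (U 1) b c ro l" and K: "0 <= K" "K <= K'" and C0: "0 <= C0'" "C0 <= C0'" and t: "t \<in> {0..T}"
  and a: "a = (if al < 1 then min (al + be') 1 else al)"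
 shows "jdata al be a K' C0' ka nu (U 1) (c t)"
 unfolding jdata_def
proof (intro conjI allI impI)
 show U: "U 1 \<in> sets nu" using st unfolding standing_def by simp
 show cm: "c t x \<in> bm nu" for x
 proof -
  have "(%((t, x), v). c t x v) \<in> bm (restrict_space borel (strip T) \<Otimes>\<^sub>M nu)" using st unfolding standing_def by simp
  from measurable_Pair2[OF this, of "(t, x)"] show ?thesis using t by (simp add: space_strip)
 qed
 show "ib nu K' (jw al (U 1) (c t x))" for x
 proof -
  note [measurable] = cm[of x]
  have "(\<integral>\<^sup>+v\<in>U 1. ennreal (norm (c t x v) powr al) \<partial>nu) + (\<integral>\<^sup>+v\<in>space nu - U 1. ennreal (min (norm (c t x v) powr min al 1) 1) \<partial>nu) <= ennreal K"
  using B1 t unfolding assumption_B1_def by blast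
  hence "(\<integral>\<^sup>+v\<in>U 1. ennreal (norm (c t x v) powr al) \<partial>nu) + (\<integral>\<^sup>+v\<in>space nu - U 1. ennreal (min (norm (c t x v) powr min al 1) 1) \<partial>nu) <= ennreal K'"
  using ennreal_leI[OF K(2)] by (rule order_trans)
  hence "ib nu K' (%v. if v \<in> U 1 then norm (c t x v) powr al else min (norm (c t x v) powr min al 1) 1)"
  using K by (intro ib_split[OF U]) auto
  thus ?thesis by (simp only: jw_def[abs_def])
 qed
 show "(\<integral>\<^sup>+v. ennreal (if norm (c t x v) <= e then norm (c t x v) powr al else 0) \<partial>nu) <= ka e" if "0 < e" for x e
 proof -
  have "(\<integral>\<^sup>+v. ennreal (if norm (c t x v) <= e then norm (c t x v) powr al else 0) \<partial>nu)
  = (\<integral>\<^sup>+v. (if norm (c t x v) <= e then ennreal (norm (c t x v) powr al) else 0) \<partial>nu)" by (intro nn_integral_cong) auto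
  also have "... <= small_jumps T al nu c e"
  unfolding small_jumps_def by (rule SUP_upper2[of "(t, x)"]) (use t in \<open>auto simp: strip_def\<close>)
  also have "... <= ka e" by (rule sj[OF that])
  finally show ?thesis .
 qed
 fix x h
 let ?p = "if 1 <= al then al * be else be"
 note [measurable] = cm[of x] cm[of "x + h"]
 have d: "(\<integral>\<^sup>+v\<in>U 1. ennreal (norm (c t (x + h) v - c t x v) powr a) \<partial>nu) <= ennreal (C0 * h pw ?p) &
  (\<integral>\<^sup>+v\<in>space nu - U 1. ennreal (min (norm (c t (x + h) v - c t x v) powr min a 1) 1) \<partial>nu) <= ennreal (C0 * h pw be)"
 proof (cases "1 <= al")
  case True
  hence "(\<integral>\<^sup>+v\<in>U 1. ennreal (norm (c t x v - c t (x + h) v) powr al) \<partial>nu) <= ennreal (C0 * h pw (al * be)) &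
  (\<integral>\<^sup>+v\<in>space nu - U 1. ennreal (min (norm (c t x v - c t (x + h) v)) 1) \<partial>nu) <= ennreal (C0 * h pw be)"
  using B2 t unfolding assumption_B2_def by blast
  thus ?thesis using True by (simp add: a norm_minus_commute)
 next
  case False
  hence "al < 1" by simp
  hence "(\<integral>\<^sup>+v\<in>U 1. ennreal (norm (c t x v - c t (x + h) v) powr min (al + be') 1) \<partial>nu) <= ennreal (C0 * h pw be) &
  (\<integral>\<^sup>+v\<in>space nu - U 1. ennreal (min (norm (c t x v - c t (x + h) v) powr min (al + be') 1) 1) \<partial>nu) <= ennreal (C0 * h pw be)"
  using B2 t unfolding assumption_B2_def by blast
  thus ?thesis using False by (simp add: a norm_minus_commute min.assoc)
 qed
 have le: "ennreal (C0 * y) <= ennreal (C0' * y)" if "0 <= y" for y using C0 that by (intro ennreal_leI mrm) auto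
 show "ib nu (C0' * h pw ?p) (%v. if v \<in> U 1 then norm (c t (x + h) v - c t x v) powr a else 0)"
  using order_trans[OF conjunct1[OF d] le] C0 by (intro ib_split[OF U]) auto
 show "ib nu (C0' * h pw be) (%v. if v \<in> U 1 then 0 else min (norm (c t (x + h) v - c t x v) powr min a 1) 1)"
  using order_trans[OF conjunct2[OF d] le] C0 by (intro ib_split[OF U]) auto
qed

lemma coefficients:
 fixes c :: "real => real^'d => 'u => real^'d"
 assumes st: "standing T nu U m b c ro l" and A: "assumption_A T al be K et m m0" and B1: "assumption_B1 T al K nu (U 1) c" and sj: "!!e. 0 < e ==> small_jumps T al nu c e <= ka e"
  and B2: "assumption_B2 T al be K C0 be' nu (U 1) b c ro l" and b: "0 < be" "be <= 1" and K: "0 <= K" "K <= K'" "(4 + 4 * marchaud1 (be/2)) * K <= K'"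
  and C0: "0 <= C0'" "C0 <= C0'" and a: "a = (if al < 1 then min (al + be') 1 else al)"
 shows "bdata T al be a K' C0' ka nu (U 1) c ro l" "t \<in> {0..T} ==> kfam al be K' (m t) (b t)"
proof -
 have nb: "norm_H T be b <= ennreal K" "norm_H T be l <= ennreal K" and nro: "!!v. v \<in> space nu ==> norm_H T be (%t x. ro t x v) <= ennreal K"
  using B2 unfolding assumption_B2_def by (auto intro: order_trans[OF add_increasing2[OF zero_le order_refl]] order_trans[OF add_increasing[OF zero_le order_refl]])
 have nm: "!!y. y ~= 0 ==> norm_H T be (%t x. m t x y) <= ennreal K" using A unfolding assumption_A_def by blast
 note hc = norm_low_hcoef[OF _ b K(1,3)]
 show "bdata T al be a K' C0' ka nu (U 1) c ro l"
  unfolding bdata_def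
 proof (intro ballI conjI allI)
  fix t x assume t: "t \<in> {0..T}"
  show "jdata al be a K' C0' ka nu (U 1) (c t)" by (rule jdata_of_assumptions[OF st B1 sj B2 K(1,2) C0 t a])
  have "(%((t, x), v). ro t x v) \<in> bm (restrict_space borel (strip T) \<Otimes>\<^sub>M nu)" using st unfolding standing_def by simp
  from measurable_Pair2[OF this, of "(t, x)"] show "ro t x \<in> bm nu" using t by (simp add: space_strip)
  show "hcoef be K' (%x. ro t x v)" if "v \<in> space nu" for v by (rule hc[OF nro[OF that] t])
  show "hcoef be K' (l t)" by (rule hc[OF nb(2) t])
 qed
 assume t: "t \<in> {0..T}"
 have hb: "hcoef be K' (b t)" by (rule hc[OF nb(1) t])
 have hm: "hcoef be K' (%x. m t x y)" if "y ~= 0" for y by (rule hc[OF nm[OF that] t])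
 show "kfam al be K' (m t) (b t)"
  unfolding kfam_def
 proof (intro conjI allI impI)
  fix x
  show "norm (b t x) <= K'" using hb bdD unfolding hcoef_def by blast
  show "kern al K' (m t x)"
  unfolding kern_def
  proof (intro conjI allI impI ballI)
  show "0 <= K'" using K by linarith
  have "(%(t, x, y). m t x y) \<in> bm (restrict_space borel ({0..T} \<times> UNIV \<times> (- {0})))" using st unfolding standing_def by blast
  from kmeasI(2)[OF this t] show "(%y. if y = 0 then 0 else m t x y) \<in> bm borel" .
  show "abs (m t x y) <= K'" if "y ~= 0" for y using hm[OF that] bdD[of K' "%x. m t x y" x] by (simp add: hcoef_def)
  fix r :: real assume "al = 1" "r \<in> {0<..<1}"
  thus "(LINT y:{y. r < norm y & norm y <= 1}|lborel. (m t x y / pk al y) *. y) = 0"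
  using A t unfolding assumption_A_def by blast
  qed
 next
  fix h x
  show "norm (df h (b t) x) <= K' * h pw (be/2)" "norm (df2 h (b t) x) <= K' * h pw be"
  using hb unfolding hcoef_def by blast+
  fix y :: "real^'d" assume y: "y ~= 0"
  have "dk h (m t) x y = df h (%x. m t x y) x" "dk h (dk h (m t)) x y = df2 h (%x. m t x y) x"
  by (simp_all add: dk_def df_def)
  thus "abs (dk h (m t) x y) <= K' * h pw (be/2)" "abs (dk h (dk h (m t)) x y) <= K' * h pw be"
  using hm[OF y] unfolding hcoef_def by (simp_all only: real_norm_def)
 qed
qed

lemma operator_eq:
 "op_A al m w t x + op_B al nu U b c ro l w t x = Lop al m b (jumpop al nu U c ro l) t (w t) x"
 by (simp add: op_A_eq op_B_def Lop_def GI_def jumpop_def jint_def)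

text \<open>The integral equations agree by \<open>operator_eq\<close>, and of the norms only
  finiteness has to be compared.\<close>

lemma solution_iff_csol:
 fixes u :: "real => real^'d => real"
 assumes "0 < al + be" "al + be < 3"
 shows "is_solution T al be (%w t x. op_A al m w t x + op_B al nu U b c ro l w t x) lam f u \<longleftrightarrow>
  meas T u & csol T al (al + be) m b (jumpop al nu U c ro l) lam f u"
proof -
 have "norm_H T (al + be) u < \<infinity> \<longleftrightarrow> (EX N. ALL t:{0..T}. bd N (u t) & Zyg (al + be) N (u t))"
 proof
  assume "EX N. ALL t:{0..T}. bd N (u t) & Zyg (al + be) N (u t)"
  then obtain N where "ALL t:{0..T}. bd N (u t) & Zyg (al + be) N (u t)" by blast
  hence N: "ALL t:{0..T}. bd (max N 0) (u t) & Zyg (al + be) (max N 0) (u t)" by (auto intro: bd_mono Zyg_mono)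
  obtain C where "holder_norm {0..T} (al + be) u <= ennreal (C * max N 0)"
  using holder_norm_of_Zyg[OF assms, where 'd = 'd and 'i = real] N by (metis max.cobounded2)
  thus "norm_H T (al + be) u < \<infinity>" unfolding norm_H_def by (auto intro: le_less_trans)
 qed (auto simp: norm_H_def intro: Zyg_of_holder_norm[OF assms])
 thus ?thesis
  unfolding is_solution_def csol_def intf_def C_H_def meas_def operator_eq by auto
qed

lemma time_holder:
 assumes N: "0 <= N" and w: "bd N (u t)" "bd N (u s)" "Zyg (al + be) N (u t)" "Zyg (al + be) N (u s)" and st: "s <= t"
  and d: "!!x. abs (u t x - u s x) <= (t - s) * N" "!!h x. abs (df3 h (%x. u t x - u s x) x) <= (t - s) * (N * h pw be)"
 shows "bd (2 * N * sqrt (t - s)) (%x. u t x - u s x :: real)" "Zyg (al / 2 + be) (2 * N * sqrt (t - s)) (%x. u t x - u s x)"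
proof -
 text \<open>Geometric mean of the uniform bound and of the Lipschitz bound in time.\<close>
 have gm: "z <= 2 * N * sqrt (t - s) * H" if z: "z <= 2 * N * A" "z <= (t - s) * (N * B)" "0 <= z" "0 <= A" "0 <= B" "0 <= H" "A * B = H\<^sup>2" for z A B H
 proof (rule power2_le_imp_le)
  have "z\<^sup>2 <= (2 * N * A) * ((t - s) * (N * B))" unfolding power2_eq_square using z N by (intro mult_mono) auto
  also have "... = 2 * N\<^sup>2 * (t - s) * (A * B)" by (simp add: power2_eq_square)
  also have "... <= 4 * N\<^sup>2 * (t - s) * (A * B)" using z st by (intro mrm) auto
  also have "... = (2 * N * sqrt (t - s) * H)\<^sup>2" using st z(7) by (simp add: power_mult_distrib)
  finally show "z\<^sup>2 <= (2 * N * sqrt (t - s) * H)\<^sup>2" .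
  show "0 <= 2 * N * sqrt (t - s) * H" using N st z by simp
 qed
 show "bd (2 * N * sqrt (t - s)) (%x. u t x - u s x)"
  unfolding bd_def
 proof
  fix x
  have "abs (u t x - u s x) <= 2 * N * 1" using bdD[OF bd_diff[OF w(1,2)], of x] by simp
  from gm[OF this, of 1 1] d(1)[of x] show "norm (u t x - u s x) <= 2 * N * sqrt (t - s)" by simp
 qed
 show "Zyg (al / 2 + be) (2 * N * sqrt (t - s)) (%x. u t x - u s x)"
  unfolding Zyg_def
 proof (intro conjI allI)
  show "0 <= 2 * N * sqrt (t - s)" using N st by simp
  fix h x
  have "norm (df3 h (%x. u t x - u s x) x) <= 2 * N * h pw (al + be)"
  using ZygD[OF Zyg_diff[OF w(3,4)], of h x] by simp
  \<comment> \<open>The order \<open>al/2 + be\<close> is the mean of \<open>al + be\<close>, from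
    the estimate in space, and \<open>be\<close>, from the Lipschitz bound in time.\<close>
  moreover have "h pw (al + be) * h pw be = (h pw (al / 2 + be))\<^sup>2"
  by (simp add: power2_eq_square powr_add[symmetric] add.commute)
  ultimately show "norm (df3 h (%x. u t x - u s x) x) <= 2 * N * sqrt (t - s) * h pw (al / 2 + be)"
  using d(2)[of h x] by (intro gm[of _ "h pw (al + be)" "h pw be"]) auto
 qed
qed

text \<open>Each entry of the minimum secures an inequality of \<open>pars\<close> or
  \<open>jpar\<close>; \<open>(be - be')/2\<close> leaves the room
  \<open>a + ta <= al + be - ta\<close> when jumps are Hoelder with exponent at most
  \<open>al + be'\<close>. The entry 1 at \<open>al = 1\<close> is a neutral default.\<close>

lemma pars_exist:
 assumes "0 < al" "al < 2" "0 < be" "be <= 1" "al < 1 ==> be' < be & 0 < al + be'"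
 shows "EX ta. pars al be ta & jpar al be ta (if al < 1 then min (al + be') 1 else al)"
proof -
 define ta where "ta = min (min (be/4) (min (al/2) ((2 - al)/2))) (if al < 1 then min ((1 - al)/2) ((be - be')/2) else if 1 < al then (al - 1)/2 else 1)"
 have "0 < ta" "ta <= be/4" "ta <= al/2" "ta <= (2 - al)/2" "al < 1 ==> ta <= (1 - al)/2 & ta <= (be - be')/2" "1 < al ==> ta <= (al - 1)/2"
  unfolding ta_def using assms by (auto simp: min_def)
 thus ?thesis using assms by (intro exI[of _ ta]) (auto simp: pars_def good_tau_def jpar_def)
qed

theorem theorem4:
  fixes T \<alpha> \<beta> K \<eta> C\<^sub>0 \<beta>' :: real and \<kappa> :: "real \<Rightarrow> ennreal"
  assumes "T > 0" and "0 < \<alpha>" and "\<alpha> < 2" and "0 < \<beta>" and "\<beta> \<le> 1" and "K > 0" and "\<eta> > 0"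
    and "(\<kappa> \<longlongrightarrow> 0) (at_right 0)"
  shows "\<exists>C>0. \<forall>(\<pi> :: 'u measure) U m m\<^sub>0 b c \<rho> l lam f.
    standing T \<pi> U m b c \<rho> l \<and>
    assumption_A T \<alpha> \<beta> K \<eta> m m\<^sub>0 \<and>
    assumption_B1 T \<alpha> K \<pi> (U 1) c \<and> (\<forall>\<epsilon>>0. small_jumps T \<alpha> \<pi> c \<epsilon> \<le> \<kappa> \<epsilon>) \<and>
    assumption_B2 T \<alpha> \<beta> K C\<^sub>0 \<beta>' \<pi> (U 1) b c \<rho> l \<and>
    lam \<ge> 0 \<and> (f :: real \<Rightarrow> real^'d \<Rightarrow> real) \<in> C_H T \<beta> \<longrightarrow>
    (\<exists>u. is_solution T \<alpha> \<beta> (\<lambda>w t x. op_A \<alpha> m w t x + op_B \<alpha> \<pi> (U 1) b c \<rho> l w t x) lam f u \<and>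
      (\<forall>v. is_solution T \<alpha> \<beta> (\<lambda>w t x. op_A \<alpha> m w t x + op_B \<alpha> \<pi> (U 1) b c \<rho> l w t x) lam f v \<longrightarrow>
           (\<forall>t\<in>{0..T}. \<forall>x. v t x = u t x)) \<and>
      norm_H T (\<alpha> + \<beta>) u \<le> ennreal C * norm_H T \<beta> f \<and>
      (\<forall>s t. 0 \<le> s \<and> s \<le> t \<and> t \<le> T \<longrightarrow>
         norm_Rd (\<alpha> / 2 + \<beta>) (\<lambda>x. u t x - u s x) \<le> ennreal (C * sqrt (t - s)) * norm_H T \<beta> f))"
proof (cases "\<alpha> < 1 \<longrightarrow> \<beta>' < \<beta> \<and> 0 < \<alpha> + \<beta>'")
 \<comment> \<open>For \<open>\<alpha> < 1\<close>, \<open>assumption_B2\<close> contains both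
   \<open>\<beta>' < \<beta>\<close> and \<open>\<alpha> + \<beta>' \<ge> \<beta> > 0\<close>. Here
   it cannot hold, so the constant 1 is a default for an empty claim.\<close>
 case False
 thus ?thesis using \<open>0 < \<beta>\<close> by (intro exI[of _ 1]) (auto simp: assumption_B2_def)
next
 case True
 define a where "a = (if \<alpha> < 1 then min (\<alpha> + \<beta>') 1 else \<alpha>)"
 obtain \<tau> where par: "pars \<alpha> \<beta> \<tau>" and ja: "jpar \<alpha> \<beta> \<tau> a"
  using pars_exist[OF assms(2-5), of \<beta>'] True unfolding a_def by blast
 \<comment> \<open>Bounds of Hoelder norms become bounds of first differences of order
   \<open>\<beta>/2\<close> and of second differences of order \<open>\<beta>\<close> at the price
   of this larger constant.\<close>
 define K' where "K' = K + (4 + 4 * marchaud1 (\<beta>/2)) * K"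
 define C0' where "C0' = max 0 C\<^sub>0"
 have m: "0 < marchaud1 (\<beta>/2)" by (rule marchaud1_pos) (use assms in simp)
 have K': "0 \<le> K" "K \<le> K'" "(4 + 4 * marchaud1 (\<beta>/2)) * K \<le> K'" "0 < K'" using m assms by (auto simp: K'_def add_pos_pos)
 have C0': "0 \<le> C0'" "C\<^sub>0 \<le> C0'" by (auto simp: C0'_def)
 obtain \<delta> r0 where \<delta>: "0 < \<delta>" and r0: "0 < r0" "r0 \<le> 1" and el: "\<forall>T \<alpha> m0 (m :: real \<Rightarrow> real^'d \<Rightarrow> real^'d \<Rightarrow> real).
  assumption_A0 T \<alpha> K \<eta> m0 \<and> 0 < \<alpha> \<and> (\<forall>t\<in>{0..T}. \<forall>x y. y \<noteq> 0 \<longrightarrow> m0 t y \<le> m t x y) \<longrightarrow> (\<forall>t\<in>{0..T}. elliptic \<delta> r0 (m t))"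
  using elliptic_of_A0[OF assms(6,7), where 'd = 'd] by blast
 \<comment> \<open>Here \<open>\<kappa>\<close> and \<open>C0'\<close> enter. Like
   \<open>\<delta>\<close> and \<open>r0\<close>, the function \<open>E\<close> is fixed before any
   coefficient, which makes \<open>C\<close> uniform over all of them.\<close>
 obtain E where E: "\<And>e. 0 \<le> E e" and lo: "\<And>T (\<pi>::'u measure) U c \<rho> l. bdata T \<alpha> \<beta> a K' C0' \<kappa> \<pi> U c \<rho> l \<Longrightarrow>
  lowop T (\<alpha> + \<beta>) (\<alpha> + \<beta> - \<tau>) \<beta> E (jumpop \<alpha> \<pi> U c \<rho> (l :: real \<Rightarrow> real^'d \<Rightarrow> real))"
  using jumpop_lowop[OF par ja less_imp_le[OF K'(4)] C0'(1) assms(8), where 'd = 'd and 'u = 'u] by blast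
 obtain C1 where C1: "0 < C1" and ap: "\<forall>m b B lam f (u::real \<Rightarrow> real^'d \<Rightarrow> real) F.
  opc T \<alpha> \<beta> \<tau> K' \<delta> r0 E m b B \<and> 0 \<le> lam \<and> csol T \<alpha> (\<alpha> + \<beta>) m b B lam f u \<and>
  (\<forall>t\<in>{0..T}. hol \<beta> F (f t)) \<longrightarrow> (\<forall>t\<in>{0..T}. bd (C1 * F) (u t) \<and> Zyg (\<alpha> + \<beta>) (C1 * F) (u t)) \<and>
  (\<forall>t t' x h. 0 \<le> t' \<and> t' \<le> t \<and> t \<le> T \<longrightarrow> \<bar>u t x - u t' x\<bar> \<le> (t - t') * (C1 * F) \<and>
   \<bar>df h (df h (df h (\<lambda>x. u t x - u t' x))) x\<bar> \<le> (t - t') * (C1 * F * norm h powr \<beta>))"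
  using apriori[where E = E and 'd = 'd, OF par K'(4) \<delta> r0 E assms(1)] by blast
 have s3: "0 < \<alpha> + \<beta>" "\<alpha> + \<beta> < 3" "0 < \<alpha> / 2 + \<beta>" "\<alpha> / 2 + \<beta> < 3" using assms by auto
 obtain C2 where C2: "0 < C2" and n2: "\<And>(u :: real \<Rightarrow> real^'d \<Rightarrow> real) N. \<forall>t\<in>{0..T}. bd N (u t) \<and> Zyg (\<alpha> + \<beta>) N (u t) \<Longrightarrow> 0 \<le> N \<Longrightarrow> holder_norm {0..T} (\<alpha> + \<beta>) u \<le> ennreal (C2 * N)"
  using holder_norm_of_Zyg[OF s3(1,2), where 'd = 'd and 'i = real] by blast
 obtain C3 where C3: "0 < C3" and n3: "\<And>(u :: unit \<Rightarrow> real^'d \<Rightarrow> real) N. \<forall>t\<in>UNIV. bd N (u t) \<and> Zyg (\<alpha> / 2 + \<beta>) N (u t) \<Longrightarrow> 0 \<le> N \<Longrightarrow> holder_norm UNIV (\<alpha> / 2 + \<beta>) u \<le> ennreal (C3 * N)"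
  using holder_norm_of_Zyg[OF s3(3,4), where 'd = 'd and 'i = unit] by blast
 \<comment> \<open>The factor 2 common to both terms is that of \<open>F\<close>, which will be
   twice the norm of \<open>f\<close>; the further 2 in the second term comes from
   \<open>time_holder\<close>.\<close>
 define C where "C = 2 * C1 * C2 + 4 * C1 * C3"
 have C: "0 < C" "C2 * (C1 * 2) \<le> C" "C3 * (2 * (C1 * 2)) \<le> C" using C1 C2 C3 by (auto simp: C_def add_pos_pos)
 show ?thesis
 proof (intro exI[of _ C] conjI C(1) allI impI; elim conjE)
  fix \<pi> :: "'u measure" and U and m :: "real \<Rightarrow> real^'d \<Rightarrow> real^'d \<Rightarrow> real" and m\<^sub>0 b c \<rho> l and lam :: real and f :: "real \<Rightarrow> real^'d \<Rightarrow> real"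
  assume st: "standing T \<pi> U m b c \<rho> l" and A: "assumption_A T \<alpha> \<beta> K \<eta> m m\<^sub>0" and B1: "assumption_B1 T \<alpha> K \<pi> (U 1) c"
   and sj: "\<forall>\<epsilon>>0. small_jumps T \<alpha> \<pi> c \<epsilon> \<le> \<kappa> \<epsilon>" and B2: "assumption_B2 T \<alpha> \<beta> K C\<^sub>0 \<beta>' \<pi> (U 1) b c \<rho> l"
   and lam: "lam \<ge> 0" and f: "f \<in> C_H T \<beta>"
  let ?B = "jumpop \<alpha> \<pi> (U 1) c \<rho> l"
  let ?sol = "is_solution T \<alpha> \<beta> (\<lambda>w t x. op_A \<alpha> m w t x + op_B \<alpha> \<pi> (U 1) b c \<rho> l w t x) lam f"
  note co = coefficients[OF st A B1 sj[rule_format] B2 assms(4,5) K'(1-3) C0' a_def]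
  have "\<forall>t\<in>{0..T}. elliptic \<delta> r0 (m t)" using el A assms(2) unfolding assumption_A_def by blast
  hence op: "opc T \<alpha> \<beta> \<tau> K' \<delta> r0 E m b ?B" unfolding opc_def using co(2) lo[OF co(1)] by blast
  have om: "opm T \<alpha> (\<alpha> + \<beta>) m b ?B"
   by (rule opm_jumpop) (use st kmeasI(1) assms(4) in \<open>auto simp: standing_def meas_def\<close>)
  \<comment> \<open>Twice the norm, because \<open>hol\<close> is stated with second differences,
    which cost twice the Hoelder seminorm.\<close>
  define F where "F = 2 * enn2real (norm_H T \<beta> f)"
  have F: "0 \<le> F" "norm_H T \<beta> f = ennreal (F / 2)" using f by (auto simp: F_def C_H_def ennreal_enn2real_if)
  have hf: "\<forall>t\<in>{0..T}. hol \<beta> F (f t)"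
  proof
   fix t assume t: "t \<in> {0..T}"
   note d = norm_low_df2[OF eq_refl[OF F(2)[unfolded norm_H_def]] assms(4,5) _ t]
   show "hol \<beta> F (f t)" unfolding hol_def using bd_mono[OF d(1)] d(2) F(1) by simp
  qed
  have fm: "meas T f" using f by (simp add: C_H_def meas_def)
  obtain u where u: "meas T u" "csol T \<alpha> (\<alpha> + \<beta>) m b ?B lam f u"
   using solution_exists[OF par K'(4) assms(1) E \<delta> r0 op om lam] fm hf unfolding solvable_def by blast
  have est: "\<forall>t\<in>{0..T}. bd (C1 * F) (u t) \<and> Zyg (\<alpha> + \<beta>) (C1 * F) (u t)"
   and time: "\<And>t t' x h. 0 \<le> t' \<and> t' \<le> t \<and> t \<le> T \<Longrightarrow> \<bar>u t x - u t' x\<bar> \<le> (t - t') * (C1 * F) \<and>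
   \<bar>df h (df h (df h (\<lambda>x. u t x - u t' x))) x\<bar> \<le> (t - t') * (C1 * F * norm h powr \<beta>)"
   using ap op lam u(2) hf by blast+
  have CF: "0 \<le> C1 * F" using C1 F by simp
  have "norm_H T (\<alpha> + \<beta>) u \<le> ennreal C * norm_H T \<beta> f"
  proof -
   have "C2 * (C1 * 2) * (F / 2) \<le> C * (F / 2)" using C F by (intro mrm) auto
   hence "ennreal (C2 * (C1 * F)) \<le> ennreal (C * (F / 2))" by (intro ennreal_leI) simp
   with n2[OF est CF] have "norm_H T (\<alpha> + \<beta>) u \<le> ennreal (C * (F / 2))" unfolding norm_H_def by (rule order_trans)
   also have "\<dots> = ennreal C * norm_H T \<beta> f" unfolding F(2) using C F by (intro ennreal_mult) auto
   finally show ?thesis .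
  qed
  moreover have "norm_Rd (\<alpha> / 2 + \<beta>) (\<lambda>x. u t x - u s x) \<le> ennreal (C * sqrt (t - s)) * norm_H T \<beta> f"
   if st: "0 \<le> s \<and> s \<le> t \<and> t \<le> T" for s t
  proof -
   have tb: "bd (C1 * F) (u t)" "bd (C1 * F) (u s)" "Zyg (\<alpha> + \<beta>) (C1 * F) (u t)" "Zyg (\<alpha> + \<beta>) (C1 * F) (u s)"
   and ts: "s \<le> t" "0 \<le> sqrt (t - s)" using est st by auto
   have "norm_Rd (\<alpha> / 2 + \<beta>) (\<lambda>x. u t x - u s x) \<le> ennreal (C3 * (2 * (C1 * F) * sqrt (t - s)))"
   unfolding norm_Rd_def using time_holder[OF CF tb ts(1)] time[OF st] CF ts(2) by (intro n3) auto
   also have "\<dots> \<le> ennreal (C * sqrt (t - s) * (F / 2))"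
   proof (rule ennreal_leI)
   have "C3 * (2 * (C1 * 2)) * (sqrt (t - s) * (F / 2)) \<le> C * (sqrt (t - s) * (F / 2))" using C F ts by (intro mrm) auto
   thus "C3 * (2 * (C1 * F) * sqrt (t - s)) \<le> C * sqrt (t - s) * (F / 2)" by (simp add: mult_ac)
   qed
   also have "\<dots> = ennreal (C * sqrt (t - s)) * norm_H T \<beta> f" unfolding F(2) using C F ts by (intro ennreal_mult) auto
   finally show ?thesis .
  qed
  moreover have "?sol u" using u solution_iff_csol[OF s3(1,2)] by blast
  moreover have "v t x = u t x" if v: "?sol v" and t: "t \<in> {0..T}" for v t x
  proof -
   have v': "csol T \<alpha> (\<alpha> + \<beta>) m b ?B lam f v" using v solution_iff_csol[OF s3(1,2)] by blast
   \<comment> \<open>The difference of two solutions has forcing \<open>f - f\<close>, so the a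
     priori bound applies with right-hand side zero.\<close>
   have "\<forall>t\<in>{0..T}. hol \<beta> 0 (\<lambda>x. f t x + (-1) * f t x)" by (simp add: hol_def bd_def df_def)
   with ap op lam csol_lin[OF par op v' u(2), of "-1"] have "bd (C1 * 0) (\<lambda>x. v t x + (-1) * u t x)" using t by blast
   from bdD[OF this, of x] show ?thesis by simp
  qed
  ultimately show "\<exists>u. ?sol u \<and> (\<forall>v. ?sol v \<longrightarrow> (\<forall>t\<in>{0..T}. \<forall>x. v t x = u t x)) \<and>
   norm_H T (\<alpha> + \<beta>) u \<le> ennreal C * norm_H T \<beta> f \<and>
   (\<forall>s t. 0 \<le> s \<and> s \<le> t \<and> t \<le> T \<longrightarrow>
   norm_Rd (\<alpha> / 2 + \<beta>) (\<lambda>x. u t x - u s x) \<le> ennreal (C * sqrt (t - s)) * norm_H T \<beta> f)"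
   by blast
 qed
qed

end
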